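(* Assume the generalized Riemann hypothesis (GRH). Let $k\geq 1$ be a fixed integer and let $a_1,\ldots,a_k$ and $A$ be fixed positive real numbers. Let $X$ be a large real number and let $t=(t_1,\ldots,t_k)$ be a real $k$-tuple with $|t_j|\leq X^A$ for all $j$. Then \begin{align*} &\sum_{\substack{p\leq X\\ p \text{ odd prime}}}\log p\,\big|L(1/2+it_1,\chi^{(8p)})\big|^{a_1}\cdots\big|L(1/2+it_k,\chi^{(8p)})\big|^{a_k}\\ &\ll X(\log X)^{(a_1^2+\cdots+a_k^2)/4}\prod_{1\leq m<\ell\leq k}\Big|\zeta\Big(1+i(t_m-t_\ell)+\tfrac{1}{\log X}\Big)\Big|^{a_ma_\ell/2}\Big|\zeta\Big(1+i(t_m+t_\ell)+\tfrac{1}{\log X}\Big)\Big|^{a_ma_\ell/2}\\ &\qquad\times\prod_{1\leq m\leq k}\Big|\zeta\Big(1+2it_m+\tfrac{1}{\log X}\Big)\Big|^{a_m^2/4+a_m/2}, \end{align*} where the implied constant depends on $k$, $A$ and the $a_j$, but not on $X$ or the $t_j$.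
   Context: For an integer $d$, $\chi^{(d)}=\left(\frac{d}{\cdot}\right)$ denotes the Kronecker symbol; for an odd prime $p$, $\chi^{(8p)}$ is a real primitive Dirichlet character modulo $8p$, and $L(s,\chi^{(8p)})$ is its Dirichlet $L$-function. $\zeta(s)$ is the Riemann zeta function. The letter $p$ denotes primes. *)

theory Defs
  imports "HOL-Analysis.Analysis" "HOL-Number_Theory.Number_Theory"
begin

definition kronecker_prime :: "int \<Rightarrow> nat \<Rightarrow> int" where
  "kronecker_prime d q =
     (if q = 2 then (if even d then 0 else if d mod 8 = 1 \<or> d mod 8 = 7 then 1 else -1)
      else Legendre d (int q))"

definition kronecker :: "int \<Rightarrow> nat \<Rightarrow> int" where
  "kronecker d n =
     (if n = 0 then (if \<bar>d\<bar> = 1 then 1 else 0)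
      else (\<Prod>q\<in>prime_factors n. kronecker_prime d q ^ multiplicity q n))"

definition kron_char :: "int \<Rightarrow> nat \<Rightarrow> complex" where
  "kron_char d n = of_int (kronecker d n)"

definition dirichlet_char :: "nat \<Rightarrow> (nat \<Rightarrow> complex) \<Rightarrow> bool" where
  "dirichlet_char q chi \<longleftrightarrow> q > 0 \<and> (\<forall>m n. chi (m * n) = chi m * chi n) \<and>
     (\<forall>n. chi (n + q) = chi n) \<and> (\<forall>n. chi n \<noteq> 0 \<longleftrightarrow> coprime n q)"

definition principal_char :: "nat \<Rightarrow> (nat \<Rightarrow> complex) \<Rightarrow> bool" where
  "principal_char q chi \<longleftrightarrow> (\<forall>n. coprime n q \<longrightarrow> chi n = 1)"

text \<open>Dirichlet L-function given by its Dirichlet series (as the limit of the partial sums);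
  for a non-principal character this converges for Re s > 0 and equals L(s,chi) there.\<close>
definition dirichlet_L :: "(nat \<Rightarrow> complex) \<Rightarrow> complex \<Rightarrow> complex" where
  "dirichlet_L chi s = lim (\<lambda>N. \<Sum>n=1..N. chi n * of_nat n powr (-s))"

text \<open>Riemann zeta function on Re s > 1 (absolutely convergent series).\<close>
definition zeta :: "complex \<Rightarrow> complex" where
  "zeta s = (\<Sum>n. of_nat (Suc n) powr (-s))"

text \<open>Dirichlet eta function, (1 - 2^(1-s)) zeta(s), convergent for Re s > 0.\<close>
definition eta :: "complex \<Rightarrow> complex" where
  "eta s = lim (\<lambda>N. \<Sum>n=1..N. (-1) ^ (n + 1) * of_nat n powr (-s))"

text \<open>Generalized Riemann hypothesis: the Riemann zeta function (via eta) and all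
  Dirichlet L-functions of non-principal characters have no zeros with Re s > 1/2.\<close>
definition GRH :: bool where
  "GRH \<longleftrightarrow> (\<forall>s. 1/2 < Re s \<and> Re s < 1 \<longrightarrow> eta s \<noteq> 0) \<and>
     (\<forall>q chi s. dirichlet_char q chi \<and> \<not> principal_char q chi \<and> 1/2 < Re s \<longrightarrow> dirichlet_L chi s \<noteq> 0)"

end

theory Submission
  imports Defs "HOL-Complex_Analysis.Complex_Analysis" "HOL-Probability.Sinc_Integral" "HOL-Real_Asymp.Real_Asymp"
begin

text \<open>The proof follows Harper's method for upper bounds of moments. Under GRH, Landau's local
  factorisation and the Borel-Caratheodory theorem control \<open>L'/L\<close> to the right of the critical line;
  smoothing along vertical lines then bounds \<open>log |L(1/2 + it, \<chi>)|\<close> by a sum over prime powers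
  \<open>n \<le> exp L\<close> plus a multiple of \<open>log X / L\<close>, for any \<open>L\<close>. The squares of primes contribute half
  the logarithm of \<open>|\<zeta>(1 + 1/log X + 2it)|\<close>, hence the factors with exponent \<open>a\<^sub>m / 2\<close>. What remains
  is the exponential of a linear form in the signs \<open>\<chi>(q)\<close>.

  The primes \<open>q\<close> are cut into blocks. For discriminants on which the parts of the linear form that
  belong to the blocks have moderate size, the exponential is dominated by a product of squares of
  truncated Taylor polynomials; for the others one stops at the last good block and pays with a high
  moment of the first bad one. All resulting polynomials in the signs are so short that GRH, applied to
  the characters \<open>m \<mapsto> (m / N)\<close>, allows one to replace the signs by independent random ones.
  Their exponential moment is \<open>exp (\<Sum> h(q)\<^sup>2 / (2q))\<close> with \<open>h(q) = \<Sum> a\<^sub>j cos (t\<^sub>j log q)\<close>, and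
  expanding the square turns this into the logarithms of \<open>|\<zeta>|\<close> on the line \<open>Re s = 1 + 1/log X\<close>.\<close>

section \<open>Logarithmic derivatives of holomorphic functions\<close>

text \<open>The loss \<open>C * ln X / L\<close> forces \<open>L\<close> to be a fixed multiple of
  \<open>ln X\<close> for most discriminants. A single truncated exponential of the sum over all
  primes up to such a cut-off fails: the sum has variance of order \<open>ln (ln X)\<close>, so the
  degree of its Taylor polynomial must tend to infinity, and monomials of that degree in primes near
  a power of \<open>X\<close> exceed every power of \<open>X\<close>. With blocks the degree follows
  the size of the primes. One block has bounded variance, large primes get a bounded degree, and the
  huge degree spent on small primes is cheap.

  The exponents have slack. GRH is used on the line Re s = 3/4, which gives errors of size
  \<open>X powr (3/4)\<close>; the length of the polynomials, the size of their coefficients and the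
  prefactors cost 1/20 each, and the remaining tenth absorbs powers of \<open>ln X\<close>.

  The smoothing argument uses the zeros only through one fact: the real part of L'/L plus a multiple
  of the logarithm of the conductor is positive to the right of the critical line. Invariant forms
  of the Schwarz lemma exploit this positivity.\<close>

lemma cmod_diff_less_cmod_add_cnj:
  assumes "Re a > 0" "Re b > 0"
  shows "cmod (a - b) < cmod (a + cnj b)"
proof -
  have "(cmod (a - b))\<^sup>2 = (Re a - Re b)\<^sup>2 + (Im a - Im b)\<^sup>2"
    by (simp add: cmod_power2)
  also have "\<dots> < (Re a + Re b)\<^sup>2 + (Im a - Im b)\<^sup>2"
    using mult_pos_pos[OF assms] by (simp add: power2_eq_square algebra_simps)
  also have "\<dots> = (cmod (a + cnj b))\<^sup>2"
    by (simp add: cmod_power2)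
  finally show ?thesis
    by (rule power_less_imp_less_base) simp
qed

text \<open>Composing \<open>f\<close> with a map that sends the right half plane to the unit disc
  and \<open>f 0\<close> to 0 makes the Schwarz lemma applicable. In contrast to Harnack's
  inequality, the whole complex difference, imaginary part included, is controlled by the real part
  at the centre.\<close>

lemma positive_real_part_disc:
  assumes hol: "f holomorphic_on ball 0 1"
    and pos: "\<And>z. cmod z < 1 \<Longrightarrow> Re (f z) > 0" and z: "cmod z < 1"
  shows "cmod (f z - f 0) \<le> 2 * cmod z / (1 - cmod z) * Re (f 0)"
proof -
  define m where "m = (\<lambda>z. (f z - f 0) / (f z + cnj (f 0)))"
  have nz: "f z + cnj (f 0) \<noteq> 0" if "cmod z < 1" for z
    using cmod_diff_less_cmod_add_cnj[OF pos[OF that] pos[of 0]] by fastforce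
  have "m holomorphic_on ball 0 1"
    unfolding m_def using hol nz by (intro holomorphic_intros) auto
  moreover have "m 0 = 0" by (simp add: m_def)
  moreover have "cmod (m z) < 1" if "cmod z < 1" for z
    using cmod_diff_less_cmod_add_cnj[OF pos[OF that] pos[of 0]] nz[OF that]
    by (simp add: m_def norm_divide)
  ultimately have "cmod (m z) \<le> cmod z"
    using Schwarz_Lemma(1)[of m z] z by blast
  then have "cmod (f z - f 0) \<le> cmod z * cmod (f z + cnj (f 0))"
    using nz[OF z] by (simp add: m_def norm_divide pos_divide_le_eq)
  also have "f z + cnj (f 0) = (f z - f 0) + of_real (2 * Re (f 0))"
    by (simp add: complex_eq_iff)
  also have "cmod \<dots> \<le> cmod (f z - f 0) + 2 * Re (f 0)"
    using pos[of 0] by (intro norm_triangle_le) (simp only: norm_of_real, simp)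
  finally have "(1 - cmod z) * cmod (f z - f 0) \<le> cmod z * (2 * Re (f 0))"
    using mult_left_mono[OF _ norm_ge_zero[of z]] by (auto simp: left_diff_distrib distrib_left)
  then show ?thesis using z by (simp add: pos_le_divide_eq mult_ac)
qed

text \<open>\<open>r\<close> is the pseudo-hyperbolic distance of \<open>z\<close> and
  \<open>w\<close>. The Moebius map \<open>T\<close> carries the disc to the half plane and 0 to
  \<open>w\<close>, so this is the disc version in invariant form.\<close>

lemma positive_real_part_halfplane:
  assumes hol: "G holomorphic_on {z. Re z > 0}"
    and pos: "\<And>z. Re z > 0 \<Longrightarrow> Re (G z) > 0" and w: "Re w > 0" and z: "Re z > 0"
    and r: "r = cmod (z - w) / cmod (z + cnj w)"
  shows "r < 1" "cmod (G z - G w) \<le> 2 * r / (1 - r) * Re (G w)"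
proof -
  have lt: "cmod (z - w) < cmod (z + cnj w)"
    using cmod_diff_less_cmod_add_cnj[OF z w] .
  show r1: "r < 1" unfolding r using lt by (simp add: divide_less_eq_1)
  have nz: "z + cnj w \<noteq> 0" using lt by auto
  define T where "T = (\<lambda>u. (w + cnj w * u) / (1 - u))"
  have one: "1 - u \<noteq> 0" if "cmod u < 1" for u :: complex using that by auto
  have ReT: "Re (T u) > 0" if "cmod u < 1" for u
  proof -
    have "Re ((w + cnj w * u) * cnj (1 - u)) = Re w * (1 - (cmod u)\<^sup>2)"
      unfolding cmod_power2 by (simp add: algebra_simps power2_eq_square)
    moreover have "(cmod u)\<^sup>2 < 1" using that by (simp add: power_less_one_iff)
    ultimately have "Re ((w + cnj w * u) * cnj (1 - u)) > 0" using w by simp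
    then show ?thesis
      unfolding T_def Re_complex_div_gt_0 .
  qed
  have "(G \<circ> T) holomorphic_on ball 0 1"
  proof (rule holomorphic_on_compose_gen[OF _ hol])
    show "T holomorphic_on ball 0 1"
      unfolding T_def using one by (intro holomorphic_intros) auto
  qed (use ReT in auto)
  moreover define u where "u = (z - w) / (z + cnj w)"
  have u: "cmod u = r" unfolding u_def r by (simp add: norm_divide)
  moreover have Tu: "T u = z"
  proof -
    have "1 - u \<noteq> 0" using one[of u] u r1 by simp
    moreover have "u * (z + cnj w) = z - w" unfolding u_def using nz by simp
    then have "w + cnj w * u = z * (1 - u)" by (simp add: algebra_simps)
    ultimately show ?thesis unfolding T_def by simp
  qed
  moreover have "T 0 = w" by (simp add: T_def)
  ultimately show "cmod (G z - G w) \<le> 2 * r / (1 - r) * Re (G w)"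
    using positive_real_part_disc[of "G \<circ> T" u] pos ReT r1 by simp
qed

text \<open>\<open>V\<close> is a potential of a function with positive real part, and
  \<open>y\<close> will be averaged against an even kernel, which removes the term linear in
  \<open>y\<close>. Moving vertically by \<open>y\<close> costs an error controlled by
  \<open>Re G\<close>; moving left from \<open>d\<close> to \<open>x\<close> gains at least
  \<open>d / 6\<close> times the same quantity. The gain pays for the averaged error once
  \<open>d\<close> is a large multiple of the width of the kernel.\<close>

lemma halfplane_potential_le:
  fixes d t y x :: real
  assumes V: "\<And>z. Re z > 0 \<Longrightarrow> (V has_field_derivative G z) (at z)"
    and hol: "G holomorphic_on {z. Re z > 0}"
    and pos: "\<And>z. Re z > 0 \<Longrightarrow> Re (G z) > 0"
    and d: "d > 0" and x: "0 < x" "x \<le> 2 * d / 3"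
  shows "Re (V (Complex x t)) \<le> Re (V (Complex d (t + y))) + y * Im (G (Complex d t))
            + Re (G (Complex d t)) * (2 * y\<^sup>2 / d + \<bar>y\<bar> ^ 3 / d\<^sup>2 - d / 6)"
proof -
  define w where "w = Complex d t"
  define h where "h = Re (G w)"
  have h: "h > 0" unfolding h_def w_def using d by (intro pos) simp
  have hor: "((\<lambda>u. Re (V (Complex u t))) has_real_derivative Re (G (Complex u t))) (at u)" if "u > 0" for u
  proof -
    have "((\<lambda>u. V (Complex u t)) has_vector_derivative 1 * G (Complex u t)) (at u)"
    proof (rule field_vector_diff_chain_at[unfolded comp_def, of "\<lambda>u. Complex u t"])
      show "((\<lambda>u. Complex u t) has_vector_derivative 1) (at u)"
        unfolding has_vector_derivative_complex_iff by (auto intro!: derivative_eq_intros)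
    qed (use V[of "Complex u t"] that in auto)
    then show ?thesis unfolding has_vector_derivative_complex_iff by simp
  qed
  have ver: "((\<lambda>u. Re (V (Complex d (t + u))) + u * Im (G w)) has_real_derivative
              (Im (G w) - Im (G (Complex d (t + u))))) (at u)" for u
  proof -
    have "((\<lambda>u. V (Complex d (t + u))) has_vector_derivative \<i> * G (Complex d (t + u))) (at u)"
    proof (rule field_vector_diff_chain_at[unfolded comp_def, of "\<lambda>u. Complex d (t + u)"])
      show "((\<lambda>u. Complex d (t + u)) has_vector_derivative \<i>) (at u)"
        unfolding has_vector_derivative_complex_iff by (auto intro!: derivative_eq_intros)
    qed (use V[of "Complex d (t + u)"] d in auto)
    then have "((\<lambda>u. Re (V (Complex d (t + u)))) has_real_derivative - Im (G (Complex d (t + u)))) (at u)"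
      unfolding has_vector_derivative_complex_iff by simp
    moreover have "((\<lambda>u. u * Im (G w)) has_real_derivative Im (G w)) (at u)"
      by (auto intro!: derivative_eq_intros)
    ultimately show ?thesis using DERIV_add by fastforce
  qed
  have Gver: "\<bar>Im (G w) - Im (G (Complex d (t + u)))\<bar> \<le> h * (2 * \<bar>y\<bar> / d + y\<^sup>2 / d\<^sup>2)" if "\<bar>u\<bar> \<le> \<bar>y\<bar>" for u
  proof -
    define z where "z = Complex d (t + u)"
    define r where "r = cmod (z - w) / cmod (z + cnj w)"
    have zw: "cmod (z - w) = \<bar>u\<bar>" by (simp add: z_def w_def cmod_def)
    have zw': "(cmod (z + cnj w))\<^sup>2 = 4 * d\<^sup>2 + u\<^sup>2"
      unfolding cmod_power2 by (simp add: z_def w_def power2_eq_square)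
    have c0: "cmod (z + cnj w) \<ge> 2 * d" using abs_Re_le_cmod[of "z + cnj w"] d by (simp add: z_def w_def)
    have c1: "cmod (z + cnj w) \<le> 2 * d + \<bar>u\<bar>"
      using cmod_le[of "z + cnj w"] d by (simp add: z_def w_def)
    have r1: "r < 1" and G: "cmod (G z - G w) \<le> 2 * r / (1 - r) * Re (G w)"
      using positive_real_part_halfplane[OF hol pos, of w z r] d by (auto simp: r_def z_def w_def)
    define S where "S = cmod (z + cnj w)"
    have S: "S > 0" "S\<^sup>2 = 4 * d\<^sup>2 + u\<^sup>2" "S \<le> 2 * d + \<bar>u\<bar>"
      using c0 c1 d zw' by (auto simp: S_def)
    have rS: "r = \<bar>u\<bar> / S" by (simp add: r_def zw S_def)
    have uS: "\<bar>u\<bar> < S" using r1 S by (simp add: rS)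
    \<comment> \<open>Multiplying numerator and denominator by \<open>S + \<bar>u\<bar>\<close>
      leaves the denominator \<open>4 * d^2\<close>, hence a bound polynomial in \<open>u\<close>
      even when \<open>r\<close> is close to 1.\<close>
    have "2 * r / (1 - r) = 2 * \<bar>u\<bar> / (S - \<bar>u\<bar>)"
      unfolding rS using S uS by (simp add: field_simps)
    also have "\<dots> = 2 * \<bar>u\<bar> * (S + \<bar>u\<bar>) / ((S - \<bar>u\<bar>) * (S + \<bar>u\<bar>))"
      using uS by simp
    also have "(S - \<bar>u\<bar>) * (S + \<bar>u\<bar>) = 4 * d\<^sup>2"
      using S(2) by (simp add: algebra_simps power2_eq_square)
    also have "2 * \<bar>u\<bar> * (S + \<bar>u\<bar>) / (4 * d\<^sup>2) \<le> 2 * \<bar>u\<bar> * ((2 * d + \<bar>u\<bar>) + \<bar>u\<bar>) / (4 * d\<^sup>2)"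
      using S d by (intro divide_right_mono mult_left_mono) auto
    also have "\<dots> = \<bar>u\<bar> / d + u\<^sup>2 / d\<^sup>2" using d by (simp add: field_simps power2_eq_square)
    also have "\<dots> \<le> 2 * \<bar>y\<bar> / d + y\<^sup>2 / d\<^sup>2"
      using that d power_mono[OF that, of 2] by (intro add_mono divide_right_mono) auto
    finally have "2 * r / (1 - r) * h \<le> (2 * \<bar>y\<bar> / d + y\<^sup>2 / d\<^sup>2) * h"
      using h by (intro mult_right_mono) auto
    with G have "cmod (G z - G w) \<le> h * (2 * \<bar>y\<bar> / d + y\<^sup>2 / d\<^sup>2)" by (simp add: h_def mult.commute)
    then show ?thesis using abs_Im_le_cmod[of "G z - G w"] by (simp add: z_def)
  qed
  have "\<bar>(Re (V (Complex d (t + y))) + y * Im (G w)) - (Re (V (Complex d (t + 0))) + 0 * Im (G w))\<bar>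
          \<le> h * (2 * \<bar>y\<bar> / d + y\<^sup>2 / d\<^sup>2) * \<bar>y - 0\<bar>"
  proof (rule differentiable_bound[where S = "closed_segment 0 y"
        and f' = "\<lambda>u v. (Im (G w) - Im (G (Complex d (t + u)))) * v", unfolded real_norm_def])
    show "((\<lambda>u. Re (V (Complex d (t + u))) + u * Im (G w)) has_derivative
        (*) (Im (G w) - Im (G (Complex d (t + u))))) (at u within closed_segment 0 y)" for u
      using ver[of u] by (simp add: has_field_derivative_def has_derivative_at_withinI)
    show "onorm ((*) (Im (G w) - Im (G (Complex d (t + u))))) \<le> h * (2 * \<bar>y\<bar> / d + y\<^sup>2 / d\<^sup>2)"
      if "u \<in> closed_segment 0 y" for u
    proof (rule onorm_le)
      have "\<bar>u\<bar> \<le> \<bar>y\<bar>" using that by (auto simp: closed_segment_eq_real_ivl split: if_splits)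
      from Gver[OF this] show "norm ((Im (G w) - Im (G (Complex d (t + u)))) * v)
           \<le> h * (2 * \<bar>y\<bar> / d + y\<^sup>2 / d\<^sup>2) * norm v" for v
        by (simp add: abs_mult mult_right_mono)
    qed
  qed auto
  then have 1: "Re (V w) \<le> Re (V (Complex d (t + y))) + y * Im (G w) + h * (2 * y\<^sup>2 / d + \<bar>y\<bar> ^ 3 / d\<^sup>2)"
    by (simp add: w_def algebra_simps power2_eq_square power3_eq_cube abs_mult_self_eq flip: abs_mult)
  have "Re (V (Complex x t)) \<le> Re (V (Complex (2 * d / 3) t))"
  proof (rule DERIV_nonneg_imp_nondecreasing[OF x(2)])
    fix u assume "x \<le> u" "u \<le> 2 * d / 3"
    then show "\<exists>y. ((\<lambda>u. Re (V (Complex u t))) has_real_derivative y) (at u) \<and> 0 \<le> y"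
      using hor[of u] pos[of "Complex u t"] x by force
  qed
  \<comment> \<open>Between \<open>2 * d / 3\<close> and \<open>d\<close> the real part of
    \<open>G\<close> keeps at least half of its value at \<open>d\<close>; the factor 2/3 is chosen
    for this. A third of \<open>d\<close> times one half is the gain \<open>d / 6\<close>.\<close>
  moreover have "\<exists>u>2 * d / 3. u < d \<and> Re (V (Complex d t)) - Re (V (Complex (2 * d / 3) t)) = (d - 2 * d / 3) * Re (G (Complex u t))"
    using d by (intro MVT2) (auto intro!: hor)
  then obtain u where u: "2 * d / 3 < u" "u < d"
    "Re (V (Complex d t)) - Re (V (Complex (2 * d / 3) t)) = d / 3 * Re (G (Complex u t))" by auto
  moreover have "Re (G (Complex u t)) \<ge> h / 2"
  proof -
    define r where "r = (d - u) / (u + d)"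
    have "r = cmod (Complex u t - w) / cmod (Complex u t + cnj w)"
      using u d by (simp add: r_def w_def cmod_def)
    then have "r < 1" and G: "cmod (G (Complex u t) - G w) \<le> 2 * r / (1 - r) * Re (G w)"
      using positive_real_part_halfplane[OF hol pos, of w "Complex u t" r] d u by (auto simp: w_def)
    have "1 - r = 2 * u / (u + d)" unfolding r_def using u d by (simp add: field_simps)
    then have "2 * r / (1 - r) = (d - u) / u" unfolding r_def using u d by (simp add: divide_simps)
    also have "\<dots> \<le> 1 / 2" using u d by (simp add: field_simps)
    finally have "2 * r / (1 - r) * h \<le> 1 / 2 * h" using h by (intro mult_right_mono) auto
    with G have "cmod (G (Complex u t) - G w) \<le> h / 2" by (simp add: h_def)
    then show ?thesis using abs_Re_le_cmod[of "G (Complex u t) - G w"] by (simp add: h_def)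
  qed
  then have "d / 3 * Re (G (Complex u t)) \<ge> d / 3 * (h / 2)" using d by (intro mult_left_mono) auto
  ultimately have "Re (V (Complex x t)) \<le> Re (V w) - d / 6 * h" unfolding w_def by linarith
  with 1 show ?thesis unfolding h_def w_def by (simp add: algebra_simps)
qed

section \<open>Borel-Caratheodory and Landau's local factorisation\<close>

lemma borel_caratheodory_deriv:
  fixes f :: "complex \<Rightarrow> complex"
  assumes r: "0 < r2" "r2 < r1" and M: "M > 0"
    and hol: "f holomorphic_on ball s0 r1" and f0: "f s0 = 0"
    and le: "\<And>z. z \<in> ball s0 r1 \<Longrightarrow> Re (f z) \<le> M" and s: "s \<in> cball s0 r2"
  shows "cmod (deriv f s) \<le> 16 * (r1 + r2) / (r1 - r2)\<^sup>2 * M"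
proof -
  \<comment> \<open>\<open>f\<close> is bounded on the disc of this intermediate radius, and
    Cauchy's inequality passes from there to the derivative on the smaller disc.\<close>
  define r' where "r' = (r1 + r2) / 2"
  have r': "r2 < r'" "r' < r1" "0 < r'" using r by (auto simp: r'_def)
  have bd: "cmod (f z) \<le> 4 * M * r' / (r1 - r')" if z: "z \<in> cball s0 r'" for z
  proof -
    define u where "u = (z - s0) / of_real r1"
    have u: "cmod u = dist s0 z / r1" using r by (simp add: u_def norm_divide dist_norm norm_minus_commute)
    have u1: "cmod u \<le> r' / r1" using z r r' by (simp add: u divide_right_mono)
    also have "r' / r1 < 1" using r' r by simp
    finally have u2: "cmod u < 1" .
    have img: "s0 + of_real r1 * v \<in> ball s0 r1" if "cmod v < 1" for v
      using that r by (simp add: dist_norm norm_mult)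
    \<comment> \<open>\<open>2 * M\<close> in place of \<open>M\<close> makes the real part strictly
      positive.\<close>
    define g where "g = (\<lambda>v. of_real (2 * M) - f (s0 + of_real r1 * v))"
    have "cmod (g u - g 0) \<le> 2 * cmod u / (1 - cmod u) * Re (g 0)"
    proof (rule positive_real_part_disc)
      have "(f \<circ> (\<lambda>v. s0 + of_real r1 * v)) holomorphic_on ball 0 1"
        by (rule holomorphic_on_compose_gen[OF _ hol]) (use img in \<open>auto intro!: holomorphic_intros\<close>)
      then show "g holomorphic_on ball 0 1" unfolding g_def comp_def by (intro holomorphic_intros)
      show "Re (g v) > 0" if "cmod v < 1" for v
        using le[OF img[OF that]] M by (simp add: g_def)
    qed (use u2 in auto)
    moreover have "s0 + of_real r1 * u = z" using r by (simp add: u_def)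
    ultimately have "cmod (f z) \<le> 2 * cmod u / (1 - cmod u) * (2 * M)"
      using f0 by (simp add: g_def)
    also have "2 * cmod u / (1 - cmod u) \<le> 2 * (r' / r1) / (1 - r' / r1)"
      using u1 u2 \<open>r' / r1 < 1\<close> r' r by (intro frac_le) auto
    also have "\<dots> = 2 * r' / (r1 - r')" using r r' by (simp add: field_simps)
    finally show ?thesis using M by (simp add: mult_ac mult_right_mono)
  qed
  have sub: "cball s (r' - r2) \<subseteq> cball s0 r'"
    using s by (simp add: cball_subset_cball_iff dist_commute)
  have sub2: "cball s0 r' \<subseteq> ball s0 r1" using r' by auto
  have "cmod ((deriv ^^ 1) f s) \<le> fact 1 * (4 * M * r' / (r1 - r')) / (r' - r2) ^ 1"
  proof (rule Cauchy_inequality)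
    show "f holomorphic_on ball s (r' - r2)"
      using hol by (rule holomorphic_on_subset) (use sub sub2 ball_subset_cball in blast)
    show "continuous_on (cball s (r' - r2)) f"
      using holomorphic_on_imp_continuous_on[OF hol] by (rule continuous_on_subset) (use sub sub2 in blast)
    fix x assume "cmod (s - x) = r' - r2"
    then have "x \<in> cball s (r' - r2)" by (simp add: dist_norm)
    then show "cmod (f x) \<le> 4 * M * r' / (r1 - r')" using sub bd by blast
  qed (use r' in auto)
  also have "\<dots> = 16 * M * r' / ((r1 - r2) * (r1 - r2)) "
    unfolding r'_def using r by (simp add: divide_simps)
  also have "\<dots> = 8 * (r1 + r2) / (r1 - r2)\<^sup>2 * M"
    unfolding r'_def by (simp add: power2_eq_square)
  also have "\<dots> \<le> 16 * (r1 + r2) / (r1 - r2)\<^sup>2 * M"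
    using r M by (intro mult_right_mono divide_right_mono) auto
  finally show ?thesis by simp
qed

text \<open>Zeros are kept in lists so that they are counted with multiplicity.\<close>

lemma prod_list_has_field_derivative:
  fixes f :: "'a \<Rightarrow> complex \<Rightarrow> complex"
  assumes "\<And>x. x \<in> set xs \<Longrightarrow> (f x has_field_derivative f' x) (at s)" "\<And>x. x \<in> set xs \<Longrightarrow> f x s \<noteq> 0"
  shows "((\<lambda>z. \<Prod>x\<leftarrow>xs. f x z) has_field_derivative (\<Prod>x\<leftarrow>xs. f x s) * (\<Sum>x\<leftarrow>xs. f' x / f x s)) (at s)"
  using assms
proof (induction xs)
  case (Cons x xs)
  have "((\<lambda>z. f x z * (\<Prod>x\<leftarrow>xs. f x z)) has_field_derivative
     f' x * (\<Prod>x\<leftarrow>xs. f x s) + ((\<Prod>x\<leftarrow>xs. f x s) * (\<Sum>x\<leftarrow>xs. f' x / f x s)) * f x s) (at s)"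
    using Cons by (intro DERIV_mult) auto
  moreover have "f' x * P + (P * Q) * f x s = f x s * P * (f' x / f x s + Q)" for P Q
    using Cons.prems(2)[of x] by (simp add: field_simps)
  ultimately show ?case by (simp add: mult.assoc)
qed auto

lemma norm_prod_list: "cmod (\<Prod>x\<leftarrow>xs. f x) = (\<Prod>x\<leftarrow>xs. cmod (f x))"
  by (induction xs) (auto simp: norm_mult)

text \<open>The number of zeros that are pulled out is bounded by Jensen's inequality.\<close>
lemma landau_log_deriv:
  fixes f :: "complex \<Rightarrow> complex"
  assumes S: "open S" "cball s0 R \<subseteq> S" and hol: "f holomorphic_on S"
    and r: "0 < r2" "r2 < r1" "r1 < R" and M: "M > 0" and f0: "f s0 \<noteq> 0"
    and bd: "\<And>z. z \<in> cball s0 R \<Longrightarrow> cmod (f z) \<le> exp M * cmod (f s0)"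
  obtains zs where "\<And>z. z \<in> set zs \<Longrightarrow> f z = 0" "real (length zs) * ln (R / r1) \<le> M"
    "\<And>s. s \<in> cball s0 r2 \<Longrightarrow> f s \<noteq> 0 \<Longrightarrow>
       cmod (deriv f s / f s - (\<Sum>z\<leftarrow>zs. 1 / (s - z)))
         \<le> (16 * (r1 + r2) / (r1 - r2)\<^sup>2 + r1 / ((R\<^sup>2 - r1\<^sup>2) * ln (R / r1))) * M"
proof -
  \<comment> \<open>\<open>P zs g\<close>: the zeros \<open>zs\<close> have been divided out of
    \<open>f\<close>, and \<open>g\<close> is what remains. They are removed one at a time; the
    Jensen bound on their number is also what makes this process end.\<close>
  define P where "P = (\<lambda>zs g. (\<forall>z\<in>set zs. f z = 0 \<and> z \<in> cball s0 r1) \<and> g holomorphic_on S \<and>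
      (\<forall>z\<in>S. f z = (\<Prod>a\<leftarrow>zs. z - a) * g z))"
  \<comment> \<open>Each factor is the denominator of a Blaschke factor for the disc of radius
    \<open>R\<close>. On the boundary circle it has the modulus of \<open>z - a\<close>, so
    \<open>g * B\<close> has the modulus of \<open>f\<close> there, and the maximum principle
    carries the bound for \<open>f\<close> to the inside.\<close>
  define B where "B = (\<lambda>zs z. \<Prod>a\<leftarrow>zs. (of_real (R\<^sup>2) - cnj (a - s0) * (z - s0)) / of_real R)"
  have lnR: "ln (R / r1) > 0" using r by simp
  have s0S: "s0 \<in> S" using S r by auto
  have holB: "B zs holomorphic_on A" for zs A
    unfolding B_def by (induction zs) (auto intro!: holomorphic_intros)
  have bdB: "cmod (g z * B zs z) \<le> exp M * cmod (f s0)" if P: "P zs g" and z: "z \<in> cball s0 R" for zs g z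
  proof -
    have *: "cmod (g z * B zs z) \<le> exp M * cmod (f s0)" if z: "z \<in> frontier (cball s0 R)" for z
    proof -
      have zR: "cmod (z - s0) = R" using z r by (simp add: dist_norm norm_minus_commute)
      have "cmod ((of_real (R\<^sup>2) - cnj (a - s0) * (z - s0)) / of_real R) = cmod (z - a)" for a
      proof -
        have "of_real (R\<^sup>2) = cnj (z - s0) * (z - s0)"
          using complex_norm_square[of "z - s0"] zR by (simp add: mult.commute)
        then have "of_real (R\<^sup>2) - cnj (a - s0) * (z - s0) = cnj (z - a) * (z - s0)"
          by (simp add: algebra_simps)
        then show ?thesis using zR r by (simp add: norm_mult norm_divide del: complex_cnj_diff)
      qed
      then have "cmod (B zs z) = cmod (\<Prod>a\<leftarrow>zs. z - a)" by (simp add: B_def norm_prod_list)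
      then have "cmod (g z * B zs z) = cmod (f z)"
        using P z S by (auto simp: P_def norm_mult)
      then show ?thesis using bd[of z] z by simp
    qed
    have "(\<lambda>z. g z * B zs z) holomorphic_on S"
      using P holB by (intro holomorphic_intros) (auto simp: P_def)
    then have hS: "(\<lambda>z. g z * B zs z) holomorphic_on cball s0 R"
      using S by (rule_tac holomorphic_on_subset)
    show ?thesis
    proof (rule maximum_modulus_frontier[of "\<lambda>z. g z * B zs z" "cball s0 R"])
      show "(\<lambda>z. g z * B zs z) holomorphic_on interior (cball s0 R)"
        using hS interior_subset by (rule holomorphic_on_subset)
      show "continuous_on (closure (cball s0 R)) (\<lambda>z. g z * B zs z)"
        using hS by (simp add: holomorphic_on_imp_continuous_on)
    qed (use z * in auto)
  qed
  have gs0: "g s0 \<noteq> 0" if "P zs g" for zs g using that f0 s0S by (auto simp: P_def)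
  have len: "real (length zs) * ln (R / r1) \<le> M" and B0: "cmod (B zs s0) = R ^ length zs"
    "cmod (f s0) \<le> cmod (g s0 * B zs s0)" if P: "P zs g" for zs g
  proof -
    show B: "cmod (B zs s0) = R ^ length zs"
    proof -
      have "cmod (of_real (R\<^sup>2) / of_real R :: complex) = R" using r by (simp add: norm_divide norm_power power2_eq_square)
      then show ?thesis by (simp add: B_def norm_prod_list map_replicate_const norm_power)
    qed
    have "(\<forall>z\<in>set zs. z \<in> cball s0 r1) \<Longrightarrow> cmod (\<Prod>a\<leftarrow>zs. s0 - a) \<le> r1 ^ length zs"
      by (induction zs) (use r in \<open>auto simp: norm_mult dist_norm intro!: mult_mono\<close>)
    then have "cmod (\<Prod>a\<leftarrow>zs. s0 - a) \<le> r1 ^ length zs" using P by (auto simp: P_def)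
    then have fs0: "cmod (f s0) \<le> r1 ^ length zs * cmod (g s0)"
      using P s0S by (auto simp: P_def norm_mult intro!: mult_right_mono)
    also have "\<dots> \<le> R ^ length zs * cmod (g s0)" using r by (intro mult_right_mono power_mono) auto
    finally show "cmod (f s0) \<le> cmod (g s0 * B zs s0)" using B by (simp add: norm_mult mult.commute)
    \<comment> \<open>Jensen's inequality: at the centre each zero contributes at most
      \<open>r1\<close> to \<open>f\<close> but exactly \<open>R\<close> to
      \<open>B\<close>.\<close>
    have "cmod (g s0) * R ^ length zs \<le> exp M * (r1 ^ length zs * cmod (g s0))"
      using order.trans[OF bdB[OF P, of s0] mult_left_mono[OF fs0, of "exp M"]] r B by (simp add: norm_mult)
    then have "R ^ length zs \<le> exp M * r1 ^ length zs" using gs0[OF P] by (simp add: mult_ac)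
    then have "(R / r1) ^ length zs \<le> exp M" using r by (simp add: power_divide pos_divide_le_eq)
    moreover have "0 < (R / r1) ^ length zs" using r by simp
    ultimately have "ln ((R / r1) ^ length zs) \<le> M" using ln_le_cancel_iff[of "(R / r1) ^ length zs" "exp M"] by simp
    then show "real (length zs) * ln (R / r1) \<le> M" using r by (simp add: ln_realpow)
  qed
  define Q where "Q = (\<lambda>n. \<exists>zs g. P zs g \<and> length zs = n)"
  have "Q 0" unfolding Q_def P_def using hol by (intro exI[of _ "[]"] exI[of _ f]) auto
  moreover have "n \<le> nat \<lfloor>M / ln (R / r1)\<rfloor>" if Qn: "Q n" for n
  proof -
    from Qn obtain zs g where "P zs g" "length zs = n" by (auto simp: Q_def)
    then have "real n * ln (R / r1) \<le> M" using len by blast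
    then show ?thesis using lnR M by (simp add: le_nat_iff le_floor_iff pos_le_divide_eq)
  qed
  ultimately have "Q (Greatest Q)" "\<And>n. Q n \<Longrightarrow> n \<le> Greatest Q"
    using GreatestI_ex_nat[of Q] Greatest_le_nat[of Q] by blast+
  then obtain zs g where P: "P zs g" and mx: "\<not> Q (Suc (length zs))"
    unfolding Q_def by (metis Suc_n_not_le_n)
  \<comment> \<open>A further zero of \<open>g\<close> in the disc could be divided out as well, by
    removability of the singularity, against the maximality of \<open>zs\<close>.\<close>
  have g_nz: "g a \<noteq> 0" if a: "a \<in> cball s0 r1" for a
  proof
    assume ga: "g a = 0"
    define g' where "g' = (\<lambda>z. if z = a then deriv g a else g z / (z - a))"
    have aS: "a \<in> S" using a r S by (meson cball_subset_cball_iff less_imp_le subset_iff subset_cball)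
    have "g' holomorphic_on S"
      using P by (intro pole_theorem_open_0[where g = g and f = g']) (auto simp: g'_def P_def S ga)
    moreover have "g z = (z - a) * g' z" for z by (simp add: g'_def ga)
    ultimately have "P (a # zs) g'"
      using P a aS ga by (auto simp: P_def)
    then show False using mx by (auto simp: Q_def intro!: exI[of _ "a # zs"])
  qed
  define g2 where "g2 = (\<lambda>z. g z * B zs z)"
  have hol2: "g2 holomorphic_on S" unfolding g2_def
    using P holB by (intro holomorphic_intros) (auto simp: P_def)
  have Bterm: "cmod (of_real (R\<^sup>2) - cnj (a - s0) * (z - s0)) \<ge> R\<^sup>2 - r1\<^sup>2"
    if "a \<in> set zs" "z \<in> cball s0 r1" for a z
  proof -
    have "cmod (cnj (a - s0) * (z - s0)) \<le> r1 * r1"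
      using that P r unfolding norm_mult complex_mod_cnj
      by (intro mult_mono) (auto simp: P_def dist_norm norm_minus_commute)
    moreover have "cmod (of_real (R\<^sup>2)) = R\<^sup>2" unfolding norm_of_real by simp
    ultimately show ?thesis
      using norm_triangle_ineq2[of "of_real (R\<^sup>2)" "cnj (a - s0) * (z - s0)"]
      by (simp only: power2_eq_square)
  qed
  have R2: "R\<^sup>2 - r1\<^sup>2 > 0" using r by (simp add: power_strict_mono)
  have Bf: "(of_real (R\<^sup>2) - cnj (a - s0) * (z - s0)) / of_real R \<noteq> 0" if "a \<in> set zs" "z \<in> cball s0 r1" for a z
    using Bterm[OF that] R2 r by auto
  have B_nz: "B zs z \<noteq> 0" if "z \<in> cball s0 r1" for z
    unfolding B_def prod_list_zero_iff using Bf[OF _ that] by force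
  have sub1: "ball s0 r1 \<subseteq> S" using S r by (meson ball_subset_cball subset_trans subset_cball less_imp_le)
  have g2_nz: "g2 z \<noteq> 0" if "z \<in> cball s0 r1" for z using g_nz B_nz that by (auto simp: g2_def)
  have "(\<lambda>z. g2 z / g2 s0) holomorphic_on ball s0 r1"
    using hol2 sub1 g2_nz[of s0] r by (intro holomorphic_intros) (auto intro: holomorphic_on_subset)
  moreover have "g2 z / g2 s0 \<noteq> 0" if "z \<in> ball s0 r1" for z
    using g2_nz[of z] g2_nz[of s0] that r by auto
  \<comment> \<open>Without zeros in the disc, \<open>g2\<close> has a logarithm there whose real
    part is bounded by \<open>M\<close> after normalisation at \<open>s0\<close>; Borel-Caratheodory
    applies to it.\<close>
  ultimately obtain L where L: "L holomorphic_on ball s0 r1" "\<And>z. z \<in> ball s0 r1 \<Longrightarrow> g2 z / g2 s0 = exp (L z)"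
    using holomorphic_logarithm_exists[OF convex_ball open_ball, of "\<lambda>z. g2 z / g2 s0" s0 r1 s0] r
    by (smt (verit) centre_in_ball)
  define \<phi> where "\<phi> = (\<lambda>z. L z - L s0)"
  have s0b: "s0 \<in> ball s0 r1" using r by auto
  have eL: "exp (L s0) = 1" using L(2)[OF s0b] g2_nz[of s0] r by simp
  have \<phi>: "\<phi> holomorphic_on ball s0 r1" "\<phi> s0 = 0" "\<And>z. z \<in> ball s0 r1 \<Longrightarrow> g2 z / g2 s0 = exp (\<phi> z)"
    using L eL by (auto simp: \<phi>_def exp_diff intro!: holomorphic_intros)
  have Re\<phi>: "Re (\<phi> z) \<le> M" if z: "z \<in> ball s0 r1" for z
  proof -
    have "exp (Re (\<phi> z)) = cmod (g2 z) / cmod (g2 s0)"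
      using \<phi>(3)[OF z] by (metis norm_divide norm_exp_eq_Re)
    also have "\<dots> \<le> exp M * cmod (f s0) / cmod (g2 s0)"
      using bdB[OF P, of z] z r by (intro divide_right_mono) (auto simp: g2_def)
    also have "\<dots> \<le> exp M"
      using B0(2)[OF P] g2_nz[of s0] r by (simp add: g2_def divide_le_eq)
    finally show ?thesis by simp
  qed
  show thesis
  proof (rule that[of zs])
    show "\<And>z. z \<in> set zs \<Longrightarrow> f z = 0" using P by (auto simp: P_def)
    show "real (length zs) * ln (R / r1) \<le> M" by (rule len[OF P])
    fix s assume s: "s \<in> cball s0 r2" and fs: "f s \<noteq> 0"
    have sb: "s \<in> ball s0 r1" "s \<in> cball s0 r1" "s \<in> S" using s r sub1 by auto
    have d\<phi>: "cmod (deriv \<phi> s) \<le> 16 * (r1 + r2) / (r1 - r2)\<^sup>2 * M"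
      using borel_caratheodory_deriv[OF r(1,2) M \<phi>(1,2) Re\<phi> s] .
    have dg2: "(g2 has_field_derivative g2 s * deriv \<phi> s) (at s)"
    proof -
      have "(\<phi> has_field_derivative deriv \<phi> s) (at s)"
        using \<phi>(1) sb by (simp add: holomorphic_derivI)
      then have "((\<lambda>z. g2 s0 * exp (\<phi> z)) has_field_derivative g2 s0 * (exp (\<phi> s) * deriv \<phi> s)) (at s)"
        by (auto intro!: derivative_eq_intros)
      moreover have eq: "g2 s0 * exp (\<phi> z) = g2 z" if "z \<in> ball s0 r1" for z
        using \<phi>(3)[OF that] g2_nz[of s0] r by (simp add: field_simps)
      ultimately show ?thesis
        using eq[OF sb(1)] sb(1)
        by (subst (asm) has_field_derivative_cong_ev[where g = g2, OF refl _ refl])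
           (auto simp: mult.assoc[symmetric] intro!: eventually_nhds_in_open[THEN eventually_mono, of "ball s0 r1"])
    qed
    have zn: "s - a \<noteq> 0" if "a \<in> set zs" for a using P fs that by (auto simp: P_def)
    have dZ: "((\<lambda>z. \<Prod>a\<leftarrow>zs. z - a) has_field_derivative (\<Prod>a\<leftarrow>zs. s - a) * (\<Sum>a\<leftarrow>zs. 1 / (s - a))) (at s)"
      by (rule prod_list_has_field_derivative) (use zn in \<open>auto intro!: derivative_eq_intros\<close>)
    \<comment> \<open>The logarithmic derivative of the factor of \<open>B\<close> that belongs to
      \<open>a\<close>. Its pole is the mirror image of \<open>a\<close> outside the disc, so it
      counts as an error term.\<close>
    define b where "b = (\<lambda>a. - cnj (a - s0) / (of_real (R\<^sup>2) - cnj (a - s0) * (s - s0)))"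
    have dB: "(B zs has_field_derivative B zs s * (\<Sum>a\<leftarrow>zs. b a)) (at s)"
    proof -
      have "(B zs has_field_derivative (B zs s * (\<Sum>a\<leftarrow>zs. (- cnj (a - s0) / of_real R) /
               ((of_real (R\<^sup>2) - cnj (a - s0) * (s - s0)) / of_real R)))) (at s)"
        unfolding B_def
        by (rule prod_list_has_field_derivative) (use Bf[OF _ sb(2)] r in \<open>auto intro!: derivative_eq_intros\<close>)
      then show ?thesis using r by (simp add: b_def)
    qed
    have df: "(f has_field_derivative deriv f s) (at s)"
      using hol sb S by (simp add: holomorphic_derivI)
    have "((\<lambda>z. f z * B zs z) has_field_derivative
           (deriv f s * B zs s + B zs s * (\<Sum>a\<leftarrow>zs. b a) * f s)) (at s)"
      by (intro DERIV_mult df dB)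
    moreover have "((\<lambda>z. (\<Prod>a\<leftarrow>zs. z - a) * g2 z) has_field_derivative
       ((\<Prod>a\<leftarrow>zs. s - a) * (\<Sum>a\<leftarrow>zs. 1 / (s - a)) * g2 s + g2 s * deriv \<phi> s * (\<Prod>a\<leftarrow>zs. s - a))) (at s)"
      by (intro DERIV_mult dZ dg2)
    moreover have eq: "f z * B zs z = (\<Prod>a\<leftarrow>zs. z - a) * g2 z" if "z \<in> S" for z
      using P that by (auto simp: P_def g2_def)
    ultimately have "deriv f s * B zs s + B zs s * (\<Sum>a\<leftarrow>zs. b a) * f s =
        (\<Prod>a\<leftarrow>zs. s - a) * (\<Sum>a\<leftarrow>zs. 1 / (s - a)) * g2 s + g2 s * deriv \<phi> s * (\<Prod>a\<leftarrow>zs. s - a)"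
      by (subst (asm) has_field_derivative_cong_ev[where g = "\<lambda>z. (\<Prod>a\<leftarrow>zs. z - a) * g2 z", OF refl _ refl])
         (use S sb in \<open>auto intro!: eventually_nhds_in_open[THEN eventually_mono, of S] intro: DERIV_unique\<close>)
    also have "\<dots> = (f s * B zs s) * ((\<Sum>a\<leftarrow>zs. 1 / (s - a)) + deriv \<phi> s)"
      unfolding eq[OF sb(3)] by (simp add: algebra_simps)
    finally have "B zs s * (deriv f s) = B zs s * (f s * ((\<Sum>a\<leftarrow>zs. 1 / (s - a)) + deriv \<phi> s - (\<Sum>a\<leftarrow>zs. b a)))"
      by (simp add: algebra_simps)
    then have "deriv f s / f s - (\<Sum>a\<leftarrow>zs. 1 / (s - a)) = deriv \<phi> s - (\<Sum>a\<leftarrow>zs. b a)"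
      using B_nz[OF sb(2)] fs by simp
    moreover have "cmod (\<Sum>a\<leftarrow>zs. b a) \<le> r1 / (R\<^sup>2 - r1\<^sup>2) * real (length zs)"
    proof -
      have "cmod (b a) \<le> r1 / (R\<^sup>2 - r1\<^sup>2)" if "a \<in> set zs" for a
        unfolding b_def norm_divide norm_minus_cancel complex_mod_cnj
        using Bterm[OF that sb(2)] R2 P that r
        by (intro frac_le) (auto simp: P_def dist_norm norm_minus_commute)
      moreover have "(\<And>a. a \<in> set xs \<Longrightarrow> cmod (b a) \<le> c) \<Longrightarrow> cmod (\<Sum>a\<leftarrow>xs. b a) \<le> c * real (length xs)" for xs c
        by (induction xs) (auto simp: algebra_simps intro!: norm_triangle_le add_mono)
      ultimately show ?thesis by blast
    qed
    moreover have "r1 / (R\<^sup>2 - r1\<^sup>2) * real (length zs) \<le> r1 / (R\<^sup>2 - r1\<^sup>2) * (M / ln (R / r1))"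
      using len[OF P] lnR R2 r by (intro mult_left_mono) (auto simp: pos_le_divide_eq)
    ultimately have "cmod (deriv f s / f s - (\<Sum>a\<leftarrow>zs. 1 / (s - a))) \<le>
        16 * (r1 + r2) / (r1 - r2)\<^sup>2 * M + r1 / (R\<^sup>2 - r1\<^sup>2) * (M / ln (R / r1))"
      using d\<phi> norm_triangle_ineq4[of "deriv \<phi> s" "\<Sum>a\<leftarrow>zs. b a"] by simp
    then show "cmod (deriv f s / f s - (\<Sum>a\<leftarrow>zs. 1 / (s - a))) \<le>
       (16 * (r1 + r2) / (r1 - r2)\<^sup>2 + r1 / ((R\<^sup>2 - r1\<^sup>2) * ln (R / r1))) * M"
      by (simp add: algebra_simps)
  qed
qed

section \<open>Dirichlet series of bounded completely multiplicative functions\<close>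

text \<open>The index is shifted so that the series over the naturals starts with the coefficient at
  1.\<close>

definition dterm :: "(nat \<Rightarrow> complex) \<Rightarrow> complex \<Rightarrow> nat \<Rightarrow> complex" where
  "dterm f s n = f (Suc n) * of_nat (Suc n) powr (- s)"

definition dser :: "(nat \<Rightarrow> complex) \<Rightarrow> complex \<Rightarrow> complex" where
  "dser f s = (\<Sum>n. dterm f s n)"

lemma cmod_nat_powr: "n > 0 \<Longrightarrow> cmod (of_nat n powr s) = real n powr Re s"
  using norm_powr_real_powr[of "of_nat n" s] by simp

lemma nat_powr_exp: "n > 0 \<Longrightarrow> (of_nat n :: complex) powr s = exp (s * of_real (ln (real n)))"
  by (simp add: powr_def Ln_of_nat)

lemma dterm_exp: "dterm f s n = f (Suc n) * exp (- s * of_real (ln (real (Suc n))))"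
  unfolding dterm_def by (subst nat_powr_exp) auto

text \<open>By the mean value theorem the terms compare from both sides with the differences of
  consecutive values of \<open>real (Suc n) powr (-e)\<close>, and these telescope.\<close>

lemma zeta_tail_bounds:
  assumes "e > (0::real)"
  shows "summable (\<lambda>n. real (Suc n) powr (-1 - e))"
    and "(\<Sum>n. real (Suc n) powr (-1 - e)) \<le> 1 + 1 / e"
    and "1 / e \<le> (\<Sum>n. real (Suc n) powr (-1 - e))"
proof -
  define g where "g = (\<lambda>n. real (Suc n) powr (-e))"
  have der: "((\<lambda>x. x powr (-e)) has_real_derivative - (e * x powr (-1 - e))) (at x)" if "x > 0" for x
    using that by (auto intro!: derivative_eq_intros simp: powr_diff powr_minus field_simps)
  have ineq: "e * real (Suc (Suc n)) powr (-1 - e) \<le> g n - g (Suc n)"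
    "g n - g (Suc n) \<le> e * real (Suc n) powr (-1 - e)" for n
  proof -
    have "\<exists>z>real (Suc n). z < real (Suc (Suc n)) \<and> real (Suc (Suc n)) powr (-e) - real (Suc n) powr (-e)
        = (real (Suc (Suc n)) - real (Suc n)) * (- (e * z powr (-1 - e)))"
      by (rule MVT2) (auto intro!: der)
    then obtain z where z: "real (Suc n) < z" "z < real (Suc (Suc n))" "g n - g (Suc n) = e * z powr (-1-e)"
      by (auto simp: g_def)
    show "e * real (Suc (Suc n)) powr (-1 - e) \<le> g n - g (Suc n)"
      unfolding z(3) using z assms by (intro mult_left_mono powr_mono2') auto
    show "g n - g (Suc n) \<le> e * real (Suc n) powr (-1 - e)"
      unfolding z(3) using z assms by (intro mult_left_mono powr_mono2') auto
  qed
  have "g \<longlonglongrightarrow> 0" unfolding g_def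
    using assms by (intro tendsto_neg_powr filterlim_compose[OF filterlim_real_sequentially filterlim_Suc]) auto
  then have tel: "(\<lambda>n. g n - g (Suc n)) sums (g 0 - 0)" by (rule telescope_sums')
  have g0: "g 0 = 1" by (simp add: g_def)
  show sm: "summable (\<lambda>n. real (Suc n) powr (-1 - e))"
    using assms by (subst summable_Suc_iff) (simp add: summable_real_powr_iff)
  then have sm': "summable (\<lambda>n. real (Suc (Suc n)) powr (-1 - e))"
    by (subst summable_Suc_iff)
  have "e * (\<Sum>n. real (Suc (Suc n)) powr (-1 - e)) = (\<Sum>n. e * real (Suc (Suc n)) powr (-1 - e))"
    using sm' by (simp add: suminf_mult)
  also have "\<dots> \<le> (\<Sum>n. g n - g (Suc n))"
    using ineq(1) sm' tel by (intro suminf_le summable_mult) (auto simp: sums_iff)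
  also have "\<dots> = 1" using tel g0 by (simp add: sums_iff)
  finally have "(\<Sum>n. real (Suc (Suc n)) powr (-1 - e)) \<le> 1 / e" using assms by (simp add: field_simps)
  moreover have "(\<Sum>n. real (Suc n) powr (-1 - e)) = 1 + (\<Sum>n. real (Suc (Suc n)) powr (-1 - e))"
    using suminf_split_head[OF sm] by simp
  ultimately show "(\<Sum>n. real (Suc n) powr (-1 - e)) \<le> 1 + 1 / e" by simp
  have "1 = (\<Sum>n. g n - g (Suc n))" using tel g0 by (simp add: sums_iff)
  also have "\<dots> \<le> (\<Sum>n. e * real (Suc n) powr (-1 - e))"
    using ineq(2) sm tel by (intro suminf_le summable_mult) (auto simp: sums_iff)
  also have "\<dots> = e * (\<Sum>n. real (Suc n) powr (-1 - e))" using sm by (simp add: suminf_mult)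
  finally show "1 / e \<le> (\<Sum>n. real (Suc n) powr (-1 - e))" using assms by (simp add: field_simps)
qed

lemma ln_le_powr: "x \<ge> 1 \<Longrightarrow> e > 0 \<Longrightarrow> ln x \<le> x powr e / (e::real)"
  using ln_add_one_self_le_self2[of "x powr e - 1"] by (simp add: ln_powr field_simps)

text \<open>Half of the excess exponent is traded for the logarithm. For small \<open>e\<close> the
  bound still has the correct order \<open>1 / e^2\<close>.\<close>

lemma zeta_log_bounds:
  assumes "e > (0::real)"
  shows "summable (\<lambda>n. ln (real (Suc n)) * real (Suc n) powr (-1 - e))"
    and "(\<Sum>n. ln (real (Suc n)) * real (Suc n) powr (-1 - e)) \<le> 2 / e * (1 + 2 / e)"
proof -
  have le: "ln (real (Suc n)) * real (Suc n) powr (-1 - e) \<le> 2 / e * real (Suc n) powr (-1 - e/2)" for n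
  proof -
    have "ln (real (Suc n)) * real (Suc n) powr (-1 - e) \<le> real (Suc n) powr (e/2) / (e/2) * real (Suc n) powr (-1 - e)"
      using assms by (intro mult_right_mono ln_le_powr) auto
    also have "\<dots> = 2 / e * (real (Suc n) powr (e/2) * real (Suc n) powr (-1 - e))" by simp
    also have "real (Suc n) powr (e/2) * real (Suc n) powr (-1 - e) = real (Suc n) powr (-1 - e/2)"
    proof -
      have "e / 2 + (-1 - e) = -1 - e / 2" by simp
      then show ?thesis by (subst powr_add[symmetric]) (simp only:)
    qed
    finally show ?thesis .
  qed
  have sm: "summable (\<lambda>n. 2 / e * real (Suc n) powr (-1 - e/2))"
    using zeta_tail_bounds(1)[of "e/2"] assms by (intro summable_mult) auto
  show sm2: "summable (\<lambda>n. ln (real (Suc n)) * real (Suc n) powr (-1 - e))"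
    by (rule summable_comparison_test'[OF sm, of 0]) (use le in \<open>simp\<close>)
  have "(\<Sum>n. ln (real (Suc n)) * real (Suc n) powr (-1 - e)) \<le> (\<Sum>n. 2 / e * real (Suc n) powr (-1 - e/2))"
    using le sm sm2 by (intro suminf_le)
  also have "\<dots> = 2 / e * (\<Sum>n. real (Suc n) powr (-1 - e/2))"
    using zeta_tail_bounds(1)[of "e/2"] assms by (intro suminf_mult) auto
  also have "\<dots> \<le> 2 / e * (1 + 1 / (e/2))"
    using zeta_tail_bounds(2)[of "e/2"] assms by (intro mult_left_mono) auto
  finally show "(\<Sum>n. ln (real (Suc n)) * real (Suc n) powr (-1 - e)) \<le> 2 / e * (1 + 2 / e)" by simp
qed

text \<open>The coefficients may grow logarithmically, so that the lemma applies to derivatives as well.\<close>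
lemma dser_props:
  assumes f: "\<And>n. cmod (f n) \<le> c * (1 + ln (real n))" and s: "Re s > 1"
  shows "summable (\<lambda>n. cmod (dterm f s n))"
    and "(dser f has_field_derivative - dser (\<lambda>n. of_real (ln (real n)) * f n) s) (at s)"
    and "summable (\<lambda>n. dterm (\<lambda>n. of_real (ln (real n)) * f n) s n)"
proof -
  have bd: "cmod (dterm f s n) \<le> c * (real (Suc n) powr (-1 - e) + ln (real (Suc n)) * real (Suc n) powr (-1 - e))"
    if s: "Re s \<ge> 1 + e" and e: "e > 0" for s e n
  proof -
    have "cmod (dterm f s n) = cmod (f (Suc n)) * real (Suc n) powr (- Re s)"
      unfolding dterm_def norm_mult by (subst cmod_nat_powr) auto
    also have "\<dots> \<le> c * (1 + ln (real (Suc n))) * real (Suc n) powr (-1 - e)"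
      using s order.trans[OF norm_ge_zero f[of "Suc n"]] by (intro mult_mono f powr_mono) auto
    finally show ?thesis by (simp add: algebra_simps)
  qed
  have sm: "summable (\<lambda>n. c * (real (Suc n) powr (-1 - e) + ln (real (Suc n)) * real (Suc n) powr (-1 - e)))"
    if "e > 0" for e
    using zeta_tail_bounds(1)[OF that] zeta_log_bounds(1)[OF that] by (intro summable_mult summable_add)
  show "summable (\<lambda>n. cmod (dterm f s n))"
    by (rule summable_comparison_test'[OF sm[of "Re s - 1"], of 0]) (use bd[of "Re s - 1" s] s in auto)
  have "\<exists>g g'. \<forall>x\<in>{s. Re s > 1}. (\<lambda>n. dterm f x n) sums g x \<and>
      (\<lambda>n. - of_real (ln (real (Suc n))) * dterm f x n) sums g' x \<and> (g has_field_derivative g' x) (at x)"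
  proof (rule series_and_derivative_comparison_local)
    show "open {s. Re s > 1}" by (rule open_halfspace_Re_gt)
    show "((\<lambda>x. dterm f x n) has_field_derivative - of_real (ln (real (Suc n))) * dterm f x n) (at x)" for n x
      unfolding dterm_exp by (auto intro!: derivative_eq_intros simp del: of_nat_Suc)
    fix x assume x: "x \<in> {s. Re s > 1}"
    define e where "e = (Re x - 1) / 2"
    have e: "e > 0" using x by (simp add: e_def)
    have "Re y \<ge> 1 + e" if "y \<in> ball x e" for y
      using that abs_Re_le_cmod[of "x - y"] by (auto simp: dist_norm e_def field_simps)
    then show "\<exists>d h. 0 < d \<and> summable h \<and> (\<forall>\<^sub>F n in sequentially. \<forall>y\<in>ball x d \<inter> {s. Re s > 1}. cmod (dterm f y n) \<le> h n)"
      using e sm[OF e] bd by (intro exI[of _ e] exI[of _ "\<lambda>n. c * (real (Suc n) powr (-1 - e) + ln (real (Suc n)) * real (Suc n) powr (-1 - e))"]) auto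
  qed
  then obtain g g' where g: "\<And>x. Re x > 1 \<Longrightarrow> (\<lambda>n. dterm f x n) sums g x"
      "\<And>x. Re x > 1 \<Longrightarrow> (\<lambda>n. - of_real (ln (real (Suc n))) * dterm f x n) sums g' x"
      "\<And>x. Re x > 1 \<Longrightarrow> (g has_field_derivative g' x) (at x)" by auto
  have "(\<lambda>n. dterm (\<lambda>n. of_real (ln (real n)) * f n) s n) sums (- g' s)"
    using sums_minus[OF g(2)[OF s]] by (simp add: dterm_def mult.assoc)
  then show "summable (\<lambda>n. dterm (\<lambda>n. of_real (ln (real n)) * f n) s n)"
    and "(dser f has_field_derivative - dser (\<lambda>n. of_real (ln (real n)) * f n) s) (at s)"
    using g(3)[OF s] g(1)
    by (auto simp: sums_iff dser_def intro!: has_field_derivative_transform_within_open[OF g(3)[OF s] open_halfspace_Re_gt[of 1]] s)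
qed

lemma dser_has_sum:
  assumes "summable (\<lambda>n. cmod (dterm f s n))"
  shows "((\<lambda>n. f n * of_nat n powr (- s)) has_sum dser f s) {0<..}"
    and "((\<lambda>n. cmod (f n * of_nat n powr (- s))) has_sum (\<Sum>n. cmod (dterm f s n))) {0<..}"
proof -
  have bij: "bij_betw Suc UNIV {0<..}"
    by (rule bij_betwI[of _ _ _ "\<lambda>n. n - 1"]) auto
  have "(dterm f s has_sum dser f s) UNIV"
    using norm_summable_imp_has_sum[OF assms] assms summable_norm_cancel[OF assms]
    by (simp add: dser_def summable_sums)
  then show "((\<lambda>n. f n * of_nat n powr (- s)) has_sum dser f s) {0<..}"
    using has_sum_reindex_bij_betw[OF bij, of "\<lambda>n. f n * of_nat n powr (- s)"]
    by (simp add: dterm_def[abs_def])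
  have "((\<lambda>n. cmod (dterm f s n)) has_sum (\<Sum>n. cmod (dterm f s n))) UNIV"
    using assms by (intro sums_nonneg_imp_has_sum) (auto simp: summable_sums)
  then show "((\<lambda>n. cmod (f n * of_nat n powr (- s))) has_sum (\<Sum>n. cmod (dterm f s n))) {0<..}"
    using has_sum_reindex_bij_betw[OF bij, of "\<lambda>n. cmod (f n * of_nat n powr (- s))"]
    by (simp add: dterm_def[abs_def])
qed

text \<open>The Dirichlet convolution of \<open>mangoldt\<close> with 1 is the logarithm, and
  complete multiplicativity turns \<open>f d * f (k div d)\<close> into \<open>f k\<close>. Absolute
  summability over pairs permits grouping them by their product.\<close>

lemma dser_mangoldt_convolution:
  assumes mult: "\<And>m n. f (m * n) = f m * f n" and f: "\<And>n. cmod (f n) \<le> 1" and s: "Re s > 1"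
  shows "dser (\<lambda>n. mangoldt n * f n) s * dser f s = dser (\<lambda>n. of_real (ln (real n)) * f n) s"
proof -
  define a where "a = (\<lambda>n. mangoldt n * f n * of_nat n powr (- s))"
  define b where "b = (\<lambda>n. f n * of_nat n powr (- s))"
  define A where "A = {0::nat<..}"
  have f1: "cmod (f n) \<le> 1 * (1 + ln (real n))" for n
    using f[of n] by (cases "n = 0") (auto intro: order.trans)
  have fL: "cmod (mangoldt n * f n) \<le> 1 * (1 + ln (real n))" for n
  proof (cases "n = 0")
    case False
    then have "mangoldt n * cmod (f n) \<le> ln (real n) * 1"
      using f[of n] by (intro mult_mono mangoldt_le mangoldt_nonneg) auto
    then show ?thesis by (simp add: norm_mult)
  qed auto
  have fl: "cmod (of_real (ln (real n)) * f n) \<le> 1 * (1 + ln (real n))" for n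
  proof (cases "n = 0")
    case False
    then have "ln (real n) * cmod (f n) \<le> ln (real n) * 1"
      using f[of n] by (intro mult_left_mono) auto
    then show ?thesis using False by (simp add: norm_mult)
  qed auto
  note sa = dser_has_sum[OF dser_props(1)[of "\<lambda>n. mangoldt n * f n", OF fL s]]
  note sb = dser_has_sum[OF dser_props(1)[of f, OF f1 s]]
  note sl = dser_has_sum[OF dser_props(1)[of "\<lambda>n. of_real (ln (real n)) * f n", OF fl s]]
  have "(\<lambda>p. cmod (a (fst p) * b (snd p))) summable_on A \<times> A"
  proof (rule summable_on_SigmaI)
    fix x assume "x \<in> A"
    show "((\<lambda>y. cmod (a (fst (x, y)) * b (snd (x, y)))) has_sum (cmod (a x) * (\<Sum>n. cmod (dterm f s n)))) A"
      using has_sum_cmult_right[OF sb(2)] by (simp add: norm_mult b_def A_def)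
  next
    show "(\<lambda>x. cmod (a x) * (\<Sum>n. cmod (dterm f s n))) summable_on A"
      using has_sum_imp_summable[OF has_sum_cmult_left[OF sa(2)]] by (simp add: a_def A_def)
  qed auto
  then have sm: "(\<lambda>p. a (fst p) * b (snd p)) summable_on A \<times> A"
    by (rule abs_summable_summable)
  have hs: "((\<lambda>p. a (fst p) * b (snd p)) has_sum dser (\<lambda>n. mangoldt n * f n) s * dser f s) (A \<times> A)"
  proof (rule has_sum_SigmaI)
    fix x assume "x \<in> A"
    show "((\<lambda>y. a (fst (x, y)) * b (snd (x, y))) has_sum (a x * dser f s)) A"
      using has_sum_cmult_right[OF sb(1)] by (simp add: b_def A_def)
  next
    show "((\<lambda>x. a x * dser f s) has_sum dser (\<lambda>n. mangoldt n * f n) s * dser f s) A"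
      using has_sum_cmult_left[OF sa(1)] by (simp add: a_def A_def)
  qed (rule sm)
  \<comment> \<open>The pair \<open>(d, e)\<close> is re-indexed as \<open>(d * e, d)\<close>, so
    that the inner sum runs over the divisors of the first component.\<close>
  have "((\<lambda>p. a (snd p) * b (fst p div snd p)) has_sum dser (\<lambda>n. mangoldt n * f n) s * dser f s)
           (Sigma A (\<lambda>k. {d. d dvd k}))"
    using hs
    by (subst has_sum_reindex_bij_witness[where T = "A \<times> A" and h = "\<lambda>p. a (fst p) * b (snd p)"
           and i = "\<lambda>p. (fst p * snd p, fst p)" and j = "\<lambda>p. (snd p, fst p div snd p)"])
       (auto simp: A_def elim!: dvdE)
  then have "((\<lambda>k. \<Sum>d | d dvd k. a d * b (k div d)) has_sum dser (\<lambda>n. mangoldt n * f n) s * dser f s) A"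
    by (rule has_sum_SigmaD) (auto simp: A_def intro!: has_sum_finite)
  moreover have "(\<Sum>d | d dvd k. a d * b (k div d)) = of_real (ln (real k)) * f k * of_nat k powr (- s)" if k: "k \<in> A" for k
  proof -
    have "a d * b (k div d) = mangoldt d * (f k * of_nat k powr (- s))" if "d dvd k" for d
    proof -
      from that obtain e where e: "k = d * e" by blast
      then have "d > 0" "e > 0" using k by (auto simp: A_def)
      then have "ln (real (d * e)) = ln (real d) + ln (real e)" by (simp add: ln_mult)
      with \<open>d > 0\<close> \<open>e > 0\<close> have "of_nat d powr (- s) * of_nat e powr (- s) = (of_nat (d * e) powr (- s) :: complex)"
        by (simp add: nat_powr_exp ring_distribs exp_add[symmetric] del: of_nat_mult)
      with e \<open>d > 0\<close> show ?thesis by (simp add: a_def b_def mult flip: of_nat_mult)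
    qed
    then have "(\<Sum>d | d dvd k. a d * b (k div d)) = (\<Sum>d | d dvd k. mangoldt d) * (f k * of_nat k powr (- s))"
      by (simp add: sum_distrib_right)
    then show ?thesis using k mangoldt_sum[of k, where ?'a = complex] by (simp add: A_def mult.assoc)
  qed
  ultimately have "((\<lambda>k. of_real (ln (real k)) * f k * of_nat k powr (- s)) has_sum dser (\<lambda>n. mangoldt n * f n) s * dser f s) A"
    by (subst (asm) has_sum_cong) auto
  then show ?thesis using sl(1) has_sum_unique unfolding A_def by blast
qed

text \<open>The logarithm of the Euler product: at the j-th power of a prime the weight is
  \<open>1 / j\<close>. At 0 and 1 the quotient is 0.\<close>

definition plog :: "(nat \<Rightarrow> complex) \<Rightarrow> complex \<Rightarrow> complex" where
  "plog f = dser (\<lambda>n. of_real (mangoldt n / ln (real n)) * f n)"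

lemma mangoldt_div_ln: "0 \<le> mangoldt n / ln (real n)" "mangoldt n / ln (real n) \<le> (1::real)"
proof -
  have "mangoldt n / ln (real n) \<le> (1::real) \<and> 0 \<le> mangoldt n / ln (real n)"
  proof (cases "n \<le> 1")
    case True
    then have "n = 0 \<or> n = 1" by auto
    then show ?thesis by auto
  next
    case False
    then show ?thesis using mangoldt_le[of n] mangoldt_nonneg[of n] by (auto simp: divide_le_eq_1)
  qed
  then show "0 \<le> mangoldt n / ln (real n)" "mangoldt n / ln (real n) \<le> (1::real)" by auto
qed

lemma dser_bounds:
  assumes f: "\<And>n. cmod (f n) \<le> 1" and s: "Re s > 1"
  shows "summable (\<lambda>n. cmod (dterm f s n))"
    and "cmod (dser f s) \<le> 1 + 1 / (Re s - 1)"
    and "f 1 = 1 \<Longrightarrow> cmod (dser f s - 1) \<le> (\<Sum>n. real (Suc (Suc n)) powr (- Re s))"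
proof -
  have bd: "cmod (dterm f s n) \<le> real (Suc n) powr (-1 - (Re s - 1))" for n
    unfolding dterm_def norm_mult using f[of "Suc n"]
    by (subst cmod_nat_powr) (auto intro: mult_left_le_one_le)
  have sm: "summable (\<lambda>n. real (Suc n) powr (-1 - (Re s - 1)))"
    using zeta_tail_bounds(1)[of "Re s - 1"] s by simp
  show sd: "summable (\<lambda>n. cmod (dterm f s n))"
    by (rule summable_comparison_test'[OF sm, of 0]) (use bd in auto)
  have "cmod (dser f s) \<le> (\<Sum>n. cmod (dterm f s n))"
    unfolding dser_def by (rule summable_norm[OF sd])
  also have "\<dots> \<le> (\<Sum>n. real (Suc n) powr (-1 - (Re s - 1)))"
    using bd sd sm by (intro suminf_le)
  also have "\<dots> \<le> 1 + 1 / (Re s - 1)" using s by (intro zeta_tail_bounds(2)) auto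
  finally show "cmod (dser f s) \<le> 1 + 1 / (Re s - 1)" .
  assume f1: "f 1 = 1"
  have sd': "summable (\<lambda>n. cmod (dterm f s (Suc n)))" using sd by (subst summable_Suc_iff)
  have "dser f s = dterm f s 0 + (\<Sum>n. dterm f s (Suc n))"
    unfolding dser_def using suminf_split_head[OF summable_norm_cancel[OF sd]] by simp
  also have "dterm f s 0 = 1" using f1 by (simp add: dterm_def)
  finally have "cmod (dser f s - 1) \<le> (\<Sum>n. cmod (dterm f s (Suc n)))"
    using summable_norm[OF sd'] by simp
  also have "\<dots> \<le> (\<Sum>n. real (Suc (Suc n)) powr (- Re s))"
    using bd[of "Suc _"] sd' sm by (intro suminf_le) (auto simp: summable_Suc_iff[of "\<lambda>n. real (Suc n) powr (-Re s)"] simp del: of_nat_Suc)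
  finally show "cmod (dser f s - 1) \<le> (\<Sum>n. real (Suc (Suc n)) powr (- Re s))" .
qed

text \<open>A bound below 1 keeps \<open>dser f\<close> away from 0 on the line Re s = 2, on which
  the discs for Landau's factorisation are centred.\<close>

lemma zeta_2_tail: "(\<Sum>n. real (Suc (Suc n)) powr (-2)) \<le> 3/4"
proof -
  have eq: "real (Suc n) powr (-2) = inverse ((real (Suc n))\<^sup>2)" for n
    by (simp add: powr_minus powr_numeral)
  have sm: "summable (\<lambda>n. real (Suc n) powr (-2))" using zeta_tail_bounds(1)[of 1] by simp
  have "(\<Sum>n. real (Suc n) powr (-2)) = pi\<^sup>2 / 6"
    unfolding eq using inverse_squares_sums by (simp add: sums_iff add_ac inverse_eq_divide)
  moreover have "(\<Sum>n. real (Suc n) powr (-2)) = 1 + (\<Sum>n. real (Suc (Suc n)) powr (-2))"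
    using suminf_split_head[OF sm] by simp
  moreover have "pi\<^sup>2 \<le> 3.2\<^sup>2" using pi_approx by (intro power_mono) auto
  ultimately show ?thesis by (simp add: power2_eq_square)
qed

text \<open>By the convolution identity \<open>dser f s * exp (- plog f s)\<close> has derivative 0,
  so it is a constant \<open>c\<close>. Its size is read off at \<open>s = 2\<close>, where both
  functions are bounded and \<open>dser f\<close> is bounded away from 0.\<close>

lemma dser_eq_exp_plog:
  assumes mult: "\<And>m n. f (m * n) = f m * f n" and f: "\<And>n. cmod (f n) \<le> 1" and f1: "f 1 = 1"
  obtains c where "exp (-2) / 4 \<le> cmod c" "cmod c \<le> 2 * exp 2"
    "\<And>s. Re s > 1 \<Longrightarrow> dser f s = c * exp (plog f s)"
    "\<And>s. Re s > 1 \<Longrightarrow> (plog f has_field_derivative - dser (\<lambda>n. mangoldt n * f n) s) (at s)"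
    "\<And>s. Re s > 1 \<Longrightarrow> (dser f has_field_derivative - dser (\<lambda>n. mangoldt n * f n) s * dser f s) (at s)"
proof -
  have fp: "cmod (of_real (mangoldt n / ln (real n)) * f n) \<le> 1" for n
    unfolding norm_mult norm_of_real using f[of n] mangoldt_div_ln[of n]
    by (intro mult_le_one) auto
  have one: "cmod x \<le> 1 \<Longrightarrow> cmod x \<le> 1 * (1 + ln (real n))" for x n
    by (cases "n = 0") (auto intro: order.trans)
  have dp: "(plog f has_field_derivative - dser (\<lambda>n. mangoldt n * f n) s) (at s)" if s: "Re s > 1" for s
  proof -
    have "dser (\<lambda>n. of_real (ln (real n)) * (of_real (mangoldt n / ln (real n)) * f n)) s = dser (\<lambda>n. mangoldt n * f n) s"
      unfolding dser_def
    proof (rule suminf_cong)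
      fix n
      have "ln (real (Suc n)) = 0 \<Longrightarrow> n = 0" by (subst (asm) ln_eq_zero_iff) auto
      then show "dterm (\<lambda>n. of_real (ln (real n)) * (of_real (mangoldt n / ln (real n)) * f n)) s n
         = dterm (\<lambda>n. mangoldt n * f n) s n"
        by (cases "n = 0") (auto simp: dterm_def simp del: of_nat_Suc)
    qed
    then show ?thesis unfolding plog_def
      using dser_props(2)[where f = "\<lambda>n. of_real (mangoldt n / ln (real n)) * f n" and c = 1, OF one[OF fp] s]
      by (simp only:)
  qed
  have df: "(dser f has_field_derivative - dser (\<lambda>n. mangoldt n * f n) s * dser f s) (at s)" if s: "Re s > 1" for s
    using dser_props(2)[OF one[OF f] s] dser_mangoldt_convolution[OF mult f s] by simp
  have "((\<lambda>s. dser f s * exp (- plog f s)) has_field_derivative 0) (at s within {s. Re s > 1})" if s: "s \<in> {s. Re s > 1}" for s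
  proof -
    have s': "Re s > 1" using s by simp
    from DERIV_mult[OF df[OF s'] DERIV_chain2[OF DERIV_exp DERIV_minus[OF dp[OF s']]]]
    have "((\<lambda>s. dser f s * exp (- plog f s)) has_field_derivative 0) (at s)"
      by (simp add: mult_ac)
    then show ?thesis by (rule has_field_derivative_at_within)
  qed
  then obtain c where c: "\<And>s. Re s > 1 \<Longrightarrow> dser f s * exp (- plog f s) = c"
    using has_field_derivative_zero_constant[OF convex_halfspace_Re_gt[of 1]] by fastforce
  then have eq: "dser f s = c * exp (plog f s)" if "Re s > 1" for s
    using c[OF that] by (simp add: exp_minus field_simps)
  have P2: "cmod (plog f 2) \<le> 2" unfolding plog_def using dser_bounds(2)[where s = 2, OF fp] by simp
  have "cmod (dser f 2 - 1) \<le> 3/4" using dser_bounds(3)[where f = f and s = 2, OF f] f1 zeta_2_tail by simp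
  then have D2: "cmod (dser f 2) \<ge> 1/4" using norm_triangle_ineq2[of 1 "1 - dser f 2"] by (simp add: norm_minus_commute)
  have D2': "cmod (dser f 2) \<le> 2" using dser_bounds(2)[where f = f and s = 2, OF f] by simp
  have cc: "cmod c = cmod (dser f 2) * exp (- Re (plog f 2))" using c[of 2] by (auto simp: norm_mult)
  have Re2: "\<bar>Re (plog f 2)\<bar> \<le> 2" using P2 abs_Re_le_cmod[of "plog f 2"] by linarith
  show thesis
  proof (rule that[of c])
    have "1/4 * exp (-2) \<le> cmod c" unfolding cc using D2 Re2 by (intro mult_mono) auto
    then show "exp (-2) / 4 \<le> cmod c" by simp
    show "cmod c \<le> 2 * exp 2" unfolding cc using D2' Re2 by (intro mult_mono) auto
  qed (use eq dp df in auto)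
qed

section \<open>Dirichlet L-functions to the right of 0\<close>

lemma dirichlet_char_simps:
  assumes "dirichlet_char q chi"
  shows "q > 0" "chi (m * n) = chi m * chi n" "chi (n + q) = chi n" "chi n \<noteq> 0 \<longleftrightarrow> coprime n q"
  using assms by (auto simp: dirichlet_char_def)

lemma dirichlet_char_1: "dirichlet_char q chi \<Longrightarrow> chi 1 = 1"
  using dirichlet_char_simps(2)[of q chi 1 1] dirichlet_char_simps(4)[of q chi 1] by simp

lemma dirichlet_char_add_mult: "dirichlet_char q chi \<Longrightarrow> chi (n + m * q) = chi n"
  by (induction m) (auto simp: dirichlet_char_simps(3) simp flip: add.assoc simp: add.commute[of q] )

lemma dirichlet_char_mod: "dirichlet_char q chi \<Longrightarrow> chi (n mod q) = chi n"
  using dirichlet_char_add_mult[of q chi "n mod q" "n div q"] by (simp add: add.commute)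

lemma dirichlet_char_cong: "dirichlet_char q chi \<Longrightarrow> [m = n] (mod q) \<Longrightarrow> chi m = chi n"
  by (metis dirichlet_char_mod cong_def)

lemma dirichlet_char_power: "dirichlet_char q chi \<Longrightarrow> chi (n ^ k) = chi n ^ k"
  by (induction k) (simp_all add: dirichlet_char_1[unfolded One_nat_def] dirichlet_char_simps(2))

text \<open>By Euler's theorem the nonzero values are roots of unity.\<close>

lemma dirichlet_char_norm: assumes "dirichlet_char q chi" shows "cmod (chi n) \<le> 1"
proof (cases "coprime n q")
  case True
  have "chi (n ^ totient q) = chi 1"
    using euler_theorem[OF True] by (rule dirichlet_char_cong[OF assms])
  then have "chi n ^ totient q = 1" using assms dirichlet_char_1[OF assms] by (simp add: dirichlet_char_power)
  then have "cmod (chi n) ^ totient q = 1" by (metis norm_power norm_one)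
  then show ?thesis
    using one_less_power[of "cmod (chi n)" "totient q"] dirichlet_char_simps(1)[OF assms] by fastforce
next
  case False
  then show ?thesis using dirichlet_char_simps(4)[OF assms, of n] by simp
qed

text \<open>Multiplication by \<open>a\<close> permutes the residues, so the sum does not change
  when multiplied by \<open>chi a \<noteq> 1\<close>.\<close>

lemma dirichlet_char_sum_period:
  assumes c: "dirichlet_char q chi" and np: "\<not> principal_char q chi"
  shows "(\<Sum>n<q. chi n) = 0"
proof -
  obtain a where a: "coprime a q" "chi a \<noteq> 1" using np by (auto simp: principal_char_def)
  have q: "q > 0" using dirichlet_char_simps(1)[OF c] .
  have inj: "inj_on (\<lambda>n. a * n mod q) {..<q}"
  proof (rule inj_onI)
    fix x y assume xy: "x \<in> {..<q}" "y \<in> {..<q}" "a * x mod q = a * y mod q"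
    then have "[x = y] (mod q)" using a cong_mult_lcancel_nat[of a q x y] by (simp add: cong_def)
    then show "x = y" using xy by (simp add: cong_def)
  qed
  then have bij: "bij_betw (\<lambda>n. a * n mod q) {..<q} {..<q}"
    unfolding bij_betw_def using q by (intro conjI endo_inj_surj) auto
  have "(\<Sum>n<q. chi n) = (\<Sum>n<q. chi (a * n mod q))"
    using sum.reindex_bij_betw[OF bij, of chi] by simp
  also have "\<dots> = chi a * (\<Sum>n<q. chi n)"
    by (simp add: dirichlet_char_mod[OF c] dirichlet_char_simps(2)[OF c] sum_distrib_left)
  finally show ?thesis using a by (simp add: algebra_simps)
qed

lemma dirichlet_char_sum_bound:
  assumes c: "dirichlet_char q chi" and np: "\<not> principal_char q chi"
  shows "cmod (\<Sum>n<N. chi n) \<le> real q"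
proof -
  have per: "(\<Sum>n<m * q. chi n) = 0" for m
  proof (induction m)
    case (Suc m)
    have "(\<Sum>n<Suc m * q. chi n) = (\<Sum>n<m * q. chi n) + (\<Sum>n\<in>{m * q..<Suc m * q}. chi n)"
      by (subst sum.union_disjoint[symmetric]) (auto intro: arg_cong2[of _ _ _ _ sum])
    also have "(\<Sum>n\<in>{m * q..<Suc m * q}. chi n) = (\<Sum>n\<in>{0..<q}. chi (n + m * q))"
      using sum.shift_bounds_nat_ivl[of chi 0 "m * q" q] by (simp add: add.commute)
    also have "\<dots> = 0"
      using dirichlet_char_sum_period[OF c np] by (simp add: dirichlet_char_add_mult[OF c] atLeast0LessThan)
    finally show ?case using Suc by simp
  qed auto
  define m where "m = N div q"
  have N: "N = m * q + N mod q" by (simp add: m_def)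
  have "(\<Sum>n<N. chi n) = (\<Sum>n<m * q. chi n) + (\<Sum>n\<in>{m * q..<N}. chi n)"
    using N by (subst sum.union_disjoint[symmetric]) (auto intro: arg_cong2[of _ _ _ _ sum])
  then have "cmod (\<Sum>n<N. chi n) \<le> (\<Sum>n\<in>{m * q..<N}. cmod (chi n))" using per norm_sum by simp
  also have "\<dots> \<le> (\<Sum>n\<in>{m * q..<N}. 1)" using dirichlet_char_norm[OF c] by (intro sum_mono) auto
  also have "\<dots> = real (card {m * q..<N})" by (simp only: real_of_card)
  also have "card {m * q..<N} = N mod q" by (simp add: m_def minus_div_mult_eq_mod)
  also have "\<dots> \<le> real q" using dirichlet_char_simps(1)[OF c] by simp
  finally show ?thesis .
qed

lemma powr_diff_bound:
  assumes s: "Re s > 0"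
  shows "cmod (of_nat (Suc n) powr (- s) - of_nat (Suc (Suc n)) powr (- s)) \<le> cmod s * real (Suc n) powr (-1 - Re s)"
proof -
  have der: "((\<lambda>z. z powr (- s)) has_field_derivative (- s) * z powr (- s - 1)) (at z within X)"
    if "z \<in> of_real ` {real (Suc n)..real (Suc (Suc n))}" for z X
    using that by (auto intro!: derivative_eq_intros simp: complex_nonpos_Reals_iff)
  have "cmod (of_real (real (Suc n)) powr (- s) - of_real (real (Suc (Suc n))) powr (- s))
     \<le> cmod s * real (Suc n) powr (-1 - Re s) * cmod (of_real (real (Suc n)) - of_real (real (Suc (Suc n))))"
  proof (rule field_differentiable_bound[where S = "of_real ` {real (Suc n)..real (Suc (Suc n))}"])
    show "convex (complex_of_real ` {real (Suc n)..real (Suc (Suc n))})"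
      by (intro convex_linear_image bounded_linear.linear bounded_linear_of_real) auto
    fix z :: complex assume z: "z \<in> of_real ` {real (Suc n)..real (Suc (Suc n))}"
    then obtain x where x: "z = of_real x" "real (Suc n) \<le> x" "x > 0" by force
    have "cmod (z powr (- s - 1)) = x powr (- Re s - 1)"
      using x norm_powr_real_powr[of z "- s - 1"] by simp
    also have "\<dots> = x powr (-1 - Re s)" by (rule arg_cong2[of _ _ _ _ "(powr)"]) auto
    also have "\<dots> \<le> real (Suc n) powr (-1 - Re s)" using x s by (intro powr_mono2') auto
    finally show "cmod ((- s) * z powr (- s - 1)) \<le> cmod s * real (Suc n) powr (-1 - Re s)"
      by (simp add: norm_mult mult_left_mono)
    show "((\<lambda>z. z powr (- s)) has_field_derivative (- s) * z powr (- s - 1)) (at z within of_real ` {real (Suc n)..real (Suc (Suc n))})"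
      by (rule der[OF z])
  next
    show "complex_of_real (real (Suc n)) \<in> of_real ` {real (Suc n)..real (Suc (Suc n))}"
      "complex_of_real (real (Suc (Suc n))) \<in> of_real ` {real (Suc n)..real (Suc (Suc n))}"
      by (intro imageI; simp)+
  qed
  also have "cmod (of_real (real (Suc n)) - of_real (real (Suc (Suc n)))) = 1"
    by (simp flip: of_real_diff)
  finally show ?thesis by simp
qed

text \<open>Partial summation trades \<open>chi\<close> for its bounded partial sums
  \<open>S\<close>. The resulting series of entire functions \<open>T n\<close> converges locally
  uniformly for Re s > 0, which gives holomorphy and a bound linear in \<open>q\<close>; the
  boundary term tends to 0.\<close>

lemma dirichlet_L_props:
  assumes c: "dirichlet_char q chi" and np: "\<not> principal_char q chi"
  shows "dirichlet_L chi holomorphic_on {s. Re s > 0}"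
    and "Re s > 0 \<Longrightarrow> cmod (dirichlet_L chi s) \<le> real q * cmod s * (1 + 1 / Re s)"
    and "Re s > 1 \<Longrightarrow> dirichlet_L chi s = dser chi s"
proof -
  define S where "S = (\<lambda>N. \<Sum>n=1..N. chi n)"
  define T where "T = (\<lambda>n s. S (Suc n) * (of_nat (Suc n) powr (- s) - of_nat (Suc (Suc n)) powr (- s)))"
  have c0: "chi 0 = 0"
  proof (rule ccontr)
    assume "chi 0 \<noteq> 0"
    then have "coprime 0 q" using dirichlet_char_simps(4)[OF c, of 0] by simp
    then have "chi n = 1" for n
      using dirichlet_char_mod[OF c, of n] dirichlet_char_mod[OF c, of 1] dirichlet_char_1[OF c] by simp
    then show False using np by (simp add: principal_char_def)
  qed
  have S: "cmod (S N) \<le> real q" for N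
  proof -
    have "{..<Suc N} = insert 0 {1..N}" by auto
    then have "S N = (\<Sum>n<Suc N. chi n)" using c0 by (simp add: S_def)
    then show ?thesis using dirichlet_char_sum_bound[OF c np, of "Suc N"] by simp
  qed
  have Tb: "cmod (T n s) \<le> real q * (cmod s * real (Suc n) powr (-1 - Re s))" if "Re s > 0" for n s
    unfolding T_def norm_mult using S powr_diff_bound[OF that, of n] by (intro mult_mono) auto
  have "\<exists>g g'. \<forall>x\<in>{s. Re s > 0}. (\<lambda>n. T n x) sums g x \<and>
      (\<lambda>n. deriv (T n) x) sums g' x \<and> (g has_field_derivative g' x) (at x)"
  proof (rule series_and_derivative_comparison_local)
    show "open {s. Re s > 0}" by (rule open_halfspace_Re_gt)
    have "T n holomorphic_on UNIV" for n
      unfolding T_def by (intro holomorphic_intros)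
    then show "(T n has_field_derivative deriv (T n) x) (at x)" for n x
      by (rule holomorphic_derivI[OF _ open_UNIV UNIV_I])
    fix x assume x: "x \<in> {s. Re s > 0}"
    define e where "e = Re x / 2"
    have e: "e > 0" using x by (simp add: e_def)
    have "cmod (T n y) \<le> real q * ((cmod x + e) * real (Suc n) powr (-1 - e))" if "y \<in> ball x e \<inter> {s. Re s > 0}" for n y
    proof -
      have y: "Re y \<ge> e" using that abs_Re_le_cmod[of "x - y"] by (auto simp: dist_norm e_def field_simps)
      have y2: "cmod y \<le> cmod x + e" using that norm_triangle_ineq2[of y x] by (auto simp: dist_norm norm_minus_commute)
      have "cmod (T n y) \<le> real q * (cmod y * real (Suc n) powr (-1 - Re y))" using Tb[of y n] that by auto
      also have "\<dots> \<le> real q * ((cmod x + e) * real (Suc n) powr (-1 - e))"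
        using y y2 by (intro mult_left_mono mult_mono powr_mono) (auto simp: e less_imp_le)
      finally show ?thesis .
    qed
    moreover have "summable (\<lambda>n. real q * ((cmod x + e) * real (Suc n) powr (-1 - e)))"
      using zeta_tail_bounds(1)[OF e] by (intro summable_mult)
    ultimately show "\<exists>d h. 0 < d \<and> summable h \<and> (\<forall>\<^sub>F n in sequentially. \<forall>y\<in>ball x d \<inter> {s. Re s > 0}. cmod (T n y) \<le> h n)"
      using e by (intro exI[of _ e] exI[of _ "\<lambda>n. real q * ((cmod x + e) * real (Suc n) powr (-1 - e))"]) auto
  qed
  then obtain g g' where g: "\<And>x. Re x > 0 \<Longrightarrow> (\<lambda>n. T n x) sums g x"
      "\<And>x. Re x > 0 \<Longrightarrow> (g has_field_derivative g' x) (at x)" by auto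
  have abel: "(\<Sum>n=1..Suc N. chi n * of_nat n powr (- s)) = (\<Sum>n<N. T n s) + S (Suc N) * of_nat (Suc N) powr (- s)" for N s
  proof (induction N)
    case (Suc N)
    have "S (Suc (Suc N)) = S (Suc N) + chi (Suc (Suc N))" by (simp add: S_def)
    then show ?case using Suc by (simp add: T_def algebra_simps)
  qed (simp add: S_def)
  have lim: "(\<lambda>N. \<Sum>n=1..N. chi n * of_nat n powr (- s)) \<longlonglongrightarrow> g s" if s: "Re s > 0" for s
  proof -
    have "(\<lambda>N. real q * real (Suc N) powr (- Re s)) \<longlonglongrightarrow> real q * 0"
      using s by (intro tendsto_mult tendsto_const tendsto_neg_powr filterlim_compose[OF filterlim_real_sequentially filterlim_Suc]) auto
    then have "(\<lambda>N. real q * real (Suc N) powr (- Re s)) \<longlonglongrightarrow> 0" by simp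
    then have "(\<lambda>N. S (Suc N) * of_nat (Suc N) powr (- s)) \<longlonglongrightarrow> 0"
    proof (rule Lim_null_comparison[rotated])
      have "cmod (S (Suc N) * of_nat (Suc N) powr (- s)) \<le> real q * real (Suc N) powr (- Re s)" for N
        unfolding norm_mult using S[of "Suc N"] by (subst cmod_nat_powr) (auto intro: mult_right_mono)
      then show "\<forall>\<^sub>F N in sequentially. cmod (S (Suc N) * of_nat (Suc N) powr (- s)) \<le> real q * real (Suc N) powr (- Re s)"
        by simp
    qed
    then have "(\<lambda>N. (\<Sum>n<N. T n s) + S (Suc N) * of_nat (Suc N) powr (- s)) \<longlonglongrightarrow> g s + 0"
      using g(1)[OF s] by (intro tendsto_add) (auto simp: sums_def)
    then show ?thesis unfolding abel[symmetric] by (subst (asm) filterlim_sequentially_Suc) simp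
  qed
  have Lg: "dirichlet_L chi s = g s" if "Re s > 0" for s
    using lim[OF that] by (simp add: dirichlet_L_def limI)
  have "g holomorphic_on {s. Re s > 0}"
    using g(2) by (auto simp: holomorphic_on_open[OF open_halfspace_Re_gt])
  then show "dirichlet_L chi holomorphic_on {s. Re s > 0}"
    by (rule holomorphic_transform) (simp add: Lg)
  show "cmod (dirichlet_L chi s) \<le> real q * cmod s * (1 + 1 / Re s)" if s: "Re s > 0"
  proof -
    have sm: "summable (\<lambda>n. real q * (cmod s * real (Suc n) powr (-1 - Re s)))"
      using zeta_tail_bounds(1)[OF s] by (intro summable_mult)
    have smT: "summable (\<lambda>n. cmod (T n s))"
      by (rule summable_comparison_test'[OF sm, of 0]) (use Tb[OF s] in auto)
    have "dirichlet_L chi s = (\<Sum>n. T n s)" using Lg[OF s] g(1)[OF s] by (simp add: sums_iff)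
    also have "cmod \<dots> \<le> (\<Sum>n. cmod (T n s))" by (rule summable_norm[OF smT])
    also have "\<dots> \<le> (\<Sum>n. real q * (cmod s * real (Suc n) powr (-1 - Re s)))"
      using Tb[OF s] by (intro suminf_le smT sm)
    also have "\<dots> = real q * (cmod s * (\<Sum>n. real (Suc n) powr (-1 - Re s)))"
      using zeta_tail_bounds(1)[OF s] by (simp add: suminf_mult summable_mult)
    also have "\<dots> \<le> real q * (cmod s * (1 + 1 / Re s))"
      using zeta_tail_bounds(2)[OF s] by (intro mult_left_mono) auto
    finally show ?thesis by (simp add: mult.assoc)
  qed
  show "dirichlet_L chi s = dser chi s" if s: "Re s > 1"
  proof -
    have "summable (dterm chi s)"
      using dser_bounds(1)[where f = chi, OF dirichlet_char_norm[OF c] s] by (rule summable_norm_cancel)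
    then have "(\<lambda>N. \<Sum>n<N. dterm chi s n) \<longlonglongrightarrow> dser chi s" unfolding dser_def by (rule summable_LIMSEQ)
    moreover have "(\<Sum>n<N. dterm chi s n) = (\<Sum>n=1..N. chi n * of_nat n powr (- s))" for N
      unfolding dterm_def by (rule sum.reindex_bij_witness[of _ "\<lambda>n. n - 1" Suc]) auto
    ultimately show ?thesis by (simp add: dirichlet_L_def limI)
  qed
qed

text \<open>The logarithm of the analytic conductor. The summand 3 makes it at least 1, so that
  absolute constants can be absorbed into it.\<close>

definition cond_log :: "nat \<Rightarrow> real \<Rightarrow> real" where
  "cond_log q t = ln (real q * (\<bar>t\<bar> + 3))"

lemma ln_3_ge_1: "ln (3::real) \<ge> 1"
  using exp_le by (subst ln_ge_iff) auto

lemma cond_log_ge_1: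
  assumes "q > 0" shows "cond_log q t \<ge> 1"
proof -
  have "1 * 3 \<le> real q * (\<bar>t\<bar> + 3)" using assms by (intro mult_mono) auto
  then have "ln 3 \<le> cond_log q t" unfolding cond_log_def by (subst ln_le_cancel_iff) auto
  then show ?thesis using ln_3_ge_1 by simp
qed

lemma dser_mangoldt_bound:
  assumes f: "\<And>n. cmod (f n) \<le> 1" and s: "Re s > 1"
  shows "cmod (dser (\<lambda>n. mangoldt n * f n) s) \<le> 2 / (Re s - 1) * (1 + 2 / (Re s - 1))"
proof -
  have bd: "cmod (dterm (\<lambda>n. mangoldt n * f n) s n) \<le> ln (real (Suc n)) * real (Suc n) powr (-1 - (Re s - 1))" for n
  proof -
    have "mangoldt (Suc n) * cmod (f (Suc n)) \<le> ln (real (Suc n)) * 1"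
      using f mangoldt_le[of "Suc n"] by (intro mult_mono mangoldt_nonneg) auto
    then have "mangoldt (Suc n) * cmod (f (Suc n)) * real (Suc n) powr (- Re s) \<le> ln (real (Suc n)) * 1 * real (Suc n) powr (- Re s)"
      by (rule mult_right_mono) auto
    then show ?thesis
      unfolding dterm_def norm_mult by (subst cmod_nat_powr) (auto simp del: of_nat_Suc)
  qed
  have e: "Re s - 1 > 0" using s by simp
  note z = zeta_log_bounds[OF e]
  have sm: "summable (\<lambda>n. cmod (dterm (\<lambda>n. mangoldt n * f n) s n))"
    by (rule summable_comparison_test'[OF z(1), of 0]) (use bd in auto)
  have "cmod (dser (\<lambda>n. mangoldt n * f n) s) \<le> (\<Sum>n. cmod (dterm (\<lambda>n. mangoldt n * f n) s n))"
    unfolding dser_def by (rule summable_norm[OF sm])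
  also have "\<dots> \<le> (\<Sum>n. ln (real (Suc n)) * real (Suc n) powr (-1 - (Re s - 1)))"
    using bd by (intro suminf_le sm z)
  finally show ?thesis using z(2) by simp
qed

lemma GRH_nonzero:
  assumes "GRH" "dirichlet_char q chi" "\<not> principal_char q chi" "Re s > 1/2"
  shows "dirichlet_L chi s \<noteq> 0"
  using assms by (auto simp: GRH_def)

text \<open>Under GRH the zeros \<open>z\<close> near \<open>s\<close> satisfy
  \<open>Re z \<le> 1/2\<close>, so each term \<open>1 / (s - z)\<close> has nonnegative real part.
  Dropping these terms gives a lower bound that is uniform up to the critical line. For the upper
  bound each term is at most \<open>1 / (Re s - 1/2)\<close>, and their number is at most a multiple
  of \<open>cond_log\<close>.\<close>

lemma dirichlet_L_log_deriv_bounds: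
  obtains C :: real where "C > 0"
    "\<And>q chi s. \<lbrakk>GRH; dirichlet_char q chi; \<not> principal_char q chi; Re s > 1/2\<rbrakk> \<Longrightarrow>
        Re (deriv (dirichlet_L chi) s / dirichlet_L chi s) \<ge> - C * cond_log q (Im s)"
    "\<And>q chi s. \<lbrakk>GRH; dirichlet_char q chi; \<not> principal_char q chi; Re s > 1/2\<rbrakk> \<Longrightarrow>
        cmod (deriv (dirichlet_L chi) s / dirichlet_L chi s) \<le> C * (1 + 1 / (Re s - 1/2)) * cond_log q (Im s)"
proof -
  \<comment> \<open>Discs around \<open>2 + it\<close>: the radius 16/10 exceeds 3/2 and so reaches
    beyond the critical line, while the radius 19/10 stays within Re z \<ge> 1/10, where the bound
    from partial summation is available.\<close>
  define R r1 r2 :: real where "R = 19/10" and "r1 = 17/10" and "r2 = 16/10"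
  define K where "K = 16 * (r1 + r2) / (r1 - r2)\<^sup>2 + r1 / ((R\<^sup>2 - r1\<^sup>2) * ln (R / r1))"
  define J where "J = 1 / ln (R / r1)"
  have lnR: "ln (R / r1) > 0" by (simp add: R_def r1_def)
  have J: "J > 0" using lnR by (simp add: J_def)
  have "0 < 16 * (r1 + r2) / (r1 - r2)\<^sup>2" by (simp add: r1_def r2_def)
  moreover have "0 < r1 / ((R\<^sup>2 - r1\<^sup>2) * ln (R / r1))"
    using lnR by (intro divide_pos_pos mult_pos_pos) (auto simp: R_def r1_def power2_eq_square)
  ultimately have K: "K > 0" by (simp add: K_def)
  have main: "Re (deriv (dirichlet_L chi) s / dirichlet_L chi s) \<ge> - (6 + 6 * K + 6 * J) * cond_log q (Im s) \<and>
      cmod (deriv (dirichlet_L chi) s / dirichlet_L chi s) \<le> (6 + 6 * K + 6 * J) * (1 + 1 / (Re s - 1/2)) * cond_log q (Im s)"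
    if grh: GRH and c: "dirichlet_char q chi" and np: "\<not> principal_char q chi" and s: "Re s > 1/2" for q chi s
  proof -
    define L where "L = dirichlet_L chi"
    define t where "t = Im s"
    define l where "l = cond_log q t"
    have q: "q > 0" using dirichlet_char_simps(1)[OF c] .
    have l: "l \<ge> 1" unfolding l_def using cond_log_ge_1[OF q] .
    have inv: "1 / (Re s - 1/2) > 0" using s by simp
    have holL: "L holomorphic_on {s. Re s > 0}" unfolding L_def by (rule dirichlet_L_props(1)[OF c np])
    show ?thesis
    proof (cases "Re s \<ge> 2")
      case True
      obtain c' where c': "\<And>s. Re s > 1 \<Longrightarrow> (dser chi has_field_derivative - dser (\<lambda>n. mangoldt n * chi n) s * dser chi s) (at s)"
        using dser_eq_exp_plog[of chi] dirichlet_char_simps(2)[OF c] dirichlet_char_norm[OF c] dirichlet_char_1[OF c] by metis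
      have "(L has_field_derivative - dser (\<lambda>n. mangoldt n * chi n) s * L s) (at s)"
      proof (rule has_field_derivative_transform_within_open[OF _ open_halfspace_Re_gt[of 1]])
        show "(dser chi has_field_derivative - dser (\<lambda>n. mangoldt n * chi n) s * L s) (at s)"
          using c'[of s] True dirichlet_L_props(3)[OF c np, of s] by (simp add: L_def)
      qed (use True dirichlet_L_props(3)[OF c np] in \<open>auto simp: L_def\<close>)
      then have "deriv L s / L s = - dser (\<lambda>n. mangoldt n * chi n) s"
        using GRH_nonzero[OF grh c np s] by (simp add: DERIV_imp_deriv L_def)
      moreover have "cmod (dser (\<lambda>n. mangoldt n * chi n) s) \<le> 2 / (Re s - 1) * (1 + 2 / (Re s - 1))"
        using dirichlet_char_norm[OF c] True by (intro dser_mangoldt_bound) auto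
      moreover have "2 / (Re s - 1) * (1 + 2 / (Re s - 1)) \<le> 2 * (1 + 2)"
        using True by (intro mult_mono add_mono) (auto simp: divide_le_eq)
      ultimately have b: "cmod (deriv L s / L s) \<le> 6" by (simp add: norm_minus_cancel)
      have b2: "6 \<le> (6 + 6 * K + 6 * J) * l" using mult_mono[of 6 "6 + 6 * K + 6 * J" 1 l] K J l by auto
      also have "\<dots> \<le> (6 + 6 * K + 6 * J) * (1 + 1 / (Re s - 1/2)) * l"
        using K J l inv by (intro mult_right_mono) (auto simp: mult_le_cancel_left1)
      finally have b3: "6 \<le> (6 + 6 * K + 6 * J) * (1 + 1 / (Re s - 1/2)) * l" .
      show ?thesis
        using b b2 b3 abs_Re_le_cmod[of "deriv L s / L s"] unfolding L_def l_def t_def by linarith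
    next
      case False
      define s0 where "s0 = Complex 2 t"
      \<comment> \<open>With \<open>Q = real q * (\<bar>t\<bar> + 3)\<close>, so
        \<open>Q \<ge> 3\<close>, the required estimate is
        \<open>60 * Q \<le> Q ^ 6 = exp M\<close>.\<close>
      define M where "M = 6 * l"
      have sub: "cball s0 R \<subseteq> {s. Re s > 0}" and Re01: "\<And>z. z \<in> cball s0 R \<Longrightarrow> Re z \<ge> 1/10"
      proof -
        show "Re z \<ge> 1/10" if "z \<in> cball s0 R" for z
          using that abs_Re_le_cmod[of "s0 - z"] by (auto simp: dist_norm s0_def R_def)
        then show "cball s0 R \<subseteq> {s. Re s > 0}" by force
      qed
      have L0: "cmod (L s0) \<ge> 1/4"
      proof -
        have "cmod (dser chi s0 - 1) \<le> 3/4"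
          using dser_bounds(3)[where f = chi and s = s0, OF dirichlet_char_norm[OF c]] zeta_2_tail dirichlet_char_1[OF c]
          by (simp add: s0_def)
        then show ?thesis
          using norm_triangle_ineq2[of 1 "1 - dser chi s0"] dirichlet_L_props(3)[OF c np, of s0]
          by (simp add: norm_minus_commute L_def s0_def)
      qed
      have bd: "cmod (L z) \<le> exp M * cmod (L s0)" if z: "z \<in> cball s0 R" for z
      proof -
        have Rez: "Re z \<ge> 1/10" using Re01[OF z] .
        have "cmod z \<le> cmod s0 + R" using z norm_triangle_ineq2[of z s0] by (simp add: dist_norm norm_minus_commute)
        also have "cmod s0 \<le> 2 + \<bar>t\<bar>" using cmod_le[of s0] by (simp add: s0_def)
        finally have zt: "cmod z \<le> 13/10 * (\<bar>t\<bar> + 3)" by (simp add: R_def)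
        have "cmod (L z) \<le> real q * cmod z * (1 + 1 / Re z)"
          unfolding L_def using dirichlet_L_props(2)[OF c np, of z] Rez by simp
        also have "\<dots> \<le> real q * (13/10 * (\<bar>t\<bar> + 3)) * 11"
          using Rez zt by (intro mult_mono) (auto simp: divide_le_eq)
        also have "\<dots> \<le> 60 * (real q * (\<bar>t\<bar> + 3)) * (1/4)"
        proof -
          have "0 \<le> real q * \<bar>t\<bar>" by simp
          then show ?thesis by (simp add: algebra_simps)
        qed
        also have "\<dots> \<le> exp M * (1/4)"
        proof (rule mult_right_mono)
        have "60 * (real q * (\<bar>t\<bar> + 3)) \<le> (real q * (\<bar>t\<bar> + 3)) ^ 5 * (real q * (\<bar>t\<bar> + 3))"
        proof (rule mult_right_mono)
          have "1 * 3 \<le> real q * (\<bar>t\<bar> + 3)" using q by (intro mult_mono) auto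
          then have "3 ^ 5 \<le> (real q * (\<bar>t\<bar> + 3)) ^ 5" by (intro power_mono) auto
          then show "60 \<le> (real q * (\<bar>t\<bar> + 3)) ^ 5" by simp
        qed auto
        also have "\<dots> = exp M"
        proof -
          have "exp M = exp l ^ 6" unfolding M_def using exp_of_nat_mult[of 6 l] by simp
          also have "exp l = real q * (\<bar>t\<bar> + 3)" using q by (simp add: l_def cond_log_def)
          finally show ?thesis by (simp add: eval_nat_numeral)
        qed
        finally show "60 * (real q * (\<bar>t\<bar> + 3)) \<le> exp M" .
        qed simp
        also have "exp M * (1/4) \<le> exp M * cmod (L s0)" using L0 by (intro mult_left_mono) auto
        finally show ?thesis .
      qed
      have sball: "s \<in> cball s0 r2"
      proof -
        have "s0 - s = of_real (2 - Re s)" by (simp add: s0_def t_def complex_eq_iff)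
        then have "dist s0 s = \<bar>2 - Re s\<bar>" unfolding dist_norm by (simp only: norm_of_real)
        then show ?thesis using s False by (simp add: r2_def)
      qed
      obtain zs where zs: "\<And>z. z \<in> set zs \<Longrightarrow> L z = 0" "real (length zs) * ln (R / r1) \<le> M"
        "\<And>s. s \<in> cball s0 r2 \<Longrightarrow> L s \<noteq> 0 \<Longrightarrow> cmod (deriv L s / L s - (\<Sum>z\<leftarrow>zs. 1 / (s - z))) \<le> K * M"
      proof (rule landau_log_deriv[of "{s. Re s > 0}" s0 R L r2 r1 M])
        show "open {s. Re s > 0}" by (rule open_halfspace_Re_gt)
      qed (use sub holL L0 l bd in \<open>auto simp: R_def r1_def r2_def M_def K_def\<close>)
      have Ls: "L s \<noteq> 0" unfolding L_def by (rule GRH_nonzero[OF grh c np s])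
      have D: "cmod (deriv L s / L s - (\<Sum>z\<leftarrow>zs. 1 / (s - z))) \<le> K * M" by (rule zs(3)[OF sball Ls])
      have Rez: "Re z \<le> 1/2" if "z \<in> set zs" for z
        using zs(1)[OF that] GRH_nonzero[OF grh c np, of z] unfolding L_def by (meson not_le)
      have nn: "Re (\<Sum>z\<leftarrow>zs. 1 / (s - z)) \<ge> 0"
      proof -
        have "Re (1 / (s - z)) \<ge> 0" if "z \<in> set zs" for z
          using Rez[OF that] s by (simp add: Re_divide' )
        then show ?thesis by (induction zs) auto
      qed
      have cnt: "real (length zs) \<le> J * M" using zs(2) lnR by (simp add: J_def field_simps)
      have up: "cmod (\<Sum>z\<leftarrow>zs. 1 / (s - z)) \<le> J * M * (1 / (Re s - 1/2))"
      proof -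
        have single: "cmod (1 / (s - z)) \<le> 1 / (Re s - 1/2)" if "z \<in> set zs" for z
          unfolding norm_divide using Rez[OF that] s abs_Re_le_cmod[of "s - z"] by (simp add: frac_le)
        have gen: "(\<And>x. x \<in> set xs \<Longrightarrow> cmod (g x) \<le> k) \<Longrightarrow> cmod (\<Sum>x\<leftarrow>xs. g x) \<le> k * real (length xs)"
          for xs k and g :: "complex \<Rightarrow> complex"
          by (induction xs) (auto simp: algebra_simps intro!: norm_triangle_le add_mono)
        have "cmod (\<Sum>z\<leftarrow>zs. 1 / (s - z)) \<le> (1 / (Re s - 1/2)) * real (length zs)" by (rule gen[OF single])
        also have "\<dots> = real (length zs) * (1 / (Re s - 1/2))" by simp
        also have "\<dots> \<le> J * M * (1 / (Re s - 1/2))" using cnt inv by (intro mult_right_mono) auto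
        finally show ?thesis .
      qed
      have a: "Re (deriv L s / L s) \<ge> - K * M"
        using D nn abs_Re_le_cmod[of "deriv L s / L s - (\<Sum>z\<leftarrow>zs. 1 / (s - z))"] by simp
      have b: "cmod (deriv L s / L s) \<le> K * M + J * M * (1 / (Re s - 1/2))"
        using D up norm_triangle_sub[of "deriv L s / L s" "\<Sum>z\<leftarrow>zs. 1 / (s - z)"] by linarith
      have a': "- (6 + 6 * K + 6 * J) * l \<le> - K * M"
      proof -
        have "0 \<le> J * l" "0 \<le> K * l" using J l K by (auto intro!: mult_nonneg_nonneg)
        then show ?thesis unfolding M_def using l by (simp add: algebra_simps)
      qed
      have b': "K * M + J * M * (1 / (Re s - 1/2)) \<le> (6 + 6 * K + 6 * J) * (1 + 1 / (Re s - 1/2)) * l"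
      proof -
        define i where "i = 1 / (Re s - 1/2)"
        have "0 \<le> i * l" "0 \<le> J * l" "0 \<le> K * l" "0 \<le> K * (i * l)" using inv l J K by (auto simp: i_def intro!: mult_nonneg_nonneg)
        then show ?thesis unfolding M_def i_def[symmetric] using l by (simp add: algebra_simps)
      qed
      show ?thesis using a a' b b' unfolding L_def l_def t_def by linarith
    qed
  qed
  show thesis
    by (rule that[of "6 + 6 * K + 6 * J"]) (use main K J in auto)
qed

section \<open>A kernel with compactly supported Fourier transform\<close>

lemma integrable_inverse_1_plus_square: "integrable lborel (\<lambda>x::real. 1 / (1 + x\<^sup>2))"
  and integral_inverse_1_plus_square: "(LINT x|lborel. 1 / (1 + x\<^sup>2)) = pi"
  using Sinc_Integral.integrable_inverse_1_plus_square Sinc_Integral.LBINT_inverse_1_plus_square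
  by (auto simp: set_integrable_def interval_lebesgue_integral_def set_lebesgue_integral_def inverse_eq_divide)

lemma integrable_decay: "integrable lborel (\<lambda>x::real. (1 + \<bar>x\<bar>) powr (-3/2))"
proof -
  have "((\<lambda>x::real. x powr (-3/2)) has_integral -(1 powr (-3/2+1)) / (-3/2+1)) {1..}"
    by (intro has_integral_powr_to_inf) auto
  then have "(\<lambda>x::real. x powr (-3/2)) absolutely_integrable_on {1..}"
    by (intro nonnegative_absolutely_integrable_1) (auto simp: has_integral_integrable)
  then have "set_integrable lborel {1..} (\<lambda>x::real. x powr (-3/2))"
    by (simp add: set_integrable_def integrable_completion)
  then have *: "integrable lborel (\<lambda>x::real. indicator {1..} x * x powr (-3/2))"
    by (simp add: set_integrable_def)
  have 1: "integrable lborel (\<lambda>x::real. indicator {0..} x * (1 + x) powr (-3/2))"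
    using lborel_integrable_real_affine[OF *, of 1 1]
    by (rule Bochner_Integration.integrable_cong[THEN iffD1, rotated 2]) (auto simp: indicator_def)
  have 2: "integrable lborel (\<lambda>x::real. indicator {0..} (-x) * (1 + -x) powr (-3/2))"
    using lborel_integrable_real_affine[OF 1, of "-1" 0] by simp
  show ?thesis
    by (rule Bochner_Integration.integrable_bound[OF Bochner_Integration.integrable_add[OF 1 2]])
       (auto simp: indicator_def)
qed

text \<open>The contour is closed up in the upper half plane.\<close>
lemma integral_real_line_eq_0:
  fixes g :: "complex \<Rightarrow> complex"
  assumes hol: "g holomorphic_on {z. Im z > -1}"
    and decay: "\<And>z. Im z \<ge> 0 \<Longrightarrow> cmod z \<ge> 1 \<Longrightarrow> cmod (g z) \<le> C / (cmod z)\<^sup>2"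
    and int: "integrable lborel (\<lambda>x. g (of_real x))"
  shows "(LINT x|lborel. g (of_real x)) = 0"
proof -
  define I where "I = (\<lambda>n. integral {- real n..real n} (\<lambda>x. g (of_real x)))"
  have C0: "C \<ge> 0" using order.trans[OF norm_ge_zero decay[of 1]] by simp
  have bd: "cmod (I n) \<le> C * pi / real n" if n: "n \<ge> 1" for n
  proof -
    have arc: "z \<in> {z. Im z > -1} \<and> cmod z = real n \<and> Im z \<ge> 0" if "z \<in> path_image (part_circlepath 0 (real n) 0 pi)" for z
    proof -
      from that obtain x where x: "x \<in> closed_segment 0 pi" "z = of_nat n * cis x"
        by (auto simp: path_image_part_circlepath')
      then have "0 \<le> x" "x \<le> pi" by (auto simp: closed_segment_eq_real_ivl)
      then have "Im z \<ge> 0" using x by (simp add: sin_ge_zero)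
      moreover have "cmod z = real n" using x by (simp add: norm_mult)
      ultimately show ?thesis by auto
    qed
    have seg: "closed_segment (- of_nat n) (of_nat n) \<subseteq> {z. Im z > -1}"
      by (auto simp: closed_segment_def)
    have v: "valid_path (linepath (- of_nat n) (of_nat n) +++ part_circlepath 0 (real n) 0 pi)"
      by (intro valid_path_join) (auto simp: exp_pi_i')
    have img: "path_image (linepath (- of_nat n) (of_nat n) +++ part_circlepath 0 (real n) 0 pi) \<subseteq> {z. Im z > -1}"
      using seg arc by (subst path_image_join) (auto simp: exp_pi_i')
    have "(g has_contour_integral 0) (linepath (- of_nat n) (of_nat n) +++ part_circlepath 0 (real n) 0 pi)"
      by (rule Cauchy_theorem_convex_simple[OF hol _ v img])
         (auto simp: convex_halfspace_Im_gt exp_pi_i')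
    moreover have ca: "g contour_integrable_on part_circlepath 0 (real n) 0 pi"
      using holomorphic_on_imp_continuous_on[OF hol] arc
      by (intro contour_integrable_continuous_part_circlepath) (auto intro: continuous_on_subset)
    moreover have cl: "g contour_integrable_on linepath (- of_nat n) (of_nat n)"
      using holomorphic_on_imp_continuous_on[OF hol] seg
      by (intro contour_integrable_continuous_linepath) (auto intro: continuous_on_subset)
    ultimately have "contour_integral (linepath (- of_nat n) (of_nat n)) g + contour_integral (part_circlepath 0 (real n) 0 pi) g = 0"
      using contour_integral_join[of g "linepath (- of_nat n) (of_nat n)" "part_circlepath 0 (real n) 0 pi"]
      by (metis contour_integral_unique valid_path_linepath valid_path_part_circlepath)
    moreover have "contour_integral (linepath (- of_nat n) (of_nat n)) g = I n"
      using n by (subst contour_integral_linepath_Reals_eq) (auto simp: I_def)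
    ultimately have "cmod (I n) = cmod (contour_integral (part_circlepath 0 (real n) 0 pi) g)"
      by (metis add_eq_0_iff norm_minus_cancel)
    also have "\<dots> \<le> C / (real n)\<^sup>2 * real n * \<bar>pi - 0\<bar>"
    proof (rule contour_integral_bound_part_circlepath[OF ca])
      show "cmod (g x) \<le> C / (real n)\<^sup>2" if "x \<in> path_image (part_circlepath 0 (real n) 0 pi)" for x
        using arc[OF that] decay[of x] n by auto
    qed (use C0 in auto)
    also have "\<dots> = C * pi / real n" using n by (simp add: power2_eq_square)
    finally show ?thesis .
  qed
  have "(\<lambda>n. C * pi / real n) \<longlonglongrightarrow> 0" by real_asymp
  then have I0: "I \<longlonglongrightarrow> 0"
    by (rule Lim_null_comparison[rotated]) (use bd in \<open>auto simp: eventually_at_top_linorder\<close>)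
  have "(\<lambda>n. LINT x|lborel. indicator {- real n..real n} x *\<^sub>R g (of_real x)) \<longlonglongrightarrow> (LINT x|lborel. g (of_real x))"
  proof (rule integral_dominated_convergence[where w = "\<lambda>x. cmod (g (of_real x))"])
    show "AE x in lborel. (\<lambda>n. indicator {- real n..real n} x *\<^sub>R g (of_real x)) \<longlonglongrightarrow> g (of_real x)"
    proof (rule AE_I2)
      fix x :: real
      obtain N :: nat where N: "\<bar>x\<bar> \<le> real N" using real_arch_simple by blast
      have "indicator {- real n..real n} x *\<^sub>R g (of_real x) = g (of_real x)" if "n \<ge> N" for n
      proof -
        have "real N \<le> real n" using that by simp
        then have "x \<in> {- real n..real n}" using N by auto
        then show ?thesis by simp
      qed
      then have "\<forall>\<^sub>F n in sequentially. indicator {- real n..real n} x *\<^sub>R g (of_real x) = g (of_real x)"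
        by (auto simp: eventually_at_top_linorder intro!: exI[of _ N])
      then show "(\<lambda>n. indicator {- real n..real n} x *\<^sub>R g (of_real x)) \<longlonglongrightarrow> g (of_real x)"
        by (rule tendsto_eventually)
    qed
    have [measurable]: "(\<lambda>x. g (of_real x)) \<in> borel_measurable borel"
      using borel_measurable_integrable[OF int] by simp
    show "(\<lambda>x. g (of_real x)) \<in> borel_measurable lborel" by simp
    show "(\<lambda>x. indicator {- real n..real n} x *\<^sub>R g (of_real x)) \<in> borel_measurable lborel" for n by measurable
    show "integrable lborel (\<lambda>x. cmod (g (of_real x)))" by (rule integrable_norm[OF int])
    show "AE x in lborel. norm (indicator {- real n..real n} x *\<^sub>R g (of_real x)) \<le> cmod (g (of_real x))" for n
      by (intro AE_I2) (simp split: split_indicator)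
  qed
  moreover have "(LINT x|lborel. indicator {- real n..real n} x *\<^sub>R g (of_real x)) = I n" for n
  proof -
    have "set_integrable lborel {- real n..real n} (\<lambda>x. g (of_real x))"
      unfolding set_integrable_def by (rule integrable_mult_indicator[OF _ int]) simp
    from set_borel_integral_eq_integral(2)[OF this] show ?thesis
      by (simp add: I_def set_lebesgue_integral_def)
  qed
  ultimately show ?thesis using I0 LIMSEQ_unique by simp
qed

text \<open>A sealed copy of the library's abbreviation, which the simplifier would unfold and split.\<close>
definition rsinc :: "real \<Rightarrow> real" where "rsinc = sinc"

section \<open>The sixth power of sinc and its Fourier transform\<close>

lemma rsinc_measurable [measurable]: "rsinc \<in> borel_measurable borel"
  unfolding rsinc_def by (rule borel_measurable_sinc)

lemma rsinc_continuous: "continuous_on A rsinc"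
  unfolding rsinc_def by (intro continuous_at_imp_continuous_on ballI isCont_sinc)

lemma rsinc_minus: "rsinc (- x) = rsinc x"
  by (simp add: rsinc_def)

definition csinc :: "complex \<Rightarrow> complex" where
  "csinc z = (if z = 0 then 1 else sin z / z)"

lemma csinc_holomorphic: "csinc holomorphic_on UNIV"
proof -
  have "deriv sin (0::complex) = 1" by (rule DERIV_imp_deriv) (auto intro!: derivative_eq_intros)
  then have "csinc 0 = deriv sin 0" unfolding csinc_def by simp
  moreover have "sin z = (z - 0) * csinc z" if "z \<in> UNIV - {0}" for z
    using that by (simp add: csinc_def)
  moreover have "sin holomorphic_on (UNIV :: complex set)" by (intro holomorphic_intros)
  ultimately show ?thesis
    using pole_theorem_open_0[of sin UNIV 0 csinc] open_UNIV sin_zero by blast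
qed

lemma csinc_of_real: "csinc (of_real x) = of_real (rsinc x)"
  by (auto simp: csinc_def rsinc_def sin_of_real)

lemma csinc_bound:
  assumes "Im z \<ge> 0" "cmod z \<ge> 1"
  shows "cmod (csinc z) \<le> exp (Im z) / cmod z"
proof -
  have "cmod (sin z) \<le> (cmod (exp (\<i> * z)) + cmod (exp (- (\<i> * z)))) / 2"
    unfolding sin_exp_eq using norm_triangle_ineq4[of "exp (\<i> * z)" "exp (- (\<i> * z))"]
    by (simp add: norm_divide norm_mult divide_right_mono)
  also have "\<dots> = (exp (- Im z) + exp (Im z)) / 2" by simp
  also have "\<dots> \<le> exp (Im z)" using assms by simp
  finally show ?thesis using assms by (auto simp: csinc_def norm_divide divide_right_mono)
qed

lemma sinc_6_bound: "rsinc x ^ 6 \<le> 8 / (1 + x\<^sup>2) ^ 3"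
proof -
  have 1: "(rsinc x)\<^sup>2 \<le> 1"
    using abs_sin_x_le_abs_x[of x] by (auto simp: rsinc_def power_divide divide_le_eq_1 abs_le_square_iff)
  have 2: "x\<^sup>2 * (rsinc x)\<^sup>2 \<le> 1" using abs_sin_le_one[of x] by (auto simp: rsinc_def power_divide abs_square_le_1)
  have "(1 + x\<^sup>2) * (rsinc x)\<^sup>2 \<le> 2" using 1 2 by (simp add: algebra_simps)
  then have "((1 + x\<^sup>2) * (rsinc x)\<^sup>2) ^ 3 \<le> 2 ^ 3" by (intro power_mono) auto
  then have "(1 + x\<^sup>2) ^ 3 * rsinc x ^ 6 \<le> 8" by (simp add: power_mult_distrib flip: power_mult)
  moreover have "(1 + x\<^sup>2) ^ 3 > 0" by (simp add: add_pos_nonneg)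
  ultimately show ?thesis by (simp add: pos_le_divide_eq mult.commute)
qed

lemma sinc_6_integrable: "integrable lborel (\<lambda>x. \<bar>x\<bar> ^ k * rsinc x ^ 6)" if "k \<le> 4"
proof (rule Bochner_Integration.integrable_bound[OF integrable_mult_right[OF integrable_inverse_1_plus_square, of 8]])
  show "(\<lambda>x. \<bar>x\<bar> ^ k * rsinc x ^ 6) \<in> borel_measurable lborel"
    by simp
  have "\<bar>x\<bar> ^ k * rsinc x ^ 6 \<le> 8 * (1 / (1 + x\<^sup>2))" for x
  proof -
    have p: "1 + x\<^sup>2 > 0" by (simp add: add_pos_nonneg)
    have "\<bar>x\<bar> ^ k \<le> (1 + x\<^sup>2) ^ 2"
    proof (cases "\<bar>x\<bar> \<le> 1")
      case True
      then have "\<bar>x\<bar> ^ k \<le> 1" by (simp add: power_le_one)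
      also have "1 \<le> (1 + x\<^sup>2) ^ 2" by simp
      finally show ?thesis .
    next
      case False
      then have "\<bar>x\<bar> ^ k \<le> \<bar>x\<bar> ^ 4" using that by (intro power_increasing) auto
      also have "\<dots> = (x\<^sup>2) ^ 2" by simp
      also have "\<dots> \<le> (1 + x\<^sup>2) ^ 2" by (intro power_mono) auto
      finally show ?thesis .
    qed
    then have "\<bar>x\<bar> ^ k * rsinc x ^ 6 \<le> (1 + x\<^sup>2) ^ 2 * (8 / (1 + x\<^sup>2) ^ 3)"
      using sinc_6_bound[of x] by (intro mult_mono) auto
    also have "\<dots> = 8 * (1 / (1 + x\<^sup>2))"
    proof -
      have "Q ^ 2 * (8 / Q ^ 3) = 8 * (1 / Q)" if "Q > 0" for Q :: real
        using that by (simp add: field_simps eval_nat_numeral)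
      then show ?thesis using p by blast
    qed
    finally show ?thesis .
  qed
  then show "AE x in lborel. norm (\<bar>x\<bar> ^ k * rsinc x ^ 6) \<le> norm (8 * (1 / (1 + x\<^sup>2)))"
    by (intro AE_I2) (simp add: abs_mult)
qed

text \<open>The sixth power of \<open>sinc\<close> is a nonnegative kernel whose Fourier transform has compact support and
  which has enough moments for a third order Taylor expansion.\<close>
definition sinc6_mass :: real where "sinc6_mass = (LINT x|lborel. rsinc x ^ 6)"

lemma sinc6_mass_pos: "sinc6_mass > 0"
proof -
  have "sinc6_mass \<noteq> 0"
  proof
    assume "sinc6_mass = 0"
    then have "AE x in lborel. rsinc x ^ 6 = 0"
      using integral_nonneg_eq_0_iff_AE[of lborel "\<lambda>x. rsinc x ^ 6"] sinc_6_integrable[of 0]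
      by (simp add: sinc6_mass_def)
    then have "AE x in lborel. \<not> (x \<in> {1<..<2::real})"
    proof (rule AE_mp, intro AE_I2 impI notI)
      fix x :: real assume "rsinc x ^ 6 = 0" "x \<in> {1<..<2}"
      moreover have "sin x > 0" using \<open>x \<in> {1<..<2}\<close> pi_gt3 by (intro sin_gt_zero) auto
      ultimately show False by (simp add: rsinc_def split: if_splits)
    qed
    then have "emeasure lborel {1<..<2::real} = 0" by (subst (asm) AE_iff_measurable[of "{1<..<2::real}"]) auto
    then show False by simp
  qed
  moreover have "sinc6_mass \<ge> 0" unfolding sinc6_mass_def by (intro integral_nonneg_AE) auto
  ultimately show ?thesis by simp
qed

text \<open>A probability density. Its Fourier transform \<open>jft\<close> can be written as a
  cosine integral because \<open>jker\<close> is even.\<close>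

definition jker :: "real \<Rightarrow> real" where "jker y = rsinc y ^ 6 / sinc6_mass"
definition jft :: "real \<Rightarrow> real" where "jft u = (LINT y|lborel. jker y * cos (u * y))"

lemma jker_nonneg: "jker y \<ge> 0" using sinc6_mass_pos by (simp add: jker_def)
lemma jker_even: "jker (- y) = jker y" by (simp add: jker_def rsinc_minus)
lemma jker_continuous: "continuous_on A jker"
  unfolding jker_def[abs_def] using sinc6_mass_pos
  by (intro continuous_intros rsinc_continuous) auto
lemma jker_measurable [measurable]: "jker \<in> borel_measurable borel"
  by (rule borel_measurable_continuous_onI[OF jker_continuous])
lemma jker_integrable: "k \<le> 4 \<Longrightarrow> integrable lborel (\<lambda>y. \<bar>y\<bar> ^ k * jker y)"
  using sinc_6_integrable[of k] by (simp add: jker_def)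
lemma jker_integral: "(LINT y|lborel. jker y) = 1"
  using sinc6_mass_pos by (simp add: jker_def sinc6_mass_def)

lemma jker_bound: "jker y \<le> 32 / sinc6_mass * (1 + \<bar>y\<bar>) powr (-2)"
proof -
  have "(1 + \<bar>y\<bar>)\<^sup>2 \<le> 2 * (1 + y\<^sup>2)" using sum_squares_bound[of 1 "\<bar>y\<bar>"] by (simp add: power2_sum)
  moreover have p: "1 + y\<^sup>2 \<ge> 1" "1 + y\<^sup>2 > 0" by (simp_all add: add_pos_nonneg)
  ultimately have "8 / (1 + y\<^sup>2) ^ 3 \<le> 32 / (1 + \<bar>y\<bar>)\<^sup>2"
  proof -
    assume a: "(1 + \<bar>y\<bar>)\<^sup>2 \<le> 2 * (1 + y\<^sup>2)"
    have "8 / (1 + y\<^sup>2) ^ 3 \<le> 8 / (1 + y\<^sup>2) ^ 1"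
      using p by (intro divide_left_mono power_increasing mult_pos_pos zero_less_power) auto
    also have "\<dots> \<le> 32 / (1 + \<bar>y\<bar>)\<^sup>2" using a p by (simp add: frac_le divide_simps)
    finally show ?thesis .
  qed
  with sinc_6_bound[of y] have "rsinc y ^ 6 \<le> 32 / (1 + \<bar>y\<bar>)\<^sup>2" by linarith
  then have "rsinc y ^ 6 / sinc6_mass \<le> 32 / (1 + \<bar>y\<bar>)\<^sup>2 / sinc6_mass" using sinc6_mass_pos by (intro divide_right_mono) auto
  moreover have "(1 + \<bar>y\<bar>) powr (-2) = 1 / (1 + \<bar>y\<bar>)\<^sup>2" by (simp add: powr_minus powr_numeral divide_inverse)
  ultimately show ?thesis by (simp add: jker_def mult.commute)
qed

lemma lborel_integral_odd:
  fixes f :: "real \<Rightarrow> real"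
  assumes "\<And>x. f (- x) = - f x" shows "(LINT x|lborel. f x) = 0"
  using lborel_integral_real_affine[of "-1" f 0] assms by simp

lemma jft_complex: "(LINT y|lborel. of_real (jker y) * exp (- \<i> * of_real (u * y))) = of_real (jft u)"
  and jker_exp_integrable: "integrable lborel (\<lambda>y. of_real (jker y) * exp (\<i> * of_real (u * y)))"
proof -
  have ij: "integrable lborel jker" using jker_integrable[of 0] by simp
  have i: "integrable lborel (\<lambda>y. of_real (jker y) * exp (\<i> * of_real (v * y)))" for v :: real
    by (rule Bochner_Integration.integrable_bound[OF ij]) (auto simp: norm_mult jker_nonneg)
  show "integrable lborel (\<lambda>y. of_real (jker y) * exp (\<i> * of_real (u * y)))" by (rule i)
  have e: "of_real (jker y) * exp (- \<i> * of_real (u * y)) = of_real (jker y * cos (u * y)) - \<i> * of_real (jker y * sin (u * y))" for y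
    by (simp add: complex_eq_iff Re_exp Im_exp)
  have c: "integrable lborel (\<lambda>y. jker y * cos (u * y))"
    by (rule Bochner_Integration.integrable_bound[OF ij]) (auto simp: abs_mult jker_nonneg mult_left_le)
  have s: "integrable lborel (\<lambda>y. jker y * sin (u * y))"
    by (rule Bochner_Integration.integrable_bound[OF ij]) (auto simp: abs_mult jker_nonneg mult_left_le)
  have "(LINT y|lborel. jker y * sin (u * y)) = 0" by (rule lborel_integral_odd) (simp add: jker_even)
  then show "(LINT y|lborel. of_real (jker y) * exp (- \<i> * of_real (u * y))) = of_real (jft u)"
    unfolding e jft_def using c s
    by (subst Bochner_Integration.integral_diff) (auto intro!: integrable_mult_right integrable_of_real simp del: of_real_mult)
qed

lemma jft_abs_le_1: "\<bar>jft u\<bar> \<le> 1"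
proof -
  have ij: "integrable lborel jker" using jker_integrable[of 0] by simp
  have "norm (jft u) \<le> (LINT y|lborel. norm (jker y * cos (u * y)))"
    unfolding jft_def by (rule integral_norm_bound)
  also have "\<dots> \<le> (LINT y|lborel. jker y)"
    by (rule integral_mono_AE) (auto intro!: Bochner_Integration.integrable_bound[OF ij] simp: abs_mult jker_nonneg mult_left_le)
  finally show ?thesis by (simp add: jker_integral)
qed

text \<open>A finite first moment makes the Fourier transform Lipschitz at 0. This removes
  \<open>jft\<close> from the sum over squares of primes.\<close>

lemma jft_near_0: obtains C where "C > 0" "\<And>u. \<bar>1 - jft u\<bar> \<le> C * \<bar>u\<bar>"
proof -
  have ij: "integrable lborel jker" using jker_integrable[of 0] by simp
  have iy: "integrable lborel (\<lambda>y. \<bar>y\<bar> * jker y)" using jker_integrable[of 1] by simp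
  define m where "m = (LINT y|lborel. \<bar>y\<bar> * jker y)"
  have m: "m \<ge> 0" unfolding m_def by (intro integral_nonneg_AE) (auto simp: jker_nonneg)
  have "\<bar>1 - jft u\<bar> \<le> (m + 1) * \<bar>u\<bar>" for u
  proof -
    have c: "integrable lborel (\<lambda>y. jker y * cos (u * y))"
      by (rule Bochner_Integration.integrable_bound[OF ij]) (auto simp: abs_mult jker_nonneg mult_left_le)
    have b: "\<bar>jker y - jker y * cos (u * y)\<bar> \<le> \<bar>u\<bar> * (\<bar>y\<bar> * jker y)" for y
    proof -
      have "\<bar>1 - cos (u * y)\<bar> \<le> \<bar>u * y\<bar>"
      proof -
        have "\<bar>cos 0 - cos (u * y)\<bar> \<le> \<bar>0 - u * y\<bar>"
          using field_differentiable_bound[of UNIV cos "\<lambda>x. - sin x" 1 0 "u * y"] by (auto intro!: derivative_eq_intros)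
        then show ?thesis by simp
      qed
      then have "jker y * \<bar>1 - cos (u * y)\<bar> \<le> jker y * \<bar>u * y\<bar>" using jker_nonneg by (intro mult_left_mono)
      moreover have "jker y - jker y * cos (u * y) = jker y * (1 - cos (u * y))" by (simp add: algebra_simps)
      ultimately show ?thesis using jker_nonneg[of y] by (simp only: abs_mult) (simp add: mult_ac)
    qed
    have "1 - jft u = (LINT y|lborel. jker y - jker y * cos (u * y))"
      unfolding jft_def using ij c by (simp add: jker_integral)
    also have "\<bar>\<dots>\<bar> \<le> (LINT y|lborel. \<bar>u\<bar> * (\<bar>y\<bar> * jker y))"
      using b iy ij c by (intro order.trans[OF integral_abs_bound] integral_mono_AE) auto
    also have "\<dots> = m * \<bar>u\<bar>" by (simp add: m_def mult.commute)
    also have "\<dots> \<le> (m + 1) * \<bar>u\<bar>" by (intro mult_right_mono) auto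
    finally show ?thesis .
  qed
  then show thesis using that[of "m + 1"] m by auto
qed

text \<open>The easy direction of Paley-Wiener: in the upper half plane \<open>csinc z ^ 6\<close>
  grows at most like \<open>exp (6 * Im z)\<close>, which the factor
  \<open>exp (\<i> * of_real u * z)\<close> compensates for \<open>u \<ge> 6\<close>, so that the
  contour can be closed there.\<close>

lemma jft_eq_0: assumes "u \<ge> 6" shows "jft u = 0"
proof -
  define g where "g = (\<lambda>z. csinc z ^ 6 * exp (\<i> * of_real u * z))"
  have geq: "g (of_real x) = of_real sinc6_mass * (of_real (jker x) * exp (- \<i> * of_real ((- u) * x)))" for x
    using sinc6_mass_pos unfolding g_def csinc_of_real jker_def by (simp add: mult.assoc)
  have "(LINT x|lborel. g (of_real x)) = 0"
  proof (rule integral_real_line_eq_0[where C = 1])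
    show "g holomorphic_on {z. Im z > -1}" unfolding g_def
      by (intro holomorphic_intros holomorphic_on_subset[OF csinc_holomorphic]) auto
    show "cmod (g z) \<le> 1 / (cmod z)\<^sup>2" if "Im z \<ge> 0" "cmod z \<ge> 1" for z
    proof -
      have "cmod (g z) \<le> (exp (Im z) / cmod z) ^ 6 * exp (- u * Im z)"
        unfolding g_def norm_mult norm_power using csinc_bound[OF that]
        by (intro mult_mono power_mono) auto
      also have "\<dots> = exp (6 * Im z) * exp (- u * Im z) / cmod z ^ 6"
        using exp_of_nat_mult[of 6 "Im z"] by (simp add: power_divide)
      also have "\<dots> = exp ((6 - u) * Im z) / cmod z ^ 6" by (simp add: left_diff_distrib exp_diff exp_minus field_simps)
      also have "\<dots> \<le> 1 / cmod z ^ 2"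
        using that assms by (intro frac_le power_increasing) (auto simp: mult_nonpos_nonneg)
      finally show ?thesis .
    qed
    show "integrable lborel (\<lambda>x. g (of_real x))"
      unfolding geq using jker_exp_integrable[of u] by (intro integrable_mult_right) simp
  qed
  moreover have "(LINT x|lborel. g (of_real x)) = of_real sinc6_mass * of_real (jft (- u))"
    by (simp only: geq integral_mult_right_zero jft_complex)
  ultimately have "jft (- u) = 0" using sinc6_mass_pos by simp
  then show ?thesis by (simp add: jft_def)
qed

lemma decay_integrable:
  fixes g :: "complex \<Rightarrow> complex"
  assumes cont: "continuous_on UNIV (\<lambda>x::real. g (of_real x))"
    and decay: "\<And>x::real. \<bar>x\<bar> \<ge> 1 \<Longrightarrow> cmod (g (of_real x)) \<le> C / x\<^sup>2"
  shows "integrable lborel (\<lambda>x. g (of_real x))"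
proof -
  have "compact ((\<lambda>x. g (of_real x)) ` {-1..1::real})"
    by (intro compact_continuous_image continuous_on_subset[OF cont]) auto
  then have "bounded ((\<lambda>x. g (of_real x)) ` {-1..1::real})" by (rule compact_imp_bounded)
  then obtain M where M: "M > 0" "\<And>x. \<bar>x\<bar> \<le> 1 \<Longrightarrow> cmod (g (of_real x)) \<le> M"
    unfolding bounded_pos by (auto simp: abs_le_iff)
  have C: "C \<ge> 0" using order.trans[OF norm_ge_zero decay[of 1]] by simp
  show ?thesis
  proof (rule Bochner_Integration.integrable_bound)
    show "integrable lborel (\<lambda>x::real. (2 * M + 2 * C) * (1 / (1 + x\<^sup>2)))"
      by (intro integrable_mult_right integrable_inverse_1_plus_square)
    show "(\<lambda>x. g (of_real x)) \<in> borel_measurable lborel"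
      using borel_measurable_continuous_onI[OF cont] by simp
    have "cmod (g (of_real x)) \<le> (2 * M + 2 * C) * (1 / (1 + x\<^sup>2))" for x :: real
    proof (cases "\<bar>x\<bar> \<le> 1")
      case True
      then have "x\<^sup>2 \<le> 1" by (simp add: abs_square_le_1)
      have "M * (1 + x\<^sup>2) \<le> M * 2" using \<open>x\<^sup>2 \<le> 1\<close> M by (intro mult_left_mono) auto
      moreover have "1 + x\<^sup>2 > 0" by (simp add: add_pos_nonneg)
      ultimately have "M \<le> (2 * M + 2 * C) * (1 / (1 + x\<^sup>2))" using C by (simp add: pos_le_divide_eq)
      then show ?thesis using M(2)[OF True] by simp
    next
      case False
      then have x: "x\<^sup>2 \<ge> 1" using abs_le_square_iff[of 1 x] by simp
      have "C * (1 + x\<^sup>2) \<le> (2 * M + 2 * C) * x\<^sup>2"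
      proof -
        have "C * 1 \<le> C * x\<^sup>2" using C x by (intro mult_left_mono) auto
        moreover have "0 \<le> M * x\<^sup>2" using M by simp
        ultimately show ?thesis by (simp add: algebra_simps)
      qed
      then have "C / x\<^sup>2 \<le> (2 * M + 2 * C) / (1 + x\<^sup>2)"
        using x M C by (simp add: divide_simps add_pos_nonneg)
      then show ?thesis using decay[of x] False by simp
    qed
    then show "AE x in lborel. norm (g (of_real x)) \<le> norm ((2 * M + 2 * C) * (1 / (1 + x\<^sup>2)))"
      using M C by (intro AE_I2) auto
  qed
qed

text \<open>\<open>g\<close> is \<open>1 / (z * (1 - \<i> * z))\<close> minus
  \<open>(exp (\<i> * a * z) - 1) / (\<i> * a * z^2)\<close>. The singularity at 0 is removable, the
  decay in the upper half plane is quadratic, and on the real line the imaginary part is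
  \<open>1 / (1 + x^2)\<close> minus the integrand divided by \<open>a\<close>. As the integral of
  \<open>g\<close> vanishes, the claim follows from the integral of
  \<open>1 / (1 + x^2)\<close>.\<close>

lemma integral_one_minus_cos:
  assumes a: "a > 0"
  shows "integrable lborel (\<lambda>y. (1 - cos (a * y)) / y\<^sup>2)" "(LINT y|lborel. (1 - cos (a * y)) / y\<^sup>2) = pi * a"
proof -
  define h where "h = (\<lambda>z. 1 / (1 - \<i> * z) - exp (\<i> * of_real (a / 2) * z) * csinc (of_real (a / 2) * z))"
  define g where "g = (\<lambda>z. if z = 0 then deriv h 0 else h z / z)"
  have nz: "1 - \<i> * z \<noteq> 0" if "Im z > -1" for z
  proof
    assume "1 - \<i> * z = 0"
    then have "Re (1 - \<i> * z) = 0" by simp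
    then show False using that by simp
  qed
  have csc: "(\<lambda>z. csinc (of_real (a / 2) * z)) holomorphic_on S" for S
    by (rule holomorphic_on_compose_gen[OF _ csinc_holomorphic, of "\<lambda>z. of_real (a / 2) * z", unfolded comp_def])
       (auto intro!: holomorphic_intros)
  have holh: "h holomorphic_on {z. Im z > -1}"
    unfolding h_def using nz by (intro holomorphic_intros csc) auto
  have h0: "h 0 = 0" by (simp add: h_def csinc_def)
  have holg: "g holomorphic_on {z. Im z > -1}"
    by (rule pole_theorem_open_0[OF holh open_halfspace_Im_gt, of 0]) (auto simp: g_def h0)
  have decay: "cmod (g z) \<le> (1 + 2 / a) / (cmod z)\<^sup>2 " if z: "Im z \<ge> 0" "cmod z \<ge> 1" for z
  proof -
    have z0: "z \<noteq> 0" using z by auto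
    have "(cmod (1 - \<i> * z))\<^sup>2 \<ge> (cmod z)\<^sup>2"
      unfolding cmod_power2 using z by (simp add: power2_eq_square algebra_simps)
    then have "cmod (1 - \<i> * z) \<ge> cmod z" by (rule power2_le_imp_le) simp
    then have 1: "cmod (1 / (1 - \<i> * z)) \<le> 1 / cmod z" unfolding norm_divide norm_one using z by (intro frac_le) auto
    define w where "w = of_real (a / 2) * z"
    have w0: "w \<noteq> 0" using z0 a by (simp add: w_def)
    have cw: "cmod w = a / 2 * cmod z" "Im w = a / 2 * Im z" using a by (auto simp: w_def norm_mult)
    have "cmod (sin w) \<le> exp (Im w)"
    proof -
      have "cmod (sin w) \<le> (cmod (exp (\<i> * w)) + cmod (exp (- (\<i> * w)))) / 2"
        unfolding sin_exp_eq using norm_triangle_ineq4[of "exp (\<i> * w)" "exp (- (\<i> * w))"]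
        by (simp add: norm_divide norm_mult divide_right_mono)
      also have "\<dots> = (exp (- Im w) + exp (Im w)) / 2" by simp
      also have "\<dots> \<le> exp (Im w)" using z a by (simp add: cw)
      finally show ?thesis .
    qed
    then have "cmod (exp (\<i> * w) * csinc w) \<le> exp (- Im w) * (exp (Im w) / cmod w)"
      unfolding norm_mult using w0 by (intro mult_mono) (auto simp: csinc_def norm_divide divide_right_mono)
    also have "\<dots> = 1 / cmod w" by (simp add: exp_minus)
    also have "\<dots> = 2 / a / cmod z" using a by (simp add: cw)
    finally have 2: "cmod (exp (\<i> * w) * csinc w) \<le> 2 / a / cmod z" .
    have "cmod (h z) \<le> 1 / cmod z + 2 / a / cmod z"
      using 1 2 norm_triangle_ineq4[of "1 / (1 - \<i> * z)" "exp (\<i> * w) * csinc w"]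
      unfolding h_def w_def mult.assoc by linarith
    also have "\<dots> = (1 + 2 / a) / cmod z" by (simp add: add_divide_distrib)
    finally have "cmod (h z) / cmod z \<le> (1 + 2 / a) / cmod z / cmod z" by (rule divide_right_mono) simp
    then show ?thesis using z0 by (simp add: g_def norm_divide power2_eq_square)
  qed
  have ig: "integrable lborel (\<lambda>x. g (of_real x))"
  proof (rule decay_integrable)
    show "continuous_on UNIV (\<lambda>x::real. g (of_real x))"
      by (rule continuous_on_compose2[OF holomorphic_on_imp_continuous_on[OF holg]]) (auto intro!: continuous_intros)
    show "cmod (g (of_real x)) \<le> (1 + 2 / a) / x\<^sup>2" if "\<bar>x\<bar> \<ge> 1" for x :: real
      using decay[of "of_real x"] that by simp
  qed
  have "(LINT x|lborel. g (of_real x)) = 0" by (rule integral_real_line_eq_0[OF holg decay ig])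
  then have Re0: "(LINT x|lborel. Re (g (of_real x))) = 0" "integrable lborel (\<lambda>x. Re (g (of_real x)))"
    using ig by (auto simp: integral_Re)
  have "integrable lborel (\<lambda>x. Im (g (of_real x)))" using ig by (rule integrable_Im)
  have Img: "Im (g (of_real x)) = 1 / (1 + x\<^sup>2) - (1 - cos (a * x)) / x\<^sup>2 / a" if "x \<noteq> 0" for x :: real
  proof -
    have eh: "exp (\<i> * of_real (a / 2) * of_real x) = cis (a / 2 * x)" by (simp add: cis_conv_exp mult.assoc)
    have sc: "csinc (of_real (a / 2) * of_real x) = of_real (sin (a / 2 * x) / (a / 2 * x))"
      using that a csinc_of_real[of "a / 2 * x"] by (simp add: rsinc_def)
    have "Im (1 / (1 - \<i> * of_real x)) = x / (1 + x\<^sup>2)" by (simp add: Im_divide power2_eq_square)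
    then have "Im (h (of_real x)) = x / (1 + x\<^sup>2) - sin (a / 2 * x) * (sin (a / 2 * x) / (a / 2 * x))"
      unfolding h_def eh sc by simp
    moreover have "1 - cos (a * x) = 2 * sin (a / 2 * x) * sin (a / 2 * x)"
      using cos_double_sin[of "a / 2 * x"] by (simp add: power2_eq_square)
    ultimately have e: "Im (h (of_real x)) = x / (1 + x\<^sup>2) - (1 - cos (a * x)) / (a * x)" by simp
    have "Im (g (of_real x)) = Im (h (of_real x)) / x" using that by (simp add: g_def)
    also have "\<dots> = 1 / (1 + x\<^sup>2) - (1 - cos (a * x)) / x\<^sup>2 / a"
      unfolding e using that a by (simp add: diff_divide_distrib power2_eq_square mult_ac)
    finally show ?thesis .
  qed
  have Im0: "(LINT x|lborel. Im (g (of_real x))) = 0"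
    using \<open>(LINT x|lborel. g (of_real x)) = 0\<close> ig by (simp add: integral_Im)
  have AE: "AE x in lborel. (1 - cos (a * x)) / x\<^sup>2 = a * (1 / (1 + x\<^sup>2)) - a * Im (g (of_real x))"
  proof (rule AE_mp[OF AE_lborel_singleton[of 0]], intro AE_I2 impI)
    fix x :: real assume "x \<noteq> 0"
    then have "a * Im (g (of_real x)) = a * (1 / (1 + x\<^sup>2)) - a * ((1 - cos (a * x)) / x\<^sup>2 / a)"
      by (simp only: Img[OF \<open>x \<noteq> 0\<close>] right_diff_distrib)
    moreover have "a * ((1 - cos (a * x)) / x\<^sup>2 / a) = (1 - cos (a * x)) / x\<^sup>2" using a by simp
    ultimately show "(1 - cos (a * x)) / x\<^sup>2 = a * (1 / (1 + x\<^sup>2)) - a * Im (g (of_real x))"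
      by linarith
  qed
  have i2: "integrable lborel (\<lambda>x. a * (1 / (1 + x\<^sup>2)) - a * Im (g (of_real x)))"
    using ig by (intro Bochner_Integration.integrable_diff integrable_mult_right integrable_inverse_1_plus_square integrable_Im)
  show "integrable lborel (\<lambda>y. (1 - cos (a * y)) / y\<^sup>2)"
    by (rule integrable_cong_AE_imp[OF i2]) (use AE in auto)
  have "(LINT y|lborel. (1 - cos (a * y)) / y\<^sup>2) = (LINT x|lborel. a * (1 / (1 + x\<^sup>2)) - a * Im (g (of_real x)))"
    using AE borel_measurable_integrable[OF i2] by (intro integral_cong_AE) auto
  also have "\<dots> = a * pi - a * 0"
    using ig by (subst Bochner_Integration.integral_diff)
      (auto intro!: integrable_mult_right integrable_inverse_1_plus_square integrable_Im simp: integral_inverse_1_plus_square Im0 simp del: mult_1_right times_divide_eq_right)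
  finally show "(LINT y|lborel. (1 - cos (a * y)) / y\<^sup>2) = pi * a" by (simp add: mult.commute)
qed

lemma integral_one_minus_cos':
  shows "integrable lborel (\<lambda>y. (1 - cos (a * y)) / y\<^sup>2)" "(LINT y|lborel. (1 - cos (a * y)) / y\<^sup>2) = pi * \<bar>a\<bar>"
proof -
  consider "a = 0" | "a > 0" | "a < 0" by linarith
  then have "integrable lborel (\<lambda>y. (1 - cos (a * y)) / y\<^sup>2) \<and> (LINT y|lborel. (1 - cos (a * y)) / y\<^sup>2) = pi * \<bar>a\<bar>"
  proof cases
    case 3
    then show ?thesis using integral_one_minus_cos[of "-a"] by simp
  qed (use integral_one_minus_cos[of a] in auto)
  then show "integrable lborel (\<lambda>y. (1 - cos (a * y)) / y\<^sup>2)" "(LINT y|lborel. (1 - cos (a * y)) / y\<^sup>2) = pi * \<bar>a\<bar>" by auto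
qed

text \<open>Fejer's kernel, whose Fourier transform is \<open>max 0 (1 - \<bar>u\<bar>)\<close>.\<close>
definition fker :: "real \<Rightarrow> real" where "fker y = (rsinc (y / 2))\<^sup>2 / (2 * pi)"

lemma fker_eq: "y \<noteq> 0 \<Longrightarrow> fker y = (1 - cos y) / y\<^sup>2 / pi"
  using cos_double_sin[of "y / 2"] by (simp add: fker_def rsinc_def power_divide)

lemma fker_continuous: "continuous_on A fker"
  unfolding fker_def by (intro continuous_intros continuous_on_compose2[OF rsinc_continuous[of UNIV]]) auto

lemma fker_nonneg: "fker y \<ge> 0" by (simp add: fker_def)

lemma fker_bound: "fker y \<le> 10 * (1 + \<bar>y\<bar>) powr (-2)"
proof -
  define v where "v = rsinc (y / 2)"
  have 1: "v\<^sup>2 \<le> 1"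
    using abs_sin_x_le_abs_x[of "y / 2", unfolded abs_le_square_iff] by (auto simp: v_def rsinc_def power_divide divide_le_eq_1 abs_le_square_iff)
  have 2: "(y / 2)\<^sup>2 * v\<^sup>2 \<le> 1" using abs_sin_le_one[of "y / 2"]
    by (cases "y = 0") (auto simp: v_def rsinc_def abs_square_le_1 power_divide)
  have "v\<^sup>2 * (1 + \<bar>y\<bar>)\<^sup>2 \<le> v\<^sup>2 * (2 * (1 + y\<^sup>2))"
    using sum_squares_bound[of 1 "\<bar>y\<bar>"] by (intro mult_left_mono) (simp_all add: power2_sum)
  also have "\<dots> = 2 * v\<^sup>2 + 8 * ((y / 2)\<^sup>2 * v\<^sup>2)" by (simp add: algebra_simps power_divide)
  also have "\<dots> \<le> 10" using 1 2 by linarith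
  finally have "v\<^sup>2 \<le> 10 / (1 + \<bar>y\<bar>)\<^sup>2" by (simp add: pos_le_divide_eq)
  moreover have "v\<^sup>2 / (2 * pi) \<le> v\<^sup>2 / 1" using pi_gt3 by (intro divide_left_mono) auto
  moreover have "(1 + \<bar>y\<bar>) powr (-2) = 1 / (1 + \<bar>y\<bar>)\<^sup>2" by (simp add: powr_minus powr_numeral divide_inverse)
  ultimately show ?thesis by (simp add: fker_def v_def)
qed

text \<open>Multiplication by \<open>cos (u * y)\<close> turns the kernel into a second difference
  of \<open>1 - cos\<close>, so its transform is half the second difference of
  \<open>\<bar>u\<bar>\<close>.\<close>

lemma fker_ft: "(LINT y|lborel. of_real (fker y) * exp (- \<i> * of_real (u * y))) = of_real (max 0 (1 - \<bar>u\<bar>))"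
  and fker_integrable: "integrable lborel fker"
proof -
  have AE: "AE y in lborel. fker y = (1 - cos (1 * y)) / y\<^sup>2 / pi"
    by (rule AE_mp[OF AE_lborel_singleton[of 0]]) (auto intro!: AE_I2 simp: fker_eq)
  have [measurable]: "fker \<in> borel_measurable borel" by (rule borel_measurable_continuous_onI[OF fker_continuous])
  show ij: "integrable lborel fker"
    by (rule integrable_cong_AE_imp[OF integrable_divide_zero[of pi lborel "\<lambda>y. (1 - cos (1 * y)) / y\<^sup>2", OF integral_one_minus_cos'(1)]])
       (use AE in auto)
  have e: "of_real (fker y) * exp (- \<i> * of_real (u * y)) = of_real (fker y * cos (u * y)) - \<i> * of_real (fker y * sin (u * y))" for y
    by (simp add: complex_eq_iff Re_exp Im_exp)
  have c: "integrable lborel (\<lambda>y. fker y * cos (u * y))"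
    by (rule Bochner_Integration.integrable_bound[OF ij]) (auto simp: abs_mult fker_nonneg mult_left_le)
  have s: "integrable lborel (\<lambda>y. fker y * sin (u * y))"
    by (rule Bochner_Integration.integrable_bound[OF ij]) (auto simp: abs_mult fker_nonneg mult_left_le)
  have s0: "(LINT y|lborel. fker y * sin (u * y)) = 0" by (rule lborel_integral_odd) (simp add: fker_def rsinc_def)
  have "(LINT y|lborel. fker y * cos (u * y)) = (LINT y|lborel. ((1 - cos ((u + 1) * y)) / y\<^sup>2 / 2 + (1 - cos ((u - 1) * y)) / y\<^sup>2 / 2 - (1 - cos (u * y)) / y\<^sup>2) / pi)"
  proof (rule integral_cong_AE)
    show "AE y in lborel. fker y * cos (u * y) = ((1 - cos ((u + 1) * y)) / y\<^sup>2 / 2 + (1 - cos ((u - 1) * y)) / y\<^sup>2 / 2 - (1 - cos (u * y)) / y\<^sup>2) / pi"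
    proof (rule AE_mp[OF AE_lborel_singleton[of 0]], intro AE_I2 impI)
      fix y :: real assume y: "y \<noteq> 0"
      have "cos ((u + 1) * y) = cos (u * y) * cos y - sin (u * y) * sin y" "cos ((u - 1) * y) = cos (u * y) * cos y + sin (u * y) * sin y"
        by (simp_all add: cos_add cos_diff ring_distribs)
      then have sum: "cos ((u + 1) * y) + cos ((u - 1) * y) = 2 * (cos (u * y) * cos y)" by simp
      have gen: "(1 - c1) / Y / 2 + (1 - c2) / Y / 2 - (1 - c3) / Y = (c3 - (c1 + c2) / 2) / Y" for c1 c2 c3 Y :: real
        by (simp add: add_divide_distrib diff_divide_distrib)
      have "fker y * cos (u * y) = (cos (u * y) - cos (u * y) * cos y) / y\<^sup>2 / pi"
        using y by (simp add: fker_eq algebra_simps)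
      then show "fker y * cos (u * y) = ((1 - cos ((u + 1) * y)) / y\<^sup>2 / 2 + (1 - cos ((u - 1) * y)) / y\<^sup>2 / 2 - (1 - cos (u * y)) / y\<^sup>2) / pi"
        unfolding gen sum by simp
    qed
  qed auto
  also have "\<dots> = (pi * \<bar>u + 1\<bar> / 2 + pi * \<bar>u - 1\<bar> / 2 - pi * \<bar>u\<bar>) / pi"
  proof -
    note i = integral_one_minus_cos'
    show ?thesis
      by (simp only: integral_divide_zero Bochner_Integration.integral_diff Bochner_Integration.integral_add i integrable_divide_zero Bochner_Integration.integrable_add)
  qed
  also have "\<dots> = \<bar>u + 1\<bar> / 2 + \<bar>u - 1\<bar> / 2 - \<bar>u\<bar>" by (simp add: add_divide_distrib diff_divide_distrib)
  also have "\<dots> = max 0 (1 - \<bar>u\<bar>)" by (auto simp: max_def abs_if field_simps)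
  finally show "(LINT y|lborel. of_real (fker y) * exp (- \<i> * of_real (u * y))) = of_real (max 0 (1 - \<bar>u\<bar>))"
    unfolding e using c s s0
    by (subst Bochner_Integration.integral_diff) (auto intro!: integrable_mult_right integrable_of_real simp del: of_real_mult)
qed

section \<open>Smoothing along vertical lines\<close>

text \<open>Integrating a Dirichlet series against a kernel multiplies its coefficients by the Fourier
  transform of the kernel. Both sides are analytic, so the identity persists to the left of the
  half plane of absolute convergence.\<close>
lemma vertical_smoothing:
  fixes f :: "complex \<Rightarrow> complex" and K :: "real \<Rightarrow> complex" and b :: "nat \<Rightarrow> complex" and h :: real
  assumes hol: "f holomorphic_on {s. Re s > 1/2}"
    and growth: "\<And>r. r > 1/2 \<Longrightarrow> \<exists>A. \<forall>s. Re s \<ge> r \<longrightarrow> cmod (f s) \<le> A * (1 + \<bar>Im s\<bar>) powr (1/2)"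
    and f_eq: "\<And>s. Re s > 1 \<Longrightarrow> f s = dser b s"
    and b: "\<And>n. cmod (b n) \<le> c * (1 + ln (real n))"
    and K: "continuous_on UNIV K" "\<And>y. cmod (K y) \<le> B * (1 + \<bar>y\<bar>) powr (-2)"
    and h: "h > 0"
    and \<kappa>: "\<And>n. n > 0 \<Longrightarrow> \<kappa> n = (LINT y|lborel. K y * exp (- \<i> * of_real (h * ln (real n) * y)))"
    and \<kappa>0: "\<And>n. n > N \<Longrightarrow> \<kappa> n = 0"
    and s: "Re s > 1/2"
  shows "integrable lborel (\<lambda>y. f (s + \<i> * of_real (h * y)) * K y)"
    and "(LINT y|lborel. f (s + \<i> * of_real (h * y)) * K y) = (\<Sum>n=1..N. b n * \<kappa> n * of_nat n powr (- s))"
proof -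
  have B0: "B \<ge> 0" using order.trans[OF norm_ge_zero K(2)[of 0]] by simp
  \<comment> \<open>The growth exponent 1/2 of \<open>f\<close> and the decay exponent -2 of
    \<open>K\<close> leave -3/2, an integrable majorant.\<close>
  define w where "w = (\<lambda>y::real. (1 + \<bar>y\<bar>) powr (-3/2))"
  have wint: "integrable lborel w" unfolding w_def by (rule integrable_decay)
  have w0: "w y \<ge> 0" for y by (simp add: w_def)
  define g where "g = (\<lambda>s y. f (s + \<i> * of_real (h * y)) * K y)"
  have maj: "\<exists>A\<ge>0. \<forall>s y. Re s \<ge> r \<longrightarrow> \<bar>Im s\<bar> \<le> T \<longrightarrow> cmod (g s y) \<le> A * w y" if "r > 1/2" "T \<ge> 0" for r T
  proof -
    obtain A where A: "\<And>s. Re s \<ge> r \<Longrightarrow> cmod (f s) \<le> A * (1 + \<bar>Im s\<bar>) powr (1/2)"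
      using growth[OF \<open>r > 1/2\<close>] by blast
    have A0: "A \<ge> 0" using order.trans[OF norm_ge_zero A[of "of_real r"]] by simp
    have "cmod (g s y) \<le> A * (1 + T + h) powr (1/2) * B * w y" if s: "Re s \<ge> r" "\<bar>Im s\<bar> \<le> T" for s y
    proof -
      have "1 + \<bar>Im (s + \<i> * of_real (h * y))\<bar> \<le> 1 + T + h * \<bar>y\<bar>"
        using s h abs_triangle_ineq[of "Im s" "h * y"] by (simp add: abs_mult)
      also have "\<dots> \<le> (1 + T + h) * (1 + \<bar>y\<bar>)" using \<open>T \<ge> 0\<close> h by (simp add: algebra_simps)
      finally have "(1 + \<bar>Im (s + \<i> * of_real (h * y))\<bar>) powr (1/2) \<le> ((1 + T + h) * (1 + \<bar>y\<bar>)) powr (1/2)"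
        by (intro powr_mono2) auto
      also have "\<dots> = (1 + T + h) powr (1/2) * (1 + \<bar>y\<bar>) powr (1/2)"
        by (intro powr_mult)
      finally have pw: "(1 + \<bar>Im (s + \<i> * of_real (h * y))\<bar>) powr (1/2) \<le> (1 + T + h) powr (1/2) * (1 + \<bar>y\<bar>) powr (1/2)" .
      have "r \<le> Re (s + \<i> * of_real (h * y))" using s by simp
      from order.trans[OF A[OF this] mult_left_mono[OF pw A0]]
      have "cmod (f (s + \<i> * of_real (h * y))) \<le> A * ((1 + T + h) powr (1/2) * (1 + \<bar>y\<bar>) powr (1/2))" .
      then have "cmod (g s y) \<le> A * ((1 + T + h) powr (1/2) * (1 + \<bar>y\<bar>) powr (1/2)) * (B * (1 + \<bar>y\<bar>) powr (-2))"
        unfolding g_def norm_mult using K(2)[of y] A0 by (intro mult_mono) auto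
      also have "\<dots> = A * (1 + T + h) powr (1/2) * B * ((1 + \<bar>y\<bar>) powr (1/2) * (1 + \<bar>y\<bar>) powr (-2))"
        by (simp add: mult_ac)
      also have "(1 + \<bar>y\<bar>) powr (1/2) * (1 + \<bar>y\<bar>) powr (-2) = w y"
        unfolding w_def by (subst powr_add[symmetric]) simp
      finally show ?thesis .
    qed
    moreover have "A * (1 + T + h) powr (1/2) * B \<ge> 0" using A0 B0 by simp
    ultimately show ?thesis by blast
  qed
  have contf: "continuous_on {s. Re s > 1/2} f" using hol by (rule holomorphic_on_imp_continuous_on)
  have contg: "continuous_on UNIV (g s)" if "Re s > 1/2" for s
    unfolding g_def
    by (intro continuous_intros K(1) continuous_on_compose2[OF contf]) (use that in auto)
  have gint: "integrable lborel (g s)" if s: "Re s > 1/2" for s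
  proof -
    obtain A where A: "\<And>y. cmod (g s y) \<le> A * w y" using maj[OF s, of "\<bar>Im s\<bar>"] by auto
    have "integrable lborel (\<lambda>y. A * w y)" using wint by (intro integrable_mult_right)
    moreover have "g s \<in> borel_measurable lborel"
      using borel_measurable_continuous_onI[OF contg[OF s]] by simp
    moreover have "AE y in lborel. norm (g s y) \<le> norm (A * w y)"
      using A by (intro AE_I2) (simp add: order.trans[OF _ abs_ge_self])
    ultimately show ?thesis by (rule Bochner_Integration.integrable_bound)
  qed
  show "integrable lborel (\<lambda>y. f (s + \<i> * of_real (h * y)) * K y)" using gint[OF s] by (simp add: g_def)
  define F where "F = (\<lambda>s. LINT y|lborel. g s y)"
  \<comment> \<open>On compact intervals the Leibniz rule gives holomorphy; the tails are uniformly
    small on small discs, so the limit \<open>F\<close> is holomorphic too.\<close>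
  define Fn where "Fn = (\<lambda>n s. integral (cbox (- real n) (real n)) (g s))"
  have Fn: "Fn n s = (LINT y|lborel. indicator {- real n..real n} y *\<^sub>R g s y)" if "Re s > 1/2" for n s
  proof -
    have "set_integrable lborel {- real n..real n} (g s)"
      unfolding set_integrable_def by (rule integrable_mult_indicator[OF _ gint[OF that]]) simp
    from set_borel_integral_eq_integral(2)[OF this] show ?thesis
      by (simp add: Fn_def set_lebesgue_integral_def)
  qed
  have holFn: "Fn n holomorphic_on {s. Re s > 1/2}" for n
    unfolding Fn_def
  proof (rule leibniz_rule_holomorphic[where fx = "\<lambda>s y. deriv f (s + \<i> * of_real (h * y)) * K y"])
    show "((\<lambda>x. g x t) has_field_derivative deriv f (x + \<i> * of_real (h * t)) * K t) (at x within {s. Re s > 1/2})"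
      if "x \<in> {s. Re s > 1/2}" for x t
    proof -
      have "(f has_field_derivative deriv f (x + \<i> * of_real (h * t))) (at (x + \<i> * of_real (h * t)))"
        using hol that by (intro holomorphic_derivI[OF _ open_halfspace_Re_gt[of "1/2"]]) auto
      then have "((\<lambda>x. f (x + \<i> * of_real (h * t))) has_field_derivative deriv f (x + \<i> * of_real (h * t))) (at x)"
        by (simp add: DERIV_shift)
      from DERIV_cmult_right[OF this, of "K t"] show ?thesis unfolding g_def
        by (rule has_field_derivative_at_within)
    qed
    show "g x integrable_on cbox (- real n) (real n)" if "x \<in> {s. Re s > 1/2}" for x
      using contg[of x] that by (intro integrable_continuous continuous_on_subset[OF contg]) auto
    have cd: "continuous_on {s. Re s > 1/2} (deriv f)"
      using hol by (intro holomorphic_on_imp_continuous_on holomorphic_deriv open_halfspace_Re_gt)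
    have "continuous_on ({s. Re s > 1/2} \<times> cbox (- real n) (real n)) (\<lambda>x. deriv f (fst x + \<i> * of_real (h * snd x)))"
      by (rule continuous_on_compose2[OF cd]) (auto intro!: continuous_intros)
    moreover have "continuous_on ({s. Re s > 1/2} \<times> cbox (- real n) (real n)) (\<lambda>x. K (snd x))"
      by (rule continuous_on_compose2[OF K(1)]) (auto intro!: continuous_intros)
    ultimately show "continuous_on ({s. Re s > 1/2} \<times> cbox (- real n) (real n)) (\<lambda>(x, t). deriv f (x + \<i> * of_real (h * t)) * K t)"
      unfolding case_prod_unfold by (rule continuous_on_mult)
  qed (rule convex_halfspace_Re_gt)
  have tail: "(\<lambda>n. LINT y|lborel. (1 - indicator {- real n..real n} y) * w y) \<longlonglongrightarrow> 0"
  proof -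
    have "(\<lambda>n. LINT y|lborel. (1 - indicator {- real n..real n} y) * w y) \<longlonglongrightarrow> (LINT y::real|lborel. 0 :: real)"
    proof (rule integral_dominated_convergence[where w = w])
      have [measurable]: "w \<in> borel_measurable borel" using borel_measurable_integrable[OF wint] by simp
      show "(\<lambda>y. (1 - indicator {- real n..real n} y) * w y) \<in> borel_measurable lborel" for n by measurable
      show "AE y in lborel. (\<lambda>n. (1 - indicator {- real n..real n} y) * w y) \<longlonglongrightarrow> 0"
      proof (rule AE_I2)
        fix y :: real
        obtain N :: nat where N: "\<bar>y\<bar> \<le> real N" using real_arch_simple by blast
        have "(1 - indicator {- real n..real n} y) * w y = 0" if "n \<ge> N" for n
        proof -
          have "real N \<le> real n" using that by simp
          then have "y \<in> {- real n..real n}" using N by auto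
          then show ?thesis by simp
        qed
        then have "\<forall>\<^sub>F n in sequentially. (1 - indicator {- real n..real n} y) * w y = 0"
          by (auto simp: eventually_at_top_linorder intro!: exI[of _ N])
        then show "(\<lambda>n. (1 - indicator {- real n..real n} y) * w y) \<longlonglongrightarrow> 0" by (rule tendsto_eventually)
      qed
      show "AE y in lborel. norm ((1 - indicator {- real n..real n} y) * w y) \<le> w y" for n
        using w0 by (intro AE_I2) (simp split: split_indicator)
    qed (use wint in simp_all)
    then show ?thesis by simp
  qed
  have holF: "F holomorphic_on {s. Re s > 1/2}"
  proof (rule holomorphic_uniform_sequence[OF open_halfspace_Re_gt holFn])
    fix x assume x: "x \<in> {s. Re s > 1/2}"
    define d where "d = (Re x - 1/2) / 2"
    have d: "d > 0" using x by (simp add: d_def)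
    have Rey: "Re y \<ge> 1/2 + d" if "y \<in> cball x d" for y
      using that abs_Re_le_cmod[of "x - y"] unfolding mem_cball dist_norm d_def by (simp add: field_simps)
    have Imy: "\<bar>Im y\<bar> \<le> \<bar>Im x\<bar> + d" if "y \<in> cball x d" for y
      using that abs_Im_le_cmod[of "x - y"] by (simp add: dist_norm)
    obtain A where A: "A \<ge> 0" "\<And>s y. Re s \<ge> 1/2 + d \<Longrightarrow> \<bar>Im s\<bar> \<le> \<bar>Im x\<bar> + d \<Longrightarrow> cmod (g s y) \<le> A * w y"
      using maj[of "1/2 + d" "\<bar>Im x\<bar> + d"] d by auto
    have ul: "uniform_limit (cball x d) Fn F sequentially"
      unfolding uniform_limit_iff
    proof (intro allI impI)
      fix e :: real assume e: "e > 0"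
      have "(\<lambda>n. A * (LINT y|lborel. (1 - indicator {- real n..real n} y) * w y)) \<longlonglongrightarrow> A * 0"
        by (intro tendsto_mult tendsto_const tail)
      then have ev: "\<forall>\<^sub>F n in sequentially. A * (LINT y|lborel. (1 - indicator {- real n..real n} y) * w y) < e"
        using e by (intro order_tendstoD(2)[of _ 0]) simp_all
      have dst: "dist (Fn n z) (F z) \<le> A * (LINT y|lborel. (1 - indicator {- real n..real n} y) * w y)" if z: "z \<in> cball x d" for n z
      proof -
        have z2: "Re z > 1/2" using Rey[OF z] d by simp
        have [measurable]: "w \<in> borel_measurable borel" using borel_measurable_integrable[OF wint] by simp
        have i1: "integrable lborel (\<lambda>y. indicator {- real n..real n} y *\<^sub>R g z y)"
          by (rule integrable_mult_indicator[OF _ gint[OF z2]]) simp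
        have i2: "integrable lborel (\<lambda>y. (1 - indicator {- real n..real n} y) * w y)"
          by (rule Bochner_Integration.integrable_bound[OF wint]) (use w0 in \<open>auto split: split_indicator\<close>)
        have "F z - Fn n z = (LINT y|lborel. g z y - indicator {- real n..real n} y *\<^sub>R g z y)"
          unfolding F_def Fn[OF z2] using gint[OF z2] i1 by (rule Bochner_Integration.integral_diff[symmetric])
        also have "cmod \<dots> \<le> (LINT y|lborel. cmod (g z y - indicator {- real n..real n} y *\<^sub>R g z y))"
          by (rule integral_norm_bound)
        also have "\<dots> \<le> (LINT y|lborel. A * ((1 - indicator {- real n..real n} y) * w y))"
        proof (rule integral_mono)
          show "integrable lborel (\<lambda>y. cmod (g z y - indicator {- real n..real n} y *\<^sub>R g z y))"
            using gint[OF z2] i1 by (intro integrable_norm Bochner_Integration.integrable_diff)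
          show "integrable lborel (\<lambda>y. A * ((1 - indicator {- real n..real n} y) * w y))"
            using i2 by (intro integrable_mult_right)
          show "cmod (g z y - indicator {- real n..real n} y *\<^sub>R g z y) \<le> A * ((1 - indicator {- real n..real n} y) * w y)" for y
            using A(2)[OF Rey[OF z] Imy[OF z], of y] by (simp split: split_indicator)
        qed
        finally show ?thesis by (simp add: dist_norm norm_minus_commute)
      qed
      show "\<forall>\<^sub>F n in sequentially. \<forall>z\<in>cball x d. dist (Fn n z) (F z) < e"
        using ev by (rule eventually_mono) (use dst order.strict_trans1 in blast)
    qed
    have "cball x d \<subseteq> {s. Re s > 1/2}" using Rey d by force
    then show "\<exists>d>0. cball x d \<subseteq> {s. Re s > 1/2} \<and> uniform_limit (cball x d) Fn F sequentially"
      using d ul by blast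
  qed
  \<comment> \<open>Where the series converges absolutely it may be integrated term by term; a
    vertical shift multiplies the n-th term by an exponential whose integral against
    \<open>K\<close> is \<open>\<kappa> n\<close>.\<close>
  have F_eq: "F s = (\<Sum>n=1..N. b n * \<kappa> n * of_nat n powr (- s))" if s: "Re s > 1" for s
  proof -
    note sm = dser_props(1)[where f = b, OF b s]
    define t where "t = (\<lambda>n y. dterm b s n * (K y * exp (- \<i> * of_real (h * ln (real (Suc n)) * y))))"
    have Kint: "integrable lborel (\<lambda>y. cmod (K y))"
    proof (rule Bochner_Integration.integrable_bound[OF integrable_mult_right[OF wint, of B]])
      show "(\<lambda>y. cmod (K y)) \<in> borel_measurable lborel"
        using borel_measurable_continuous_onI[OF K(1)] by simp
      have "(1 + \<bar>y\<bar>) powr (-2) \<le> w y" for y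
        unfolding w_def by (intro powr_mono) auto
      then have "cmod (K y) \<le> B * w y" for y
        using K(2)[of y] B0 by (meson mult_left_mono order.trans)
      then show "AE y in lborel. norm (cmod (K y)) \<le> norm (B * w y)"
        by (intro AE_I2) (simp add: order.trans[OF _ abs_ge_self])
    qed
    have Km: "K \<in> borel_measurable borel" by (rule borel_measurable_continuous_onI[OF K(1)])
    have dt: "dterm b (s + \<i> * of_real (h * y)) n * K y = t n y" for n y
      unfolding t_def dterm_exp by (simp add: exp_add ring_distribs mult_ac exp_diff exp_minus divide_inverse)
    have tn: "cmod (t n y) = cmod (dterm b s n) * cmod (K y)" for n y
      by (simp add: t_def norm_mult)
    have tint: "integrable lborel (t n)" for n
    proof (rule Bochner_Integration.integrable_bound[OF integrable_mult_right[OF Kint, of "cmod (dterm b s n)"]])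
      show "t n \<in> borel_measurable lborel" unfolding t_def using Km by measurable
    qed (simp add: tn)
    have "F s = (LINT y|lborel. (\<Sum>n. t n y))"
    proof -
      have "g s y = (\<Sum>n. t n y)" for y
      proof -
        have smy: "summable (\<lambda>n. dterm b (s + \<i> * of_real (h * y)) n)"
          using summable_norm_cancel[OF dser_props(1)[where f = b and s = "s + \<i> * of_real (h * y)", OF b]] s by simp
        have "g s y = (\<Sum>n. dterm b (s + \<i> * of_real (h * y)) n) * K y"
          unfolding g_def using f_eq[of "s + \<i> * of_real (h * y)"] s by (simp add: dser_def)
        also have "\<dots> = (\<Sum>n. dterm b (s + \<i> * of_real (h * y)) n * K y)" by (rule suminf_mult2[OF smy])
        also have "\<dots> = (\<Sum>n. t n y)" by (simp only: dt)
        finally show ?thesis .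
      qed
      then have "g s = (\<lambda>y. \<Sum>n. t n y)" by (rule ext)
      then show ?thesis by (simp only: F_def)
    qed
    also have "\<dots> = (\<Sum>n. LINT y|lborel. t n y)"
    proof (rule integral_suminf)
      show "AE y in lborel. summable (\<lambda>n. norm (t n y))"
        unfolding tn using sm by (intro AE_I2 summable_mult2)
      show "summable (\<lambda>n. LINT y|lborel. norm (t n y))"
        unfolding tn using sm by (simp add: summable_mult2)
    qed (rule tint)
    also have "(\<lambda>n. LINT y|lborel. t n y) = (\<lambda>n. dterm b s n * \<kappa> (Suc n))"
      unfolding t_def by (simp add: \<kappa> del: of_nat_Suc)
    also have "(\<Sum>n. dterm b s n * \<kappa> (Suc n)) = (\<Sum>n<N. dterm b s n * \<kappa> (Suc n))"
      by (rule suminf_finite) (auto simp: \<kappa>0)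
    also have "\<dots> = (\<Sum>n=1..N. b n * \<kappa> n * of_nat n powr (- s))"
      unfolding dterm_def by (rule sum.reindex_bij_witness[of _ "\<lambda>n. n - 1" Suc]) auto
    finally show ?thesis .
  qed
  have "F s = (\<Sum>n=1..N. b n * \<kappa> n * of_nat n powr (- s))"
  proof (rule analytic_continuation_open[of "{s. Re s > 1}" "{s. Re s > 1/2}" F])
    show "{s. Re s > 1} \<noteq> {}" by (auto intro!: exI[of _ 2])
    show "connected {s. Re s > 1/2}" by (intro convex_connected convex_halfspace_Re_gt)
    show "(\<lambda>s. \<Sum>n=1..N. b n * \<kappa> n * of_nat n powr (- s)) holomorphic_on {s. Re s > 1/2}"
      by (intro holomorphic_intros) auto
    show "open {s. Re s > 1}" "open {s. Re s > 1/2}" by (rule open_halfspace_Re_gt)+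
    show "F holomorphic_on {s. Re s > 1/2}" by (rule holF)
  qed (use F_eq s in auto)
  then show "(LINT y|lborel. f (s + \<i> * of_real (h * y)) * K y) = (\<Sum>n=1..N. b n * \<kappa> n * of_nat n powr (- s))"
    by (simp add: F_def g_def)
qed

section \<open>An upper bound for L-functions on the critical line\<close>

lemma ln_le_sqrt: "x \<ge> 1 \<Longrightarrow> ln x \<le> 2 * x powr (1/2)" for x :: real
  using ln_le_powr[of x "1/2"] by simp

text \<open>Brings the conductor into the shape demanded by the growth condition of
  \<open>vertical_smoothing\<close>.\<close>

lemma cond_log_growth:
  assumes "q > 0" shows "cond_log q t \<le> 4 * real q * (1 + \<bar>t\<bar>) powr (1/2)"
proof -
  have q1: "real q \<ge> 1" using assms by simp
  have "1 * 1 \<le> real q * (\<bar>t\<bar> + 3)" using q1 by (intro mult_mono) auto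
  then have "cond_log q t \<le> 2 * (real q * (\<bar>t\<bar> + 3)) powr (1/2)"
    unfolding cond_log_def by (intro ln_le_sqrt) simp
  also have "(real q * (\<bar>t\<bar> + 3)) powr (1/2) \<le> ((2 * real q)\<^sup>2 * (1 + \<bar>t\<bar>)) powr (1/2)"
  proof (intro powr_mono2)
    have "real q * (\<bar>t\<bar> + 3) \<le> real q * (4 * (1 + \<bar>t\<bar>))" by (intro mult_left_mono) auto
    also have "\<dots> \<le> real q * (real q * (4 * (1 + \<bar>t\<bar>)))" using mult_right_mono[OF q1, of "real q * (4 * (1 + \<bar>t\<bar>))"] by simp
    finally show "real q * (\<bar>t\<bar> + 3) \<le> (2 * real q)\<^sup>2 * (1 + \<bar>t\<bar>)" by (simp add: power2_eq_square mult_ac)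
  qed auto
  also have "((2 * real q)\<^sup>2 * (1 + \<bar>t\<bar>)) powr (1/2) = ((2 * real q)\<^sup>2) powr (1/2) * (1 + \<bar>t\<bar>) powr (1/2)"
    by (rule powr_mult)
  also have "((2 * real q)\<^sup>2) powr (1/2) = 2 * real q" by (simp add: powr_half_sqrt real_sqrt_mult)
  finally show ?thesis by simp
qed

text \<open>\<open>V\<close> is the logarithm of L on Re s > 1/2 that continues \<open>plog\<close>;
  it exists because L has no zeros there. The constant from \<open>dser_eq_exp_plog\<close> survives
  as the factor \<open>2 * exp 2\<close>. The growth of \<open>V\<close> comes from integrating L'/L
  along the horizontal segment to the line Re s = 2.\<close>

lemma dirichlet_L_log:
  assumes grh: GRH and c: "dirichlet_char q chi" and np: "\<not> principal_char q chi"
  obtains V where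
    "\<And>s. Re s > 1/2 \<Longrightarrow> (V has_field_derivative deriv (dirichlet_L chi) s / dirichlet_L chi s) (at s)"
    "\<And>s. Re s > 1 \<Longrightarrow> V s = plog chi s"
    "\<And>s. Re s > 1/2 \<Longrightarrow> cmod (dirichlet_L chi s) \<le> 2 * exp 2 * exp (Re (V s))"
    "\<And>r. r > 1/2 \<Longrightarrow> \<exists>A. \<forall>s. Re s \<ge> r \<longrightarrow> cmod (V s) \<le> A * (1 + \<bar>Im s\<bar>) powr (1/2)"
proof -
  define H where "H = {s. Re s > 1/2}"
  define L where "L = dirichlet_L chi"
  have oH: "open H" and cH: "convex H" unfolding H_def by (rule open_halfspace_Re_gt convex_halfspace_Re_gt)+
  have q: "q > 0" using dirichlet_char_simps(1)[OF c] .
  have holL: "L holomorphic_on H"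
    unfolding L_def using dirichlet_L_props(1)[OF c np] by (rule holomorphic_on_subset) (auto simp: H_def)
  have nz: "L s \<noteq> 0" if "s \<in> H" for s using GRH_nonzero[OF grh c np] that by (auto simp: L_def H_def)
  have hold: "(\<lambda>s. deriv L s / L s) holomorphic_on H"
    using holL nz oH by (intro holomorphic_intros holomorphic_deriv) auto
  obtain g where g0: "\<And>s. s \<in> H \<Longrightarrow> (g has_field_derivative deriv L s / L s) (at s within H)"
    using holomorphic_convex_primitive'[OF cH oH hold] by blast
  have g: "(g has_field_derivative deriv L s / L s) (at s)" if "s \<in> H" for s
    using g0[OF that] by (simp only: at_within_open[OF that oH])
  obtain c0 where c0: "cmod c0 \<le> 2 * exp 2" "\<And>s. Re s > 1 \<Longrightarrow> dser chi s = c0 * exp (plog chi s)"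
    "\<And>s. Re s > 1 \<Longrightarrow> (plog chi has_field_derivative - dser (\<lambda>n. mangoldt n * chi n) s) (at s)"
    "\<And>s. Re s > 1 \<Longrightarrow> (dser chi has_field_derivative - dser (\<lambda>n. mangoldt n * chi n) s * dser chi s) (at s)"
    by (rule dser_eq_exp_plog[of chi, OF dirichlet_char_simps(2)[OF c] dirichlet_char_norm[OF c] dirichlet_char_1[OF c]]) (rule that; assumption)
  have logd: "deriv L s / L s = - dser (\<lambda>n. mangoldt n * chi n) s" if s: "Re s > 1" for s
  proof -
    have "(L has_field_derivative - dser (\<lambda>n. mangoldt n * chi n) s * L s) (at s)"
    proof (rule has_field_derivative_transform_within_open[OF _ open_halfspace_Re_gt[of 1]])
      show "(dser chi has_field_derivative - dser (\<lambda>n. mangoldt n * chi n) s * L s) (at s)"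
        using c0(4)[OF s] dirichlet_L_props(3)[OF c np s] by (simp add: L_def)
    qed (use s dirichlet_L_props(3)[OF c np] in \<open>auto simp: L_def\<close>)
    then show ?thesis using nz[of s] s by (simp add: DERIV_imp_deriv H_def)
  qed
  have "((\<lambda>s. plog chi s - g s) has_field_derivative 0) (at s within {s. Re s > 1})" if s: "s \<in> {s. Re s > 1}" for s
  proof -
    have s': "Re s > 1" "s \<in> H" using s by (auto simp: H_def)
    from DERIV_diff[OF c0(3)[OF s'(1)] g[OF s'(2)]] logd[OF s'(1)] show ?thesis
      by (simp add: has_field_derivative_at_within)
  qed
  then obtain k where k: "\<And>s. Re s > 1 \<Longrightarrow> plog chi s - g s = k"
    using has_field_derivative_zero_constant[OF convex_halfspace_Re_gt[of 1]] by fastforce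
  define V where "V = (\<lambda>s. g s + k)"
  have dV: "(V has_field_derivative deriv L s / L s) (at s)" if "s \<in> H" for s
    unfolding V_def using DERIV_add[OF g[OF that] DERIV_const] by simp
  have Vp: "V s = plog chi s" if "Re s > 1" for s unfolding V_def k[OF that, symmetric] by simp
  have "((\<lambda>s. L s * exp (- V s)) has_field_derivative 0) (at s within H)" if s: "s \<in> H" for s
  proof -
    have "(L has_field_derivative deriv L s) (at s)" using holL oH s by (rule holomorphic_derivI)
    from DERIV_mult[OF this DERIV_chain2[OF DERIV_exp DERIV_minus[OF dV[OF s]]]] nz[OF s]
    have "((\<lambda>s. L s * exp (- V s)) has_field_derivative 0) (at s)" by (simp add: field_simps)
    then show ?thesis by (rule has_field_derivative_at_within)
  qed
  from has_field_derivative_zero_constant[OF cH this]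
  obtain k' where k': "\<And>s. s \<in> H \<Longrightarrow> L s * exp (- V s) = k'" by blast
  \<comment> \<open>Comparison at the single point 2, in the region of absolute convergence.\<close>
  have "k' = c0"
    using k'[of 2] Vp[of 2] c0(2)[of 2] dirichlet_L_props(3)[OF c np, of 2] by (simp add: H_def L_def mult.assoc exp_minus_inverse)
  then have Lb: "cmod (L s) \<le> 2 * exp 2 * exp (Re (V s))" if "s \<in> H" for s
  proof -
    have "L s * exp (- V s) * exp (V s) = c0 * exp (V s)" using k'[OF that] \<open>k' = c0\<close> by simp
    then have "L s = c0 * exp (V s)" by (simp add: mult.assoc mult_exp_exp)
    then show ?thesis using c0(1) by (simp add: norm_mult)
  qed
  obtain C where C: "C > 0" "\<And>s. Re s > 1/2 \<Longrightarrow> cmod (deriv L s / L s) \<le> C * (1 + 1 / (Re s - 1/2)) * cond_log q (Im s)"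
    by (rule dirichlet_L_log_deriv_bounds, rule that) (use grh c np in \<open>auto simp: L_def\<close>)
  have fp: "cmod (of_real (mangoldt n / ln (real n)) * chi n) \<le> 1" for n
    unfolding norm_mult norm_of_real using dirichlet_char_norm[OF c, of n] mangoldt_div_ln[of n]
    by (intro mult_le_one) auto
  have V2: "cmod (V s) \<le> 2" if "Re s \<ge> 2" for s
  proof -
    have "cmod (plog chi s) \<le> 1 + 1 / (Re s - 1)"
      unfolding plog_def using that by (intro dser_bounds(2) fp) auto
    also have "\<dots> \<le> 2" using that by (simp add: divide_le_eq)
    finally show ?thesis using Vp[of s] that by simp
  qed
  have growth: "\<exists>A. \<forall>s. Re s \<ge> r \<longrightarrow> cmod (V s) \<le> A * (1 + \<bar>Im s\<bar>) powr (1/2)" if r: "r > 1/2" for r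
  proof -
    define M where "M = C * (1 + 1 / (r - 1/2))"
    have M: "M > 0" unfolding M_def using C r by (intro mult_pos_pos add_pos_pos) auto
    have "cmod (V s) \<le> (2 + 2 * M * (4 * real q)) * (1 + \<bar>Im s\<bar>) powr (1/2)" if s: "Re s \<ge> r" for s
    proof -
      define p where "p = (1 + \<bar>Im s\<bar>) powr (1/2)"
      have p1: "p \<ge> 1" unfolding p_def by (rule ge_one_powr_ge_zero) auto
      show ?thesis
      proof (cases "Re s \<ge> 2")
        case True
        have "2 * 1 \<le> (2 + 2 * M * (4 * real q)) * p" using p1 M by (intro mult_mono) auto
        then show ?thesis using V2[OF True] by (simp add: p_def)
      next
        case False
        define s2 where "s2 = Complex 2 (Im s)"
        have seg: "Re z \<ge> r \<and> Im z = Im s" if z: "z \<in> closed_segment s s2" for z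
        proof -
          from z obtain u where u: "0 \<le> u" "u \<le> 1" "z = (1 - u) *\<^sub>R s + u *\<^sub>R s2" by (auto simp: closed_segment_def)
          have "Re z = Re s + u * (2 - Re s)" unfolding u(3) by (simp add: s2_def algebra_simps)
          moreover have "u * (2 - Re s) \<ge> 0" using u False by simp
          moreover have "Im z = Im s" unfolding u(3) by (simp add: s2_def algebra_simps)
          ultimately show ?thesis using s by simp
        qed
        have "cmod (V s - V s2) \<le> M * cond_log q (Im s) * cmod (s - s2)"
        proof (rule field_differentiable_bound[of "closed_segment s s2" V "\<lambda>s. deriv L s / L s"])
          fix z assume z: "z \<in> closed_segment s s2"
          have zH: "z \<in> H" using seg[OF z] r by (simp add: H_def)
          show "(V has_field_derivative deriv L z / L z) (at z within closed_segment s s2)"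
            using dV[OF zH] by (rule has_field_derivative_at_within)
          have "cmod (deriv L z / L z) \<le> C * (1 + 1 / (Re z - 1/2)) * cond_log q (Im z)"
            using zH by (intro C) (simp add: H_def)
          also have "\<dots> \<le> M * cond_log q (Im s)"
            unfolding M_def using seg[OF z] r C cond_log_ge_1[OF q, of "Im s"]
            by (intro mult_mono add_mono frac_le) auto
          finally show "cmod (deriv L z / L z) \<le> M * cond_log q (Im s)" .
        qed auto
        moreover have s22: "cmod (s - s2) \<le> 2"
        proof -
          have "s - s2 = of_real (Re s - 2)" by (simp add: s2_def complex_eq_iff)
          then have "cmod (s - s2) = \<bar>Re s - 2\<bar>" by (simp only: norm_of_real)
          then show ?thesis using False s r by simp
        qed
        moreover have "M * cond_log q (Im s) * cmod (s - s2) \<le> M * (4 * real q * p) * 2"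
          using s22 M p1 cond_log_growth[OF q, of "Im s"] unfolding p_def[symmetric]
          by (intro mult_mono mult_left_mono) auto
        ultimately have "cmod (V s - V s2) \<le> M * (4 * real q * p) * 2" by linarith
        moreover have "cmod (V s2) \<le> 2 * p" using V2[of s2] p1 by (simp add: s2_def)
        ultimately have "cmod (V s) \<le> 2 * p + M * (4 * real q * p) * 2"
          using norm_triangle_sub[of "V s" "V s2"] by linarith
        then show ?thesis unfolding p_def[symmetric] by (simp add: algebra_simps)
      qed
    qed
    then show ?thesis by blast
  qed
  show thesis
    by (rule that[of V]) (use dV Vp Lb growth in \<open>auto simp: H_def L_def\<close>)
qed

text \<open>The kernel is even, so the linear term integrates to 0 whatever its coefficient. In the
  application \<open>b\<close> contains \<open>Im (G (Complex d t))\<close>, which need not be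
  small.\<close>

lemma jker_average:
  fixes F :: "real \<Rightarrow> real" and m2 m3 :: real
  assumes le: "\<And>y. P \<le> F y + a + b * y + g * y\<^sup>2 + e * \<bar>y\<bar> ^ 3"
    and int: "integrable lborel (\<lambda>y. F y * jker y)"
    and m: "m2 = (LINT y|lborel. y\<^sup>2 * jker y)" "m3 = (LINT y|lborel. \<bar>y\<bar> ^ 3 * jker y)"
  shows "P \<le> (LINT y|lborel. F y * jker y) + a + g * m2 + e * m3"
proof -
  have i0: "integrable lborel jker" using jker_integrable[of 0] by simp
  have i1: "integrable lborel (\<lambda>y. y * jker y)"
    by (rule Bochner_Integration.integrable_bound[OF jker_integrable[of 1]]) (auto simp: abs_mult jker_nonneg)
  have i2: "integrable lborel (\<lambda>y. y\<^sup>2 * jker y)" using jker_integrable[of 2] by simp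
  have i3: "integrable lborel (\<lambda>y. \<bar>y\<bar> ^ 3 * jker y)" using jker_integrable[of 3] by simp
  have z: "(LINT y|lborel. y * jker y) = 0" by (rule lborel_integral_odd) (simp add: jker_even)
  have "P = (LINT y|lborel. P * jker y)" by (simp add: jker_integral)
  also have "\<dots> \<le> (LINT y|lborel. F y * jker y + a * jker y + b * (y * jker y) + g * (y\<^sup>2 * jker y) + e * (\<bar>y\<bar> ^ 3 * jker y))"
  proof (rule integral_mono)
    show "integrable lborel (\<lambda>y. P * jker y)" using i0 by (rule integrable_mult_right)
    show "integrable lborel (\<lambda>y. F y * jker y + a * jker y + b * (y * jker y) + g * (y\<^sup>2 * jker y) + e * (\<bar>y\<bar> ^ 3 * jker y))"
      by (intro Bochner_Integration.integrable_add integrable_mult_right int i0 i1 i2 i3)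
    show "P * jker y \<le> F y * jker y + a * jker y + b * (y * jker y) + g * (y\<^sup>2 * jker y) + e * (\<bar>y\<bar> ^ 3 * jker y)" for y
      using mult_right_mono[OF le[of y] jker_nonneg[of y]] by (simp add: algebra_simps)
  qed
  also have "\<dots> = (LINT y|lborel. F y * jker y) + a * 1 + b * 0 + g * m2 + e * m3"
    by (simp only: Bochner_Integration.integral_add Bochner_Integration.integrable_add integrable_mult_right int i0 i1 i2 i3
       integral_mult_right_zero m jker_integral z)
  finally show ?thesis by simp
qed

text \<open>The function is an antiderivative of \<open>Ln (z + 5/2)\<close>, whose own derivative
  is at most 1 for Re z > 0. The first order Taylor expansion is split along the real and imaginary
  parts of the step.\<close>

lemma Ln_shift_Taylor:
  assumes "Re w > 0" "Re w' > 0"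
  shows "Re ((w' + 5/2) * Ln (w' + 5/2) - (w' + 5/2)) \<le> Re ((w + 5/2) * Ln (w + 5/2) - (w + 5/2))
      + Re (w' - w) * ln (cmod (w + 5/2)) - Im (w' - w) * Im (Ln (w + 5/2)) + (cmod (w' - w))\<^sup>2"
proof -
  define f where "f = (\<lambda>i::nat. if i = 0 then (\<lambda>z. (z + 5/2) * Ln (z + 5/2) - (z + 5/2))
       else if i = 1 then (\<lambda>z. Ln (z + 5/2)) else (\<lambda>z. 1 / (z + 5/2)))"
  define S where "S = {z. Re z > 0}"
  have nn: "z + 5/2 \<notin> \<real>\<^sub>\<le>\<^sub>0" "z + 5/2 \<noteq> 0" if "z \<in> S" for z
    using that by (auto simp: S_def complex_nonpos_Reals_iff complex_eq_iff)
  have "cmod (f 0 w' - (\<Sum>i\<le>1. f i w * (w' - w) ^ i / fact i)) \<le> 1 * cmod (w' - w) ^ Suc 1 / fact 1"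
  proof (rule complex_Taylor[where S = S])
    show "convex S" unfolding S_def by (rule convex_halfspace_Re_gt)
    show "(f i has_field_derivative f (Suc i) x) (at x within S)" if "x \<in> S" "i \<le> 1" for i x
    proof (cases "i = 0")
      case True
      have "((\<lambda>z. (z + 5/2) * Ln (z + 5/2) - (z + 5/2)) has_field_derivative Ln (x + 5/2)) (at x within S)"
        using nn[OF that(1)] by (auto intro!: derivative_eq_intros simp: inverse_eq_divide)
      then show ?thesis using True by (simp add: f_def)
    next
      case False
      then have "i = 1" using that by simp
      moreover have "((\<lambda>z. Ln (z + 5/2)) has_field_derivative 1 / (x + 5/2)) (at x within S)"
        using nn[OF that(1)] by (auto intro!: derivative_eq_intros simp: inverse_eq_divide)
      ultimately show ?thesis by (simp add: f_def)
    qed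
    show "cmod (f (Suc 1) x) \<le> 1" if "x \<in> S" for x
    proof -
      have "cmod (x + 5/2) \<ge> 1" using that abs_Re_le_cmod[of "x + 5/2"] by (simp add: S_def)
      then show ?thesis by (simp add: f_def norm_divide divide_le_eq_1)
    qed
  qed (use assms in \<open>auto simp: S_def\<close>)
  then have "cmod (f 0 w' - (f 0 w + f 1 w * (w' - w))) \<le> (cmod (w' - w))\<^sup>2" by (simp add: power2_eq_square)
  then have "Re (f 0 w') \<le> Re (f 0 w) + Re (f 1 w * (w' - w)) + (cmod (w' - w))\<^sup>2"
    using abs_Re_le_cmod[of "f 0 w' - (f 0 w + f 1 w * (w' - w))"] by simp
  moreover have "Re (f 1 w * (w' - w)) = Re (w' - w) * ln (cmod (w + 5/2)) - Im (w' - w) * Im (Ln (w + 5/2))"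
    using nn(2)[of w] assms by (simp add: f_def S_def algebra_simps)
  moreover have "f 0 = (\<lambda>z. (z + 5/2) * Ln (z + 5/2) - (z + 5/2))" by (simp add: f_def)
  ultimately show ?thesis by (simp only:)
qed

text \<open>Adding a multiple of the logarithm of the conductor to L'/L gives a function
  \<open>G\<close> with positive real part to the right of the critical line.
  \<open>halfplane_potential_le\<close> bounds its potential \<open>V1\<close> near the line by
  values at distance \<open>\<delta> / ln x\<close>, and averaging with \<open>jker\<close> at scale
  \<open>6 / ln x\<close> turns the latter into a Dirichlet polynomial of length \<open>x\<close>.
  What the added term contributes is of order \<open>cond_log q t / ln x\<close>.\<close>

lemma dirichlet_L_upper_bound:
  obtains C \<delta> :: real where "C > 0" "\<delta> > 0"
    "\<And>q chi t x. \<lbrakk>GRH; dirichlet_char q chi; \<not> principal_char q chi; ln x \<ge> 1; x > 0\<rbrakk> \<Longrightarrow>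
      cmod (dirichlet_L chi (Complex (1/2) t)) \<le> exp (Re (\<Sum>n=1..nat \<lfloor>x\<rfloor>.
         of_real (mangoldt n / ln (real n)) * chi n * of_real (jft (6 * ln (real n) / ln x))
           * of_nat n powr (- Complex (1/2 + \<delta> / ln x) t)) + C + C * cond_log q t / ln x)"
proof -
  obtain C0 where C0: "C0 > 0"
    "\<And>q chi s. \<lbrakk>GRH; dirichlet_char q chi; \<not> principal_char q chi; Re s > 1/2\<rbrakk> \<Longrightarrow>
        Re (deriv (dirichlet_L chi) s / dirichlet_L chi s) \<ge> - C0 * cond_log q (Im s)"
    by (rule dirichlet_L_log_deriv_bounds, rule that)
  \<comment> \<open>\<open>G\<close> contains \<open>ln (cmod (z + 5/2))\<close>, and
    \<open>\<bar>Im z\<bar> + 3 \<le> (cmod (z + 5/2))^2\<close> costs a factor 2; the summand 1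
    makes the real part strictly positive.\<close>
  define C1 where "C1 = 2 * C0 + 1"
  have C1: "C1 > 0" using C0 by (simp add: C1_def)
  define m2 where "m2 = (LINT y|lborel. y\<^sup>2 * jker y)"
  define m3 where "m3 = (LINT y|lborel. \<bar>y\<bar> ^ 3 * jker y)"
  have m: "m2 \<ge> 0" "m3 \<ge> 0" unfolding m2_def m3_def by (intro integral_nonneg_AE; simp add: jker_nonneg)+
  \<comment> \<open>With \<open>h = 6 / T\<close> and \<open>d = \<delta> / T\<close> the averaged
    errors are \<open>72 * m2 / \<delta>\<close> and \<open>216 * m3 / \<delta>^2\<close>, divided
    by \<open>T\<close> and multiplied by \<open>Re G\<close>. This \<open>\<delta>\<close> makes
    their sum at most \<open>d / 6\<close> times \<open>Re G\<close>.\<close>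
  define \<delta> where "\<delta> = 1 + 6 * (72 * m2 + 216 * m3)"
  have d1: "\<delta> \<ge> 1" using m by (simp add: \<delta>_def)
  define C where "C = 2 + ln 2 + C1 * (\<delta> * (1 + ln (1 + \<delta>)) + \<delta>\<^sup>2 + 36 * m2)"
  have "1 + ln (1 + \<delta>) > 0" using d1 by (simp add: add_pos_nonneg)
  then have Cpos: "C > 0" unfolding C_def using C1 d1 m by (intro add_pos_nonneg) (auto intro!: mult_nonneg_nonneg add_nonneg_nonneg)
  have main: "cmod (dirichlet_L chi (Complex (1/2) t)) \<le> exp (Re (\<Sum>n=1..nat \<lfloor>x\<rfloor>.
         of_real (mangoldt n / ln (real n)) * chi n * of_real (jft (6 * ln (real n) / ln x))
           * of_nat n powr (- Complex (1/2 + \<delta> / ln x) t)) + C + C * cond_log q t / ln x)"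
    if grh: GRH and c: "dirichlet_char q chi" and np: "\<not> principal_char q chi" and x: "ln x \<ge> 1" "x > 0" for q chi t x
  proof -
    define L where "L = dirichlet_L chi"
    define T where "T = ln x"
    have T: "T \<ge> 1" using x by (simp add: T_def)
    \<comment> \<open>The transform of \<open>jker\<close> vanishes from 6 on, so this width cuts
      the sum off at \<open>n \<le> x\<close>.\<close>
    define h where "h = 6 / T"
    define d where "d = \<delta> / T"
    have h: "h > 0" and d: "d > 0" "d \<le> \<delta>" using T d1 by (auto simp: h_def d_def divide_le_eq mult_le_cancel_left1)
    have q: "q > 0" using dirichlet_char_simps(1)[OF c] .
    have q1: "ln (real q) \<ge> 0" using q by simp
    obtain V where
      dV0: "\<And>s. Re s > 1/2 \<Longrightarrow> (V has_field_derivative deriv (dirichlet_L chi) s / dirichlet_L chi s) (at s)" and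
      Vp: "\<And>s. Re s > 1 \<Longrightarrow> V s = plog chi s" and
      LV0: "\<And>s. Re s > 1/2 \<Longrightarrow> cmod (dirichlet_L chi s) \<le> 2 * exp 2 * exp (Re (V s))" and
      Vg: "\<And>r. r > 1/2 \<Longrightarrow> \<exists>A. \<forall>s. Re s \<ge> r \<longrightarrow> cmod (V s) \<le> A * (1 + \<bar>Im s\<bar>) powr (1/2)"
      by (rule dirichlet_L_log[OF grh c np]) (rule that; assumption)
    note dV = dV0[folded L_def] and LV = LV0[folded L_def]
    have holV: "V holomorphic_on {s. Re s > 1/2}"
      unfolding holomorphic_on_open[OF open_halfspace_Re_gt] using dV by blast
    define S where "S = (\<Sum>n=1..nat \<lfloor>x\<rfloor>.
         of_real (mangoldt n / ln (real n)) * chi n * of_real (jft (6 * ln (real n) / ln x))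
           * of_nat n powr (- Complex (1/2 + \<delta> / ln x) t))"
    define s where "s = Complex (1/2 + d) t"
    have fp: "cmod (of_real (mangoldt n / ln (real n)) * chi n) \<le> 1 * (1 + ln (real n))" for n
    proof -
      have "cmod (of_real (mangoldt n / ln (real n)) * chi n) \<le> 1"
        unfolding norm_mult norm_of_real using dirichlet_char_norm[OF c, of n] mangoldt_div_ln[of n]
        by (intro mult_le_one) auto
      then show ?thesis by (cases "n = 0") (auto intro: order.trans)
    qed
    have sm: "integrable lborel (\<lambda>y. V (s + \<i> * of_real (h * y)) * of_real (jker y))"
       "(LINT y|lborel. V (s + \<i> * of_real (h * y)) * of_real (jker y)) = S"
    proof -
      have Kc: "continuous_on UNIV (\<lambda>y. complex_of_real (jker y))"
        by (intro continuous_intros jker_continuous)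
      have Kb: "cmod (of_real (jker y)) \<le> 32 / sinc6_mass * (1 + \<bar>y\<bar>) powr - 2" for y
        unfolding norm_of_real using jker_bound[of y] jker_nonneg[of y] by simp
      have kap: "of_real (jft (h * ln (real n))) = (LINT y|lborel. of_real (jker y) * exp (- \<i> * of_real (h * ln (real n) * y)))" for n
        by (rule jft_complex[symmetric])
      have kap0: "of_real (jft (h * ln (real n))) = (0::complex)" if n: "nat \<lfloor>x\<rfloor> < n" for n
      proof -
        have "x < real n" using n x by linarith
        then have "T \<le> ln (real n)" unfolding T_def using x by (subst ln_le_cancel_iff) auto
        then have "h * ln (real n) \<ge> h * T" using h by (intro mult_left_mono) auto
        then have "h * ln (real n) \<ge> 6" using T by (simp add: h_def)
        then show ?thesis by (simp add: jft_eq_0)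
      qed
      have Vs: "V s = dser (\<lambda>n. of_real (mangoldt n / ln (real n)) * chi n) s" if "Re s > 1" for s
        unfolding Vp[OF that] by (simp only: plog_def)
      have sRe: "Re s > 1/2" using d by (simp add: s_def)
      note vs = vertical_smoothing[OF holV Vg Vs fp Kc Kb h kap kap0 sRe]
      show "integrable lborel (\<lambda>y. V (s + \<i> * of_real (h * y)) * of_real (jker y))" by (rule vs(1))
      have e: "jft (h * ln (real n)) = jft (6 * ln (real n) / ln x)" for n by (simp add: h_def T_def)
      show "(LINT y|lborel. V (s + \<i> * of_real (h * y)) * of_real (jker y)) = S"
        using vs(2) unfolding e S_def s_def d_def T_def .
    qed
    \<comment> \<open>The shift by 5/2 keeps the logarithm off its branch cut, and
      \<open>(5/2)^2 \<ge> 5/2 + 3\<close> is what positivity requires for small imaginary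
      parts.\<close>
    define G where "G = (\<lambda>z. deriv L (z + 1/2) / L (z + 1/2) + of_real C1 * (of_real (ln (real q)) + Ln (z + 5/2)))"
    define V1 where "V1 = (\<lambda>z. V (z + 1/2) + of_real C1 * (of_real (ln (real q)) * z + ((z + 5/2) * Ln (z + 5/2) - (z + 5/2))))"
    have dV1: "(V1 has_field_derivative G z) (at z)" if z: "Re z > 0" for z
    proof -
      have "(V has_field_derivative deriv L (z + 1/2) / L (z + 1/2)) (at (z + 1/2))"
        using z by (intro dV) simp
      then have "((\<lambda>z. V (z + 1/2)) has_field_derivative deriv L (z + 1/2) / L (z + 1/2)) (at z)"
        by (simp add: DERIV_shift)
      moreover have "z + 5/2 \<notin> \<real>\<^sub>\<le>\<^sub>0" "z + 5/2 \<noteq> 0" using z by (auto simp: complex_nonpos_Reals_iff complex_eq_iff)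
      then have "((\<lambda>z. of_real C1 * (of_real (ln (real q)) * z + ((z + 5/2) * Ln (z + 5/2) - (z + 5/2)))) has_field_derivative
          of_real C1 * (of_real (ln (real q)) + Ln (z + 5/2))) (at z)"
        by (auto intro!: derivative_eq_intros)
      ultimately show ?thesis unfolding V1_def G_def by (rule DERIV_add)
    qed
    have holG: "G holomorphic_on {z. Re z > 0}"
    proof -
      have "V1 holomorphic_on {z. Re z > 0}"
        unfolding holomorphic_on_open[OF open_halfspace_Re_gt] using dV1 by blast
      then have "deriv V1 holomorphic_on {z. Re z > 0}" by (intro holomorphic_deriv open_halfspace_Re_gt)
      then show ?thesis by (rule holomorphic_transform) (use dV1 in \<open>auto intro!: DERIV_imp_deriv\<close>)
    qed
    have posG: "Re (G z) > 0" if z: "Re z > 0" for z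
    proof -
      define l where "l = ln (cmod (z + 5/2))"
      define u where "u = \<bar>Im z\<bar>"
      have c1: "cmod (z + 5/2) \<ge> 5/2" using abs_Re_le_cmod[of "z + 5/2"] z by simp
      have c2: "cmod (z + 5/2) \<ge> u" using abs_Im_le_cmod[of "z + 5/2"] by (simp add: u_def)
      have l0: "l > 0" unfolding l_def using c1 by (subst ln_gt_zero_iff) auto
      have "u + 3 \<le> (cmod (z + 5/2))\<^sup>2"
      proof (cases "u \<le> 5/2")
        case True
        have "(5/2)\<^sup>2 \<le> (cmod (z + 5/2))\<^sup>2" using c1 by (intro power_mono) auto
        then show ?thesis using True by (simp add: power2_eq_square)
      next
        case False
        have "5/2 * u \<le> u * u" using False by (intro mult_right_mono) auto
        then have "u + 3 \<le> u * u" using False by linarith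
        also have "\<dots> \<le> (cmod (z + 5/2))\<^sup>2" using c2 power_mono[of u "cmod (z + 5/2)" 2] by (simp add: u_def power2_eq_square)
        finally show ?thesis .
      qed
      then have "ln (u + 3) \<le> ln ((cmod (z + 5/2))\<^sup>2)"
        using c1 by (subst ln_le_cancel_iff) (auto simp: u_def)
      also have "\<dots> = 2 * l" using c1 by (simp add: l_def ln_realpow)
      finally have lu: "ln (u + 3) \<le> 2 * l" .
      have "cond_log q (Im z) = ln (real q) + ln (u + 3)" using q by (simp add: cond_log_def u_def ln_mult)
      then have "Re (deriv L (z + 1/2) / L (z + 1/2)) \<ge> - C0 * (ln (real q) + ln (u + 3))"
        using C0(2)[OF grh c np, of "z + 1/2"] z by (simp add: L_def)
      moreover have "C0 * (ln (real q) + ln (u + 3)) \<le> C0 * (ln (real q) + 2 * l)"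
        using lu C0 by (intro mult_left_mono) auto
      moreover have "C0 * ln (real q) \<ge> 0" using C0 q1 by simp
      moreover have "z + 5/2 \<noteq> 0" using z by (auto simp: complex_eq_iff)
      then have "Re (of_real C1 * (of_real (ln (real q)) + Ln (z + 5/2))) = C1 * (ln (real q) + l)"
        by (simp add: l_def)
      ultimately show ?thesis unfolding G_def C1_def using l0 q1 by (simp add: algebra_simps)
    qed
    have bound: "Re (V (Complex (1/2 + x0) t)) \<le> Re S + C1 * (\<delta> * (1 + ln (1 + \<delta>)) + \<delta>\<^sup>2 + 36 * m2) * cond_log q t / T"
      if x0: "0 < x0" "x0 \<le> 2 * d / 3" for x0
    proof -
      define w where "w = Complex x0 t"
      define H where "H = Re (G (Complex d t))"
      have H: "H > 0" unfolding H_def using d by (intro posG) simp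
      define al where "al = C1 * ((d - x0) * (ln (real q) + ln (cmod (w + 5/2))) + (d - x0)\<^sup>2) - H * (d / 6)"
      define be where "be = h * Im (G (Complex d t)) - C1 * h * Im (Ln (w + 5/2))"
      define ga where "ga = C1 * h\<^sup>2 + H * (2 * h\<^sup>2 / d)"
      define ep where "ep = H * (h ^ 3 / d\<^sup>2)"
      have pt: "Re (V (Complex (1/2 + x0) t)) \<le> Re (V (s + \<i> * of_real (h * y))) + al + be * y + ga * y\<^sup>2 + ep * \<bar>y\<bar> ^ 3" for y
      proof -
        define w' where "w' = Complex d (t + h * y)"
        have "Re (V1 w) \<le> Re (V1 w') + (h * y) * Im (G (Complex d t))
            + Re (G (Complex d t)) * (2 * (h * y)\<^sup>2 / d + \<bar>h * y\<bar> ^ 3 / d\<^sup>2 - d / 6)"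
          unfolding w_def w'_def by (rule halfplane_potential_le[OF dV1 holG posG d(1) x0])
        also have "\<bar>h * y\<bar> ^ 3 = h ^ 3 * \<bar>y\<bar> ^ 3" using h by (simp add: abs_mult power_mult_distrib)
        finally have 1: "Re (V1 w) \<le> Re (V1 w') + (h * y) * Im (G (Complex d t))
            + H * (2 * (h * y)\<^sup>2 / d + h ^ 3 * \<bar>y\<bar> ^ 3 / d\<^sup>2 - d / 6)" by (simp add: H_def)
        have ww: "Re (w' - w) = d - x0" "Im (w' - w) = h * y" by (auto simp: w_def w'_def)
        then have cw: "(cmod (w' - w))\<^sup>2 = (d - x0)\<^sup>2 + (h * y)\<^sup>2" by (simp only: cmod_power2)
        define P where "P = (\<lambda>z. Re ((z + 5/2) * Ln (z + 5/2) - (z + 5/2)))"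
        have "P w' \<le> P w + (d - x0) * ln (cmod (w + 5/2)) - h * y * Im (Ln (w + 5/2)) + ((d - x0)\<^sup>2 + (h * y)\<^sup>2)"
          using Ln_shift_Taylor[of w w'] x0 d unfolding ww cw by (simp add: w_def w'_def P_def)
        then have 2: "C1 * P w' \<le> C1 * (P w + (d - x0) * ln (cmod (w + 5/2)) - h * y * Im (Ln (w + 5/2)) + ((d - x0)\<^sup>2 + (h * y)\<^sup>2))"
          using C1 by (intro mult_left_mono) auto
        have V1e: "Re (V1 z) = Re (V (z + 1/2)) + C1 * (ln (real q) * Re z + P z)" for z
          by (simp add: V1_def P_def)
        have w1: "w + 1/2 = Complex (1/2 + x0) t" by (simp add: w_def complex_eq_iff)
        have w2: "w' + 1/2 = s + \<i> * of_real (h * y)" by (simp add: w'_def s_def complex_eq_iff)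
        have Rw: "Re w = x0" "Re w' = d" by (auto simp: w_def w'_def)
        show ?thesis
          using 1 2 unfolding V1e w1 w2 Rw al_def be_def ga_def ep_def by (simp add: algebra_simps power_mult_distrib)
      qed
      have int: "integrable lborel (\<lambda>y. Re (V (s + \<i> * of_real (h * y))) * jker y)"
        using integrable_Re[OF sm(1)] by simp
      have "(LINT y|lborel. Re (V (s + \<i> * of_real (h * y))) * jker y) = Re S"
        using integral_Re[OF sm(1)] sm(2) by simp
      with jker_average[OF pt int m2_def m3_def]
      have A: "Re (V (Complex (1/2 + x0) t)) \<le> Re S + al + ga * m2 + ep * m3" by simp
      \<comment> \<open>The gain \<open>H * (d / 6)\<close> contained in \<open>al\<close> absorbs
        the quadratic and cubic terms, no matter how large \<open>H\<close> is.\<close>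
      have Hneg: "H * (2 * h\<^sup>2 / d) * m2 + H * (h ^ 3 / d\<^sup>2) * m3 \<le> H * (d / 6)"
      proof -
        have "2 * h\<^sup>2 / d * m2 + h ^ 3 / d\<^sup>2 * m3 = (72 * m2 / \<delta> + 216 * m3 / \<delta>\<^sup>2) / T"
          unfolding h_def d_def using T d1 by (simp add: field_simps power2_eq_square power3_eq_cube)
        also have "72 * m2 / \<delta> + 216 * m3 / \<delta>\<^sup>2 \<le> 72 * m2 / \<delta> + 216 * m3 / \<delta>"
          using d1 m by (intro add_left_mono divide_left_mono) (auto simp: power2_eq_square mult_le_cancel_left1)
        also have "\<dots> = (72 * m2 + 216 * m3) / \<delta>" by (simp add: add_divide_distrib)
        also have "\<dots> \<le> \<delta> / 6"
        proof -
          have "(72 * m2 + 216 * m3) * 6 \<le> \<delta> * 1" by (simp add: \<delta>_def)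
          also have "\<dots> \<le> \<delta> * \<delta>" using d1 by (intro mult_left_mono) auto
          finally show ?thesis using d1 by (simp add: pos_divide_le_eq)
        qed
        finally have "2 * h\<^sup>2 / d * m2 + h ^ 3 / d\<^sup>2 * m3 \<le> d / 6" using T by (simp add: d_def divide_right_mono)
        then have "H * (2 * h\<^sup>2 / d * m2 + h ^ 3 / d\<^sup>2 * m3) \<le> H * (d / 6)" using H by (intro mult_left_mono) auto
        then show ?thesis by (simp add: distrib_left mult.assoc)
      qed
      have le1: "(d - x0) * (ln (real q) + ln (cmod (w + 5/2))) \<le> \<delta> / T * ((1 + ln (1 + \<delta>)) * cond_log q t)"
      proof -
        have "cmod (w + 5/2) \<le> (x0 + 5/2) + \<bar>t\<bar>"
          using cmod_le[of "w + 5/2"] x0 by (simp add: w_def)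
        also have "\<dots> \<le> (1 + \<delta>) * (\<bar>t\<bar> + 3)"
        proof -
          have "x0 \<le> \<delta>" "0 \<le> \<delta> * \<bar>t\<bar>" using x0 d d1 by (auto intro: order.trans)
          then show ?thesis using d1 unfolding distrib_left distrib_right by linarith
        qed
        finally have "cmod (w + 5/2) \<le> (1 + \<delta>) * (\<bar>t\<bar> + 3)" .
        moreover have "cmod (w + 5/2) \<ge> 5/2" using abs_Re_le_cmod[of "w + 5/2"] x0 by (simp add: w_def)
        ultimately have "ln (cmod (w + 5/2)) \<le> ln ((1 + \<delta>) * (\<bar>t\<bar> + 3))"
          using d1 by (subst ln_le_cancel_iff) (auto intro!: mult_pos_pos)
        also have "\<dots> = ln (1 + \<delta>) + ln (\<bar>t\<bar> + 3)" using d1 by (simp add: ln_mult)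
        finally have "ln (cmod (w + 5/2)) \<le> ln (1 + \<delta>) + ln (\<bar>t\<bar> + 3)" .
        moreover have "cond_log q t = ln (real q) + ln (\<bar>t\<bar> + 3)"
          unfolding cond_log_def using q by (subst ln_mult) auto
        ultimately have "ln (real q) + ln (cmod (w + 5/2)) \<le> ln (1 + \<delta>) + cond_log q t" by linarith
        also have "\<dots> \<le> (1 + ln (1 + \<delta>)) * cond_log q t"
          using cond_log_ge_1[OF q, of t] d1 mult_left_mono[of 1 "cond_log q t" "ln (1 + \<delta>)"] by (simp add: algebra_simps)
        finally have b: "ln (real q) + ln (cmod (w + 5/2)) \<le> (1 + ln (1 + \<delta>)) * cond_log q t" .
        have "0 \<le> (1 + ln (1 + \<delta>)) * cond_log q t"
          using cond_log_ge_1[OF q, of t] d1 by (intro mult_nonneg_nonneg) auto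
        with b have "(d - x0) * (ln (real q) + ln (cmod (w + 5/2))) \<le> (d - x0) * ((1 + ln (1 + \<delta>)) * cond_log q t)"
          using x0 d by (intro mult_left_mono) auto
        also have "\<dots> \<le> d * ((1 + ln (1 + \<delta>)) * cond_log q t)"
          using x0 \<open>0 \<le> (1 + ln (1 + \<delta>)) * cond_log q t\<close> by (intro mult_right_mono) auto
        finally show ?thesis by (simp add: d_def)
      qed
      have le2: "(d - x0)\<^sup>2 \<le> \<delta>\<^sup>2 * cond_log q t / T"
      proof -
        have "(d - x0)\<^sup>2 \<le> d\<^sup>2" using x0 d by (intro power_mono) auto
        also have "d\<^sup>2 = \<delta>\<^sup>2 * 1 / T / T" by (simp add: d_def power2_eq_square)
        also have "\<dots> \<le> \<delta>\<^sup>2 * cond_log q t / T / 1"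
          using T cond_log_ge_1[OF q, of t] by (intro frac_le divide_right_mono mult_left_mono) auto
        finally show ?thesis by simp
      qed
      have le3: "h\<^sup>2 * m2 \<le> 36 * m2 * cond_log q t / T"
      proof -
        have "h\<^sup>2 * m2 = 36 * m2 * 1 / T / T" by (simp add: h_def power2_eq_square)
        also have "\<dots> \<le> 36 * m2 * cond_log q t / T / 1"
          using T cond_log_ge_1[OF q, of t] m by (intro frac_le divide_right_mono mult_left_mono) auto
        finally show ?thesis by simp
      qed
      have "al + ga * m2 + ep * m3 \<le> C1 * ((d - x0) * (ln (real q) + ln (cmod (w + 5/2))) + (d - x0)\<^sup>2 + h\<^sup>2 * m2)"
        using Hneg unfolding al_def ga_def ep_def by (simp add: algebra_simps)
      also have "\<dots> \<le> C1 * (\<delta> / T * ((1 + ln (1 + \<delta>)) * cond_log q t) + \<delta>\<^sup>2 * cond_log q t / T + 36 * m2 * cond_log q t / T)"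
        using le1 le2 le3 C1 by (intro mult_left_mono) auto
      also have "\<dots> = C1 * (\<delta> * (1 + ln (1 + \<delta>)) + \<delta>\<^sup>2 + 36 * m2) * cond_log q t / T"
        using T by (simp add: field_simps)
      finally show ?thesis using A by linarith
    qed
    define E where "E = Re S + C1 * (\<delta> * (1 + ln (1 + \<delta>)) + \<delta>\<^sup>2 + 36 * m2) * cond_log q t / T"
    have Lb: "cmod (L (Complex (1/2 + x0) t)) \<le> 2 * exp 2 * exp E" if x0: "0 < x0" "x0 \<le> 2 * d / 3" for x0
    proof -
      have "cmod (L (Complex (1/2 + x0) t)) \<le> 2 * exp 2 * exp (Re (V (Complex (1/2 + x0) t)))"
        using x0 by (intro LV) simp
      also have "\<dots> \<le> 2 * exp 2 * exp E" using bound[OF x0] by (intro mult_left_mono) (auto simp: E_def)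
      finally show ?thesis .
    qed
    \<comment> \<open>The bound is uniform in \<open>x0\<close>, and L, unlike its logarithm, is
      continuous up to the critical line; let \<open>x0\<close> tend to 0.\<close>
    have "isCont L (Complex (1/2) t)"
      using holomorphic_on_imp_continuous_on[OF dirichlet_L_props(1)[OF c np]]
      by (auto simp: L_def continuous_on_eq_continuous_at[OF open_halfspace_Re_gt])
    moreover have "((\<lambda>x0. Complex (1/2 + x0) t) \<longlongrightarrow> Complex (1/2 + 0) t) (at_right 0)"
      by (intro tendsto_intros)
    then have "((\<lambda>x0. Complex (1/2 + x0) t) \<longlongrightarrow> Complex (1/2) t) (at_right 0)" by simp
    ultimately have "((\<lambda>x0. L (Complex (1/2 + x0) t)) \<longlongrightarrow> L (Complex (1/2) t)) (at_right 0)"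
      by (rule isCont_tendsto_compose)
    then have "((\<lambda>x0. cmod (L (Complex (1/2 + x0) t))) \<longlongrightarrow> cmod (L (Complex (1/2) t))) (at_right 0)"
      by (rule tendsto_norm)
    moreover have "\<forall>\<^sub>F x0 in at_right 0. cmod (L (Complex (1/2 + x0) t)) \<le> 2 * exp 2 * exp E"
      unfolding eventually_at_right_field using Lb d by (intro exI[of _ "2 * d / 3"]) auto
    ultimately have "cmod (L (Complex (1/2) t)) \<le> 2 * exp 2 * exp E"
      by (rule tendsto_upperbound) simp
    also have "\<dots> = exp (E + (2 + ln 2))" by (simp add: exp_add)
    also have "\<dots> \<le> exp (Re S + C + C * cond_log q t / T)"
    proof -
      define D where "D = C1 * (\<delta> * (1 + ln (1 + \<delta>)) + \<delta>\<^sup>2 + 36 * m2)"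
      have D: "D \<ge> 0" unfolding D_def using C1 d1 m by (auto intro!: mult_nonneg_nonneg add_nonneg_nonneg)
      have Ce: "C = 2 + ln 2 + D" by (simp add: C_def D_def)
      have "D * (cond_log q t / T) \<le> C * (cond_log q t / T)"
        unfolding Ce using cond_log_ge_1[OF q, of t] T by (intro mult_right_mono) auto
      then show ?thesis unfolding E_def D_def[symmetric] using Ce D by simp
    qed
    finally show ?thesis by (simp add: S_def L_def T_def)
  qed
  show thesis by (rule that[of C \<delta>]) (use Cpos d1 main in auto)
qed

section \<open>Quadratic characters\<close>

lemma Legendre_values: "Legendre a p \<in> {-1, 0, 1}"
  by (auto simp: Legendre_def)

lemma Legendre_cong: "[a = b] (mod p) \<Longrightarrow> Legendre a p = Legendre b p"
  by (simp add: Legendre_def QuadRes_def cong_def)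

lemma Legendre_eq_0_iff: "Legendre a p = 0 \<longleftrightarrow> p dvd a"
  by (auto simp: Legendre_def cong_0_iff)

lemma Legendre_1: "p > 1 \<Longrightarrow> Legendre 1 p = 1"
  by (auto simp: Legendre_def QuadRes_def cong_0_iff intro!: exI[of _ 1])

text \<open>Euler's criterion gives a congruence modulo \<open>p\<close>; both sides are at most 1
  in absolute value, so for \<open>p > 2\<close> they are equal.\<close>

lemma Legendre_mult:
  assumes "prime p" "p > 2"
  shows "Legendre (a * b) (int p) = Legendre a (int p) * Legendre b (int p)"
proof -
  have "[Legendre (a * b) (int p) = (a * b) ^ ((p - 1) div 2)] (mod int p)"
    by (rule euler_criterion[OF assms])
  moreover have "[Legendre a (int p) * Legendre b (int p) = a ^ ((p - 1) div 2) * b ^ ((p - 1) div 2)] (mod int p)"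
    by (intro cong_mult euler_criterion assms)
  ultimately have "[Legendre (a * b) (int p) = Legendre a (int p) * Legendre b (int p)] (mod int p)"
    unfolding power_mult_distrib using cong_sym cong_trans by blast
  then have d: "int p dvd Legendre (a * b) (int p) - Legendre a (int p) * Legendre b (int p)"
    by (simp add: cong_iff_dvd_diff)
  have "\<bar>Legendre (a * b) (int p) - Legendre a (int p) * Legendre b (int p)\<bar> < int p"
    using Legendre_values[of "a * b" "int p"] Legendre_values[of a "int p"] Legendre_values[of b "int p"] assms(2) by auto
  with d show ?thesis by (metis dvd_imp_le_int eq_iff_diff_eq_0 not_le abs_of_nat)
qed

text \<open>Otherwise squaring would map \<open>{1..<p}\<close> onto itself and hence be injective,
  but 1 and \<open>p - 1\<close> have the same square.\<close>

lemma exists_nonresidue: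
  assumes "prime p" "p > 2"
  obtains a :: nat where "Legendre (int a) (int p) = -1"
proof (rule ccontr)
  assume "\<not> thesis"
  then have nr: "Legendre (int a) (int p) \<noteq> -1" for a using that by blast
  define S where "S = {1..<p}"
  define f where "f = (\<lambda>x. x\<^sup>2 mod p)"
  have fS: "f ` S \<subseteq> S"
  proof (rule image_subsetI)
    fix x assume "x \<in> S"
    then have "\<not> p dvd x" by (auto simp: S_def dest: nat_dvd_not_less)
    then have "\<not> p dvd x\<^sup>2" using assms by (simp add: prime_dvd_power_iff)
    then show "f x \<in> S" using assms by (auto simp: f_def S_def dvd_eq_mod_eq_0 Suc_le_eq)
  qed
  have "S \<subseteq> f ` S"
  proof
    fix a assume a: "a \<in> S"
    then have "\<not> p dvd a" by (auto simp: S_def dest: nat_dvd_not_less)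
    then have "Legendre (int a) (int p) = 1"
      using nr[of a] Legendre_values[of "int a" "int p"] Legendre_eq_0_iff[of "int a" "int p"] by auto
    then obtain y where y: "[y\<^sup>2 = int a] (mod int p)"
      by (auto simp: Legendre_def QuadRes_def split: if_splits)
    define x where "x = nat (y mod int p)"
    have "int x = y mod int p" using assms by (simp add: x_def)
    then have "[int x = y] (mod int p)" by (simp add: cong_def)
    then have "[int x ^ 2 = int a] (mod int p)" using y cong_pow cong_trans by blast
    then have "[x\<^sup>2 = a] (mod p)" by (simp flip: of_nat_power add: cong_int_iff)
    then have fx: "f x = a" using a by (simp add: f_def cong_def S_def)
    have "x < p" using \<open>int x = y mod int p\<close> assms by (metis of_nat_0_less_iff of_nat_less_iff pos_mod_bound prime_gt_0_nat)
    moreover have "x \<noteq> 0"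
    proof
      assume "x = 0"
      then show False using fx a by (simp add: f_def S_def)
    qed
    ultimately show "a \<in> f ` S" using fx by (auto simp: S_def)
  qed
  then have "f ` S = S" using fS by blast
  then have "inj_on f S" by (intro eq_card_imp_inj_on) (simp_all add: S_def)
  moreover have "f (p - 1) = f 1"
  proof -
    have "(p - 1)\<^sup>2 = p * (p - 2) + 1" using assms(2)
      by (simp add: power2_eq_square diff_mult_distrib diff_mult_distrib2) (cases p; simp add: algebra_simps)
    then show ?thesis unfolding f_def power_one by (simp only: mod_mult_self4)
  qed
  ultimately have "p - 1 = 1" using assms(2) by (auto simp: S_def inj_on_def)
  then show False using assms(2) by simp
qed

text \<open>Gauss's lemma with multiplier 2: \<open>E\<close> consists of the doubled residues that
  exceed half of \<open>p\<close>, and the parity of their number depends on \<open>p\<close> modulo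
  8 only.\<close>

lemma Legendre_2:
  assumes "prime p" "p > 2"
  shows "Legendre 2 (int p) = (if p mod 8 = 1 \<or> p mod 8 = 7 then 1 else -1)"
proof -
  have odd: "odd p" using assms prime_odd_nat by auto
  interpret GAUSS p 2
    using assms odd by unfold_locales (auto simp: cong_0_iff dest: zdvd_imp_le)
  define h where "h = (int p - 1) div 2"
  have p: "int p = 2 * h + 1" using odd by (auto simp: h_def elim!: oddE)
  have "E = (\<lambda>x. 2 * x) ` {h div 2 + 1..h}"
  proof -
    have "C = (\<lambda>x. 2 * x) ` {1..h}"
    proof -
      have "C = (\<lambda>x. (x * 2) mod int p) ` {1..h}" by (auto simp: C_def B_def A_def h_def image_image)
      also have "\<dots> = (\<lambda>x. 2 * x) ` {1..h}" using p by (intro image_cong) auto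
      finally show ?thesis .
    qed
    then have "E = (\<lambda>x. 2 * x) ` {1..h} \<inter> {h<..}" by (simp add: E_def h_def)
    also have "\<dots> = (\<lambda>x. 2 * x) ` {h div 2 + 1..h}"
      using p assms(2) by (auto intro!: image_eqI)
    finally show ?thesis .
  qed
  then have "card E = nat (h - h div 2)"
    by (simp add: card_image inj_on_def)
  then have L: "Legendre 2 (int p) = (-1) ^ nat (h - h div 2)" using gauss_lemma by simp
  have "even (nat (h - h div 2)) \<longleftrightarrow> (p mod 8 = 1 \<or> p mod 8 = 7)"
  proof -
    have h0: "h \<ge> 0" using p by linarith
    define k where "k = nat h"
    have hk: "h = int k" using h0 by (simp add: k_def)
    have pk: "p = 2 * k + 1" using p hk by linarith
    have "nat (h - h div 2) = k - k div 2" unfolding hk by (simp add: nat_diff_distrib zdiv_int[symmetric] of_nat_diff flip: of_nat_div)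
    moreover have "even (k - k div 2) \<longleftrightarrow> (p mod 8 = 1 \<or> p mod 8 = 7)" unfolding pk by presburger
    ultimately show ?thesis by simp
  qed
  then show ?thesis unfolding L by auto
qed

text \<open>By quadratic reciprocity this is the Kronecker symbol of \<open>8 * p\<close> as a function of its lower argument.\<close>
definition chi8p :: "nat \<Rightarrow> nat \<Rightarrow> int" where
  "chi8p p n = (if even n then 0 else (if n mod 8 = 1 \<or> n mod 8 = 7 then 1 else -1)
     * (if p mod 4 = 3 \<and> n mod 4 = 3 then -1 else 1) * Legendre (int n) (int p))"

lemma chi8p_mult:
  assumes "prime p" "p > 2" shows "chi8p p (m * n) = chi8p p m * chi8p p n"
proof (cases "even m \<or> even n")
  case False
  have m8: "m mod 8 = 1 \<or> m mod 8 = 3 \<or> m mod 8 = 5 \<or> m mod 8 = 7"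
    and n8: "n mod 8 = 1 \<or> n mod 8 = 3 \<or> n mod 8 = 5 \<or> n mod 8 = 7" using False by presburger+
  have mn: "(m * n) mod 8 = ((m mod 8) * (n mod 8)) mod 8" by (simp add: mod_mult_eq)
  have m4: "x mod 4 = (x mod 8) mod 4" for x :: nat by (simp add: mod_mod_cancel)
  have "(if (m * n) mod 8 = 1 \<or> (m * n) mod 8 = 7 then 1 else -1) * (if p mod 4 = 3 \<and> (m * n) mod 4 = 3 then -1 else 1)
     = ((if m mod 8 = 1 \<or> m mod 8 = 7 then 1 else -1) * (if p mod 4 = 3 \<and> m mod 4 = 3 then -1 else 1)) *
       ((if n mod 8 = 1 \<or> n mod 8 = 7 then 1 else -1) * (if p mod 4 = 3 \<and> n mod 4 = 3 then -1 else (1::int)))"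
    unfolding m4[of "m * n"] m4[of m] m4[of n] mn using m8 n8 by (elim disjE) simp_all
  then show ?thesis using False unfolding chi8p_def by (simp add: Legendre_mult[OF assms])
qed (auto simp: chi8p_def)

text \<open>8 is twice a square, so only \<open>Legendre 2\<close> survives of it, and reciprocity
  swaps \<open>p\<close> and \<open>q\<close>.\<close>

lemma kronecker_prime_8p:
  assumes p: "prime p" "p > 2" and q: "prime q"
  shows "kronecker_prime (8 * int p) q = chi8p p q"
proof (cases "q = 2")
  case False
  then have q2: "q > 2" using prime_ge_2_nat[OF q] by simp
  have oq: "odd q" using q q2 prime_odd_nat by auto
  have op: "odd p" using p prime_odd_nat by auto
  show ?thesis
  proof (cases "q = p")
    case True
    have "Legendre (8 * int p) (int p) = 0" "Legendre (int p) (int p) = 0" by (simp_all add: Legendre_eq_0_iff)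
    then show ?thesis using True False by (simp add: kronecker_prime_def chi8p_def)
  next
    case qp: False
    have "Legendre (8 * int p) (int q) = Legendre (2 * (2 * (2 * int p))) (int q)" by simp
    also have "\<dots> = Legendre 2 (int q) * (Legendre 2 (int q) * (Legendre 2 (int q) * Legendre (int p) (int q)))"
      by (simp only: Legendre_mult[OF q q2])
    also have "\<dots> = Legendre 2 (int q) * Legendre (int p) (int q)"
      using Legendre_2[OF q q2] by (simp split: if_splits)
    also have "Legendre (int p) (int q) = (if p mod 4 = 3 \<and> q mod 4 = 3 then -1 else 1) * Legendre (int q) (int p)"
    proof -
      have rec: "Legendre (int p) (int q) * Legendre (int q) (int p) = (-1) ^ ((p - 1) div 2 * ((q - 1) div 2))"
        using Quadratic_Reciprocity[of p q] p q q2 qp by simp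
      have "even ((p - 1) div 2 * ((q - 1) div 2)) \<longleftrightarrow> \<not> (p mod 4 = 3 \<and> q mod 4 = 3)"
      proof -
        have "even ((p - 1) div 2) \<longleftrightarrow> p mod 4 \<noteq> 3" using op by presburger
        moreover have "even ((q - 1) div 2) \<longleftrightarrow> q mod 4 \<noteq> 3" using oq by presburger
        ultimately show ?thesis by simp
      qed
      then have "Legendre (int p) (int q) * Legendre (int q) (int p) = (if p mod 4 = 3 \<and> q mod 4 = 3 then -1 else 1)"
        unfolding rec by auto
      then show ?thesis
        using Legendre_values[of "int p" "int q"] Legendre_values[of "int q" "int p"] by (auto split: if_splits)
    qed
    finally show ?thesis
      using False oq Legendre_2[OF q q2] by (simp add: kronecker_prime_def chi8p_def)
  qed
qed (simp add: kronecker_prime_def chi8p_def)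

lemma kronecker_8p:
  assumes p: "prime p" "p > 2"
  shows "kronecker (8 * int p) n = chi8p p n"
proof (cases "n = 0")
  case True
  then show ?thesis using p by (simp add: kronecker_def chi8p_def)
next
  case False
  have c1: "chi8p p (Suc 0) = 1" using p by (simp add: chi8p_def Legendre_1)
  have pw: "chi8p p (m ^ k) = chi8p p m ^ k" for m k
    by (induction k) (simp_all add: chi8p_mult[OF p] c1)
  have prod: "chi8p p (prod f A) = (\<Prod>x\<in>A. chi8p p (f x))" if "finite A" for f and A :: "nat set"
    using that by (induction A) (simp_all add: chi8p_mult[OF p] c1)
  have "kronecker (8 * int p) n = (\<Prod>q\<in>prime_factors n. chi8p p q ^ multiplicity q n)"
    unfolding kronecker_def using False kronecker_prime_8p[OF p] by (auto intro!: prod.cong dest: in_prime_factors_imp_prime)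
  also have "\<dots> = chi8p p (\<Prod>q\<in>prime_factors n. q ^ multiplicity q n)"
    by (simp add: prod pw)
  also have "(\<Prod>q\<in>prime_factors n. q ^ multiplicity q n) = n"
    using False prime_factorization_nat[of n] by simp
  finally show ?thesis .
qed

lemma kron_char_8p:
  assumes p: "prime p" "p > 2"
  shows "dirichlet_char (8 * p) (kron_char (8 * int p))" "\<not> principal_char (8 * p) (kron_char (8 * int p))"
    and "prime q \<Longrightarrow> q > 2 \<Longrightarrow> kron_char (8 * int p) q = of_int (Legendre (8 * int p) (int q))"
    and "kron_char (8 * int p) 2 = 0" "kron_char (8 * int p) 0 = 0"
proof -
  have op: "odd p" using p prime_odd_nat by auto
  have k: "kron_char (8 * int p) n = of_int (chi8p p n)" for n by (simp add: kron_char_def kronecker_8p[OF p])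
  have per: "chi8p p (n + 8 * p) = chi8p p n" for n
  proof -
    have "(n + 8 * p) mod 8 = n mod 8" by simp
    moreover have "(n + 8 * p) mod 4 = n mod 4" by presburger
    moreover have "Legendre (int (n + 8 * p)) (int p) = Legendre (int n) (int p)"
      by (rule Legendre_cong) (simp add: cong_iff_dvd_diff)
    ultimately show ?thesis by (simp add: chi8p_def)
  qed
  have nz: "chi8p p n \<noteq> 0 \<longleftrightarrow> coprime n (8 * p)" for n
  proof -
    have "coprime n (2 ^ 3) \<longleftrightarrow> odd n"
      by (simp only: coprime_power_right_iff coprime_right_2_iff_odd) simp
    then have "coprime n (8 * p) \<longleftrightarrow> odd n \<and> coprime n p" by simp
    also have "\<dots> \<longleftrightarrow> odd n \<and> \<not> p dvd n"
      using p(1) by (auto simp: coprime_commute[of n p] prime_imp_coprime_nat dest: coprime_common_divisor_nat)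
    finally show ?thesis by (auto simp: chi8p_def Legendre_eq_0_iff)
  qed
  show "dirichlet_char (8 * p) (kron_char (8 * int p))"
    using p nz by (auto simp: dirichlet_char_def k chi8p_mult[OF p] per)
  obtain a where a: "Legendre (int a) (int p) = -1" by (rule exists_nonresidue[OF p])
  have "coprime 8 p" using op by (metis coprime_left_2_iff_odd coprime_power_left_iff numeral_eq_Suc power_numeral_odd even_numeral mult_2 numeral_Bit0 coprime_mult_left_iff)
  \<comment> \<open>Being 1 modulo 8 trivialises all factors of \<open>chi8p\<close> except the
    Legendre symbol, which is -1 by the choice of \<open>a\<close>.\<close>
  then obtain n where n: "[n = 1] (mod 8)" "[n = a] (mod p)"
    using binary_chinese_remainder_nat[of 8 p 1 a] by blast
  have "Legendre (int n) (int p) = -1"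
    using Legendre_cong[of "int n" "int a" "int p"] n(2) a by (simp add: cong_int_iff)
  moreover have "n mod 8 = 1" using n(1) by (simp add: cong_def)
  then have "odd n" "n mod 4 = 1" by presburger+
  ultimately have "chi8p p n = -1" using \<open>n mod 8 = 1\<close> by (simp add: chi8p_def)
  then show "\<not> principal_char (8 * p) (kron_char (8 * int p))"
    using nz[of n] by (auto simp: principal_char_def k intro!: exI[of _ n])
  show "kron_char (8 * int p) q = of_int (Legendre (8 * int p) (int q))" if "prime q" "q > 2"
    using that kronecker_prime_8p[OF p, of q] by (simp add: k kronecker_prime_def)
  show "kron_char (8 * int p) 2 = 0" "kron_char (8 * int p) 0 = 0" by (simp_all add: k chi8p_def)
qed

text \<open>A monomial in the signs, viewed as a function of the discriminant, is such a character
  up to a constant factor. GRH is applied to it, with the product of the primes in \<open>M\<close>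
  as modulus. A prime of odd multiplicity is what makes cancellation possible.\<close>

lemma legendre_product_char:
  assumes M: "\<And>q. q \<in># M \<Longrightarrow> prime q \<and> q > 2"
  defines "\<psi> \<equiv> \<lambda>m::nat. of_int (\<Prod>q\<in>#M. Legendre (int m) (int q)) :: complex"
  shows "dirichlet_char (prod_mset M) \<psi>"
    and "odd (count M q) \<Longrightarrow> \<not> principal_char (prod_mset M) \<psi>"
proof -
  have mult: "(\<Prod>q\<in>#M. Legendre (int (m * n)) (int q)) = (\<Prod>q\<in>#M. Legendre (int m) (int q)) * (\<Prod>q\<in>#M. Legendre (int n) (int q))" for m n
    unfolding prod_mset.distrib[symmetric] using M
    by (intro arg_cong[of _ _ prod_mset] image_mset_cong) (simp add: Legendre_mult)
  have per: "(\<Prod>q\<in>#M. Legendre (int (n + prod_mset M)) (int q)) = (\<Prod>q\<in>#M. Legendre (int n) (int q))" for n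
  proof (intro arg_cong[of _ _ prod_mset] image_mset_cong Legendre_cong)
    fix q assume "q \<in># M"
    then have "q dvd prod_mset M" by (rule dvd_prod_mset)
    then show "[int (n + prod_mset M) = int n] (mod int q)" by (simp add: cong_iff_dvd_diff)
  qed
  have nz: "(\<Prod>q\<in>#M. Legendre (int n) (int q)) \<noteq> 0 \<longleftrightarrow> coprime n (prod_mset M)" for n
  proof -
    have "coprime n (prod_mset M) \<longleftrightarrow> (\<forall>q\<in>#M. coprime n q)"
      by (induction M) auto
    also have "\<dots> \<longleftrightarrow> (\<forall>q\<in>#M. \<not> q dvd n)"
      using M by (metis coprime_commute prime_imp_coprime_nat prime_nat_iff coprime_common_divisor_nat dvd_refl not_prime_1 One_nat_def)
    finally show ?thesis by (auto simp: prod_mset_zero_iff Legendre_eq_0_iff)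
  qed
  have "prod_mset M > 0" using M by (metis neq0_conv prod_mset_zero_iff not_prime_0)
  then show dc: "dirichlet_char (prod_mset M) \<psi>"
    using nz unfolding dirichlet_char_def \<psi>_def mult per of_int_mult of_int_eq_0_iff by simp
  assume odd: "odd (count M q)"
  then have qM: "q \<in># M" by (metis count_inI even_zero)
  then have q: "prime q" "q > 2" using M by auto
  obtain a where a: "Legendre (int a) (int q) = -1" by (rule exists_nonresidue[OF q])
  define N where "N = filter_mset (\<lambda>x. x \<noteq> q) M"
  have MN: "M = replicate_mset (count M q) q + N"
    by (rule multiset_eqI) (auto simp: N_def)
  have "coprime q (prod_mset N)"
  proof -
    have "coprime q x" if "x \<in># N" for x
      using that M q by (auto simp: N_def primes_coprime)
    then show ?thesis by (induction N) auto
  qed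
  \<comment> \<open>A nonresidue at \<open>q\<close> that is 1 modulo the other primes: the symbol
    at \<open>q\<close> enters with odd multiplicity and the product is -1.\<close>
  then obtain n where n: "[n = a] (mod q)" "[n = 1] (mod prod_mset N)"
    using binary_chinese_remainder_nat[of q "prod_mset N" a 1] by blast
  have Ln: "Legendre (int n) (int q) = -1"
    using Legendre_cong[of "int n" "int a" "int q"] n(1) a by (simp add: cong_int_iff)
  have "Legendre (int n) (int x) = 1" if "x \<in># N" for x
  proof -
    have "x dvd prod_mset N" using that by (rule dvd_prod_mset)
    then have "[n = 1] (mod x)" using n(2) cong_dvd_modulus_nat by blast
    then have "Legendre (int n) (int x) = Legendre 1 (int x)"
      using Legendre_cong[of "int n" 1 "int x"] cong_int_iff[of n 1 x] by simp
    moreover have "x > 2" using that M by (auto simp: N_def)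
    ultimately show ?thesis by (simp add: Legendre_1)
  qed
  then have "(\<Prod>x\<in>#N. Legendre (int n) (int x)) = (\<Prod>x\<in>#N. 1)"
    by (intro arg_cong[of _ _ prod_mset] image_mset_cong)
  then have "(\<Prod>x\<in>#M. Legendre (int n) (int x)) = -1"
    by (subst MN) (simp add: Ln odd)
  then have "\<psi> n = -1" by (simp add: \<psi>_def)
  then show "\<not> principal_char (prod_mset M) \<psi>"
    using dc by (auto simp: principal_char_def dirichlet_char_def intro!: exI[of _ n])
qed

section \<open>Sums over primes\<close>

lemma ln_fact_mangoldt: "ln (fact n) = (\<Sum>d=1..n. mangoldt d * real (n div d))"
proof (induction n)
  case (Suc n)
  have "(\<Sum>d=1..Suc n. mangoldt d * real (Suc n div d)) =
        (\<Sum>d=1..Suc n. mangoldt d * real (n div d) + (if d dvd Suc n then mangoldt d else 0))"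
    by (intro sum.cong) (auto simp: div_Suc dvd_eq_mod_eq_0 algebra_simps)
  also have "\<dots> = (\<Sum>d=1..Suc n. mangoldt d * real (n div d)) + (\<Sum>d=1..Suc n. if d dvd Suc n then mangoldt d else 0)"
    by (rule sum.distrib)
  also have "(\<Sum>d=1..Suc n. mangoldt d * real (n div d)) = (\<Sum>d=1..n. mangoldt d * real (n div d))"
    by simp
  also have "(\<Sum>d=1..Suc n. if d dvd Suc n then mangoldt d else 0) = (\<Sum>d | d dvd Suc n. mangoldt d)"
  proof (rule sum.mono_neutral_cong_right)
    show "{d. d dvd Suc n} \<subseteq> {1..Suc n}" by (auto simp: Suc_le_eq dest: dvd_imp_le intro: dvd_pos_nat[of "Suc n"])
  qed auto
  also have "\<dots> = ln (real (Suc n))" using mangoldt_sum[of "Suc n", where ?'a = real] by simp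
  also have "(\<Sum>d=1..n. mangoldt d * real (n div d)) = ln (fact n)" using Suc by simp
  finally have "(\<Sum>d=1..Suc n. mangoldt d * real (Suc n div d)) = ln (fact n) + ln (real (Suc n))" .
  also have "\<dots> = ln (fact (Suc n))" by (simp add: ln_mult add.commute del: of_nat_Suc)
  finally show ?case by simp
qed auto

text \<open>Chebyshev's argument: \<open>2 * m div d - 2 * (m div d)\<close> is never negative and
  equals 1 for \<open>m < d \<le> 2 * m\<close>, so the logarithm of the central binomial
  coefficient is an upper bound.\<close>

lemma mangoldt_sum_double: "(\<Sum>d=Suc m..2 * m. mangoldt d) \<le> 2 * real m * ln 2"
proof -
  have "(\<Sum>d=Suc m..2 * m. mangoldt d) \<le> (\<Sum>d=1..2 * m. mangoldt d * (real (2 * m div d) - 2 * real (m div d)))"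
  proof -
    have "(\<Sum>d=Suc m..2 * m. mangoldt d) = (\<Sum>d\<in>{d\<in>{1..2 * m}. d > m}. mangoldt d * (real (2 * m div d) - 2 * real (m div d)))"
    proof (rule sum.cong)
      fix d assume "d \<in> {d\<in>{1..2 * m}. d > m}"
      then have "2 * m div d = 1" "m div d = 0" by (auto intro!: div_nat_eqI)
      then show "mangoldt d = mangoldt d * (real (2 * m div d) - 2 * real (m div d))" by simp
    qed auto
    also have "\<dots> \<le> (\<Sum>d=1..2 * m. mangoldt d * (real (2 * m div d) - 2 * real (m div d)))"
    proof (rule sum_mono2)
      fix d assume "d \<in> {1..2 * m} - {d\<in>{1..2 * m}. d > m}"
      have "2 * (m div d) \<le> 2 * m div d"
        using div_times_less_eq_dividend[of m d]
        by (cases "d = 0") (auto simp: less_eq_div_iff_mult_less_eq)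
      then have "2 * real (m div d) \<le> real (2 * m div d)" by (metis of_nat_le_iff of_nat_mult of_nat_numeral)
      then show "0 \<le> mangoldt d * (real (2 * m div d) - 2 * real (m div d))"
        by (simp add: mangoldt_nonneg)
    qed auto
    finally show ?thesis .
  qed
  also have "\<dots> = ln (fact (2 * m)) - 2 * ln (fact m)"
  proof -
    have "(\<Sum>d=1..2 * m. mangoldt d * real (m div d)) = (\<Sum>d=1..m. mangoldt d * real (m div d))"
      by (rule sum.mono_neutral_right) auto
    moreover have "(\<Sum>d=1..2 * m. mangoldt d * (A d - 2 * B d)) = (\<Sum>d=1..2 * m. mangoldt d * A d) - 2 * (\<Sum>d=1..2 * m. mangoldt d * B d)"
      for A B :: "nat \<Rightarrow> real"
      by (simp add: right_diff_distrib sum_subtractf sum_distrib_left mult_ac)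
    ultimately show ?thesis unfolding ln_fact_mangoldt by (simp only:)
  qed
  also have "\<dots> = ln (real ((2 * m) choose m))"
  proof -
    have "real ((2 * m) choose m) = fact (2 * m) / (fact m * fact m)"
      using binomial_fact[of m "2 * m", where ?'a = real] by simp
    then show ?thesis by (simp add: ln_div ln_mult)
  qed
  also have "\<dots> \<le> ln (2 ^ (2 * m))"
  proof -
    have "real ((2 * m) choose m) \<le> real (2 ^ (2 * m))" using binomial_le_pow2 of_nat_le_iff by blast
    then show ?thesis by (subst ln_le_cancel_iff) (auto simp: zero_less_binomial)
  qed
  also have "\<dots> = 2 * real m * ln 2" by (simp add: ln_realpow)
  finally show ?thesis .
qed

lemma chebyshev_psi: "(\<Sum>d=1..n. mangoldt d) \<le> 4 * real n"
proof (induction n rule: less_induct)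
  case (less n)
  show ?case
  proof (cases "n = 0")
    case False
    define m where "m = n div 2"
    have m: "m < n" "2 * m \<le> n" "n \<le> Suc (2 * m)" using False by (auto simp: m_def)
    have "(\<Sum>d=1..n. mangoldt d) \<le> (\<Sum>d=1..2 * m. mangoldt d) + ln (real n)"
    proof (cases "n = 2 * m")
      case True
      then show ?thesis using False by simp
    next
      case False
      then have n: "n = Suc (2 * m)" using m by simp
      have "mangoldt n \<le> ln (real n)" by (rule mangoldt_le) (simp add: n)
      then show ?thesis by (simp add: n)
    qed
    also have "(\<Sum>d=1..2 * m. mangoldt d) = (\<Sum>d=1..m. mangoldt d) + (\<Sum>d=Suc m..2 * m. mangoldt d)"
      by (subst sum.union_disjoint[symmetric]) (auto intro!: sum.cong)
    also have "(\<Sum>d=1..m. mangoldt d) \<le> 4 * real m" using less m by simp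
    also have "(\<Sum>d=Suc m..2 * m. mangoldt d) \<le> 2 * real m * ln 2" by (rule mangoldt_sum_double)
    also have "2 * real m * ln 2 \<le> 2 * real m * 1" using ln_2_less_1 by (intro mult_left_mono) auto
    also have "ln (real n) \<le> real n - 1" using False by (intro ln_le_minus_one) auto
    finally have "(\<Sum>d=1..n. mangoldt d) \<le> 6 * real m + real n" by simp
    also have "6 * real m \<le> 3 * real n" using m(2) by (simp add: of_nat_le_iff[symmetric, where ?'a = real] del: of_nat_le_iff)
    finally show ?thesis by simp
  qed auto
qed

section \<open>Mertens-type estimates from the zeta function near 1\<close>

lemma dser_one: "dser (\<lambda>_. 1) s = zeta s"
  by (simp add: dser_def dterm_def zeta_def)

lemma nat_powr_of_real: "complex_of_nat n powr (- of_real y) = of_real (real n powr (- y))"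
  using powr_of_real[of "real n" "- y"] by simp

lemma zeta_real_lower: "e > 0 \<Longrightarrow> cmod (dser (\<lambda>_. 1) (of_real (1 + e))) \<ge> 1 / e"
proof -
  assume e: "e > 0"
  have sm: "summable (dterm (\<lambda>_. 1) (of_real (1 + e)))"
    by (rule summable_norm_cancel, rule dser_bounds(1)) (use e in simp_all)
  have "Re (dterm (\<lambda>_. 1) (of_real (1 + e)) n) = real (Suc n) powr (-1 - e)" for n
  proof -
    have "- (1 + e) = -1 - e" by simp
    then show ?thesis unfolding dterm_def nat_powr_of_real by (simp only: mult_1 Re_complex_of_real)
  qed
  then have "Re (dser (\<lambda>_. 1) (of_real (1 + e))) = (\<Sum>n. real (Suc n) powr (-1 - e))"
    unfolding dser_def using sm by (simp add: Re_suminf)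
  then show ?thesis using zeta_tail_bounds(3)[OF e] complex_Re_le_cmod[of "dser (\<lambda>_. 1) (of_real (1 + e))"] by simp
qed

text \<open>By the convolution identity the sum times zeta is the series with logarithmic
  coefficients, which is of order at most \<open>1 / e^2\<close> for small \<open>e\<close>, while
  zeta is at least \<open>1 / e\<close>.\<close>

lemma mangoldt_series_bound:
  assumes e: "e > 0"
  shows "summable (\<lambda>n. mangoldt (Suc n) * real (Suc n) powr (-1 - e))"
    and "(\<Sum>n. mangoldt (Suc n) * real (Suc n) powr (-1 - e)) \<le> 2 + 4 / e"
proof -
  define s where "s = complex_of_real (1 + e)"
  have s: "Re s > 1" using e by (simp add: s_def)
  have one: "cmod ((\<lambda>_::nat. 1::complex) n) \<le> 1" for n by simp
  have bd: "mangoldt (Suc n) * real (Suc n) powr (-1 - e) \<le> ln (real (Suc n)) * real (Suc n) powr (-1 - e)" for n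
    using mangoldt_le[of "Suc n"] by (intro mult_right_mono) auto
  show sm: "summable (\<lambda>n. mangoldt (Suc n) * real (Suc n) powr (-1 - e))"
    by (rule summable_comparison_test'[OF zeta_log_bounds(1)[OF e], of 0]) (use bd in \<open>auto simp: mangoldt_nonneg abs_mult simp del: of_nat_Suc\<close>)
  have tm: "dterm (\<lambda>n. of_real (c n) * 1) s n = of_real (c (Suc n) * real (Suc n) powr (-1 - e))" for c :: "nat \<Rightarrow> real" and n
  proof -
    have "- (1 + e) = -1 - e" by simp
    then show ?thesis unfolding dterm_def s_def nat_powr_of_real by (simp only: mult_1_right of_real_mult)
  qed
  have A: "dser (\<lambda>n. of_real (mangoldt n) * 1) s = of_real (\<Sum>n. mangoldt (Suc n) * real (Suc n) powr (-1 - e))"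
    unfolding dser_def tm by (rule suminf_of_real[OF sm, symmetric])
  have B: "dser (\<lambda>n. of_real (ln (real n)) * 1) s = of_real (\<Sum>n. ln (real (Suc n)) * real (Suc n) powr (-1 - e))"
    unfolding dser_def tm by (rule suminf_of_real[OF zeta_log_bounds(1)[OF e], symmetric])
  define D where "D = (\<Sum>n. mangoldt (Suc n) * real (Suc n) powr (-1 - e))"
  have D0: "D \<ge> 0" unfolding D_def using sm by (intro suminf_nonneg) (auto simp: mangoldt_nonneg)
  have "dser (\<lambda>n. mangoldt n * 1) s * dser (\<lambda>_. 1) s = dser (\<lambda>n. of_real (ln (real n)) * 1) s"
    by (rule dser_mangoldt_convolution) (use s in auto)
  then have "of_real D * dser (\<lambda>_. 1) s = of_real (\<Sum>n. ln (real (Suc n)) * real (Suc n) powr (-1 - e))"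
    using A B by (simp add: D_def)
  then have "cmod (of_real D * dser (\<lambda>_. 1) s) = cmod (of_real (\<Sum>n. ln (real (Suc n)) * real (Suc n) powr (-1 - e)))" by simp
  then have "D * cmod (dser (\<lambda>_. 1) s) = \<bar>\<Sum>n. ln (real (Suc n)) * real (Suc n) powr (-1 - e)\<bar>"
    unfolding norm_mult norm_of_real using D0 by simp
  also have "\<dots> = (\<Sum>n. ln (real (Suc n)) * real (Suc n) powr (-1 - e))"
    using zeta_log_bounds(1)[OF e] by (intro abs_of_nonneg suminf_nonneg) auto
  also have "\<dots> \<le> 2 / e * (1 + 2 / e)" by (rule zeta_log_bounds(2)[OF e])
  finally have "D * cmod (dser (\<lambda>_. 1) s) \<le> 2 / e * (1 + 2 / e)" .
  moreover have "D * (1 / e) \<le> D * cmod (dser (\<lambda>_. 1) s)"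
    using zeta_real_lower[OF e] D0 by (intro mult_left_mono) (simp_all add: s_def)
  ultimately have "D * (1 / e) \<le> 2 / e * (1 + 2 / e)" by linarith
  then have "D * (1 / e) * e \<le> 2 / e * (1 + 2 / e) * e" using e by (intro mult_right_mono) auto
  then have "D \<le> 2 * (1 + 2 / e)" using e by simp
  then show "(\<Sum>n. mangoldt (Suc n) * real (Suc n) powr (-1 - e)) \<le> 2 + 4 / e" by (simp add: D_def)
qed

abbreviation primes_upto :: "real \<Rightarrow> nat set" where
  "primes_upto X \<equiv> {p. prime p \<and> real p \<le> X}"

lemma finite_primes_upto [simp]: "finite (primes_upto X)"
  by (rule finite_subset[of _ "{..nat \<lfloor>X\<rfloor>}"]) (auto simp: le_nat_floor)

text \<open>Rankin's trick: for \<open>p \<le> X\<close> the factor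
  \<open>real p powr (- 1 / ln X)\<close> is at least \<open>exp (-1)\<close>, so the finite sum is
  majorised by the convergent series to the right of 1.\<close>

lemma sum_ln_over_primes:
  assumes "ln X \<ge> 1" "X > 0"
  shows "(\<Sum>p\<in>primes_upto X. ln (real p) / real p) \<le> 18 * ln X"
proof -
  define e where "e = 1 / ln X"
  have X1: "X > 1" using assms ln_gt_zero_iff[of X] by linarith
  then have e: "e > 0" by (simp add: e_def)
  note ms = mangoldt_series_bound[OF e]
  have "(\<Sum>p\<in>primes_upto X. ln (real p) / real p) \<le> (\<Sum>p\<in>primes_upto X. exp 1 * (mangoldt p * real p powr (-1 - e)))"
  proof (rule sum_mono)
    fix p assume p: "p \<in> primes_upto X"
    then have p0: "real p > 0" "ln (real p) \<ge> 0" "ln (real p) \<le> ln X" using prime_gt_1_nat[of p] assms by auto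
    have pw: "real p powr (-1 - e) = real p powr (-1) * real p powr (- e)" using powr_add[of "real p" "-1" "-e"] by simp
    have "real p powr (- e) = exp (- (ln (real p) / ln X))" using p0 by (simp add: powr_def e_def)
    moreover have "exp (-1) \<le> exp (- (ln (real p) / ln X))" using p0 X1 assms p by (simp add: divide_le_eq_1)
    ultimately have "real p powr (-1) * exp (-1) \<le> real p powr (-1 - e)" unfolding pw by (intro mult_left_mono) auto
    then have "exp 1 * (ln (real p) * real p powr (-1 - e)) \<ge> exp 1 * (ln (real p) * (real p powr (-1) * exp (-1)))"
      using p0 by (intro mult_left_mono) auto
    also have "exp 1 * (ln (real p) * (real p powr (-1) * exp (-1))) = ln (real p) / real p"
      using p0 by (simp add: powr_minus exp_minus divide_inverse)
    finally show "ln (real p) / real p \<le> exp 1 * (mangoldt p * real p powr (-1 - e))" using p by simp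
  qed
  also have "\<dots> = exp 1 * (\<Sum>p\<in>primes_upto X. mangoldt p * real p powr (-1 - e))" by (simp add: sum_distrib_left)
  also have "(\<Sum>p\<in>primes_upto X. mangoldt p * real p powr (-1 - e)) = (\<Sum>n\<in>(\<lambda>p. p - 1) ` primes_upto X. mangoldt (Suc n) * real (Suc n) powr (-1 - e))"
    by (rule sum.reindex_bij_witness[of _ Suc "\<lambda>p. p - 1"]) (auto simp: prime_gt_0_nat Suc_leI of_nat_diff)
  also have "\<dots> \<le> (\<Sum>n. mangoldt (Suc n) * real (Suc n) powr (-1 - e))"
    by (rule sum_le_suminf[OF ms(1)]) (auto simp: mangoldt_nonneg)
  also have "\<dots> \<le> 6 * ln X" using ms(2) assms by (simp add: e_def)
  also have "exp 1 * (6 * ln X) \<le> 3 * (6 * ln X)" using exp_le assms X1 by (intro mult_right_mono) auto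
  finally show ?thesis by (simp add: mult_left_mono)
qed

lemma dser_one_eq_exp: obtains c where "c \<noteq> 0" "\<And>s. Re s > 1 \<Longrightarrow> zeta s = c * exp (plog (\<lambda>_. 1) s)"
proof -
  obtain c where c: "exp (-2) / 4 \<le> cmod c" "\<And>s. Re s > 1 \<Longrightarrow> dser (\<lambda>_. 1) s = c * exp (plog (\<lambda>_. 1) s)"
    by (rule dser_eq_exp_plog[of "\<lambda>_. 1"]) auto
  have "cmod c > 0" by (rule less_le_trans[OF _ c(1)]) simp
  then show thesis using that[of c] c(2) by (auto simp: dser_one)
qed

text \<open>Used with \<open>a = 1\<close>, \<open>k0 = 2\<close> for proper prime powers near the
  line Re s = 1, and with \<open>a = 1/2\<close>, \<open>k0 = 3\<close> for cubes and higher powers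
  on the critical line.\<close>

lemma prime_power_sum_bound:
  fixes a :: real and k0 :: nat
  assumes a: "a > 0" "a * real k0 > 1"
  obtains C where "C > 0" "\<And>F. finite F \<Longrightarrow> F \<subseteq> {p ^ k | p k. prime p \<and> k \<ge> k0} \<Longrightarrow> (\<Sum>n\<in>F. real n powr (-a)) \<le> C"
proof -
  define e where "e = a * real k0 - 1"
  have e: "e > 0" using a by (simp add: e_def)
  define r where "r = 2 powr (-a)"
  have "2 powr (-a) < 2 powr 0" using a by (intro powr_less_mono) auto
  then have r: "0 < r" "r < 1" by (auto simp: r_def)
  define C where "C = (1 + 1 / e) * (1 / (1 - r))"
  have Cp: "C > 0" using e r by (simp add: C_def add_pos_pos)
  have "(\<Sum>n\<in>F. real n powr (-a)) \<le> C" if F: "finite F" "F \<subseteq> {p ^ k | p k. prime p \<and> k \<ge> k0}" for F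
  proof -
    define N where "N = Max (insert 0 F)"
    have N: "n \<le> N" if "n \<in> F" for n using F that by (simp add: N_def)
    define I where "I = {p. prime p \<and> p \<le> N} \<times> {k0..N + k0}"
    have fI: "finite I" by (simp add: I_def)
    have sub: "F \<subseteq> (\<lambda>(p, k). p ^ k) ` I"
    proof
      fix n assume n: "n \<in> F"
      then obtain p k where pk: "n = p ^ k" "prime p" "k \<ge> k0" using F by blast
      show "n \<in> (\<lambda>(p, k). p ^ k) ` I"
      proof (cases "k = 0")
        case True
        then show ?thesis using a pk by simp
      next
        case False
        have "p \<le> p ^ k" using False prime_gt_0_nat[OF pk(2)] by (simp add: self_le_power Suc_le_eq)
        moreover have "k < p ^ k" using prime_gt_1_nat[OF pk(2)] power_gt_expt by auto
        ultimately show ?thesis using N[OF n] pk by (auto simp: I_def intro!: image_eqI[of _ _ "(p, k)"])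
      qed
    qed
    have "(\<Sum>n\<in>F. real n powr (-a)) \<le> (\<Sum>n\<in>(\<lambda>(p, k). p ^ k) ` I. real n powr (-a))"
      using sub fI by (intro sum_mono2) auto
    also have "\<dots> \<le> (\<Sum>x\<in>I. ((\<lambda>n. real n powr (-a)) \<circ> (\<lambda>(p, k). p ^ k)) x)"
      by (rule sum_image_le[OF fI]) auto
    also have "\<dots> = (\<Sum>p | prime p \<and> p \<le> N. \<Sum>k=k0..N + k0. real (p ^ k) powr (-a))"
      unfolding I_def by (simp add: sum.cartesian_product case_prod_unfold)
    also have "\<dots> \<le> (\<Sum>p | prime p \<and> p \<le> N. real p powr (-1 - e) * (1 / (1 - r)))"
    proof (rule sum_mono)
      fix p assume "p \<in> {p. prime p \<and> p \<le> N}"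
      then have p: "real p \<ge> 2" using prime_ge_2_nat by auto
      have pw: "real (p ^ k) powr (-a) = (real p powr (-a)) ^ k" for k
        using p by (simp add: powr_realpow[symmetric] powr_powr mult.commute)
      have pr: "real p powr (-a) \<le> r" unfolding r_def using p a by (intro powr_mono2') auto
      have "(\<Sum>k=k0..N + k0. real (p ^ k) powr (-a)) = (\<Sum>k=0..N. (real p powr (-a)) ^ (k + k0))"
        unfolding pw using sum.shift_bounds_cl_nat_ivl[of "\<lambda>k. (real p powr (-a)) ^ k" 0 k0 N] by simp
      also have "\<dots> = (real p powr (-a)) ^ k0 * (\<Sum>k=0..N. (real p powr (-a)) ^ k)"
        by (simp add: power_add sum_distrib_left mult.commute)
      also have "\<dots> \<le> (real p powr (-a)) ^ k0 * (1 / (1 - r))"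
      proof (rule mult_left_mono)
        have "(\<Sum>k=0..N. (real p powr (-a)) ^ k) \<le> (\<Sum>k=0..N. r ^ k)"
          using pr by (intro sum_mono power_mono) auto
        also have "\<dots> \<le> (\<Sum>k. r ^ k)" using r by (intro sum_le_suminf) auto
        also have "\<dots> = 1 / (1 - r)" using r by (simp add: suminf_geometric)
        finally show "(\<Sum>k=0..N. (real p powr (-a)) ^ k) \<le> 1 / (1 - r)" .
      qed simp
      also have "(real p powr (-a)) ^ k0 = real p powr (-1 - e)"
        using p by (simp add: e_def powr_realpow[symmetric] powr_powr mult.commute)
      finally show "(\<Sum>k=k0..N + k0. real (p ^ k) powr (-a)) \<le> real p powr (-1 - e) * (1 / (1 - r))" .
    qed
    also have "\<dots> = (\<Sum>p | prime p \<and> p \<le> N. real p powr (-1 - e)) * (1 / (1 - r))" by (simp add: sum_divide_distrib)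
    also have "\<dots> \<le> (1 + 1 / e) * (1 / (1 - r))"
    proof (rule mult_right_mono)
      have "(\<Sum>p | prime p \<and> p \<le> N. real p powr (-1 - e)) = (\<Sum>n\<in>(\<lambda>p. p - 1) ` {p. prime p \<and> p \<le> N}. real (Suc n) powr (-1 - e))"
        by (rule sum.reindex_bij_witness[of _ Suc "\<lambda>p. p - 1"]) (auto simp: prime_gt_0_nat)
      also have "\<dots> \<le> (\<Sum>n. real (Suc n) powr (-1 - e))"
        by (rule sum_le_suminf[OF zeta_tail_bounds(1)[OF e]]) auto
      also have "\<dots> \<le> 1 + 1 / e" by (rule zeta_tail_bounds(2)[OF e])
      finally show "(\<Sum>p | prime p \<and> p \<le> N. real p powr (-1 - e)) \<le> 1 + 1 / e" .
    qed (use r in auto)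
    finally show ?thesis by (simp add: C_def)
  qed
  then show thesis using that Cp by blast
qed

definition prime_cos :: "real \<Rightarrow> real \<Rightarrow> real" where
  "prime_cos X t = (\<Sum>p\<in>primes_upto X. cos (t * ln (real p)) / real p)"

lemma primepow_nonprime:
  assumes "primepow n" "\<not> prime n" shows "n \<in> {p ^ k | p k. prime p \<and> k \<ge> 2}"
proof -
  obtain p k where "prime p" "k > 0" "n = p ^ k" using assms by (auto simp: primepow_def)
  moreover have "k \<noteq> 1" using assms(2) calculation by auto
  ultimately show ?thesis by (auto intro!: exI[of _ p] exI[of _ k])
qed

text \<open>Let \<open>e = 1 / ln X\<close>. At primes up to \<open>X\<close> (the set
  \<open>A\<close>) the terms of \<open>plog\<close> and \<open>prime_cos\<close> differ by at most
  \<open>e * ln p / p\<close>; primes beyond \<open>X\<close> (\<open>B\<close>) satisfy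
  \<open>1 \<le> e * ln p\<close> and are handled by \<open>mangoldt_series_bound\<close>; proper
  prime powers (\<open>D\<close>) converge absolutely. The three errors are 18, 6 and
  \<open>C1\<close>.\<close>

lemma zeta_prime_cos:
  obtains C where "C > 0" "\<And>X t. ln X \<ge> 1 \<Longrightarrow> X > 0 \<Longrightarrow>
    \<bar>prime_cos X t - ln (cmod (zeta (Complex (1 + 1 / ln X) t)))\<bar> \<le> C \<and> zeta (Complex (1 + 1 / ln X) t) \<noteq> 0"
proof -
  obtain c where c: "c \<noteq> 0" "\<And>s. Re s > 1 \<Longrightarrow> zeta s = c * exp (plog (\<lambda>_. 1) s)"
    by (rule dser_one_eq_exp) (rule that; assumption)
  obtain C1 where C1: "C1 > 0" "\<And>F. finite F \<Longrightarrow> F \<subseteq> {p ^ k | p k. prime p \<and> k \<ge> 2} \<Longrightarrow> (\<Sum>n\<in>F. real n powr (-1)) \<le> C1"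
    by (rule prime_power_sum_bound[of 1 2]) auto
  define C where "C = C1 + 24 + \<bar>ln (cmod c)\<bar>"
  have "\<bar>prime_cos X t - ln (cmod (zeta (Complex (1 + 1 / ln X) t)))\<bar> \<le> C \<and> zeta (Complex (1 + 1 / ln X) t) \<noteq> 0"
    if X: "ln X \<ge> 1" "X > 0" for X t
  proof -
    define e where "e = 1 / ln X"
    have X1: "X > 1" using X ln_gt_zero_iff[of X] by linarith
    then have e: "e > 0" "e \<le> 1" using X by (auto simp: e_def divide_le_eq_1)
    define s where "s = Complex (1 + e) t"
    have s: "Re s > 1" using e by (simp add: s_def)
    define g where "g = (\<lambda>n. mangoldt n / ln (real n) * real n powr (-1 - e) * cos (t * ln (real n)))"
    have dt: "Re (dterm (\<lambda>n. of_real (mangoldt n / ln (real n)) * 1) s n) = g (Suc n)" for n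
    proof -
      have "exp (- s * of_real (ln (real (Suc n)))) = of_real (real (Suc n) powr (-1 - e)) * cis (- (t * ln (real (Suc n))))"
      proof -
        have "- s * of_real (ln (real (Suc n))) = of_real ((-1 - e) * ln (real (Suc n))) + \<i> * of_real (- (t * ln (real (Suc n))))"
          by (simp add: s_def complex_eq_iff algebra_simps)
        then show ?thesis by (simp only: exp_add cis_conv_exp[symmetric] exp_of_real) (simp add: powr_def)
      qed
      then show ?thesis unfolding dterm_exp g_def by (simp del: of_nat_Suc)
    qed
    have one: "cmod (of_real (mangoldt n / ln (real n)) * 1) \<le> 1" for n
      using mangoldt_div_ln[of n] by (simp del: of_real_divide)
    have sm: "summable (\<lambda>n. dterm (\<lambda>n. of_real (mangoldt n / ln (real n)) * 1) s n)"
      using dser_bounds(1)[OF one s] by (rule summable_norm_cancel)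
    have lim: "(\<lambda>N. \<Sum>n<N. g (Suc n)) \<longlonglongrightarrow> Re (plog (\<lambda>_. 1) s)"
      using tendsto_Re[OF summable_LIMSEQ[OF sm]] unfolding Re_sum dt plog_def dser_def .
    have part: "\<bar>(\<Sum>n<N. g (Suc n)) - prime_cos X t\<bar> \<le> C1 + 24" if N: "real N \<ge> X" for N
    proof -
      define A where "A = primes_upto X"
      define B where "B = {p. prime p \<and> p \<le> N \<and> real p > X}"
      define D where "D = {n. primepow n \<and> \<not> prime n \<and> n \<le> N}"
      have fin: "finite A" "finite B" "finite D" by (auto simp: A_def B_def D_def)
      have "(\<Sum>n<N. g (Suc n)) = (\<Sum>n=1..N. g n)"
        by (rule sum.reindex_bij_witness[of _ "\<lambda>n. n - 1" Suc]) auto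
      also have "\<dots> = (\<Sum>n\<in>A \<union> B \<union> D. g n)"
      proof (rule sum.mono_neutral_right)
        have "p \<le> N" if "p \<in> A" for p
        proof -
          have "real p \<le> real N" using that N by (simp add: A_def)
          then show ?thesis by simp
        qed
        then show "A \<union> B \<union> D \<subseteq> {1..N}"
          by (auto simp: A_def B_def D_def Suc_le_eq prime_gt_0_nat dest: primepow_gt_0_nat)
        show "\<forall>i\<in>{1..N} - (A \<union> B \<union> D). g i = 0"
          by (auto simp: A_def B_def D_def g_def mangoldt_def)
      qed auto
      also have "\<dots> = (\<Sum>n\<in>A. g n) + (\<Sum>n\<in>B. g n) + (\<Sum>n\<in>D. g n)"
      proof -
        have "A \<inter> B = {}" "(A \<union> B) \<inter> D = {}" by (auto simp: A_def B_def D_def)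
        then show ?thesis using fin by (simp add: sum.union_disjoint)
      qed
      finally have split: "(\<Sum>n<N. g (Suc n)) = (\<Sum>n\<in>A. g n) + (\<Sum>n\<in>B. g n) + (\<Sum>n\<in>D. g n)" .
      have gp: "g p = real p powr (-1 - e) * cos (t * ln (real p))" if "prime p" for p
        using that prime_gt_1_nat[OF that] by (simp add: g_def)
      have gb: "\<bar>g n\<bar> \<le> real n powr (-1 - e)" for n
      proof -
        have "\<bar>g n\<bar> = \<bar>mangoldt n / ln (real n)\<bar> * real n powr (-1 - e) * \<bar>cos (t * ln (real n))\<bar>"
          by (simp add: g_def abs_mult)
        also have "\<dots> \<le> 1 * real n powr (-1 - e) * 1"
          using mangoldt_div_ln[of n] by (intro mult_mono) auto
        finally show ?thesis by simp
      qed
      have "\<bar>(\<Sum>n\<in>D. g n)\<bar> \<le> (\<Sum>n\<in>D. real n powr (-1))"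
      proof (rule order.trans[OF sum_abs sum_mono])
        fix n assume "n \<in> D"
        then have "n \<ge> 1" by (auto simp: D_def Suc_le_eq dest: primepow_gt_0_nat)
        then show "\<bar>g n\<bar> \<le> real n powr (-1)" using e by (intro order.trans[OF gb] powr_mono) auto
      qed
      also have "\<dots> \<le> C1" using primepow_nonprime by (intro C1(2) fin) (auto simp: D_def)
      finally have bD: "\<bar>(\<Sum>n\<in>D. g n)\<bar> \<le> C1" .
      have "\<bar>(\<Sum>n\<in>B. g n)\<bar> \<le> (\<Sum>n\<in>B. e * (mangoldt n * real n powr (-1 - e)))"
      proof (rule order.trans[OF sum_abs sum_mono])
        fix p assume p: "p \<in> B"
        then have "ln X \<le> ln (real p)" using X by (auto simp: B_def)
        then have "1 \<le> e * mangoldt p" using X X1 p by (simp add: e_def B_def divide_simps)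
        then have "1 * real p powr (-1 - e) \<le> (e * mangoldt p) * real p powr (-1 - e)" by (intro mult_right_mono) auto
        then show "\<bar>g p\<bar> \<le> e * (mangoldt p * real p powr (-1 - e))" using gb[of p] by (simp add: mult.assoc)
      qed
      also have "\<dots> = e * (\<Sum>n\<in>B. mangoldt n * real n powr (-1 - e))" by (simp add: sum_distrib_left)
      also have "(\<Sum>n\<in>B. mangoldt n * real n powr (-1 - e)) = (\<Sum>n\<in>(\<lambda>p. p - 1) ` B. mangoldt (Suc n) * real (Suc n) powr (-1 - e))"
        by (rule sum.reindex_bij_witness[of _ Suc "\<lambda>p. p - 1"]) (auto simp: B_def prime_gt_0_nat)
      also have "\<dots> \<le> (\<Sum>n. mangoldt (Suc n) * real (Suc n) powr (-1 - e))"
        using fin by (intro sum_le_suminf mangoldt_series_bound(1) e) (auto simp: mangoldt_nonneg)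
      also have "\<dots> \<le> 2 + 4 / e" by (rule mangoldt_series_bound(2)[OF e(1)])
      also have "e * (2 + 4 / e) \<le> 6" using e by (simp add: distrib_left)
      finally have bB: "\<bar>(\<Sum>n\<in>B. g n)\<bar> \<le> 6" using e by (simp add: mult_left_mono)
      have "\<bar>(\<Sum>n\<in>A. g n) - prime_cos X t\<bar> = \<bar>\<Sum>p\<in>A. g p - cos (t * ln (real p)) / real p\<bar>"
        by (simp add: prime_cos_def A_def sum_subtractf)
      also have "\<dots> \<le> (\<Sum>p\<in>A. e * (ln (real p) / real p))"
      proof (rule order.trans[OF sum_abs sum_mono])
        fix p assume p: "p \<in> A"
        then have pp: "prime p" "real p > 1" using prime_gt_1_nat by (auto simp: A_def)
        have "g p - cos (t * ln (real p)) / real p = (1 / real p) * (real p powr (-e) - 1) * cos (t * ln (real p))"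
        proof -
          have "real p powr (-1 - e) = real p powr (-1) * real p powr (-e)" using powr_add[of "real p" "-1" "-e"] by simp
          then show ?thesis using pp by (simp add: gp powr_minus divide_inverse algebra_simps)
        qed
        then have "\<bar>g p - cos (t * ln (real p)) / real p\<bar> = (1 / real p) * \<bar>real p powr (-e) - 1\<bar> * \<bar>cos (t * ln (real p))\<bar>"
          by (simp only: abs_mult) simp
        also have "\<dots> \<le> (1 / real p) * (e * ln (real p)) * 1"
        proof (intro mult_mono)
          have "real p powr (-e) \<le> 1" using pp e by (simp add: powr_minus ge_one_powr_ge_zero inverse_le_1_iff)
          moreover have "real p powr (-e) \<ge> 1 - e * ln (real p)"
            using pp exp_ge_add_one_self[of "- e * ln (real p)"] by (simp add: powr_def)
          ultimately show "\<bar>real p powr (-e) - 1\<bar> \<le> e * ln (real p)" by simp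
        qed (use pp e in auto)
        finally show "\<bar>g p - cos (t * ln (real p)) / real p\<bar> \<le> e * (ln (real p) / real p)" by simp
      qed
      also have "\<dots> = e * (\<Sum>p\<in>A. ln (real p) / real p)" by (simp add: sum_distrib_left)
      also have "\<dots> \<le> e * (18 * ln X)" using sum_ln_over_primes[OF X] e by (intro mult_left_mono) (auto simp: A_def)
      also have "\<dots> = 18" using X X1 by (simp add: e_def)
      finally have "\<bar>(\<Sum>n\<in>A. g n) - prime_cos X t\<bar> \<le> 18" .
      then show ?thesis using bB bD unfolding split by linarith
    qed
    have "(\<lambda>N. \<bar>(\<Sum>n<N. g (Suc n)) - prime_cos X t\<bar>) \<longlonglongrightarrow> \<bar>Re (plog (\<lambda>_. 1) s) - prime_cos X t\<bar>"
      by (intro tendsto_intros lim)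
    then have fin: "\<bar>Re (plog (\<lambda>_. 1) s) - prime_cos X t\<bar> \<le> C1 + 24"
    proof (rule tendsto_upperbound)
      obtain N0 :: nat where N0: "X \<le> real N0" using real_arch_simple by blast
      have "X \<le> real N" if "N \<ge> N0" for N using N0 that by (meson of_nat_mono order.trans)
      then show "\<forall>\<^sub>F N in sequentially. \<bar>(\<Sum>n<N. g (Suc n)) - prime_cos X t\<bar> \<le> C1 + 24"
        using part by (auto simp: eventually_at_top_linorder intro!: exI[of _ N0])
    qed simp
    have z: "zeta s = c * exp (plog (\<lambda>_. 1) s)" by (rule c(2)[OF s])
    then have "cmod (zeta s) = cmod c * exp (Re (plog (\<lambda>_. 1) s))" by (simp add: norm_mult)
    then have "ln (cmod (zeta s)) = ln (cmod c) + Re (plog (\<lambda>_. 1) s)" using c(1) by (simp add: ln_mult)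
    with fin have "\<bar>prime_cos X t - ln (cmod (zeta s))\<bar> \<le> C" unfolding C_def by linarith
    then show ?thesis using z c(1) by (simp add: s_def e_def)
  qed
  then show thesis using that[of C] C1 by (simp add: C_def add_pos_nonneg)
qed

text \<open>The extreme case is \<open>t = 0\<close>, where zeta is at most
  \<open>1 + ln X\<close>.\<close>

lemma prime_cos_bound:
  obtains C where "C > 0" "\<And>X t. ln X \<ge> 1 \<Longrightarrow> X > 0 \<Longrightarrow> \<bar>prime_cos X t\<bar> \<le> ln (ln X) + C"
proof -
  obtain C where C: "C > 0" "\<And>X t. ln X \<ge> 1 \<Longrightarrow> X > 0 \<Longrightarrow>
    \<bar>prime_cos X t - ln (cmod (zeta (Complex (1 + 1 / ln X) t)))\<bar> \<le> C \<and> zeta (Complex (1 + 1 / ln X) t) \<noteq> 0"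
    by (rule zeta_prime_cos) (rule that; assumption)
  have "\<bar>prime_cos X t\<bar> \<le> ln (ln X) + (C + 1)" if X: "ln X \<ge> 1" "X > 0" for X t
  proof -
    have X1: "X > 1" using X ln_gt_zero_iff[of X] by linarith
    have "\<bar>prime_cos X t\<bar> \<le> prime_cos X 0"
      unfolding prime_cos_def by (intro order.trans[OF sum_abs sum_mono]) (auto simp: divide_right_mono)
    also have "\<dots> \<le> ln (cmod (zeta (Complex (1 + 1 / ln X) 0))) + C" using C(2)[OF X, of 0] by linarith
    also have "ln (cmod (zeta (Complex (1 + 1 / ln X) 0))) \<le> ln (ln X) + 1"
    proof -
      have "cmod (zeta (Complex (1 + 1 / ln X) 0)) \<le> 1 + 1 / (Re (Complex (1 + 1 / ln X) 0) - 1)"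
        unfolding dser_one[symmetric] using X X1 by (intro dser_bounds(2)) auto
      also have "\<dots> \<le> ln X * exp 1"
      proof -
        have "1 + ln X \<le> ln X * 2" using X by simp
        also have "\<dots> \<le> ln X * exp 1" using X X1 exp_ge_add_one_self[of 1] by (intro mult_left_mono) auto
        finally show ?thesis by simp
      qed
      finally have "ln (cmod (zeta (Complex (1 + 1 / ln X) 0))) \<le> ln (ln X * exp 1)"
        using C(2)[OF X, of 0] X X1 by (subst ln_le_cancel_iff) auto
      then show ?thesis using X X1 by (simp add: ln_mult)
    qed
    finally show ?thesis by simp
  qed
  then show thesis using that[of "C + 1"] C by simp
qed

section \<open>Character sums over prime powers\<close>

lemma dirichlet_L_log_deriv_eq:
  assumes c: "dirichlet_char q chi" and np: "\<not> principal_char q chi" and s: "Re s > 1"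
  shows "- (deriv (dirichlet_L chi) s / dirichlet_L chi s) = dser (\<lambda>n. mangoldt n * chi n) s"
proof -
  obtain c0 where c0: "exp (-2) / 4 \<le> cmod c0" "\<And>s. Re s > 1 \<Longrightarrow> dser chi s = c0 * exp (plog chi s)"
    "\<And>s. Re s > 1 \<Longrightarrow> (dser chi has_field_derivative - dser (\<lambda>n. mangoldt n * chi n) s * dser chi s) (at s)"
    by (rule dser_eq_exp_plog[of chi, OF dirichlet_char_simps(2)[OF c] dirichlet_char_norm[OF c] dirichlet_char_1[OF c]]) (rule that; assumption)
  have "cmod c0 > 0" by (rule less_le_trans[OF _ c0(1)]) simp
  then have nz: "dser chi s \<noteq> 0" using c0(2)[OF s] by simp
  have "(dirichlet_L chi has_field_derivative - dser (\<lambda>n. mangoldt n * chi n) s * dser chi s) (at s)"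
    by (rule has_field_derivative_transform_within_open[OF c0(3)[OF s] open_halfspace_Re_gt[of 1]])
       (use s dirichlet_L_props(3)[OF c np] in auto)
  then show ?thesis using nz dirichlet_L_props(3)[OF c np s] by (simp add: DERIV_imp_deriv)
qed

text \<open>The sum is the integral of - L'/L against Fejer's kernel along the line Re s = 3/4,
  where GRH bounds the logarithmic derivative by the conductor. The abscissa 3/4 lies strictly
  between 1/2, where that bound degenerates, and 1; it is the origin of the exponent 3/4 in the
  later error terms.\<close>

lemma smooth_char_sum:
  obtains C :: real where "C > 0"
    "\<And>q chi Y N. \<lbrakk>GRH; dirichlet_char q chi; \<not> principal_char q chi; Y > 0; real N \<ge> 3 * Y\<rbrakk> \<Longrightarrow>
      cmod (\<Sum>n=1..N. mangoldt n * chi n * of_real (max 0 (1 - \<bar>ln (real n / Y)\<bar>)) * of_nat n powr (- (3/4))) \<le> C * ln (real q + 2)"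
proof -
  obtain C0 where C0: "C0 > 0"
    "\<And>q chi s. \<lbrakk>GRH; dirichlet_char q chi; \<not> principal_char q chi; Re s > 1/2\<rbrakk> \<Longrightarrow>
        cmod (deriv (dirichlet_L chi) s / dirichlet_L chi s) \<le> C0 * (1 + 1 / (Re s - 1/2)) * cond_log q (Im s)"
    by (rule dirichlet_L_log_deriv_bounds, rule that)
  define w where "w = (\<lambda>y::real. (1 + \<bar>y\<bar>) powr (-3/2))"
  have wint: "integrable lborel w" unfolding w_def by (rule integrable_decay)
  define W where "W = (LINT y|lborel. w y)"
  have W0: "W \<ge> 0" unfolding W_def by (intro integral_nonneg_AE) (auto simp: w_def)
  define C where "C = C0 * 5 * 50 * W + 1"
  have "C > 0" using C0 W0 by (simp add: C_def add_nonneg_pos)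
  moreover have "cmod (\<Sum>n=1..N. mangoldt n * chi n * of_real (max 0 (1 - \<bar>ln (real n / Y)\<bar>)) * of_nat n powr (- (3/4))) \<le> C * ln (real q + 2)"
    if grh: GRH and c: "dirichlet_char q chi" and np: "\<not> principal_char q chi" and Y: "Y > 0" and N: "real N \<ge> 3 * Y" for q chi Y N
  proof -
    define L where "L = dirichlet_L chi"
    define f where "f = (\<lambda>s. - (deriv L s / L s))"
    have q: "q > 0" using dirichlet_char_simps(1)[OF c] .
    define lq where "lq = ln (real q + 2)"
    have lq1: "lq \<ge> 1"
    proof -
      have "ln 3 \<le> lq" unfolding lq_def using q by (subst ln_le_cancel_iff) auto
      then show ?thesis using ln_3_ge_1 by simp
    qed
    have oH: "open {s. Re s > 1/2}" by (rule open_halfspace_Re_gt)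
    have holL: "L holomorphic_on {s. Re s > 1/2}"
      unfolding L_def using dirichlet_L_props(1)[OF c np] by (rule holomorphic_on_subset) auto
    have nz: "L s \<noteq> 0" if "Re s > 1/2" for s unfolding L_def by (rule GRH_nonzero[OF grh c np that])
    have holf: "f holomorphic_on {s. Re s > 1/2}"
      unfolding f_def using holL nz oH by (intro holomorphic_intros holomorphic_deriv) auto
    have cl: "cond_log q t \<le> 5 * lq * (1 + \<bar>t\<bar>) powr (1/2)" for t
    proof -
      have "cond_log q t = ln (real q) + ln (\<bar>t\<bar> + 3)"
        unfolding cond_log_def using q by (subst ln_mult) auto
      also have "ln (real q) \<le> lq" unfolding lq_def using q by (subst ln_le_cancel_iff) auto
      also have "ln (\<bar>t\<bar> + 3) \<le> 2 * (\<bar>t\<bar> + 3) powr (1/2)" by (intro ln_le_sqrt) auto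
      also have "(\<bar>t\<bar> + 3) powr (1/2) \<le> (4 * (1 + \<bar>t\<bar>)) powr (1/2)" by (intro powr_mono2) auto
      also have "\<dots> = 4 powr (1/2) * (1 + \<bar>t\<bar>) powr (1/2)" by (rule powr_mult)
      also have "4 powr (1/2) = (2::real)" by (simp add: powr_half_sqrt)
      finally have 1: "cond_log q t \<le> lq + 4 * (1 + \<bar>t\<bar>) powr (1/2)" by simp
      have p: "(1 + \<bar>t\<bar>) powr (1/2) \<ge> 1" by (rule ge_one_powr_ge_zero) auto
      have "lq * 1 \<le> lq * (1 + \<bar>t\<bar>) powr (1/2)" using p lq1 by (intro mult_left_mono) auto
      moreover have "1 * (1 + \<bar>t\<bar>) powr (1/2) \<le> lq * (1 + \<bar>t\<bar>) powr (1/2)" using lq1 by (intro mult_right_mono) auto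
      ultimately show ?thesis using 1 by simp
    qed
    have fb: "cmod (f s) \<le> C0 * (1 + 1 / (r - 1/2)) * (5 * lq) * (1 + \<bar>Im s\<bar>) powr (1/2)" if r: "r > 1/2" "Re s \<ge> r" for r s
    proof -
      have "cmod (f s) \<le> C0 * (1 + 1 / (Re s - 1/2)) * cond_log q (Im s)"
        unfolding f_def L_def norm_minus_cancel using r by (intro C0(2)[OF grh c np]) auto
      also have "\<dots> \<le> C0 * (1 + 1 / (r - 1/2)) * (5 * lq * (1 + \<bar>Im s\<bar>) powr (1/2))"
        using r C0 cl[of "Im s"] cond_log_ge_1[OF q, of "Im s"]
        by (intro mult_mono add_mono frac_le) (auto intro!: add_nonneg_nonneg)
      finally show ?thesis by (simp only: mult_ac)
    qed
    have growth: "\<exists>A. \<forall>s. Re s \<ge> r \<longrightarrow> cmod (f s) \<le> A * (1 + \<bar>Im s\<bar>) powr (1/2)" if "r > 1/2" for r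
      using fb[OF that] by blast
    have feq: "f s = dser (\<lambda>n. mangoldt n * chi n) s" if "Re s > 1" for s
      unfolding f_def L_def by (rule dirichlet_L_log_deriv_eq[OF c np that])
    have bb: "cmod (mangoldt n * chi n) \<le> 1 * (1 + ln (real n))" for n
    proof (cases "n = 0")
      case False
      then have "mangoldt n * cmod (chi n) \<le> ln (real n) * 1"
        using dirichlet_char_norm[OF c, of n] by (intro mult_mono mangoldt_le mangoldt_nonneg) auto
      then show ?thesis by (simp add: norm_mult)
    qed auto
    \<comment> \<open>The twist translates the transform so that it is centred at
      \<open>n = Y\<close>.\<close>
    define K where "K = (\<lambda>y. of_real (fker y) * exp (\<i> * of_real (ln Y * y)))"
    have Kc: "continuous_on UNIV K" unfolding K_def by (intro continuous_intros fker_continuous)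
    have Kn: "cmod (K y) = fker y" for y by (simp add: K_def norm_mult fker_nonneg)
    have Kb: "cmod (K y) \<le> 10 * (1 + \<bar>y\<bar>) powr (-2)" for y unfolding Kn by (rule fker_bound)
    define \<kappa> where "\<kappa> = (\<lambda>n. complex_of_real (max 0 (1 - \<bar>ln (real n / Y)\<bar>)))"
    have kap: "\<kappa> n = (LINT y|lborel. K y * exp (- \<i> * of_real (1 * ln (real n) * y)))" if "n > 0" for n
    proof -
      have "K y * exp (- \<i> * of_real (1 * ln (real n) * y)) = of_real (fker y) * exp (- \<i> * of_real (ln (real n / Y) * y))" for y
        unfolding K_def using that Y by (simp add: ln_div exp_add[symmetric] algebra_simps mult_exp_exp)
      then show ?thesis unfolding \<kappa>_def fker_ft[symmetric] by simp
    qed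
    \<comment> \<open>The support ends at \<open>exp 1 * Y\<close>, and 3 is a convenient bound for
      \<open>exp 1\<close>.\<close>
    have kap0: "\<kappa> n = 0" if n: "n > N" for n
    proof -
      have "real n \<ge> 3 * Y" using n N by linarith
      then have "ln (real n / Y) \<ge> ln 3" using Y by (subst ln_le_cancel_iff) (auto simp: pos_le_divide_eq)
      then have "ln (real n / Y) \<ge> 1" using ln_3_ge_1 by linarith
      then show ?thesis by (simp add: \<kappa>_def)
    qed
    have sRe: "Re (3/4 :: complex) > 1/2" by simp
    note vs = vertical_smoothing[OF holf growth feq bb Kc Kb zero_less_one kap kap0 sRe]
    have "cmod (\<Sum>n=1..N. mangoldt n * chi n * \<kappa> n * of_nat n powr (- (3/4))) \<le> (LINT y|lborel. cmod (f (3/4 + \<i> * of_real (1 * y)) * K y))"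
    proof -
      have eq: "(LINT y|lborel. f (3/4 + \<i> * of_real (1 * y)) * K y) = (\<Sum>n=1..N. mangoldt n * chi n * \<kappa> n * of_nat n powr (- (3/4)))"
        by (rule vs(2))
      show ?thesis unfolding eq[symmetric] by (rule integral_norm_bound)
    qed
    also have "\<dots> \<le> (LINT y|lborel. C0 * 5 * 50 * lq * w y)"
    proof (rule integral_mono)
      show "integrable lborel (\<lambda>y. cmod (f (3/4 + \<i> * of_real (1 * y)) * K y))" by (rule integrable_norm[OF vs(1)])
      show "integrable lborel (\<lambda>y. C0 * 5 * 50 * lq * w y)" using wint by (rule integrable_mult_right)
      fix y :: real
      have "cmod (f (3/4 + \<i> * of_real (1 * y))) \<le> C0 * (1 + 1 / (3/4 - 1/2)) * (5 * lq) * (1 + \<bar>y\<bar>) powr (1/2)"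
        using fb[of "3/4" "3/4 + \<i> * of_real (1 * y)"] by simp
      then have "cmod (f (3/4 + \<i> * of_real (1 * y)) * K y) \<le> (C0 * (1 + 1 / (3/4 - 1/2)) * (5 * lq) * (1 + \<bar>y\<bar>) powr (1/2)) * (10 * (1 + \<bar>y\<bar>) powr (-2))"
        unfolding norm_mult using Kb[of y] C0 lq1 by (intro mult_mono) auto
      also have "\<dots> = C0 * 5 * 50 * lq * ((1 + \<bar>y\<bar>) powr (1/2) * (1 + \<bar>y\<bar>) powr (-2))" by simp
      also have "(1 + \<bar>y\<bar>) powr (1/2) * (1 + \<bar>y\<bar>) powr (-2) = w y"
        unfolding w_def by (subst powr_add[symmetric]) simp
      finally show "cmod (f (3/4 + \<i> * of_real (1 * y)) * K y) \<le> C0 * 5 * 50 * lq * w y" .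
    qed
    also have "\<dots> = C0 * 5 * 50 * W * lq" by (simp add: W_def)
    also have "\<dots> \<le> C * lq" unfolding C_def using lq1 by (intro mult_right_mono) auto
    finally show ?thesis by (simp add: \<kappa>_def lq_def)
  qed
  ultimately show thesis using that by blast
qed

text \<open>The factor \<open>max 0 (1 - \<bar>ln (m / Y)\<bar>)\<close> is the Fourier transform of Fejer's kernel. A sum over
  \<open>Y = X, X/e, X/e\<^sup>2, \<dots>\<close> majorises \<open>ln p / 4\<close> at all primes \<open>p \<le> X\<close>.\<close>
definition tri :: "real \<Rightarrow> nat \<Rightarrow> real" where
  "tri Y m = (real m / Y) powr (-3/4) * max 0 (1 - \<bar>ln (real m / Y)\<bar>)"

definition pweight :: "real \<Rightarrow> nat \<Rightarrow> real" where
  "pweight X m = mangoldt m * (\<Sum>j\<le>nat \<lceil>ln X\<rceil>. tri (X * exp (- real j)) m)"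

lemma tri_nonneg: "tri Y m \<ge> 0" by (simp add: tri_def)

section \<open>A weight that majorises the primes\<close>

lemma pweight_nonneg: "pweight X m \<ge> 0"
  by (simp add: pweight_def mangoldt_nonneg sum_nonneg tri_nonneg)

lemma tri_upper: "Y > 0 \<Longrightarrow> m > 0 \<Longrightarrow> tri Y m \<le> 3"
proof (cases "\<bar>ln (real m / Y)\<bar> \<le> 1")
  case True
  assume Y: "Y > 0" "m > 0"
  have "(real m / Y) powr (-3/4) = exp (-3/4 * ln (real m / Y))" using Y by (simp add: powr_def)
  also have "\<dots> \<le> exp 1" using True by (subst exp_le_cancel_iff) (simp add: abs_le_iff)
  also have "\<dots> \<le> 3" by (rule exp_le)
  finally have "tri Y m \<le> 3 * 1" unfolding tri_def by (intro mult_mono) auto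
  then show ?thesis by simp
qed (simp add: tri_def)

lemma tri_eq_0: "Y > 0 \<Longrightarrow> real m \<ge> 3 * Y \<Longrightarrow> tri Y m = 0"
proof -
  assume Y: "Y > 0" "real m \<ge> 3 * Y"
  then have "ln (real m / Y) \<ge> ln 3" by (subst ln_le_cancel_iff) (auto simp: pos_le_divide_eq)
  then have "ln (real m / Y) \<ge> 1" using ln_3_ge_1 by linarith
  then show ?thesis by (simp add: tri_def)
qed

text \<open>The integer \<open>j\<close> nearest to \<open>ln (X / p)\<close> selects a scale whose
  centre is within a factor \<open>exp (1/2)\<close> of \<open>p\<close>; there the triangle is at
  least 1/2 and the power at least 5/8.\<close>

lemma pweight_prime:
  assumes p: "prime p" "real p \<le> X"
  shows "pweight X p \<ge> ln (real p) / 4"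
proof -
  have p1: "real p > 1" using prime_gt_1_nat[OF p(1)] by simp
  have X: "X > 0" using p p1 by linarith
  define v where "v = ln (X / real p)"
  have v0: "v \<ge> 0" unfolding v_def using p p1 by (intro ln_ge_zero) (simp add: pos_le_divide_eq)
  have vX: "v \<le> ln X" unfolding v_def using p p1 X by (subst ln_le_cancel_iff) (auto simp: pos_divide_le_eq mult_le_cancel_left1)
  define j where "j = nat \<lfloor>v + 1/2\<rfloor>"
  have j: "\<bar>real j - v\<bar> \<le> 1/2" using v0 unfolding j_def by linarith
  have jle: "j \<le> nat \<lceil>ln X\<rceil>"
  proof -
    have "\<lfloor>v + 1/2\<rfloor> \<le> \<lceil>ln X\<rceil>" using vX by linarith
    then show ?thesis by (simp add: j_def nat_mono)
  qed
  have e: "ln (real p / (X * exp (- real j))) = real j - v"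
    using p1 X by (simp add: v_def ln_div ln_mult)
  have "(1/4 :: real) \<le> (5/8) * (1/2)" by simp
  also have "\<dots> \<le> tri (X * exp (- real j)) p"
    unfolding tri_def
  proof (rule mult_mono)
    have "5/8 \<le> exp (-3/8 :: real)" using exp_ge_add_one_self[of "-3/8 :: real"] by simp
    also have "\<dots> \<le> exp (-3/4 * (real j - v))"
    proof -
      have "real j - v \<le> 1/2" using j by linarith
      then show ?thesis by (subst exp_le_cancel_iff) (simp add: field_simps)
    qed
    also have "\<dots> = (real p / (X * exp (- real j))) powr (-3/4)"
      unfolding e[symmetric] using p1 X by (simp add: powr_def)
    finally show "5/8 \<le> (real p / (X * exp (- real j))) powr (-3/4)" .
    show "1/2 \<le> max 0 (1 - \<bar>ln (real p / (X * exp (- real j)))\<bar>)" unfolding e using j by simp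
  qed auto
  also have "\<dots> \<le> (\<Sum>j\<le>nat \<lceil>ln X\<rceil>. tri (X * exp (- real j)) p)"
    using jle by (intro member_le_sum) (auto simp: tri_nonneg)
  finally have "ln (real p) * (1/4) \<le> ln (real p) * (\<Sum>j\<le>nat \<lceil>ln X\<rceil>. tri (X * exp (- real j)) p)"
    using p1 by (intro mult_left_mono) auto
  then show ?thesis using p by (simp add: pweight_def)
qed

text \<open>Chebyshev's bound applies at each scale. The scales form a geometric progression, so
  their total is of order \<open>X\<close> without an extra logarithm.\<close>

lemma pweight_total:
  assumes X: "X \<ge> 1"
  shows "(\<Sum>m=1..N. pweight X m) \<le> 72 * X"
proof -
  have one: "(\<Sum>m=1..N. mangoldt m * tri Y m) \<le> 36 * Y" if Y: "Y > 0" for Y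
  proof -
    define M where "M = nat \<lfloor>3 * Y\<rfloor>"
    have "(\<Sum>m=1..N. mangoldt m * tri Y m) = (\<Sum>m\<in>{1..N} \<inter> {1..M}. mangoldt m * tri Y m)"
    proof (rule sum.mono_neutral_right)
      have "tri Y m = 0" if "m \<notin> {1..M}" "m \<ge> 1" for m
      proof -
        have "m > M" using that by auto
        then have "real m > 3 * Y" using Y unfolding M_def by linarith
        then show ?thesis using Y by (simp add: tri_eq_0)
      qed
      then show "\<forall>i\<in>{1..N} - {1..N} \<inter> {1..M}. mangoldt i * tri Y i = 0" by auto
    qed auto
    also have "\<dots> \<le> (\<Sum>m\<in>{1..M}. mangoldt m * tri Y m)"
      by (intro sum_mono2) (auto simp: mangoldt_nonneg tri_nonneg)
    also have "\<dots> \<le> (\<Sum>m=1..M. mangoldt m * 3)"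
      using Y by (intro sum_mono mult_left_mono tri_upper) (auto simp: mangoldt_nonneg)
    also have "\<dots> = 3 * (\<Sum>m=1..M. mangoldt m)" by (simp add: sum_distrib_right[symmetric])
    also have "\<dots> \<le> 3 * (4 * real M)" using chebyshev_psi[of M] by (intro mult_left_mono) auto
    also have "real M \<le> 3 * Y" unfolding M_def using Y by simp
    finally show ?thesis by simp
  qed
  have "(\<Sum>m=1..N. pweight X m) = (\<Sum>j\<le>nat \<lceil>ln X\<rceil>. \<Sum>m=1..N. mangoldt m * tri (X * exp (- real j)) m)"
    unfolding pweight_def sum_distrib_left by (rule sum.swap)
  also have "\<dots> \<le> (\<Sum>j\<le>nat \<lceil>ln X\<rceil>. 36 * X * exp (-1) ^ j)"
  proof (rule sum_mono)
    fix j
    have "exp (-1) ^ j = exp (- real j)" using exp_of_nat_mult[of j "-1::real"] by simp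
    then show "(\<Sum>m=1..N. mangoldt m * tri (X * exp (- real j)) m) \<le> 36 * X * exp (-1) ^ j"
      using one[of "X * exp (- real j)"] X by (simp add: mult.assoc)
  qed
  also have "\<dots> = 36 * X * (\<Sum>j<Suc (nat \<lceil>ln X\<rceil>). exp (-1) ^ j)"
    unfolding lessThan_Suc_atMost by (simp add: sum_distrib_left)
  also have "(\<Sum>j<Suc (nat \<lceil>ln X\<rceil>). exp (-1) ^ j) \<le> (\<Sum>j. exp (-1 :: real) ^ j)"
    by (intro sum_le_suminf summable_geometric) auto
  also have "(\<Sum>j. exp (-1 :: real) ^ j) \<le> 2"
  proof -
    have "exp (-1 :: real) \<le> 1/2"
    proof -
      have "(2::real) \<le> exp 1" using exp_ge_add_one_self[of "1::real"] by simp
      then have "inverse (exp (1::real)) \<le> inverse 2" by (rule le_imp_inverse_le) simp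
      then show ?thesis by (simp add: exp_minus)
    qed
    then have "1 / (1 - exp (-1 :: real)) \<le> 1 / (1/2)" by (intro divide_left_mono) auto
    moreover have "(\<Sum>j. exp (-1 :: real) ^ j) = 1 / (1 - exp (-1))" by (rule suminf_geometric) simp
    ultimately show ?thesis by simp
  qed
  finally show ?thesis using X by (simp add: mult_left_mono)
qed

lemma pweight_char_sum:
  obtains C :: real where "C > 0"
    "\<And>q chi X. \<lbrakk>GRH; dirichlet_char q chi; \<not> principal_char q chi; X \<ge> 1\<rbrakk> \<Longrightarrow>
      cmod (\<Sum>m=1..nat \<lceil>3 * X\<rceil>. of_real (pweight X m) * chi m) \<le> C * (ln X + 2) * X powr (3/4) * ln (real q + 2)"
proof -
  obtain C0 where C0: "C0 > 0" "\<And>q chi Y N. \<lbrakk>GRH; dirichlet_char q chi; \<not> principal_char q chi; Y > 0; real N \<ge> 3 * Y\<rbrakk> \<Longrightarrow>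
      cmod (\<Sum>n=1..N. mangoldt n * chi n * of_real (max 0 (1 - \<bar>ln (real n / Y)\<bar>)) * of_nat n powr (- (3/4))) \<le> C0 * ln (real q + 2)"
    by (rule smooth_char_sum, rule that)
  have "cmod (\<Sum>m=1..nat \<lceil>3 * X\<rceil>. of_real (pweight X m) * chi m) \<le> C0 * (ln X + 2) * X powr (3/4) * ln (real q + 2)"
    if grh: GRH and c: "dirichlet_char q chi" and np: "\<not> principal_char q chi" and X: "X \<ge> 1" for q chi X
  proof -
    define N where "N = nat \<lceil>3 * X\<rceil>"
    have q: "q > 0" using dirichlet_char_simps(1)[OF c] .
    have lq: "ln (real q + 2) \<ge> 0" by simp
    have one: "cmod (\<Sum>m=1..N. of_real (mangoldt m * tri (X * exp (- real j)) m) * chi m) \<le> X powr (3/4) * (C0 * ln (real q + 2))" for j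
    proof -
      define Y where "Y = X * exp (- real j)"
      have Y: "Y > 0" "Y \<le> X" using X by (auto simp: Y_def mult_le_cancel_left1)
      have "real N \<ge> 3 * Y" using Y real_nat_ceiling_ge[of "3 * X"] unfolding N_def by linarith
      have "of_real (mangoldt m * tri Y m) * chi m = of_real (Y powr (3/4)) *
          (mangoldt m * chi m * of_real (max 0 (1 - \<bar>ln (real m / Y)\<bar>)) * of_nat m powr (- (3/4)))" for m
      proof -
        have "(real m / Y) powr (-3/4) = real m powr (-3/4) * Y powr (3/4)"
        proof -
          have "(real m / Y) powr (-3/4) = real m powr (-3/4) / Y powr (-3/4)" by (rule powr_divide)
          moreover have "Y powr (-3/4) = inverse (Y powr (3/4))" using powr_minus[of Y "3/4"] by simp
          ultimately show ?thesis by (simp only: divide_inverse inverse_inverse_eq)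
        qed
        moreover have "complex_of_nat m powr (- (3/4)) = of_real (real m powr (-3/4))"
          using powr_of_real[of "real m" "-3/4"] by simp
        ultimately show ?thesis unfolding tri_def by (simp only: of_real_mult of_real_mangoldt mult_ac)
      qed
      then have "(\<Sum>m=1..N. of_real (mangoldt m * tri Y m) * chi m) = of_real (Y powr (3/4)) *
         (\<Sum>m=1..N. mangoldt m * chi m * of_real (max 0 (1 - \<bar>ln (real m / Y)\<bar>)) * of_nat m powr (- (3/4)))"
        by (simp only: sum_distrib_left)
      then have "cmod (\<Sum>m=1..N. of_real (mangoldt m * tri Y m) * chi m) = Y powr (3/4) *
         cmod (\<Sum>m=1..N. mangoldt m * chi m * of_real (max 0 (1 - \<bar>ln (real m / Y)\<bar>)) * of_nat m powr (- (3/4)))"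
        by (simp only: norm_mult norm_of_real abs_of_nonneg powr_ge_zero)
      also have "\<dots> \<le> X powr (3/4) * (C0 * ln (real q + 2))"
        using Y by (intro mult_mono C0(2)[OF grh c np Y(1) \<open>real N \<ge> 3 * Y\<close>] powr_mono2) auto
      finally show ?thesis by (simp add: Y_def)
    qed
    have "(\<Sum>m=1..N. of_real (pweight X m) * chi m) = (\<Sum>j\<le>nat \<lceil>ln X\<rceil>. \<Sum>m=1..N. of_real (mangoldt m * tri (X * exp (- real j)) m) * chi m)"
      unfolding pweight_def sum_distrib_left of_real_sum sum_distrib_right by (rule sum.swap)
    also have "cmod \<dots> \<le> (\<Sum>j\<le>nat \<lceil>ln X\<rceil>. X powr (3/4) * (C0 * ln (real q + 2)))"
      by (rule order.trans[OF norm_sum sum_mono]) (rule one)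
    also have "\<dots> = real (Suc (nat \<lceil>ln X\<rceil>)) * (X powr (3/4) * (C0 * ln (real q + 2)))" by simp
    also have "\<dots> \<le> (ln X + 2) * (X powr (3/4) * (C0 * ln (real q + 2)))"
    proof (rule mult_right_mono)
      have "ln X \<ge> 0" using X by simp
      then show "real (Suc (nat \<lceil>ln X\<rceil>)) \<le> ln X + 2" by linarith
    qed (use C0 lq in auto)
    finally show ?thesis by (simp add: N_def mult_ac)
  qed
  then show thesis using that C0 by blast
qed

text \<open>The value of the character of \<open>8 * m\<close> at an odd prime \<open>q\<close>. It
  makes sense for every \<open>m\<close>, as the weight \<open>pweight\<close> also charges prime
  powers.\<close>

definition leg_sign :: "nat \<Rightarrow> nat \<Rightarrow> real" where
  "leg_sign m q = of_int (Legendre (8 * int m) (int q))"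

lemma leg_sign_bound: "\<bar>leg_sign m q\<bar> \<le> 1"
  using Legendre_values[of "8 * int m" "int q"] by (auto simp: leg_sign_def)

text \<open>A prime power up to \<open>M\<close> that shares a factor with \<open>N\<close> divides
  \<open>N ^ K\<close> once \<open>K\<close> is at least its exponent, and over the divisors of
  \<open>N ^ K\<close> the function \<open>mangoldt\<close> sums to
  \<open>ln (N ^ K)\<close>.\<close>

lemma mangoldt_sum_not_coprime:
  assumes N: "N > 0" and x: "x \<ge> 1" and M: "real M \<le> 4 * x"
  shows "(\<Sum>m | m \<in> {1..M} \<and> \<not> coprime m N. mangoldt m :: real) \<le> 8 * sqrt x * real N"
proof -
  \<comment> \<open>The exponents are logarithmic in \<open>x\<close>; the square root is a crude
    majorant that stays below the power 3/4 of the main error.\<close>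
  define K where "K = nat \<lfloor>8 * sqrt x\<rfloor>"
  have "(\<Sum>m | m \<in> {1..M} \<and> \<not> coprime m N. mangoldt m :: real) = (\<Sum>m | m \<in> {1..M} \<and> \<not> coprime m N \<and> primepow m. mangoldt m)"
    by (rule sum.mono_neutral_right) (auto simp: mangoldt_def)
  also have "\<dots> \<le> (\<Sum>d | d dvd N ^ K. mangoldt d)"
  proof (rule sum_mono2)
    show "finite {d. d dvd N ^ K}" using N by simp
    show "{m. m \<in> {1..M} \<and> \<not> coprime m N \<and> primepow m} \<subseteq> {d. d dvd N ^ K}"
    proof safe
      fix m assume m: "m \<in> {1..M}" "\<not> coprime m N" "primepow m"
      then obtain p k where pk: "prime p" "k > 0" "m = p ^ k" by (auto simp: primepow_def)
      have "p dvd N" using m(2) pk by (metis coprime_commute coprime_power_left_iff prime_imp_coprime)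
      have "2 ^ k \<le> p ^ k" using prime_ge_2_nat[OF pk(1)] by (intro power_mono) auto
      then have "real (2 ^ k) \<le> real M" using m(1) pk(3) by (intro of_nat_mono) (auto intro: order_trans)
      then have "(2::real) ^ k \<le> real M" by simp
      then have "(2::real) ^ k \<le> 4 * x" using M by linarith
      then have "ln ((2::real) ^ k) \<le> ln (4 * x)" using x by (subst ln_le_cancel_iff) auto
      also have "\<dots> \<le> 2 * (4 * x) powr (1/2)" using x by (intro ln_le_sqrt) auto
      also have "\<dots> = 4 * sqrt x" using x by (simp add: powr_half_sqrt real_sqrt_mult)
      finally have "real k * ln 2 \<le> 4 * sqrt x" by (simp add: ln_realpow)
      moreover have "real k * (1/2) \<le> real k * ln 2" using ln2_ge_two_thirds by (intro mult_left_mono) auto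
      ultimately have "real k \<le> 8 * sqrt x" by linarith
      then have "k \<le> K" unfolding K_def by (simp add: le_nat_floor)
      have "p ^ k dvd p ^ K" using \<open>k \<le> K\<close> by (rule le_imp_power_dvd)
      also have "\<dots> dvd N ^ K" using \<open>p dvd N\<close> by (rule dvd_power_same)
      finally show "m dvd N ^ K" using pk by simp
    qed
  qed (auto simp: mangoldt_nonneg)
  also have "\<dots> = ln (real (N ^ K))" using N mangoldt_sum[of "N ^ K", where 'a = real] by simp
  also have "\<dots> = real K * ln (real N)" using N by (simp add: ln_realpow)
  also have "\<dots> \<le> 8 * sqrt x * real N"
  proof (rule mult_mono)
    show "real K \<le> 8 * sqrt x" unfolding K_def using x by simp
    show "ln (real N) \<le> real N" using N ln_le_minus_one[of "real N"] by linarith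
  qed (use x N in auto)
  finally show ?thesis .
qed

text \<open>Weighted averages of monomials in the signs are close to expectations over independent
  random signs. If some multiplicity is odd, the monomial is a nonprincipal character in
  \<open>m\<close> and GRH gives cancellation. If all are even, it is the indicator that
  \<open>m\<close> is coprime to the product, and the exceptional \<open>m\<close> carry little
  weight. The factor \<open>prod_mset M\<close> is affordable because only short monomials
  occur.\<close>

lemma leg_sign_transfer:
  obtains C :: real where "C > 0"
    "\<And>X M. \<lbrakk>GRH; X \<ge> 1; \<And>q. q \<in># M \<Longrightarrow> prime q \<and> q > 2\<rbrakk> \<Longrightarrow>
      \<bar>(\<Sum>m=1..nat \<lceil>3 * X\<rceil>. pweight X m * (\<Prod>q\<in>#M. leg_sign m q)) -
        (\<Sum>m=1..nat \<lceil>3 * X\<rceil>. pweight X m) * (if \<forall>q. even (count M q) then 1 else 0)\<bar>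
      \<le> C * (ln X + 2) * X powr (3/4) * real (prod_mset M)"
proof -
  obtain C0 where C0: "C0 > 0" "\<And>q chi X. \<lbrakk>GRH; dirichlet_char q chi; \<not> principal_char q chi; X \<ge> 1\<rbrakk> \<Longrightarrow>
      cmod (\<Sum>m=1..nat \<lceil>3 * X\<rceil>. of_real (pweight X m) * chi m) \<le> C0 * (ln X + 2) * X powr (3/4) * ln (real q + 2)"
    by (rule pweight_char_sum, rule that)
  define C where "C = 2 * C0 + 24"
  have "\<bar>(\<Sum>m=1..nat \<lceil>3 * X\<rceil>. pweight X m * (\<Prod>q\<in>#M. leg_sign m q)) -
        (\<Sum>m=1..nat \<lceil>3 * X\<rceil>. pweight X m) * (if \<forall>q. even (count M q) then 1 else 0)\<bar>
      \<le> C * (ln X + 2) * X powr (3/4) * real (prod_mset M)"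
    if grh: GRH and X: "X \<ge> 1" and M: "\<And>q. q \<in># M \<Longrightarrow> prime q \<and> q > 2" for X M
  proof -
    define N where "N = prod_mset M"
    have N: "N > 0"
    proof -
      have "0 \<notin># M" using M[of 0] by auto
      then show ?thesis unfolding N_def by (simp add: prod_mset_zero_iff zero_less_iff_neq_zero)
    qed
    define J where "J = nat \<lceil>3 * X\<rceil>"
    have l0: "ln X \<ge> 0" using X by simp
    show ?thesis
    proof (cases "\<forall>q. even (count M q)")
      case False
      then obtain q0 where q0: "odd (count M q0)" by auto
      define \<psi> where "\<psi> = (\<lambda>m::nat. of_int (\<Prod>q\<in>#M. Legendre (int m) (int q)) :: complex)"
      \<comment> \<open>The factor 8 of the discriminant contributes the same value for every
        \<open>m\<close>.\<close>
      define s where "s = (\<Prod>q\<in>#M. Legendre 8 (int q))"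
      have c: "dirichlet_char N \<psi>" unfolding N_def \<psi>_def by (rule legendre_product_char(1)[OF M])
      have np: "\<not> principal_char N \<psi>" unfolding N_def \<psi>_def by (rule legendre_product_char(2)[OF M q0])
      have eq: "complex_of_real (\<Prod>q\<in>#M. leg_sign m q) = of_int s * \<psi> m" for m
      proof -
        have "(\<Prod>q\<in>#M. leg_sign m q) = of_int (\<Prod>q\<in>#M. Legendre (8 * int m) (int q))"
          unfolding leg_sign_def by (induction M) auto
        also have "(\<Prod>q\<in>#M. Legendre (8 * int m) (int q)) = s * (\<Prod>q\<in>#M. Legendre (int m) (int q))"
          unfolding s_def prod_mset.distrib[symmetric] using M
          by (intro arg_cong[of _ _ prod_mset] image_mset_cong) (simp add: Legendre_mult)
        finally show ?thesis by (simp add: \<psi>_def)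
      qed
      have s1: "\<bar>real_of_int s\<bar> \<le> 1"
      proof -
        have "\<bar>s\<bar> \<le> 1" unfolding s_def
        proof (induction M)
          case (add q M)
          have "\<bar>Legendre 8 (int q)\<bar> * \<bar>\<Prod>q\<in>#M. Legendre 8 (int q)\<bar> \<le> 1 * 1"
            using add Legendre_values[of 8 "int q"] by (intro mult_mono) auto
          then show ?case by (simp add: abs_mult)
        qed simp
        then show ?thesis by linarith
      qed
      have "complex_of_real (\<Sum>m=1..J. pweight X m * (\<Prod>q\<in>#M. leg_sign m q)) = of_int s * (\<Sum>m=1..J. of_real (pweight X m) * \<psi> m)"
        unfolding of_real_sum of_real_mult eq sum_distrib_left by (simp only: mult_ac)
      then have "\<bar>\<Sum>m=1..J. pweight X m * (\<Prod>q\<in>#M. leg_sign m q)\<bar> = \<bar>real_of_int s\<bar> * cmod (\<Sum>m=1..J. of_real (pweight X m) * \<psi> m)"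
        by (metis norm_mult norm_of_int norm_of_real of_int_abs)
      also have "\<dots> \<le> 1 * (C0 * (ln X + 2) * X powr (3/4) * ln (real N + 2))"
        using s1 C0(2)[OF grh c np X] unfolding J_def by (intro mult_mono) auto
      also have "\<dots> \<le> 1 * (C0 * (ln X + 2) * X powr (3/4) * (2 * real N))"
      proof (intro mult_left_mono)
        have "ln (real N + 2) \<le> real N + 2 - 1" by (rule ln_le_minus_one) simp
        also have "\<dots> \<le> 2 * real N" using N by simp
        finally show "ln (real N + 2) \<le> 2 * real N" .
      qed (use C0(1) l0 in auto)
      also have "1 * (C0 * (ln X + 2) * X powr (3/4) * (2 * real N)) \<le> C * (ln X + 2) * X powr (3/4) * real N"

      proof -
        have "1 * (C0 * (ln X + 2) * X powr (3/4) * (2 * real N)) = 2 * C0 * ((ln X + 2) * X powr (3/4) * real N)" by simp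
        also have "\<dots> \<le> C * ((ln X + 2) * X powr (3/4) * real N)"
          unfolding C_def using l0 by (intro mult_right_mono) auto
        finally show ?thesis by (simp only: mult_ac)
      qed
      finally show ?thesis unfolding if_not_P[OF False] by (simp add: J_def N_def)
    next
      case True
      have val: "(\<Prod>q\<in>#M. leg_sign m q) = (if coprime m N then 1 else 0)" for m
      proof -
        have M': "\<And>q. q \<in> set_mset M \<Longrightarrow> leg_sign m q = 0 \<longleftrightarrow> q dvd m"
        proof -
          fix q assume "q \<in> set_mset M"
          then have q: "prime q" "q > 2" using M by auto
          have "leg_sign m q = 0 \<longleftrightarrow> int q dvd int (8 * m)" by (simp add: leg_sign_def Legendre_eq_0_iff)
          also have "\<dots> \<longleftrightarrow> q dvd 2 ^ 3 * m" by (simp only: int_dvd_int_iff) simp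
          also have "\<dots> \<longleftrightarrow> q dvd m"
          proof
            assume "q dvd 2 ^ 3 * m"
            then have "q dvd 2 ^ 3 \<or> q dvd m" using q(1) by (simp only: prime_dvd_mult_iff)
            moreover have "\<not> q dvd 2 ^ 3"
            proof
              assume "q dvd 2 ^ 3"
              then have "q dvd 2" using q(1) prime_dvd_power by blast
              then show False using q(2) by (auto dest: dvd_imp_le)
            qed
            ultimately show "q dvd m" by blast
          qed simp
          finally show "leg_sign m q = 0 \<longleftrightarrow> q dvd m" .
        qed
        show ?thesis
        proof (cases "coprime m N")
          case cop: True
          have "(\<Prod>q\<in>#M. leg_sign m q) = (\<Prod>q\<in>set_mset M. leg_sign m q ^ count M q)"
            by (rule image_prod_mset_multiplicity)
          also have "\<dots> = (\<Prod>q\<in>set_mset M. 1)"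
          proof (rule prod.cong)
            fix q assume q: "q \<in> set_mset M"
            have "\<not> q dvd m"
            proof
              assume "q dvd m"
              moreover have "q dvd N" unfolding N_def using q by (rule dvd_prod_mset)
              ultimately have "q dvd 1" using cop by (metis coprime_common_divisor_nat nat_dvd_1_iff_1)
              then show False using M[OF q] by simp
            qed
            then have "leg_sign m q \<noteq> 0" using M'[OF q] by simp
            then have "leg_sign m q = 1 \<or> leg_sign m q = -1"
              using Legendre_values[of "8 * int m" "int q"] by (auto simp: leg_sign_def)
            then show "leg_sign m q ^ count M q = 1" using True by auto
          qed simp
          finally show ?thesis using cop by simp
        next
          case ncop: False
          then have "gcd m N \<noteq> 1" using coprime_iff_gcd_eq_1[of m N] by blast
          then obtain p where "prime p" "p dvd gcd m N" using prime_factor_nat by blast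
          then have p: "prime p" "p dvd m" "p dvd N" by auto
          have "\<exists>q. q \<in># M \<and> p dvd q" using p(1,3) unfolding N_def by (metis prime_dvd_prod_mset_iff)
          then obtain q where q: "q \<in># M" "p dvd q" by blast
          then have "q = p" using M p(1) primes_dvd_imp_eq by metis
          then have "leg_sign m q = 0" using M'[OF q(1)] p by simp
          then have "(\<Prod>q\<in>#M. leg_sign m q) = 0" using q(1) by (auto simp: prod_mset_zero_iff)
          then show ?thesis using ncop by simp
        qed
      qed
      have "(\<Sum>m=1..J. pweight X m) - (\<Sum>m=1..J. pweight X m * (\<Prod>q\<in>#M. leg_sign m q)) = (\<Sum>m=1..J. if \<not> coprime m N then pweight X m else 0)"
        unfolding sum_subtractf[symmetric] val by (intro sum.cong) auto
      also have "\<dots> = (\<Sum>m | m \<in> {1..J} \<and> \<not> coprime m N. pweight X m)"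
        by (rule sum.inter_filter[symmetric]) simp
      finally have d: "(\<Sum>m=1..J. pweight X m) - (\<Sum>m=1..J. pweight X m * (\<Prod>q\<in>#M. leg_sign m q)) = (\<Sum>m | m \<in> {1..J} \<and> \<not> coprime m N. pweight X m)" .
      have d0: "(\<Sum>m | m \<in> {1..J} \<and> \<not> coprime m N. pweight X m) \<ge> 0" by (intro sum_nonneg pweight_nonneg)
      have "(\<Sum>m | m \<in> {1..J} \<and> \<not> coprime m N. pweight X m) \<le> (\<Sum>m | m \<in> {1..J} \<and> \<not> coprime m N. 3 * (ln X + 2) * mangoldt m)"
      proof (rule sum_mono)
        fix m assume m: "m \<in> {m \<in> {1..J}. \<not> coprime m N}"
        have "(\<Sum>j\<le>nat \<lceil>ln X\<rceil>. tri (X * exp (- real j)) m) \<le> (\<Sum>j\<le>nat \<lceil>ln X\<rceil>. 3)"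
          using m X by (intro sum_mono tri_upper) auto
        also have "\<dots> \<le> 3 * (ln X + 2)"
        proof -
          have "real (Suc (nat \<lceil>ln X\<rceil>)) \<le> ln X + 2" using l0 by linarith
          then show ?thesis by simp
        qed
        finally have "mangoldt m * (\<Sum>j\<le>nat \<lceil>ln X\<rceil>. tri (X * exp (- real j)) m) \<le> mangoldt m * (3 * (ln X + 2))"
          by (intro mult_left_mono mangoldt_nonneg)
        then show "pweight X m \<le> 3 * (ln X + 2) * mangoldt m" by (simp add: pweight_def mult_ac)
      qed
      also have "\<dots> = 3 * (ln X + 2) * (\<Sum>m | m \<in> {1..J} \<and> \<not> coprime m N. mangoldt m)" by (simp only: sum_distrib_left)
      also have "\<dots> \<le> 3 * (ln X + 2) * (8 * sqrt X * real N)"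
      proof (rule mult_left_mono)
        have "real J \<le> 3 * X + 1" unfolding J_def using X by linarith
        then show "(\<Sum>m | m \<in> {1..J} \<and> \<not> coprime m N. mangoldt m) \<le> 8 * sqrt X * real N"
          using X by (intro mangoldt_sum_not_coprime[OF N X]) auto
      qed (use l0 in auto)
      also have "\<dots> \<le> 3 * (ln X + 2) * (8 * X powr (3/4) * real N)"
      proof -
        have "X powr (1/2) \<le> X powr (3/4)" using X by (intro powr_mono) auto
        then have "sqrt X \<le> X powr (3/4)" using X by (simp add: powr_half_sqrt)
        then show ?thesis using l0 by (intro mult_left_mono mult_right_mono) auto
      qed
      also have "\<dots> = 24 * ((ln X + 2) * X powr (3/4) * real N)" by simp
      also have "\<dots> \<le> C * ((ln X + 2) * X powr (3/4) * real N)"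
        unfolding C_def using C0(1) l0 by (intro mult_right_mono) auto
      finally show ?thesis using d d0 True unfolding J_def N_def by (simp add: mult.assoc abs_le_iff)
    qed
  qed
  moreover have "C > 0" using C0 by (simp add: C_def)
  ultimately show thesis using that by blast
qed

section \<open>Random signs\<close>

definition sgn_of :: "nat set \<Rightarrow> nat \<Rightarrow> real" where
  "sgn_of A q = (if q \<in> A then -1 else 1)"

text \<open>Expectation over independent uniform signs on \<open>Q\<close>, encoded as the mean over
  the sets of primes with sign -1. Outside of \<open>Q\<close> every sign is 1.\<close>

definition sE :: "nat set \<Rightarrow> ((nat \<Rightarrow> real) \<Rightarrow> real) \<Rightarrow> real" where
  "sE Q F = (\<Sum>A\<in>Pow Q. F (sgn_of A)) / 2 ^ card Q"

lemma sE_cmult: "sE Q (\<lambda>\<epsilon>. c * F \<epsilon>) = c * sE Q F"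
  by (simp add: sE_def sum_distrib_left)

lemma sE_add: "sE Q (\<lambda>\<epsilon>. F \<epsilon> + G \<epsilon>) = sE Q F + sE Q G"
  by (simp add: sE_def sum.distrib add_divide_distrib)

lemma sE_mono: "(\<And>\<epsilon>. F \<epsilon> \<le> G \<epsilon>) \<Longrightarrow> sE Q F \<le> sE Q G"
  by (simp add: sE_def divide_right_mono sum_mono)

lemma sE_const: "finite Q \<Longrightarrow> sE Q (\<lambda>\<epsilon>. c) = c"
  by (simp add: sE_def card_Pow)

lemma sE_nonneg: "(\<And>\<epsilon>. F \<epsilon> \<ge> 0) \<Longrightarrow> sE Q F \<ge> 0"
  by (simp add: sE_def sum_nonneg)

lemma sE_mult_indep:
  assumes fin: "finite Q1" "finite Q2" and dis: "Q1 \<inter> Q2 = {}"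
    and F: "\<And>\<epsilon> \<epsilon>'. (\<And>q. q \<in> Q1 \<Longrightarrow> \<epsilon> q = \<epsilon>' q) \<Longrightarrow> F \<epsilon> = F \<epsilon>'"
    and G: "\<And>\<epsilon> \<epsilon>'. (\<And>q. q \<in> Q2 \<Longrightarrow> \<epsilon> q = \<epsilon>' q) \<Longrightarrow> G \<epsilon> = G \<epsilon>'"
  shows "sE (Q1 \<union> Q2) (\<lambda>\<epsilon>. F \<epsilon> * G \<epsilon>) = sE Q1 F * sE Q2 G"
proof -
  have "(\<Sum>A\<in>Pow (Q1 \<union> Q2). F (sgn_of A) * G (sgn_of A)) = (\<Sum>(A, B)\<in>Pow Q1 \<times> Pow Q2. F (sgn_of A) * G (sgn_of B))"
  proof (rule sum.reindex_bij_witness[of _ "\<lambda>(A, B). A \<union> B" "\<lambda>A. (A \<inter> Q1, A \<inter> Q2)"])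
    fix A assume "A \<in> Pow (Q1 \<union> Q2)"
    have "F (sgn_of (A \<inter> Q1)) = F (sgn_of A)" by (rule F) (auto simp: sgn_of_def)
    moreover have "G (sgn_of (A \<inter> Q2)) = G (sgn_of A)" by (rule G) (auto simp: sgn_of_def)
    ultimately show "(case (A \<inter> Q1, A \<inter> Q2) of (A, B) \<Rightarrow> F (sgn_of A) * G (sgn_of B)) = F (sgn_of A) * G (sgn_of A)" by simp
  qed (use dis in auto)
  also have "\<dots> = (\<Sum>A\<in>Pow Q1. F (sgn_of A)) * (\<Sum>B\<in>Pow Q2. G (sgn_of B))"
    by (simp add: sum_product sum.cartesian_product)
  finally show ?thesis
    using fin dis by (simp add: sE_def card_Un_disjoint power_add)
qed

lemma sE_prod_indep:
  fixes g :: "'i \<Rightarrow> (nat \<Rightarrow> real) \<Rightarrow> real"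
  assumes "finite I" "\<And>i. i \<in> I \<Longrightarrow> finite (S i)" "\<And>i j. i \<in> I \<Longrightarrow> j \<in> I \<Longrightarrow> i \<noteq> j \<Longrightarrow> S i \<inter> S j = {}"
    and "\<And>i \<epsilon> \<epsilon>'. i \<in> I \<Longrightarrow> (\<And>q. q \<in> S i \<Longrightarrow> \<epsilon> q = \<epsilon>' q) \<Longrightarrow> g i \<epsilon> = g i \<epsilon>'"
  shows "sE (\<Union>i\<in>I. S i) (\<lambda>\<epsilon>. \<Prod>i\<in>I. g i \<epsilon>) = (\<Prod>i\<in>I. sE (S i) (g i))"
  using assms
proof (induction I)
  case empty
  then show ?case by (simp add: sE_def)
next
  case (insert i I)
  have "sE (S i \<union> (\<Union>i\<in>I. S i)) (\<lambda>\<epsilon>. g i \<epsilon> * (\<Prod>i\<in>I. g i \<epsilon>)) = sE (S i) (g i) * sE (\<Union>i\<in>I. S i) (\<lambda>\<epsilon>. \<Prod>i\<in>I. g i \<epsilon>)"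
  proof (rule sE_mult_indep)
    show "S i \<inter> (\<Union>i\<in>I. S i) = {}" using insert.prems(2)[of i] insert.hyps by fastforce
    show "g i \<epsilon> = g i \<epsilon>'" if "\<And>q. q \<in> S i \<Longrightarrow> \<epsilon> q = \<epsilon>' q" for \<epsilon> \<epsilon>'
      using that by (intro insert.prems(3)) auto
    show "(\<Prod>i\<in>I. g i \<epsilon>) = (\<Prod>i\<in>I. g i \<epsilon>')" if "\<And>q. q \<in> (\<Union>i\<in>I. S i) \<Longrightarrow> \<epsilon> q = \<epsilon>' q" for \<epsilon> \<epsilon>'
      using that by (intro prod.cong refl insert.prems(3)) auto
    show "finite (S i)" by (rule insert.prems(1)) simp
    show "finite (\<Union>i\<in>I. S i)" using insert.hyps(1) insert.prems(1) by (intro finite_UN_I) auto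
  qed
  also have "sE (\<Union>i\<in>I. S i) (\<lambda>\<epsilon>. \<Prod>i\<in>I. g i \<epsilon>) = (\<Prod>i\<in>I. sE (S i) (g i))"
  proof (rule insert.IH)
    show "finite (S j)" if "j \<in> I" for j using that by (intro insert.prems(1)) simp
    show "S j \<inter> S l = {}" if "j \<in> I" "l \<in> I" "j \<noteq> l" for j l using that by (intro insert.prems(2)) simp_all
    show "g j \<epsilon> = g j \<epsilon>'" if "j \<in> I" "\<And>q. q \<in> S j \<Longrightarrow> \<epsilon> q = \<epsilon>' q" for j \<epsilon> \<epsilon>'
      by (rule insert.prems(3)) (use that in simp_all)
  qed
  finally show ?case using insert.hyps by simp
qed

lemma sE_restrict:
  assumes "finite Q" "Q' \<subseteq> Q" and F: "\<And>\<epsilon> \<epsilon>'. (\<And>q. q \<in> Q' \<Longrightarrow> \<epsilon> q = \<epsilon>' q) \<Longrightarrow> F \<epsilon> = F \<epsilon>'"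
  shows "sE Q F = sE Q' F"
proof -
  have "sE (Q' \<union> (Q - Q')) (\<lambda>\<epsilon>. F \<epsilon> * 1) = sE Q' F * sE (Q - Q') (\<lambda>_. 1)"
  proof (rule sE_mult_indep)
    show "finite Q'" "finite (Q - Q')" using finite_subset[OF assms(2,1)] assms(1) by simp_all
    show "F \<epsilon> = F \<epsilon>'" if "\<And>q. q \<in> Q' \<Longrightarrow> \<epsilon> q = \<epsilon>' q" for \<epsilon> \<epsilon>' by (rule F) (rule that)
  qed auto
  moreover have "Q' \<union> (Q - Q') = Q" by (rule Un_Diff_cancel[THEN trans]) (rule Un_absorb1[OF assms(2)])
  ultimately show ?thesis using assms(1) by (simp add: sE_const)
qed

lemma sE_exp:
  assumes "finite Q" shows "sE Q (\<lambda>\<epsilon>. exp (\<Sum>q\<in>Q. c q * \<epsilon> q)) = (\<Prod>q\<in>Q. cosh (c q))"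
proof -
  have "sE (\<Union>q\<in>Q. {q}) (\<lambda>\<epsilon>. \<Prod>q\<in>Q. exp (c q * \<epsilon> q)) = (\<Prod>q\<in>Q. sE {q} (\<lambda>\<epsilon>. exp (c q * \<epsilon> q)))"
    using assms by (intro sE_prod_indep) auto
  moreover have "sE {q} (\<lambda>\<epsilon>. exp (c q * \<epsilon> q)) = cosh (c q)" for q
  proof -
    have "Pow {q} = {{}, {q}}" by auto
    then show ?thesis by (simp add: sE_def sgn_of_def cosh_def)
  qed
  ultimately show ?thesis using assms by (simp add: exp_sum)
qed

text \<open>Passing to complementary subsets reverses every sign.\<close>

lemma sE_flip:
  assumes "finite Q"
  shows "sE Q (\<lambda>\<epsilon>. f (- (\<Sum>q\<in>Q. c q * \<epsilon> q))) = sE Q (\<lambda>\<epsilon>. f (\<Sum>q\<in>Q. c q * \<epsilon> q))"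
proof -
  have "(\<Sum>A\<in>Pow Q. f (- (\<Sum>q\<in>Q. c q * sgn_of A q))) = (\<Sum>A\<in>Pow Q. f (\<Sum>q\<in>Q. c q * sgn_of A q))"
  proof (rule sum.reindex_bij_witness[of _ "\<lambda>A. Q - A" "\<lambda>A. Q - A"])
    fix A assume "A \<in> Pow Q"
    have "(\<Sum>q\<in>Q. c q * sgn_of (Q - A) q) = - (\<Sum>q\<in>Q. c q * sgn_of A q)"
      unfolding sum_negf[symmetric] by (rule sum.cong) (auto simp: sgn_of_def)
    then show "f (\<Sum>q\<in>Q. c q * sgn_of (Q - A) q) = f (- (\<Sum>q\<in>Q. c q * sgn_of A q))" by simp
  qed auto
  then show ?thesis by (simp add: sE_def)
qed

lemma image_prod_mset_count:
  fixes f :: "nat \<Rightarrow> real"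
  assumes "finite Q" "set_mset M \<subseteq> Q"
  shows "(\<Prod>q\<in>#M. f q) = (\<Prod>q\<in>Q. f q ^ count M q)"
  using assms(2)
proof (induction M)
  case (add x M)
  have "(\<Prod>q\<in>Q. f q ^ count (add_mset x M) q) = (\<Prod>q\<in>Q. (if q = x then f q else 1) * f q ^ count M q)"
    by (intro prod.cong) auto
  also have "\<dots> = (\<Prod>q\<in>Q. if q = x then f q else 1) * (\<Prod>q\<in>Q. f q ^ count M q)" by (rule prod.distrib)
  also have "(\<Prod>q\<in>Q. if q = x then f q else 1) = f x" using add.prems assms(1) by (simp add: prod.delta)
  finally show ?case using add by simp
qed simp

lemma sE_monomial:
  assumes fin: "finite Q" and M: "set_mset M \<subseteq> Q"
  shows "sE Q (\<lambda>\<epsilon>. \<Prod>q\<in>#M. \<epsilon> q) = (if \<forall>q. even (count M q) then 1 else 0)"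
proof -
  have "sE (\<Union>q\<in>Q. {q}) (\<lambda>\<epsilon>. \<Prod>q\<in>Q. \<epsilon> q ^ count M q) = (\<Prod>q\<in>Q. sE {q} (\<lambda>\<epsilon>. \<epsilon> q ^ count M q))"
    using fin by (intro sE_prod_indep) auto
  moreover have "sE {q} (\<lambda>\<epsilon>. \<epsilon> q ^ count M q) = (if even (count M q) then 1 else 0)" for q
  proof -
    have "Pow {q} = {{}, {q}}" by auto
    then show ?thesis by (simp add: sE_def sgn_of_def)
  qed
  ultimately have "sE Q (\<lambda>\<epsilon>. \<Prod>q\<in>#M. \<epsilon> q) = (\<Prod>q\<in>Q. if even (count M q) then 1 else 0)"
    unfolding image_prod_mset_count[OF fin M] by simp
  also have "\<dots> = (if \<forall>q. even (count M q) then 1 else 0)"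
  proof (cases "\<forall>q. even (count M q)")
    case False
    then obtain q where q: "odd (count M q)" by auto
    then have "q \<in> Q" using M by (metis count_inI even_zero subsetD)
    then have "(\<Prod>q\<in>Q. if even (count M q) then 1 else (0::real)) = 0" using fin q by (auto simp: prod_zero_iff)
    then show ?thesis using False by simp
  qed simp
  finally show ?thesis .
qed

section \<open>Truncated exponentials and Gaussian bounds\<close>

definition exp_trunc :: "nat \<Rightarrow> real \<Rightarrow> real" where
  "exp_trunc n x = (\<Sum>k\<le>n. x ^ k / fact k)"

text \<open>Symmetrisation removes the mixed term between even and odd powers. The two truncated
  parts are dominated termwise by cosh and sinh, and the squares of these add up to
  \<open>cosh (2 * w)\<close>. So truncation does not spoil the bound for the exponential
  moment.\<close>

lemma exp_trunc_even_le: "((exp_trunc n w)\<^sup>2 + (exp_trunc n (- w))\<^sup>2) / 2 \<le> cosh (2 * w)"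
proof -
  define ev where "ev = (\<Sum>k\<le>n. if even k then w ^ k / fact k else 0)"
  define od where "od = (\<lambda>w::real. \<Sum>k\<le>n. if even k then 0 else w ^ k / fact k)"
  have p: "exp_trunc n w = ev + od w"
    unfolding exp_trunc_def ev_def od_def sum.distrib[symmetric] by (rule sum.cong) auto
  have m: "exp_trunc n (- w) = ev - od w"
    unfolding exp_trunc_def ev_def od_def sum_subtractf[symmetric] by (rule sum.cong) auto
  have "ev \<le> cosh w"
  proof -
    have s: "(\<lambda>k. if even k then w ^ k / fact k else 0) sums cosh w"
      using cosh_converges[of w] by (simp add: divide_inverse mult.commute cong: if_cong)
    have "ev \<le> suminf (\<lambda>k. if even k then w ^ k / fact k else 0)"
      unfolding ev_def using s by (intro sum_le_suminf) (auto simp: sums_iff)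
    then show ?thesis using s by (simp add: sums_iff)
  qed
  moreover have "ev \<ge> 0" unfolding ev_def by (intro sum_nonneg) auto
  ultimately have 1: "ev\<^sup>2 \<le> (cosh w)\<^sup>2" by (intro power_mono)
  have "od \<bar>w\<bar> \<le> sinh \<bar>w\<bar>"
  proof -
    have s: "(\<lambda>k. if even k then 0 else \<bar>w\<bar> ^ k / fact k) sums sinh \<bar>w\<bar>"
      using sinh_converges[of "\<bar>w\<bar>"] by (simp add: divide_inverse mult.commute cong: if_cong)
    have "od \<bar>w\<bar> \<le> suminf (\<lambda>k. if even k then 0 else \<bar>w\<bar> ^ k / fact k)"
      unfolding od_def using s by (intro sum_le_suminf) (auto simp: sums_iff)
    then show ?thesis using s by (simp add: sums_iff)
  qed
  moreover have "od \<bar>w\<bar> \<ge> 0" unfolding od_def by (intro sum_nonneg) auto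
  ultimately have "(od \<bar>w\<bar>)\<^sup>2 \<le> (sinh \<bar>w\<bar>)\<^sup>2" by (intro power_mono)
  moreover have "(od \<bar>w\<bar>)\<^sup>2 = (od w)\<^sup>2"
  proof (cases "w \<ge> 0")
    case False
    have "od (- w) = - od w" unfolding od_def sum_negf[symmetric] by (rule sum.cong) auto
    then show ?thesis using False by simp
  qed simp
  moreover have "(sinh \<bar>w\<bar>)\<^sup>2 = (sinh w)\<^sup>2" by (cases "w \<ge> 0") auto
  ultimately have 2: "(od w)\<^sup>2 \<le> (sinh w)\<^sup>2" by simp
  have "((exp_trunc n w)\<^sup>2 + (exp_trunc n (- w))\<^sup>2) / 2 = ev\<^sup>2 + (od w)\<^sup>2"
    unfolding p m by (simp add: power2_sum power2_diff field_simps)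
  also have "\<dots> \<le> (cosh w)\<^sup>2 + (sinh w)\<^sup>2" using 1 2 by simp
  also have "\<dots> = cosh (2 * w)" by (simp add: cosh_double)
  finally show ?thesis .
qed

text \<open>Both sides agree at 0, and \<open>tanh y \<le> y\<close> compares their logarithmic
  derivatives for positive arguments.\<close>

lemma cosh_le_exp: "cosh x \<le> exp (x\<^sup>2 / 2)" for x :: real
proof -
  have nonneg: "cosh x \<le> exp (x\<^sup>2 / 2)" if x: "x \<ge> 0" for x :: real
  proof -
    have 1: "tanh y \<le> y" if "y \<ge> 0" for y :: real
    proof -
      have "0 - tanh 0 \<le> y - tanh y"
      proof (rule DERIV_nonneg_imp_nondecreasing[OF that])
        fix u :: real
        have "((\<lambda>u. u - tanh u) has_real_derivative 1 - (1 - tanh u ^ 2)) (at u)"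
          by (auto intro!: derivative_eq_intros)
        then show "\<exists>y. ((\<lambda>u. u - tanh u) has_real_derivative y) (at u) \<and> 0 \<le> y" by fastforce
      qed
      then show ?thesis by simp
    qed
    have "0\<^sup>2 / 2 - ln (cosh 0) \<le> x\<^sup>2 / 2 - ln (cosh x)"
    proof (rule DERIV_nonneg_imp_nondecreasing[OF x])
      fix u :: real assume u: "0 \<le> u"
      have "((\<lambda>x. x\<^sup>2 / 2 - ln (cosh x)) has_real_derivative u - tanh u) (at u)"
        by (auto intro!: derivative_eq_intros simp: tanh_def)
      then show "\<exists>y. ((\<lambda>x. x\<^sup>2 / 2 - ln (cosh x)) has_real_derivative y) (at u) \<and> 0 \<le> y" using 1[OF u] by fastforce
    qed
    then have "ln (cosh x) \<le> x\<^sup>2 / 2" by simp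
    moreover have "cosh x = exp (ln (cosh x))" by simp
    ultimately show ?thesis by (metis exp_le_cancel_iff)
  qed
  show ?thesis using nonneg[of x] nonneg[of "- x"] by (cases "x \<ge> 0") auto
qed

lemma sE_cosh_le:
  assumes "finite Q"
  shows "sE Q (\<lambda>\<epsilon>. cosh (\<Sum>q\<in>Q. c q * \<epsilon> q)) \<le> exp ((\<Sum>q\<in>Q. (c q)\<^sup>2) / 2)"
proof -
  have "sE Q (\<lambda>\<epsilon>. cosh (\<Sum>q\<in>Q. c q * \<epsilon> q)) = sE Q (\<lambda>\<epsilon>. (1/2) * exp (\<Sum>q\<in>Q. c q * \<epsilon> q) + (1/2) * exp (- (\<Sum>q\<in>Q. c q * \<epsilon> q)))"
    by (simp add: cosh_def field_simps)
  also have "\<dots> = (\<Prod>q\<in>Q. cosh (c q))"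
    unfolding sE_add sE_cmult sE_flip[OF assms, of exp] sE_exp[OF assms] by simp
  also have "\<dots> \<le> (\<Prod>q\<in>Q. exp ((c q)\<^sup>2 / 2))"
    by (intro prod_mono) (auto simp: cosh_le_exp)
  also have "\<dots> = exp ((\<Sum>q\<in>Q. (c q)\<^sup>2) / 2)" using assms by (simp add: exp_sum sum_divide_distrib)
  finally show ?thesis .
qed

lemma sE_exp_trunc_le:
  assumes "finite Q"
  shows "sE Q (\<lambda>\<epsilon>. (exp_trunc n ((\<Sum>q\<in>Q. c q * \<epsilon> q) / 2))\<^sup>2) \<le> exp ((\<Sum>q\<in>Q. (c q)\<^sup>2) / 2)"
proof -
  define M where "M = (\<lambda>\<epsilon>. \<Sum>q\<in>Q. c q * \<epsilon> q)"
  define f where "f = (\<lambda>y. (exp_trunc n (y / 2))\<^sup>2)"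
  have "sE Q (\<lambda>\<epsilon>. f (M \<epsilon>)) = sE Q (\<lambda>\<epsilon>. (1/2) * f (M \<epsilon>) + (1/2) * f (- M \<epsilon>))"
    unfolding sE_add sE_cmult M_def sE_flip[OF assms, of f] by simp
  also have "\<dots> \<le> sE Q (\<lambda>\<epsilon>. cosh (M \<epsilon>))"
  proof (rule sE_mono)
    fix \<epsilon>
    show "(1/2) * f (M \<epsilon>) + (1/2) * f (- M \<epsilon>) \<le> cosh (M \<epsilon>)"
      using exp_trunc_even_le[of n "M \<epsilon> / 2"] by (simp add: f_def)
  qed
  also have "\<dots> \<le> exp ((\<Sum>q\<in>Q. (c q)\<^sup>2) / 2)" unfolding M_def by (rule sE_cosh_le[OF assms])
  finally show ?thesis by (simp add: f_def M_def)
qed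

lemma even_power_le_cosh: "y ^ (2 * r) / fact (2 * r) \<le> cosh y" for y :: real
proof -
  have s: "(\<lambda>k. if even k then y ^ k / fact k else 0) sums cosh y"
    using cosh_converges[of y] by (simp add: divide_inverse mult.commute cong: if_cong)
  have "(\<Sum>k\<in>{2 * r}. if even k then y ^ k / fact k else 0) \<le> suminf (\<lambda>k. if even k then y ^ k / fact k else 0)"
    using s by (intro sum_le_suminf) (auto simp: sums_iff)
  then show ?thesis using s by (simp add: sums_iff)
qed

text \<open>An even power is at most a multiple of the cosh of \<open>l\<close> times the variable,
  and the expectation of the latter is bounded as for a Gaussian. The choice
  \<open>l^2 = 2 * r / V\<close> balances both factors and gives the growth of Gaussian moments up
  to constants.\<close>

lemma sE_moment_le:
  assumes fin: "finite Q" and V: "(\<Sum>q\<in>Q. (c q)\<^sup>2) \<le> V" "V > 0" and r: "r > 0"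
  shows "sE Q (\<lambda>\<epsilon>. (\<Sum>q\<in>Q. c q * \<epsilon> q) ^ (2 * r)) \<le> (2 * real r * exp 1 * V) ^ r"
proof -
  define l where "l = sqrt (2 * real r / V)"
  have l: "l > 0" "l\<^sup>2 = 2 * real r / V" using V r by (auto simp: l_def)
  have "sE Q (\<lambda>\<epsilon>. (\<Sum>q\<in>Q. c q * \<epsilon> q) ^ (2 * r)) \<le> sE Q (\<lambda>\<epsilon>. (fact (2 * r) / l ^ (2 * r)) * cosh (\<Sum>q\<in>Q. l * c q * \<epsilon> q))"
  proof (rule sE_mono)
    fix \<epsilon> :: "nat \<Rightarrow> real"
    have "(\<Sum>q\<in>Q. l * c q * \<epsilon> q) = l * (\<Sum>q\<in>Q. c q * \<epsilon> q)" by (simp add: sum_distrib_left mult.assoc)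
    then show "(\<Sum>q\<in>Q. c q * \<epsilon> q) ^ (2 * r) \<le> (fact (2 * r) / l ^ (2 * r)) * cosh (\<Sum>q\<in>Q. l * c q * \<epsilon> q)"
      using even_power_le_cosh[of "l * (\<Sum>q\<in>Q. c q * \<epsilon> q)" r] l(1) by (simp add: power_mult_distrib field_simps)
  qed
  also have "\<dots> = (fact (2 * r) / l ^ (2 * r)) * sE Q (\<lambda>\<epsilon>. cosh (\<Sum>q\<in>Q. l * c q * \<epsilon> q))" by (rule sE_cmult)
  also have "\<dots> \<le> (fact (2 * r) / l ^ (2 * r)) * exp ((\<Sum>q\<in>Q. (l * c q)\<^sup>2) / 2)"
    using l sE_cosh_le[OF fin, of "\<lambda>q. l * c q"] by (intro mult_left_mono) auto
  also have "(\<Sum>q\<in>Q. (l * c q)\<^sup>2) = l\<^sup>2 * (\<Sum>q\<in>Q. (c q)\<^sup>2)" by (simp add: power_mult_distrib sum_distrib_left)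
  also have "exp (l\<^sup>2 * (\<Sum>q\<in>Q. (c q)\<^sup>2) / 2) \<le> exp (real r)"
  proof -
    have "l\<^sup>2 * (\<Sum>q\<in>Q. (c q)\<^sup>2) \<le> l\<^sup>2 * V" using V by (intro mult_left_mono) auto
    also have "\<dots> = 2 * real r" using V l by simp
    finally show ?thesis by simp
  qed
  also have "fact (2 * r) \<le> (2 * real r) ^ (2 * r)"
  proof -
    have "fact (2 * r) \<le> real ((2 * r) ^ (2 * r))" by (rule fact_le_power)
    then show ?thesis by simp
  qed
  finally have "sE Q (\<lambda>\<epsilon>. (\<Sum>q\<in>Q. c q * \<epsilon> q) ^ (2 * r)) \<le> (2 * real r) ^ (2 * r) / l ^ (2 * r) * exp (real r)"
    using l by (simp add: divide_right_mono mult_right_mono mult_left_mono)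
  also have "\<dots> = ((2 * real r)\<^sup>2 / l\<^sup>2 * exp 1) ^ r"
    using exp_of_nat_mult[of r "1::real"] by (simp add: power_mult power_mult_distrib power_divide)
  also have "(2 * real r)\<^sup>2 / l\<^sup>2 * exp 1 = 2 * real r * exp 1 * V"
    unfolding l(2) using r V by (simp add: power2_eq_square field_simps)
  finally show ?thesis .
qed

text \<open>The square is nonnegative for all arguments, so that the bound survives summation over the
  arguments outside of the range as well.\<close>
lemma exp_le_exp_trunc:
  fixes l :: nat
  assumes y: "\<bar>y\<bar> \<le> real l" and l: "l \<ge> 1"
  shows "exp y \<le> (1 + exp (- real l))\<^sup>2 * (exp_trunc (8 * l) (y / 2))\<^sup>2"
proof -
  \<comment> \<open>At arguments up to \<open>l / 2\<close>, splitting \<open>(l / 2) ^ N\<close>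
    into \<open>(1/8) ^ N\<close> and \<open>(4 * l) ^ N\<close> bounds the remainder after degree
    \<open>8 * l\<close> by \<open>exp (l / 2 + 4 * l)\<close> times \<open>exp (-1) ^ N\<close>.
    That is \<open>exp (- 7/2 * l - 1)\<close>, small even relative to
    \<open>exp (y / 2)\<close>.\<close>
  define N where "N = Suc (8 * l)"
  obtain t where t: "\<bar>t\<bar> \<le> \<bar>y / 2\<bar>" "exp (y / 2) = (\<Sum>m<N. (y / 2) ^ m / fact m) + exp t / fact N * (y / 2) ^ N"
    using Maclaurin_exp_le[of "y / 2" N] by blast
  have E: "(\<Sum>m<N. (y / 2) ^ m / fact m) = exp_trunc (8 * l) (y / 2)"
    unfolding exp_trunc_def N_def lessThan_Suc_atMost ..
  have pf: "(4 * real l) ^ N / fact N \<le> exp (4 * real l)"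
  proof -
    have "(\<Sum>k\<in>{N}. (4 * real l) ^ k /\<^sub>R fact k) \<le> suminf (\<lambda>k. (4 * real l) ^ k /\<^sub>R fact k)"
      by (intro sum_le_suminf summable_exp_generic) auto
    then show ?thesis by (simp add: exp_def divide_inverse mult.commute)
  qed
  have "\<bar>exp t / fact N * (y / 2) ^ N\<bar> = exp t / fact N * \<bar>y / 2\<bar> ^ N" by (simp add: abs_mult power_abs)
  also have "\<dots> \<le> exp (real l / 2) / fact N * (real l / 2) ^ N"
    using t(1) y by (intro mult_mono divide_right_mono power_mono) auto
  also have "(real l / 2) ^ N = (1/8) ^ N * (4 * real l) ^ N"
    using power_mult_distrib[of "1/8" "4 * real l" N] by simp
  also have "exp (real l / 2) / fact N * ((1/8) ^ N * (4 * real l) ^ N) = exp (real l / 2) * (1/8) ^ N * ((4 * real l) ^ N / fact N)"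
    by (simp only: divide_inverse mult_ac)
  also have "\<dots> \<le> exp (real l / 2) * (1/8) ^ N * exp (4 * real l)"
    using pf by (intro mult_left_mono) auto
  also have "(1/8 :: real) ^ N \<le> exp (-1) ^ N"
  proof (rule power_mono)
    have "exp 1 \<le> (8::real)" using exp_le by simp
    then show "1/8 \<le> exp (-1 :: real)" by (simp add: exp_minus field_simps)
  qed simp
  also have "exp (-1 :: real) ^ N = exp (- (8 * real l) - 1)"
  proof -
    have "exp (-1 :: real) ^ N = exp (real N * (-1))" by (rule exp_of_nat_mult[symmetric])
    also have "real N * (-1) = - (8 * real l) - 1" by (simp add: N_def)
    finally show ?thesis .
  qed
  also have "exp (real l / 2) * exp (- (8 * real l) - 1) * exp (4 * real l) = exp (- (7 / 2 * real l) - 1)"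
    by (simp add: exp_add[symmetric])
  also have "\<dots> \<le> exp (- real l) * exp (y / 2) * (1/2)"
  proof -
    have "exp (- (7 / 2 * real l) - 1) \<le> exp (- (3 / 2 * real l)) * exp (-1)"
      unfolding exp_add[symmetric] by simp
    also have "\<dots> \<le> exp (- real l + y / 2) * (1/2)"
    proof (rule mult_mono)
      show "exp (- (3 / 2 * real l)) \<le> exp (- real l + y / 2)" using y by simp
      show "exp (-1) \<le> (1/2 :: real)" using exp_ge_add_one_self[of "1::real"] by (simp add: exp_minus field_simps)
    qed auto
    finally show ?thesis by (simp only: exp_add)
  qed
  finally have rem: "\<bar>exp t / fact N * (y / 2) ^ N\<bar> \<le> exp (- real l) * exp (y / 2) * (1/2)"
    by (simp add: mult_left_mono mult_right_mono)
  define u where "u = exp (- real l)"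
  have u: "0 < u" "u \<le> 1" by (auto simp: u_def)
  define e where "e = exp (y / 2)"
  have e: "e > 0" by (simp add: e_def)
  have El: "exp_trunc (8 * l) (y / 2) \<ge> e - u * e * (1/2)"
    using t(2) rem unfolding E e_def u_def by linarith
  have "e \<le> (1 + u) * exp_trunc (8 * l) (y / 2)"
  proof -
    have "e \<le> (1 + u) * (e - u * e * (1/2))"
    proof -
      have "u * (u * e) \<le> 1 * (u * e)" using u e by (intro mult_right_mono) auto
      then show ?thesis by (simp add: algebra_simps)
    qed
    also have "\<dots> \<le> (1 + u) * exp_trunc (8 * l) (y / 2)" using El u by (intro mult_left_mono) auto
    finally show ?thesis .
  qed
  then have "e\<^sup>2 \<le> ((1 + u) * exp_trunc (8 * l) (y / 2))\<^sup>2" using e by (intro power_mono) auto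
  moreover have "e\<^sup>2 = exp y" unfolding e_def power2_eq_square by (simp add: exp_add[symmetric])
  ultimately show ?thesis by (simp add: power_mult_distrib u_def)
qed

text \<open>The \<open>\<ell>\<^sup>1\<close> norm \<open>B\<close> of the coefficients and the bound \<open>N\<close> for the products of primes that occur as
  monomials control the error when Legendre symbols are replaced by random signs.\<close>
inductive dpoly :: "nat set \<Rightarrow> real \<Rightarrow> real \<Rightarrow> ((nat \<Rightarrow> real) \<Rightarrow> real) \<Rightarrow> bool" for Q where
  monom: "set_mset M \<subseteq> Q \<Longrightarrow> real (prod_mset M) \<le> N \<Longrightarrow> \<bar>c\<bar> \<le> B \<Longrightarrow> dpoly Q B N (\<lambda>\<epsilon>. c * (\<Prod>q\<in>#M. \<epsilon> q))"
| add: "dpoly Q B1 N F \<Longrightarrow> dpoly Q B2 N G \<Longrightarrow> dpoly Q (B1 + B2) N (\<lambda>\<epsilon>. F \<epsilon> + G \<epsilon>)"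

section \<open>Calculus of short polynomials in the signs\<close>

lemma dpoly_nonneg: "dpoly Q B N F \<Longrightarrow> B \<ge> 0 \<and> N \<ge> 0"
  by (induction rule: dpoly.induct) (auto intro: order.trans[OF abs_ge_zero] order.trans[OF of_nat_0_le_iff])

lemma dpoly_mono: "dpoly Q B N F \<Longrightarrow> B \<le> B' \<Longrightarrow> N \<le> N' \<Longrightarrow> dpoly Q B' N' F"
proof (induction arbitrary: B' rule: dpoly.induct)
  case (add B1 N F B2 G)
  have "dpoly Q (B1 + (B' - B1 - B2)) N' F" by (rule add.IH(1)) (use add.prems in auto)
  moreover have "dpoly Q B2 N' G" by (rule add.IH(2)) (use add.prems in auto)
  ultimately have "dpoly Q (B1 + (B' - B1 - B2) + B2) N' (\<lambda>\<epsilon>. F \<epsilon> + G \<epsilon>)" by (rule dpoly.add)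
  then show ?case by simp
qed (auto intro: dpoly.monom)

lemma dpoly_const: "1 \<le> N \<Longrightarrow> \<bar>c\<bar> \<le> B \<Longrightarrow> dpoly Q B N (\<lambda>\<epsilon>. c)"
  using dpoly.monom[of "{#}" Q N c B] by simp

lemma dpoly_mult:
  assumes "dpoly Q B1 N1 F" "dpoly Q B2 N2 G"
  shows "dpoly Q (B1 * B2) (N1 * N2) (\<lambda>\<epsilon>. F \<epsilon> * G \<epsilon>)"
  using assms
proof (induction rule: dpoly.induct)
  case (monom M N c B)
  from monom(4,1,2,3) show ?case
  proof (induction rule: dpoly.induct)
    case (monom M' N' c' B')
    have "dpoly Q (B * B') (N * N') (\<lambda>\<epsilon>. (c * c') * (\<Prod>q\<in>#M + M'. \<epsilon> q))"
    proof (rule dpoly.monom)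
      show "real (prod_mset (M + M')) \<le> N * N'"
        using monom.hyps(2) monom.prems(2) by (auto intro!: mult_mono order.trans[OF of_nat_0_le_iff])
      show "\<bar>c * c'\<bar> \<le> B * B'"
        using monom.hyps(3) monom.prems(3) by (auto simp: abs_mult intro!: mult_mono order.trans[OF abs_ge_zero])
    qed (use monom in auto)
    then show ?case by (simp add: mult_ac)
  next
    case (add B1 N' F B2 G)
    from dpoly.add[OF add.IH] add.prems show ?case by (simp add: algebra_simps)
  qed
next
  case (add B1 N F B2 G')
  from dpoly.add[OF add.IH] add.prems show ?case by (simp add: algebra_simps)
qed

lemma dpoly_power: "dpoly Q B N F \<Longrightarrow> dpoly Q (B ^ n) (N ^ n) (\<lambda>\<epsilon>. F \<epsilon> ^ n)"
  by (induction n) (auto intro: dpoly_const dpoly_mult)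

lemma dpoly_prod:
  assumes "finite I" "\<And>i. i \<in> I \<Longrightarrow> dpoly Q (B i) (N i) (F i)"
  shows "dpoly Q (\<Prod>i\<in>I. B i) (\<Prod>i\<in>I. N i) (\<lambda>\<epsilon>. \<Prod>i\<in>I. F i \<epsilon>)"
  using assms by (induction I) (auto intro: dpoly_const dpoly_mult)

lemma dpoly_sum:
  assumes "finite I" "\<And>i. i \<in> I \<Longrightarrow> dpoly Q (B i) N (F i)" "1 \<le> N"
  shows "dpoly Q (\<Sum>i\<in>I. B i) N (\<lambda>\<epsilon>. \<Sum>i\<in>I. F i \<epsilon>)"
  using assms by (induction I) (auto intro: dpoly_const dpoly.add)

lemma dpoly_cmult: "dpoly Q B N F \<Longrightarrow> 1 \<le> N \<Longrightarrow> dpoly Q (\<bar>c\<bar> * B) N (\<lambda>\<epsilon>. c * F \<epsilon>)"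
  using dpoly_mult[OF dpoly_const[of 1 c "\<bar>c\<bar>" Q]] by simp

lemma dpoly_linear:
  assumes "finite S" "S \<subseteq> Q" "\<And>q. q \<in> S \<Longrightarrow> real q \<le> N" "1 \<le> N" "(\<Sum>q\<in>S. \<bar>c q\<bar>) \<le> B"
  shows "dpoly Q B N (\<lambda>\<epsilon>. \<Sum>q\<in>S. c q * \<epsilon> q)"
proof -
  have "dpoly Q (\<Sum>q\<in>S. \<bar>c q\<bar>) N (\<lambda>\<epsilon>. \<Sum>q\<in>S. c q * \<epsilon> q)"
  proof (rule dpoly_sum)
    fix q assume "q \<in> S"
    then show "dpoly Q \<bar>c q\<bar> N (\<lambda>\<epsilon>. c q * \<epsilon> q)"
      using dpoly.monom[of "{#q#}" Q N "c q" "\<bar>c q\<bar>"] assms by auto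
  qed (use assms in auto)
  then show ?thesis using assms(5) by (rule dpoly_mono) simp
qed

text \<open>Because of \<open>B \<le> x / 2\<close> the k-th term has norm at most
  \<open>(x / 4) ^ k\<close>, so the norm of the whole polynomial is bounded by the same
  \<open>x ^ n\<close> as its monomials.\<close>

lemma dpoly_exp_trunc:
  assumes "dpoly Q B x F" "B \<le> x / 2" "x \<ge> 2" "n \<ge> 1"
  shows "dpoly Q (x ^ n) (x ^ n) (\<lambda>\<epsilon>. exp_trunc n (F \<epsilon> / 2))"
proof -
  have B0: "B \<ge> 0" using dpoly_nonneg[OF assms(1)] by simp
  have "dpoly Q (\<Sum>k\<le>n. \<bar>1 / (2 ^ k * fact k)\<bar> * B ^ k) (x ^ n) (\<lambda>\<epsilon>. \<Sum>k\<le>n. (1 / (2 ^ k * fact k)) * F \<epsilon> ^ k)"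
  proof (rule dpoly_sum)
    fix k assume k: "k \<in> {..n}"
    have "1 \<le> x ^ n" using assms by simp
    moreover have "x ^ k \<le> x ^ n" using assms k by (intro power_increasing) auto
    ultimately show "dpoly Q (\<bar>1 / (2 ^ k * fact k)\<bar> * B ^ k) (x ^ n) (\<lambda>\<epsilon>. (1 / (2 ^ k * fact k)) * F \<epsilon> ^ k)"
      using assms(1) by (intro dpoly_cmult dpoly_mono[OF dpoly_power[OF assms(1)]]) auto
  qed (use assms in auto)
  moreover have "(\<lambda>\<epsilon>. \<Sum>k\<le>n. (1 / (2 ^ k * fact k)) * F \<epsilon> ^ k) = (\<lambda>\<epsilon>. exp_trunc n (F \<epsilon> / 2))"
    by (simp add: exp_trunc_def power_divide)
  moreover have "(\<Sum>k\<le>n. \<bar>1 / (2 ^ k * fact k)\<bar> * B ^ k) \<le> x ^ n"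
  proof -
    have "(\<Sum>k\<le>n. \<bar>1 / (2 ^ k * fact k)\<bar> * B ^ k) = (\<Sum>k\<le>n. (B / 2) ^ k / fact k)"
      by (simp add: power_divide)
    also have "\<dots> \<le> (\<Sum>k\<le>n. (x / 4) ^ k)"
    proof (rule sum_mono)
      fix k
      have "(B / 2) ^ k / fact k \<le> (B / 2) ^ k / 1" using B0 by (intro divide_left_mono) (auto simp: fact_ge_1)
      also have "\<dots> \<le> (x / 4) ^ k" using B0 assms by (simp add: power_mono)
      finally show "(B / 2) ^ k / fact k \<le> (x / 4) ^ k" .
    qed
    also have "\<dots> \<le> x ^ n"
      using assms(4)
    proof (induction n rule: dec_induct)
      case base
      then show ?case using assms(3) by simp
    next
      case (step n)
      have "(x / 4) ^ Suc n \<le> (x / 2) ^ Suc n" using assms(3) by (intro power_mono) auto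
      also have "\<dots> = x * x ^ n / (2 * 2 ^ n)" by (simp add: power_divide)
      also have "\<dots> \<le> x * x ^ n / 2" using assms(3) by (intro divide_left_mono) auto
      finally have "(x / 4) ^ Suc n \<le> x * x ^ n / 2" .
      moreover have "2 * x ^ n \<le> x * x ^ n" using assms(3) by (intro mult_right_mono) auto
      ultimately show ?case using step by simp
    qed
    finally show ?thesis .
  qed
  ultimately have "dpoly Q (\<Sum>k\<le>n. \<bar>1 / (2 ^ k * fact k)\<bar> * B ^ k) (x ^ n) (\<lambda>\<epsilon>. exp_trunc n (F \<epsilon> / 2))"
    and "(\<Sum>k\<le>n. \<bar>1 / (2 ^ k * fact k)\<bar> * B ^ k) \<le> x ^ n" by simp_all
  then show ?thesis by (rule dpoly_mono) simp
qed

text \<open>A monomial costs at most \<open>Er\<close> times its coefficient, and the coefficients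
  have total size at most \<open>B\<close>.\<close>

lemma dpoly_transfer:
  fixes \<omega> :: "'d \<Rightarrow> real" and \<epsilon> :: "'d \<Rightarrow> nat \<Rightarrow> real"
  assumes F: "dpoly Q B N F" and fin: "finite Q"
    and err: "\<And>M. set_mset M \<subseteq> Q \<Longrightarrow> real (prod_mset M) \<le> N \<Longrightarrow>
       \<bar>(\<Sum>d\<in>D. \<omega> d * (\<Prod>q\<in>#M. \<epsilon> d q)) - W * (if \<forall>q. even (count M q) then 1 else 0)\<bar> \<le> Er"
  shows "\<bar>(\<Sum>d\<in>D. \<omega> d * F (\<epsilon> d)) - W * sE Q F\<bar> \<le> B * Er"
  using F err
proof (induction rule: dpoly.induct)
  case (monom M N c B)
  have "(\<Sum>d\<in>D. \<omega> d * (c * (\<Prod>q\<in>#M. \<epsilon> d q))) - W * sE Q (\<lambda>\<epsilon>. c * (\<Prod>q\<in>#M. \<epsilon> q)) =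
     c * ((\<Sum>d\<in>D. \<omega> d * (\<Prod>q\<in>#M. \<epsilon> d q)) - W * (if \<forall>q. even (count M q) then 1 else 0))"
    unfolding sE_cmult sE_monomial[OF fin monom(1)] right_diff_distrib sum_distrib_left by (simp add: mult_ac)
  also have "\<bar>\<dots>\<bar> \<le> B * Er"
    unfolding abs_mult using monom.prems[OF monom(1,2)] monom(3) by (intro mult_mono) auto
  finally show ?case .
next
  case (add B1 N F B2 G)
  have "(\<Sum>d\<in>D. \<omega> d * (F (\<epsilon> d) + G (\<epsilon> d))) - W * sE Q (\<lambda>\<epsilon>. F \<epsilon> + G \<epsilon>) =
     ((\<Sum>d\<in>D. \<omega> d * F (\<epsilon> d)) - W * sE Q F) + ((\<Sum>d\<in>D. \<omega> d * G (\<epsilon> d)) - W * sE Q G)"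
    by (simp add: sE_add algebra_simps sum.distrib)
  also have "\<bar>\<dots>\<bar> \<le> B1 * Er + B2 * Er"
    using add by (intro order.trans[OF abs_triangle_ineq] add_mono) auto
  finally show ?case by (simp add: algebra_simps)
qed

section \<open>A bound by short sums over primes\<close>

definition odd_primes :: "real \<Rightarrow> nat set" where
  "odd_primes x = {q. prime q \<and> q > 2 \<and> real q \<le> x}"

lemma finite_odd_primes [simp]: "finite (odd_primes x)"
  by (rule finite_subset[OF _ finite_primes_upto[of x]]) (auto simp: odd_primes_def)

text \<open>The coefficient at a prime of the smoothed polynomial with cut-off \<open>exp L\<close>,
  where the weight \<open>mangoldt q / ln q\<close> is 1.\<close>

definition prime_coeff :: "real \<Rightarrow> real \<Rightarrow> nat \<Rightarrow> real" where
  "prime_coeff \<delta> L q = real q powr - (1/2 + \<delta> / L) * jft (6 * ln (real q) / L)"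

text \<open>\<open>e p\<close> is the square of a character value, hence 1 outside the finite set
  \<open>E\<close> of primes dividing the discriminant. Replacing the smooth weights by
  \<open>1 / p\<close> costs \<open>ln p / (L * p)\<close> per prime up to constants, as
  \<open>jft\<close> is Lipschitz at 0; extending the range from \<open>exp (L / 2)\<close> to
  \<open>X\<close> costs a multiple of \<open>ln X / L\<close> by the Mertens-type bound. Bounded
  errors are absorbed since \<open>ln X / L \<ge> 1\<close>.\<close>

lemma prime_squares_bound:
  assumes d: "\<delta> > 0"
  obtains C where "C > 0"
    "\<And>L X t B e E. \<lbrakk>L \<ge> 1; L \<le> ln X; X > 0; B = {p. prime p \<and> real (p\<^sup>2) \<le> exp L};
        finite E; (\<Sum>p\<in>E. 1 / real p) \<le> 1; \<And>p. p \<in> B - E \<Longrightarrow> e p = 1; \<And>p. p \<in> B \<Longrightarrow> e p \<in> {0, 1}\<rbrakk> \<Longrightarrow>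
      (\<Sum>p\<in>B. e p * jft (12 * ln (real p) / L) * real p powr - (1 + 2 * \<delta> / L) * cos (t * ln (real p)))
        \<le> prime_cos X t + C * ln X / L"
proof -
  obtain Cj where Cj: "Cj > 0" "\<And>u. \<bar>1 - jft u\<bar> \<le> Cj * \<bar>u\<bar>" by (rule jft_near_0) (rule that; assumption)
  define C where "C = (12 * Cj + 2 * \<delta>) * 18 + 2 + 36"
  have main: "(\<Sum>p\<in>B. e p * jft (12 * ln (real p) / L) * real p powr - (1 + 2 * \<delta> / L) * cos (t * ln (real p)))
        \<le> prime_cos X t + C * ln X / L"
    if L: "L \<ge> 1" "L \<le> ln X" and X: "X > 0" and B: "B = {p. prime p \<and> real (p\<^sup>2) \<le> exp L}"
      and E: "finite E" "(\<Sum>p\<in>E. 1 / real p) \<le> 1" and e: "\<And>p. p \<in> B - E \<Longrightarrow> e p = 1" "\<And>p. p \<in> B \<Longrightarrow> e p \<in> {0, 1}"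
    for L X t B e E
  proof -
    have B1: "B \<subseteq> primes_upto (exp L)"
    proof
      fix p assume p: "p \<in> B"
      then have "p \<ge> 1" using B prime_ge_1_nat by auto
      then have "real p \<le> real p ^ 2" by (intro self_le_power) auto
      moreover have "prime p" "real p ^ 2 \<le> exp L" using p B by auto
      ultimately have "prime p" "real p \<le> exp L" using order.trans by blast+
      then show "p \<in> primes_upto (exp L)" by simp
    qed
    have eX: "exp L \<le> X" using L X by (simp add: ln_ge_iff)
    have B2: "B \<subseteq> primes_upto X" using B1 eX by force
    have fB: "finite B" by (rule finite_subset[OF B1 finite_primes_upto])
    have pp: "real p \<ge> 1" "ln (real p) \<ge> 0" if "p \<in> primes_upto X" for p using that prime_ge_1_nat[of p] by auto
    define u where "u = (\<lambda>p. e p * jft (12 * ln (real p) / L) * real p powr - (1 + 2 * \<delta> / L) * cos (t * ln (real p)))"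
    have one: "u p \<le> cos (t * ln (real p)) / real p + (12 * Cj + 2 * \<delta>) / L * (ln (real p) / real p) + (if p \<in> E then 2 / real p else 0)"
      if p: "p \<in> B" for p
    proof -
      have p1: "real p \<ge> 1" "ln (real p) \<ge> 0" using pp p B2 by auto
      define w where "w = real p powr (- (2 * \<delta> / L))"
      have w: "w > 0" "w \<le> 1" "1 - w \<le> 2 * \<delta> / L * ln (real p)"
      proof -
        have we: "w = exp (- (2 * \<delta> / L * ln (real p)))" using p1 by (simp add: w_def powr_def)
        have n: "2 * \<delta> / L * ln (real p) \<ge> 0" using d L p1 by simp
        show "w > 0" by (simp add: we)
        show "w \<le> 1" unfolding we using n by (subst exp_le_one_iff) linarith
        show "1 - w \<le> 2 * \<delta> / L * ln (real p)" unfolding we using exp_ge_add_one_self[of "- (2 * \<delta> / L * ln (real p))"] by linarith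
      qed
      have sp: "real p powr - (1 + 2 * \<delta> / L) = w / real p"
      proof -
        have "real p powr (- (1 + 2 * \<delta> / L)) = real p powr ((- (2 * \<delta> / L)) + (- 1))" by (simp add: algebra_simps)
        also have "\<dots> = w * real p powr (-1)" unfolding w_def by (rule powr_add)
        finally show ?thesis using p1 by (simp add: powr_minus divide_inverse)
      qed
      define J where "J = jft (12 * ln (real p) / L)"
      have J: "\<bar>1 - J\<bar> \<le> 12 * Cj / L * ln (real p)"
      proof -
        have "\<bar>12 * ln (real p) / L\<bar> = 12 * ln (real p) / L" using p1 L by simp
        then show ?thesis using Cj(2)[of "12 * ln (real p) / L"] by (simp add: J_def mult_ac)
      qed
      define c where "c = cos (t * ln (real p))"
      have c: "\<bar>c\<bar> \<le> 1" by (simp add: c_def)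
      have Jw: "\<bar>1 - J * w\<bar> \<le> (12 * Cj + 2 * \<delta>) / L * ln (real p)"
      proof -
        have "1 - J * w = (1 - J) * w + (1 - w)" by (simp add: algebra_simps)
        then have "\<bar>1 - J * w\<bar> \<le> \<bar>1 - J\<bar> * w + (1 - w)" using w abs_triangle_ineq[of "(1 - J) * w" "1 - w"] by (simp add: abs_mult)
        also have "\<bar>1 - J\<bar> * w \<le> \<bar>1 - J\<bar> * 1" using w by (intro mult_left_mono) auto
        also have "\<bar>1 - J\<bar> * 1 + (1 - w) \<le> 12 * Cj / L * ln (real p) + 2 * \<delta> / L * ln (real p)" using J w by simp
        finally show ?thesis by (simp add: add_divide_distrib ring_distribs)
      qed
      have main: "J * w * c \<le> c + (12 * Cj + 2 * \<delta>) / L * ln (real p)"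
      proof -
        have "c - J * w * c = (1 - J * w) * c" by (simp add: algebra_simps)
        moreover have "\<bar>(1 - J * w) * c\<bar> \<le> \<bar>1 - J * w\<bar> * 1" unfolding abs_mult using c by (intro mult_left_mono) auto
        moreover have "- ((1 - J * w) * c) \<le> \<bar>(1 - J * w) * c\<bar>" by (rule abs_ge_minus_self)
        ultimately have "- (c - J * w * c) \<le> \<bar>1 - J * w\<bar>" by simp
        then show ?thesis using Jw by linarith
      qed
      have nn: "0 \<le> (12 * Cj + 2 * \<delta>) / L * ln (real p)" using Cj d L p1 by simp
      have "e p * J * w * c \<le> c + (12 * Cj + 2 * \<delta>) / L * ln (real p) + (if p \<in> E then 2 else 0)"
      proof (cases "p \<in> E")
        case False
        then show ?thesis using e(1)[of p] p main by simp
      next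
        case True
        have "e p = 0 \<or> e p = 1" using e(2)[OF p] by auto
        then show ?thesis using True main nn c by (auto simp: abs_le_iff)
      qed
      then have "e p * J * w * c / real p \<le> (c + (12 * Cj + 2 * \<delta>) / L * ln (real p) + (if p \<in> E then 2 else 0)) / real p"
        using p1 by (intro divide_right_mono) auto
      also have "\<dots> = c / real p + (12 * Cj + 2 * \<delta>) / L * (ln (real p) / real p) + (if p \<in> E then 2 / real p else 0)"
        by (simp add: add_divide_distrib)
      finally show ?thesis unfolding u_def sp J_def c_def by simp
    qed
    have lX: "ln X / L \<ge> 1" using L by simp
    have "(\<Sum>p\<in>B. u p) \<le> (\<Sum>p\<in>B. cos (t * ln (real p)) / real p + (12 * Cj + 2 * \<delta>) / L * (ln (real p) / real p) + (if p \<in> E then 2 / real p else 0))"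
      by (rule sum_mono) (rule one)
    also have "\<dots> = (\<Sum>p\<in>B. cos (t * ln (real p)) / real p) + (12 * Cj + 2 * \<delta>) / L * (\<Sum>p\<in>B. ln (real p) / real p) + (\<Sum>p\<in>B. if p \<in> E then 2 / real p else 0)"
      by (simp only: sum.distrib sum_distrib_left)
    also have "(\<Sum>p\<in>B. if p \<in> E then 2 / real p else 0) \<le> 2"
    proof -
      have "(\<Sum>p\<in>B. if p \<in> E then 2 / real p else 0) = (\<Sum>p\<in>B \<inter> E. 2 / real p)"
        using fB by (simp add: sum.inter_restrict)
      also have "\<dots> \<le> (\<Sum>p\<in>E. 2 / real p)" using E by (intro sum_mono2) auto
      also have "\<dots> = 2 * (\<Sum>p\<in>E. 1 / real p)" by (simp add: sum_distrib_left)
      finally show ?thesis using E by linarith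
    qed
    also have "(12 * Cj + 2 * \<delta>) / L * (\<Sum>p\<in>B. ln (real p) / real p) \<le> (12 * Cj + 2 * \<delta>) / L * (18 * L)"
    proof (rule mult_left_mono)
      have "(\<Sum>p\<in>B. ln (real p) / real p) \<le> (\<Sum>p\<in>primes_upto (exp L). ln (real p) / real p)"
        using B1 pp eX by (intro sum_mono2) (auto intro!: divide_nonneg_nonneg)
      also have "\<dots> \<le> 18 * ln (exp L)" using L by (intro sum_ln_over_primes) auto
      finally show "(\<Sum>p\<in>B. ln (real p) / real p) \<le> 18 * L" by simp
    qed (use Cj d L in auto)
    also have "(\<Sum>p\<in>B. cos (t * ln (real p)) / real p) \<le> prime_cos X t + 36 * ln X / L"
    proof -
      have sp: "prime_cos X t = (\<Sum>p\<in>B. cos (t * ln (real p)) / real p) + (\<Sum>p\<in>primes_upto X - B. cos (t * ln (real p)) / real p)"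
        unfolding prime_cos_def by (subst sum.subset_diff[OF B2]) auto
      have "- (\<Sum>p\<in>primes_upto X - B. cos (t * ln (real p)) / real p) \<le> (\<Sum>p\<in>primes_upto X - B. 2 / L * (ln (real p) / real p))"
        unfolding sum_negf[symmetric]
      proof (rule sum_mono)
        fix p assume p: "p \<in> primes_upto X - B"
        have p1: "real p \<ge> 1" using pp[of p] p by auto
        have "real (p\<^sup>2) > exp L" using p B by auto
        then have "ln (exp L) < ln (real (p\<^sup>2))" using p1 by (subst ln_less_cancel_iff) auto
        then have l2: "L < 2 * ln (real p)" using p1 by (simp add: ln_realpow)
        have "- cos (t * ln (real p)) \<le> 1" by (metis cos_ge_minus_one minus_le_iff)
        also have "1 \<le> 2 / L * ln (real p)" using l2 L by (simp add: field_simps)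
        finally have "- cos (t * ln (real p)) / real p \<le> 2 / L * ln (real p) / real p" using p1 by (intro divide_right_mono) auto
        then show "- (cos (t * ln (real p)) / real p) \<le> 2 / L * (ln (real p) / real p)" by simp
      qed
      also have "\<dots> \<le> (\<Sum>p\<in>primes_upto X. 2 / L * (ln (real p) / real p))"
        using pp L by (intro sum_mono2) auto
      also have "\<dots> = 2 / L * (\<Sum>p\<in>primes_upto X. ln (real p) / real p)" by (simp only: sum_distrib_left)
      also have "\<dots> \<le> 2 / L * (18 * ln X)" using L X by (intro mult_left_mono sum_ln_over_primes) auto
      finally show ?thesis using sp by simp
    qed
    finally have "(\<Sum>p\<in>B. u p) \<le> prime_cos X t + 36 * ln X / L + (12 * Cj + 2 * \<delta>) / L * (18 * L) + 2"
      by simp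
    also have "(12 * Cj + 2 * \<delta>) / L * (18 * L) = (12 * Cj + 2 * \<delta>) * 18 * 1" using L by simp
    also have "prime_cos X t + 36 * ln X / L + (12 * Cj + 2 * \<delta>) * 18 * 1 + 2 \<le> prime_cos X t + 36 * ln X / L + (12 * Cj + 2 * \<delta>) * 18 * (ln X / L) + 2 * (ln X / L)"
      using lX Cj d by (intro add_mono mult_left_mono) auto
    also have "\<dots> = prime_cos X t + C * ln X / L" by (simp add: C_def algebra_simps add_divide_distrib)
    finally show ?thesis by (simp add: u_def)
  qed
  have "C > 0" using Cj d by (simp add: C_def add_pos_pos)
  then show thesis by (rule that) (rule main)
qed

text \<open>Prime powers are sorted by exponent. Primes form the part that varies with
  \<open>d\<close>; squares give a term that hardly depends on \<open>d\<close> because the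
  character is quadratic; higher powers converge absolutely on the critical line.\<close>

lemma dirichlet_L_prime_bound:
  assumes A: "A > 0"
  obtains C \<delta> :: real where "C > 0" "\<delta> > 0"
    "\<And>d t L X. \<lbrakk>GRH; prime d; d > 2; real d \<le> X; 1 \<le> L; L \<le> ln X; \<bar>t\<bar> \<le> X powr A\<rbrakk> \<Longrightarrow>
      cmod (dirichlet_L (kron_char (8 * int d)) (Complex (1/2) t)) \<le>
        exp ((\<Sum>q\<in>odd_primes (exp L). prime_coeff \<delta> L q * cos (t * ln (real q)) * leg_sign d q)
              + prime_cos X (2 * t) / 2 + C * ln X / L)"
proof -
  obtain C0 \<delta> :: real where C0: "C0 > 0" "\<delta> > 0"
    "\<And>q chi t x. \<lbrakk>GRH; dirichlet_char q chi; \<not> principal_char q chi; ln x \<ge> 1; x > 0\<rbrakk> \<Longrightarrow>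
      cmod (dirichlet_L chi (Complex (1/2) t)) \<le> exp (Re (\<Sum>n=1..nat \<lfloor>x\<rfloor>.
         of_real (mangoldt n / ln (real n)) * chi n * of_real (jft (6 * ln (real n) / ln x))
           * of_nat n powr (- Complex (1/2 + \<delta> / ln x) t)) + C0 + C0 * cond_log q t / ln x)"
    by (rule dirichlet_L_upper_bound) (rule that; assumption)
  obtain C1 where C1: "C1 > 0" "\<And>F. finite F \<Longrightarrow> F \<subseteq> {p ^ k | p k. prime p \<and> k \<ge> 3} \<Longrightarrow> (\<Sum>n\<in>F. real n powr (-(1/2))) \<le> C1"
    by (rule prime_power_sum_bound[of "1/2" 3]) auto
  obtain C2 where C2: "C2 > 0"
    "\<And>L X t B e E. \<lbrakk>L \<ge> 1; L \<le> ln X; X > 0; B = {p. prime p \<and> real (p\<^sup>2) \<le> exp L};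
        finite E; (\<Sum>p\<in>E. 1 / real p) \<le> 1; \<And>p. p \<in> B - E \<Longrightarrow> e p = 1; \<And>p. p \<in> B \<Longrightarrow> e p \<in> {0, 1}\<rbrakk> \<Longrightarrow>
      (\<Sum>p\<in>B. e p * jft (12 * ln (real p) / L) * real p powr - (1 + 2 * \<delta> / L) * cos (t * ln (real p)))
        \<le> prime_cos X t + C2 * ln X / L"
  proof (rule prime_squares_bound[OF C0(2)])
    fix C2 :: real
    assume a: "C2 > 0" and b: "\<And>L X t B e E. \<lbrakk>L \<ge> 1; L \<le> ln X; X > 0; B = {p. prime p \<and> real (p\<^sup>2) \<le> exp L};
        finite E; (\<Sum>p\<in>E. 1 / real p) \<le> 1; \<And>p. p \<in> B - E \<Longrightarrow> e p = 1; \<And>p. p \<in> B \<Longrightarrow> e p \<in> {0, 1}\<rbrakk> \<Longrightarrow>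
      (\<Sum>p\<in>B. e p * jft (12 * ln (real p) / L) * real p powr - (1 + 2 * \<delta> / L) * cos (t * ln (real p)))
        \<le> prime_cos X t + C2 * ln X / L"
    show thesis by (rule that[OF a]) (rule b)
  qed
  define C where "C = C0 + C0 * (7 + A) + C1 + C2"
  have main: "cmod (dirichlet_L (kron_char (8 * int d)) (Complex (1/2) t)) \<le>
        exp ((\<Sum>q\<in>odd_primes (exp L). prime_coeff \<delta> L q * cos (t * ln (real q)) * leg_sign d q)
              + prime_cos X (2 * t) / 2 + C * ln X / L)"
    if grh: GRH and d: "prime d" "d > 2" "real d \<le> X" and L: "1 \<le> L" "L \<le> ln X" and t: "\<bar>t\<bar> \<le> X powr A" for d t L X
  proof -
    have X: "X > 0" using d by linarith
    have X1: "X \<ge> 1" using L X ln_ge_zero_iff[of X] by linarith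
    have lX: "ln X / L \<ge> 1" using L by simp
    define chi where "chi = kron_char (8 * int d)"
    note c = kron_char_8p(1)[OF d(1,2), folded chi_def]
    note np = kron_char_8p(2)[OF d(1,2), folded chi_def]
    define \<eta> where "\<eta> = (\<lambda>n. real_of_int (kronecker (8 * int d) n))"
    have chi_eta: "chi n = of_real (\<eta> n)" for n by (simp add: chi_def \<eta>_def kron_char_def)
    have eta1: "\<bar>\<eta> n\<bar> \<le> 1" for n using dirichlet_char_norm[OF c, of n] by (simp add: chi_eta)
    have eta_leg: "\<eta> q = leg_sign d q" if "prime q" "q > 2" for q
    proof -
      have "chi q = of_int (Legendre (8 * int d) (int q))" unfolding chi_def by (rule kron_char_8p(3)[OF d(1,2) that])
      then have "complex_of_real (\<eta> q) = complex_of_real (leg_sign d q)" by (simp add: chi_eta leg_sign_def)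
      then show ?thesis by (simp only: of_real_eq_iff)
    qed
    have eta2: "\<eta> 2 = 0" using kron_char_8p(4)[OF d(1,2)] by (simp add: \<eta>_def kron_char_def)
    have eta_sq: "\<eta> (p\<^sup>2) = (\<eta> p)\<^sup>2" for p
    proof -
      have "complex_of_real (\<eta> (p\<^sup>2)) = complex_of_real ((\<eta> p)\<^sup>2)"
        using dirichlet_char_power[OF c, of p 2] by (simp add: chi_eta)
      then show ?thesis by (simp only: of_real_eq_iff)
    qed
    define T where "T = (\<lambda>n. mangoldt n / ln (real n) * \<eta> n * jft (6 * ln (real n) / L) * real n powr - (1/2 + \<delta> / L) * cos (t * ln (real n)))"
    define N where "N = nat \<lfloor>exp L\<rfloor>"
    have ReT: "Re (of_real (mangoldt n / ln (real n)) * chi n * of_real (jft (6 * ln (real n) / L)) * of_nat n powr (- Complex (1/2 + \<delta> / L) t)) = T n" if "n \<ge> 1" for n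
    proof -
      have "of_nat n powr (- Complex (1/2 + \<delta> / L) t) = exp (- Complex (1/2 + \<delta> / L) t * of_real (ln (real n)))"
        using that by (simp add: powr_def Ln_of_nat)
      then have "Re (of_nat n powr (- Complex (1/2 + \<delta> / L) t)) = exp (- ((1/2 + \<delta> / L) * ln (real n))) * cos (t * ln (real n))"
        by (simp add: Re_exp)
      also have "exp (- ((1/2 + \<delta> / L) * ln (real n))) = real n powr - (1/2 + \<delta> / L)" using that by (simp add: powr_def algebra_simps)
      finally have r: "Re (of_nat n powr (- Complex (1/2 + \<delta> / L) t)) = real n powr - (1/2 + \<delta> / L) * cos (t * ln (real n))" .
      have "of_real (mangoldt n / ln (real n)) * chi n * of_real (jft (6 * ln (real n) / L)) * of_nat n powr (- Complex (1/2 + \<delta> / L) t)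
        = of_real (mangoldt n / ln (real n) * \<eta> n * jft (6 * ln (real n) / L)) * of_nat n powr (- Complex (1/2 + \<delta> / L) t)"
        unfolding chi_eta by (simp only: of_real_mult)
      then show ?thesis unfolding T_def by (simp only: Re_complex_of_real times_complex.sel complex.sel Im_complex_of_real r mult_zero_left diff_zero)
    qed
    have b0: "cmod (dirichlet_L chi (Complex (1/2) t)) \<le> exp ((\<Sum>n=1..N. T n) + C0 + C0 * cond_log (8 * d) t / L)"
    proof -
      have "Re (\<Sum>n=1..N. of_real (mangoldt n / ln (real n)) * chi n * of_real (jft (6 * ln (real n) / L)) * of_nat n powr (- Complex (1/2 + \<delta> / L) t)) = (\<Sum>n=1..N. T n)"
        unfolding Re_sum by (rule sum.cong) (use ReT in auto)
      then show ?thesis using C0(3)[OF grh c np, of "exp L" t] L by (simp add: N_def)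
    qed
    \<comment> \<open>One \<open>ln X\<close> comes from \<open>d\<close> and
      \<open>A * ln X\<close> from \<open>t\<close>; the constant \<open>ln 32 = 5 * ln 2\<close> is
      covered by the remaining \<open>6 * ln X\<close>.\<close>
    have cl: "cond_log (8 * d) t \<le> (7 + A) * ln X"
    proof -
      have p1: "X powr A \<ge> 1" using X1 A by (intro ge_one_powr_ge_zero) auto
      have "cond_log (8 * d) t \<le> ln (32 * (X * X powr A))" unfolding cond_log_def
      proof (subst ln_le_cancel_iff)
        have "real (8 * d) * (\<bar>t\<bar> + 3) \<le> (8 * X) * (4 * X powr A)" using d t p1 by (intro mult_mono) auto
        then show "real (8 * d) * (\<bar>t\<bar> + 3) \<le> 32 * (X * X powr A)" by simp
      qed (use d X in \<open>auto intro!: mult_pos_pos\<close>)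
      also have "\<dots> = ln 32 + ln X + A * ln X" using X by (simp add: ln_mult ln_powr)
      also have "ln (32 :: real) = 5 * ln 2" using ln_realpow[of "2::real" 5] by simp
      also have "5 * ln (2::real) \<le> 6 * ln X" using ln_le_minus_one[of "2::real"] L by simp
      finally show ?thesis by (simp add: algebra_simps)
    qed
    have C0cl: "C0 * cond_log (8 * d) t / L \<le> C0 * (7 + A) * ln X / L"
      using cl C0 L by (simp add: divide_right_mono mult_left_mono mult.assoc)
    define A1 where "A1 = {n \<in> {1..N}. prime n}"
    define B where "B = {p. prime p \<and> real (p\<^sup>2) \<le> exp L}"
    define A2 where "A2 = (\<lambda>p. p\<^sup>2) ` B"
    have N_iff: "n \<le> N \<longleftrightarrow> real n \<le> exp L" for n unfolding N_def by (simp add: le_nat_iff le_floor_iff)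
    have A2sub: "A2 \<subseteq> {1..N}"
      unfolding A2_def B_def using N_iff by (auto simp: prime_gt_0_nat Suc_le_eq simp del: of_nat_power)
    have disj: "A1 \<inter> A2 = {}" unfolding A1_def A2_def B_def by (auto simp: prime_power_iff)
    have split: "(\<Sum>n=1..N. T n) = (\<Sum>n\<in>A1. T n) + (\<Sum>n\<in>A2. T n) + (\<Sum>n\<in>{1..N} - (A1 \<union> A2). T n)"
    proof -
      have "(\<Sum>n=1..N. T n) = (\<Sum>n\<in>{1..N} - (A1 \<union> A2). T n) + (\<Sum>n\<in>A1 \<union> A2. T n)"
        using A2sub by (intro sum.subset_diff) (auto simp: A1_def)
      also have "(\<Sum>n\<in>A1 \<union> A2. T n) = (\<Sum>n\<in>A1. T n) + (\<Sum>n\<in>A2. T n)"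
        using disj finite_subset[OF A2sub] by (intro sum.union_disjoint) (auto simp: A1_def)
      finally show ?thesis by simp
    qed
    have s1: "(\<Sum>n\<in>A1. T n) = (\<Sum>q\<in>odd_primes (exp L). prime_coeff \<delta> L q * cos (t * ln (real q)) * leg_sign d q)"
    proof -
      have "(\<Sum>n\<in>A1. T n) = (\<Sum>n\<in>odd_primes (exp L). T n)"
      proof (rule sum.mono_neutral_right)
        show "odd_primes (exp L) \<subseteq> A1" unfolding A1_def odd_primes_def using N_iff by (auto simp: Suc_le_eq prime_gt_0_nat)
        have "n = 2" if "n \<in> A1 - odd_primes (exp L)" for n
        proof -
          have "prime n" "n \<le> N" "\<not> (n > 2 \<and> real n \<le> exp L)" using that by (auto simp: A1_def odd_primes_def)
          then show ?thesis using N_iff[of n] prime_ge_2_nat[of n] by auto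
        qed
        then show "\<forall>i\<in>A1 - odd_primes (exp L). T i = 0" using eta2 by (auto simp: T_def)
      qed (simp add: A1_def)
      also have "\<dots> = (\<Sum>q\<in>odd_primes (exp L). prime_coeff \<delta> L q * cos (t * ln (real q)) * leg_sign d q)"
      proof (rule sum.cong)
        fix q assume "q \<in> odd_primes (exp L)"
        then have q: "prime q" "q > 2" by (auto simp: odd_primes_def)
        have "mangoldt q / ln (real q) = (1 :: real)" using q by simp
        then show "T q = prime_coeff \<delta> L q * cos (t * ln (real q)) * leg_sign d q"
          unfolding T_def prime_coeff_def eta_leg[OF q] by simp
      qed simp
      finally show ?thesis .
    qed
    have s3: "(\<Sum>n\<in>{1..N} - (A1 \<union> A2). T n) \<le> C1"
    proof -
      define F where "F = {n \<in> {1..N} - (A1 \<union> A2). primepow n}"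
      have "(\<Sum>n\<in>{1..N} - (A1 \<union> A2). T n) = (\<Sum>n\<in>F. T n)"
        unfolding F_def by (rule sum.mono_neutral_right) (auto simp: T_def mangoldt_def)
      also have "\<dots> \<le> (\<Sum>n\<in>F. real n powr (-(1/2)))"
      proof (rule sum_mono)
        fix n assume n: "n \<in> F"
        then have n1: "n > 1" "real n \<ge> 1" using primepow_gt_Suc_0[of n] by (auto simp: F_def)
        have a: "\<bar>mangoldt n / ln (real n)\<bar> \<le> 1" using mangoldt_le[of n] mangoldt_nonneg[of n] n1 by simp
        have p: "real n powr - (1/2 + \<delta> / L) \<le> real n powr (-(1/2))" using n1 C0 L by (intro powr_mono) auto
        have "T n \<le> \<bar>mangoldt n / ln (real n)\<bar> * \<bar>\<eta> n\<bar> * \<bar>jft (6 * ln (real n) / L)\<bar> * real n powr - (1/2 + \<delta> / L) * \<bar>cos (t * ln (real n))\<bar>"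
          unfolding T_def by (rule order.trans[OF abs_ge_self]) (simp add: abs_mult)
        also have "\<dots> \<le> 1 * 1 * 1 * real n powr (-(1/2)) * 1"
          using a eta1 jft_abs_le_1 p by (intro mult_mono) auto
        finally show "T n \<le> real n powr (-(1/2))" by simp
      qed
      also have "\<dots> \<le> C1"
      proof (rule C1(2))
        show "F \<subseteq> {p ^ k | p k. prime p \<and> k \<ge> 3}"
        proof
          fix n assume n: "n \<in> F"
          then obtain p k where pk: "prime p" "k > 0" "n = p ^ k" by (auto simp: F_def primepow_def)
          have nN: "1 \<le> n" "n \<le> N" using n by (auto simp: F_def)
          have "k \<noteq> 1"
          proof
            assume "k = 1"
            then have "n \<in> A1" using pk nN by (simp add: A1_def)
            then show False using n by (simp add: F_def)
          qed
          moreover have "k \<noteq> 2"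
          proof
            assume k: "k = 2"
            have "real (p\<^sup>2) \<le> exp L" using nN pk k N_iff[of n] by simp
            then have "n \<in> A2" unfolding A2_def B_def using pk k by auto
            then show False using n by (simp add: F_def)
          qed
          ultimately have "k \<ge> 3" using pk by simp
          then show "n \<in> {p ^ k | p k. prime p \<and> k \<ge> 3}" using pk by auto
        qed
      qed (simp add: F_def)
      finally show ?thesis .
    qed
    have s2: "(\<Sum>n\<in>A2. T n) \<le> prime_cos X (2 * t) / 2 + C2 * ln X / L"
    proof -
      have "(\<Sum>n\<in>A2. T n) = (\<Sum>p\<in>B. T (p\<^sup>2))"
        unfolding A2_def by (subst sum.reindex) (auto intro!: inj_onI simp: power2_eq_iff_nonneg)
      also have "\<dots> = (\<Sum>p\<in>B. (1/2) * ((\<eta> p)\<^sup>2 * jft (12 * ln (real p) / L) * real p powr - (1 + 2 * \<delta> / L) * cos ((2 * t) * ln (real p))))"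
      proof (rule sum.cong)
        fix p assume "p \<in> B"
        then have p: "prime p" by (simp add: B_def)
        have p1: "real p > 1" using prime_gt_1_nat[OF p] by simp
        have l: "ln (real (p\<^sup>2)) = 2 * ln (real p)" using p1 by (simp add: ln_realpow)
        have m: "mangoldt (p\<^sup>2) = ln (real p)" using p by simp
        have pw: "real (p\<^sup>2) powr - (1/2 + \<delta> / L) = real p powr - (1 + 2 * \<delta> / L)"
        proof -
          have "real (p\<^sup>2) powr - (1/2 + \<delta> / L) = (real p powr 2) powr - (1/2 + \<delta> / L)" using p1 by simp
          also have "\<dots> = real p powr (2 * - (1/2 + \<delta> / L))" by (rule powr_powr)
          also have "2 * - (1/2 + \<delta> / L) = - (1 + 2 * \<delta> / L)" by (simp add: field_simps)
          finally show ?thesis .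
        qed
        show "T (p\<^sup>2) = (1/2) * ((\<eta> p)\<^sup>2 * jft (12 * ln (real p) / L) * real p powr - (1 + 2 * \<delta> / L) * cos ((2 * t) * ln (real p)))"
          unfolding T_def l m pw eta_sq using p1 by (simp add: mult_ac)
      qed simp
      also have "\<dots> = (\<Sum>p\<in>B. (\<eta> p)\<^sup>2 * jft (12 * ln (real p) / L) * real p powr - (1 + 2 * \<delta> / L) * cos ((2 * t) * ln (real p))) / 2"
        by (simp add: sum_divide_distrib)
      also have "\<dots> \<le> (prime_cos X (2 * t) + C2 * ln X / L) / 2"
      proof (intro divide_right_mono C2(2)[OF L X B_def])
        \<comment> \<open>The character vanishes at 2 and at \<open>d\<close>; as
          \<open>d \<ge> 3\<close>, the reciprocals sum to less than 1.\<close>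
        show "finite {2, d}" by simp
        show "(\<Sum>p\<in>{2, d}. 1 / real p) \<le> 1" using d(2) by (simp add: field_simps)
        have v: "\<eta> p \<in> {-1, 0, 1} \<and> (\<eta> p = 0 \<longrightarrow> p = 2 \<or> p = d)" if p: "p \<in> B" for p
        proof (cases "p = 2")
          case False
          have pp: "prime p" using p by (simp add: B_def)
          then have p2: "p > 2" using False prime_ge_2_nat[OF pp] by simp
          have "p = d" if "leg_sign d p = 0"
          proof -
            have "int p dvd int (8 * d)" using that by (simp add: leg_sign_def Legendre_eq_0_iff)
            then have "p dvd 2 ^ 3 * d" by (simp only: int_dvd_int_iff) simp
            then have "p dvd 2 ^ 3 \<or> p dvd d" using pp by (simp only: prime_dvd_mult_iff)
            moreover have "\<not> p dvd 2 ^ 3"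
            proof
              assume "p dvd 2 ^ 3"
              then have "p dvd 2" using pp prime_dvd_power by blast
              then show False using p2 by (auto dest: dvd_imp_le)
            qed
            ultimately show "p = d" using pp d(1) primes_dvd_imp_eq by blast
          qed
          then show ?thesis unfolding eta_leg[OF pp p2] using Legendre_values[of "8 * int d" "int p"] by (auto simp: leg_sign_def)
        qed (simp add: eta2)
        show "(\<eta> p)\<^sup>2 = 1" if "p \<in> B - {2, d}" for p using v[of p] that by auto
        show "(\<eta> p)\<^sup>2 \<in> {0, 1}" if "p \<in> B" for p using v[of p] that by auto
      qed simp
      also have "\<dots> \<le> prime_cos X (2 * t) / 2 + C2 * ln X / L" proof -
        have "0 \<le> C2 * ln X / L" using C2(1) L by simp
        then show ?thesis by (simp add: add_divide_distrib)
      qed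
      finally show ?thesis .
    qed
    have "(\<Sum>n=1..N. T n) + C0 + C0 * cond_log (8 * d) t / L \<le>
       (\<Sum>q\<in>odd_primes (exp L). prime_coeff \<delta> L q * cos (t * ln (real q)) * leg_sign d q) + prime_cos X (2 * t) / 2
         + (C2 * ln X / L + C1 * 1 + C0 * 1 + C0 * (7 + A) * ln X / L)"
      using split s1 s2 s3 C0cl by linarith
    also have "C2 * ln X / L + C1 * 1 + C0 * 1 + C0 * (7 + A) * ln X / L \<le> C2 * ln X / L + C1 * (ln X / L) + C0 * (ln X / L) + C0 * (7 + A) * ln X / L"
      using lX C0 C1 by (intro add_mono mult_left_mono) auto
    also have "\<dots> = C * ln X / L" by (simp add: C_def algebra_simps add_divide_distrib)
    finally show ?thesis using b0 unfolding chi_def by (meson exp_le_cancel_iff order.trans add_left_mono)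
  qed
  have "C > 0" using C0 C1 C2 A by (simp add: C_def add_pos_pos)
  then show thesis using C0(2) by (rule that) (rule main)
qed

section \<open>Moments over quadratic twists\<close>

lemma odd_primes_mono: "x \<le> y \<Longrightarrow> odd_primes x \<subseteq> odd_primes y"
  by (auto simp: odd_primes_def)

lemma card_odd_primes: "x \<ge> 0 \<Longrightarrow> real (card (odd_primes x)) \<le> x"
proof -
  assume x: "x \<ge> 0"
  have "odd_primes x \<subseteq> {1..nat \<lfloor>x\<rfloor>}" by (auto simp: odd_primes_def le_nat_iff le_floor_iff)
  then have "card (odd_primes x) \<le> card {1..nat \<lfloor>x\<rfloor>}" by (rule card_mono[rotated]) simp
  then have "real (card (odd_primes x)) \<le> real (nat \<lfloor>x\<rfloor>)" by simp
  also have "\<dots> \<le> x" using x by simp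
  finally show ?thesis .
qed

lemma sum_geometric_half_le: "(\<Sum>s\<in>A. (1/2) ^ s) \<le> (2::real)" if "finite A"
proof -
  have "(\<Sum>s\<in>A. (1/2) ^ s) \<le> suminf (\<lambda>s. (1/2 :: real) ^ s)" using that by (intro sum_le_suminf summable_geometric) auto
  also have "\<dots> = 2" using suminf_geometric[of "1/2 :: real"] by simp
  finally show ?thesis .
qed

lemma exp_minus_le_half_power: "exp (- real n) \<le> (1/2 :: real) ^ n"
proof -
  have "(2::real) \<le> exp 1" using exp_ge_add_one_self[of "1::real"] by simp
  then have "inverse (exp (1::real)) \<le> inverse 2" by (rule le_imp_inverse_le) simp
  then have "exp (- 1 :: real) \<le> 1/2" by (simp add: exp_minus)
  then have "exp (- 1 :: real) ^ n \<le> (1/2) ^ n" by (intro power_mono) auto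
  then show ?thesis using exp_of_nat_mult[of n "-1::real"] by simp
qed

text \<open>The scales \<open>\<Lambda> s\<close> are logarithms of cut-off points for the primes, decreasing by factors of 16;
  \<open>block s\<close> contains the primes between two consecutive cut-off points. The sizes are chosen such that
  \<open>ell s * \<Lambda> s\<close> is summable while \<open>(ell s)\<^sup>2\<close> exceeds the variance of the sum over \<open>block s\<close> by far.\<close>
locale prime_scales =
  fixes X H C1 y0 :: real and \<kappa> R :: nat and h :: "nat \<Rightarrow> real" and c :: "real \<Rightarrow> nat \<Rightarrow> real"
    and \<Lambda> :: "nat \<Rightarrow> real"
  assumes X: "X > 0" and C1: "C1 > 0" and y0: "y0 \<ge> 1" "y0 \<ge> 20 * C1" "exp (y0 / 2) \<ge> 2 * H"
    and \<Lambda>_def: "\<And>s. \<Lambda> s = ln X / (1280 * real \<kappa> * 16 ^ s)" and \<Lambda>_R: "y0 \<le> \<Lambda> R" "\<Lambda> R \<le> 16 * y0"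
    and kappa: "\<kappa> \<ge> 1" "real \<kappa> \<ge> 32 * exp 1 * (288 * H\<^sup>2 + 1) * exp (1280 * C1 + 1)"
    and h: "\<And>q. \<bar>h q\<bar> \<le> H" and c: "\<And>L q. L \<ge> 1 \<Longrightarrow> q > 0 \<Longrightarrow> \<bar>c L q\<bar> \<le> \<bar>h q\<bar> / sqrt (real q)"
begin

definition block :: "nat \<Rightarrow> nat set" where
  "block s = odd_primes (exp (\<Lambda> s)) - odd_primes (exp (\<Lambda> (Suc s)))"

text \<open>Two scales occur: \<open>s\<close> selects the primes, \<open>l\<close> the cut-off
  \<open>exp (\<Lambda> l)\<close> and with it the coefficients, which change from one cut-off to
  the next. Hence block \<open>s\<close> has to be tested against every
  \<open>l \<le> s\<close>.\<close>

definition P :: "nat \<Rightarrow> nat \<Rightarrow> (nat \<Rightarrow> real) \<Rightarrow> real" where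
  "P s l \<epsilon> = (\<Sum>q\<in>block s. c (\<Lambda> l) q * \<epsilon> q)"

definition ell :: "nat \<Rightarrow> nat" where "ell s = \<kappa> * 8 ^ s"
text \<open>Half the exponent of the moment used on a bad block. It is proportional to
  \<open>1 / \<Lambda> s\<close>, so that the length of this power and the ratio of
  \<open>rr s\<close> to the loss \<open>C1 * ln X / \<Lambda> (Suc s)\<close> are the same for all
  \<open>s\<close>.\<close>

definition rr :: "nat \<Rightarrow> nat" where "rr s = 16 * \<kappa> * 16 ^ s"

text \<open>On a good block a majorant of \<open>exp (P s l \<epsilon>)\<close> up to a factor close
  to 1; the argument is halved on account of the square.\<close>

definition g :: "nat \<Rightarrow> nat \<Rightarrow> (nat \<Rightarrow> real) \<Rightarrow> real" where
  "g s l \<epsilon> = (exp_trunc (8 * ell s) (P s l \<epsilon> / 2))\<^sup>2"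

text \<open>The exponential moment of a Gaussian with the variance of the full linear form: the main
  term.\<close>

definition G :: real where "G = exp ((\<Sum>q\<in>odd_primes X. (h q)\<^sup>2 / real q) / 2)"

section \<open>Elementary properties of the scales and blocks\<close>

lemma H0: "H \<ge> 0" using h[of 0] abs_ge_zero[of "h 0"] by linarith

lemma lnX: "ln X = 1280 * real \<kappa> * 16 ^ s * \<Lambda> s"
  using kappa(1) by (simp add: \<Lambda>_def)

lemma lnX_pos: "ln X > 0"
  unfolding lnX[of R] using kappa(1) \<Lambda>_R(1) y0(1) by (intro mult_pos_pos) auto

lemma \<Lambda>_mono: "s \<le> s' \<Longrightarrow> \<Lambda> s' \<le> \<Lambda> s"
  unfolding \<Lambda>_def using kappa(1) lnX_pos by (intro divide_left_mono mult_left_mono power_increasing) auto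

lemma \<Lambda>_ge: "s \<le> R \<Longrightarrow> \<Lambda> s \<ge> y0"
  using \<Lambda>_mono[of s R] \<Lambda>_R(1) by linarith

lemma \<Lambda>_ge_1: "s \<le> R \<Longrightarrow> \<Lambda> s \<ge> 1"
  using \<Lambda>_ge[of s] y0(1) by linarith

lemma \<Lambda>_le: "\<Lambda> s \<le> ln X"
proof -
  have "1 * 1 \<le> real \<kappa> * 16 ^ s" using kappa(1) by (intro mult_mono) auto
  then have "ln X / (1280 * real \<kappa> * 16 ^ s) \<le> ln X / 1" using lnX_pos by (intro divide_left_mono) auto
  then show ?thesis by (simp add: \<Lambda>_def)
qed

lemma \<Lambda>_Suc: "\<Lambda> s = 16 * \<Lambda> (Suc s)"
  by (simp add: \<Lambda>_def)

lemma finite_block [simp]: "finite (block s)"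
  by (simp add: block_def)

lemma block_subset: "block s \<subseteq> odd_primes X"
proof -
  have "exp (\<Lambda> s) \<le> exp (ln X)" using \<Lambda>_le by (simp only: exp_le_cancel_iff)
  then show ?thesis using X odd_primes_mono[of "exp (\<Lambda> s)" X] by (auto simp: block_def)
qed

lemma block_disjoint: "s \<noteq> s' \<Longrightarrow> block s \<inter> block s' = {}"
proof (induction s s' rule: linorder_wlog)
  case (le s s')
  then have "\<Lambda> s' \<le> \<Lambda> (Suc s)" by (intro \<Lambda>_mono) auto
  then have "odd_primes (exp (\<Lambda> s')) \<subseteq> odd_primes (exp (\<Lambda> (Suc s)))" by (intro odd_primes_mono) simp
  then show ?case by (auto simp: block_def)
qed auto

lemma sum_odd_primes_split:
  fixes \<phi> :: "nat \<Rightarrow> real"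
  assumes "l \<le> R"
  shows "(\<Sum>q\<in>odd_primes (exp (\<Lambda> l)). \<phi> q) = (\<Sum>q\<in>odd_primes (exp (\<Lambda> R)). \<phi> q) + (\<Sum>s\<in>{l..<R}. \<Sum>q\<in>block s. \<phi> q)"
  using assms
proof (induction l rule: inc_induct)
  case (step l)
  have "odd_primes (exp (\<Lambda> (Suc l))) \<subseteq> odd_primes (exp (\<Lambda> l))"
    using \<Lambda>_mono[of l "Suc l"] by (intro odd_primes_mono) simp
  then have "(\<Sum>q\<in>odd_primes (exp (\<Lambda> l)). \<phi> q) = (\<Sum>q\<in>block l. \<phi> q) + (\<Sum>q\<in>odd_primes (exp (\<Lambda> (Suc l))). \<phi> q)"
    unfolding block_def by (intro sum.subset_diff) auto
  then show ?case unfolding step.IH using step.hyps by (simp add: sum.atLeast_Suc_lessThan)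
qed simp

lemma in_block:
  assumes "q \<in> block s" "s < R"
  shows "prime q" "q > 2" "real q \<le> exp (\<Lambda> s)" "real q > exp (\<Lambda> (Suc s))"
  using assms by (auto simp: block_def odd_primes_def)

lemma block_c_sq:
  assumes "q \<in> block s" "s < R" "l \<le> R" shows "(c (\<Lambda> l) q)\<^sup>2 \<le> (h q)\<^sup>2 / real q"
proof -
  have q: "q > 0" using in_block(2)[OF assms(1,2)] by simp
  have "\<bar>c (\<Lambda> l) q\<bar>\<^sup>2 \<le> (\<bar>h q\<bar> / sqrt (real q))\<^sup>2" using c[OF \<Lambda>_ge_1[OF assms(3)] q] by (intro power_mono) auto
  then show ?thesis by (simp add: power_divide)
qed

text \<open>On a block \<open>ln q\<close> is at least \<open>\<Lambda> s / 16\<close>, so the bound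
  \<open>18 * \<Lambda> s\<close> for the sum of \<open>ln q / q\<close> becomes
  \<open>18 * 16\<close>. Thus every block has bounded variance.\<close>

lemma block_recip_sum:
  assumes s: "s < R" shows "(\<Sum>q\<in>block s. 1 / real q) \<le> 288"
proof -
  have l1: "\<Lambda> (Suc s) \<ge> 1" using s by (intro \<Lambda>_ge_1) auto
  have "(\<Sum>q\<in>block s. 1 / real q) \<le> (\<Sum>q\<in>block s. 1 / \<Lambda> (Suc s) * (ln (real q) / real q))"
  proof (rule sum_mono)
    fix q assume q: "q \<in> block s"
    have q0: "real q > 0" using in_block(2)[OF q s] by simp
    have "ln (exp (\<Lambda> (Suc s))) \<le> ln (real q)" using in_block(4)[OF q s] q0 by (subst ln_le_cancel_iff) auto
    then have "1 \<le> 1 / \<Lambda> (Suc s) * ln (real q)" using l1 by simp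
    then have "1 / real q \<le> 1 / \<Lambda> (Suc s) * ln (real q) / real q" using q0 by (intro divide_right_mono) auto
    then show "1 / real q \<le> 1 / \<Lambda> (Suc s) * (ln (real q) / real q)" by simp
  qed
  also have "\<dots> = 1 / \<Lambda> (Suc s) * (\<Sum>q\<in>block s. ln (real q) / real q)" by (simp only: sum_distrib_left)
  also have "\<dots> \<le> 1 / \<Lambda> (Suc s) * (18 * \<Lambda> s)"
  proof (rule mult_left_mono)
    have "(\<Sum>q\<in>block s. ln (real q) / real q) \<le> (\<Sum>q\<in>primes_upto (exp (\<Lambda> s)). ln (real q) / real q)"
    proof (rule sum_mono2)
      show "block s \<subseteq> primes_upto (exp (\<Lambda> s))" by (auto simp: block_def odd_primes_def)
      fix q assume "q \<in> primes_upto (exp (\<Lambda> s)) - block s"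
      then have "q \<ge> 1" using prime_ge_1_nat by auto
      then show "0 \<le> ln (real q) / real q" by simp
    qed simp
    also have "\<dots> \<le> 18 * ln (exp (\<Lambda> s))" using s \<Lambda>_ge_1[of s] by (intro sum_ln_over_primes) auto
    finally show "(\<Sum>q\<in>block s. ln (real q) / real q) \<le> 18 * \<Lambda> s" by simp
  qed (use l1 in auto)
  also have "\<dots> = 288" using l1 \<Lambda>_Suc[of s] by simp
  finally show ?thesis .
qed

text \<open>All blocks lie beyond \<open>exp y0\<close>, where a coefficient is at most
  \<open>H / sqrt q \<le> 1/2\<close>. This supplies the hypothesis \<open>B \<le> x / 2\<close> of
  \<open>dpoly_exp_trunc\<close>.\<close>

lemma block_abs_sum:
  assumes s: "s < R" and l: "l \<le> R"
  shows "(\<Sum>q\<in>block s. \<bar>c (\<Lambda> l) q\<bar>) \<le> exp (\<Lambda> s) / 2"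
proof -
  have "(\<Sum>q\<in>block s. \<bar>c (\<Lambda> l) q\<bar>) \<le> (\<Sum>q\<in>block s. 1 / 2)"
  proof (rule sum_mono)
    fix q assume q: "q \<in> block s"
    have q0: "q > 0" using in_block(2)[OF q s] by simp
    have "exp (y0 / 2) * exp (y0 / 2) = exp y0" by (simp add: exp_add[symmetric])
    also have "exp y0 \<le> exp (\<Lambda> (Suc s))" using \<Lambda>_ge[of "Suc s"] s by simp
    also have "\<dots> \<le> real q" using in_block(4)[OF q s] by simp
    finally have "exp (y0 / 2) \<le> sqrt (real q)" by (intro real_le_rsqrt) (simp add: power2_eq_square)
    then have 1: "2 * H \<le> sqrt (real q)" using y0(3) by linarith
    have "\<bar>c (\<Lambda> l) q\<bar> \<le> \<bar>h q\<bar> / sqrt (real q)" using c[OF \<Lambda>_ge_1[OF l] q0] .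
    also have "\<dots> \<le> H / sqrt (real q)" using h[of q] by (intro divide_right_mono) auto
    also have "\<dots> \<le> 1 / 2" using 1 q0 by (simp add: field_simps)
    finally show "\<bar>c (\<Lambda> l) q\<bar> \<le> 1 / 2" .
  qed
  also have "\<dots> = real (card (block s)) / 2" by simp
  also have "real (card (block s)) \<le> real (card (odd_primes (exp (\<Lambda> s))))"
    by (intro of_nat_mono card_mono) (auto simp: block_def)
  also have "\<dots> \<le> exp (\<Lambda> s)" by (rule card_odd_primes) simp
  finally show ?thesis by simp
qed

lemma ell_ge: "ell s \<ge> Suc s" "ell s \<ge> 1"
proof -
  have "Suc s \<le> 8 ^ s" by (induction s) auto
  also have "\<dots> \<le> \<kappa> * 8 ^ s" using kappa(1) by simp
  finally show "ell s \<ge> Suc s" unfolding ell_def .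
  then show "ell s \<ge> 1" by simp
qed

lemma P_local: "(\<And>q. q \<in> block s \<Longrightarrow> \<epsilon> q = \<epsilon>' q) \<Longrightarrow> P s l \<epsilon> = P s l \<epsilon>'"
  unfolding P_def by (rule sum.cong) auto

lemma g_local: "(\<And>q. q \<in> block s \<Longrightarrow> \<epsilon> q = \<epsilon>' q) \<Longrightarrow> g s l \<epsilon> = g s l \<epsilon>'"
  unfolding g_def using P_local[of s \<epsilon> \<epsilon>' l] by simp

lemma g_nonneg: "g s l \<epsilon> \<ge> 0"
  by (simp add: g_def)

lemma sE_g_le:
  assumes "s < R" "l \<le> R"
  shows "sE (block s) (g s l) \<le> exp ((\<Sum>q\<in>block s. (h q)\<^sup>2 / real q) / 2)"
proof -
  have "sE (block s) (g s l) \<le> exp ((\<Sum>q\<in>block s. (c (\<Lambda> l) q)\<^sup>2) / 2)"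
    unfolding g_def P_def by (rule sE_exp_trunc_le) simp
  also have "\<dots> \<le> exp ((\<Sum>q\<in>block s. (h q)\<^sup>2 / real q) / 2)"
    using block_c_sq assms by (simp add: sum_mono)
  finally show ?thesis .
qed

text \<open>Markov's inequality for a bad block in moment form. The variance is at most
  \<open>V\<close>, and \<open>rr m / (ell m)^2\<close> is small thanks to \<open>\<kappa>\<close>,
  whose lower bound is made for this estimate: the moment beats the loss
  \<open>exp (1280 * C1 * rr m)\<close> from working with the shorter cut-off at scale
  \<open>Suc m\<close>, and \<open>exp (- rr m)\<close> is left over.\<close>

lemma sE_P_power_le:
  assumes m: "m < R" and l: "l \<le> R"
  shows "sE (block m) (\<lambda>\<epsilon>. (P m l \<epsilon> / real (ell m)) ^ (2 * rr m)) * exp (C1 * ln X / \<Lambda> (Suc m)) \<le> exp (- real (rr m))"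
proof -
  define V where "V = 288 * H\<^sup>2 + 1"
  define r where "r = rr m"
  have V: "V > 0" unfolding V_def by (intro add_nonneg_pos) auto
  have r: "r > 0" using kappa(1) by (simp add: r_def rr_def)
  have ell0: "real (ell m) > 0" using ell_ge(2)[of m] by simp
  have vs: "(\<Sum>q\<in>block m. (c (\<Lambda> l) q)\<^sup>2) \<le> V"
  proof -
    have "(\<Sum>q\<in>block m. (c (\<Lambda> l) q)\<^sup>2) \<le> (\<Sum>q\<in>block m. H\<^sup>2 * (1 / real q))"
    proof (rule sum_mono)
      fix q assume q: "q \<in> block m"
      have "\<bar>h q\<bar>\<^sup>2 \<le> H\<^sup>2" using h[of q] by (intro power_mono) auto
      then have "(h q)\<^sup>2 / real q \<le> H\<^sup>2 / real q" by (intro divide_right_mono) auto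
      then show "(c (\<Lambda> l) q)\<^sup>2 \<le> H\<^sup>2 * (1 / real q)" using block_c_sq[OF q m l] by simp
    qed
    also have "\<dots> = H\<^sup>2 * (\<Sum>q\<in>block m. 1 / real q)" by (simp only: sum_distrib_left)
    also have "\<dots> \<le> H\<^sup>2 * 288" using block_recip_sum[OF m] by (intro mult_left_mono) auto
    finally show ?thesis by (simp add: V_def)
  qed
  have base: "2 * real r * exp 1 * V / (real (ell m))\<^sup>2 \<le> exp (- (1280 * C1 + 1))"
  proof -
    have "(8 ^ m)\<^sup>2 = (16 ^ m * 4 ^ m :: real)" by (simp add: power_mult_distrib[symmetric] power_mult[symmetric] mult.commute[of m] power_mult power2_eq_square)
    then have "(real (ell m))\<^sup>2 = (real \<kappa> * 4 ^ m) * (real \<kappa> * 16 ^ m)"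
      by (simp add: ell_def power_mult_distrib power2_eq_square)
    moreover have "2 * real r * exp 1 * V = (32 * exp 1 * V) * (real \<kappa> * 16 ^ m)" by (simp add: r_def rr_def)
    ultimately have "2 * real r * exp 1 * V / (real (ell m))\<^sup>2 = (32 * exp 1 * V) * (real \<kappa> * 16 ^ m) / ((real \<kappa> * 4 ^ m) * (real \<kappa> * 16 ^ m))"
      by (simp only:)
    also have "\<dots> = (32 * exp 1 * V) / (real \<kappa> * 4 ^ m)"
      using kappa(1) by (intro mult_divide_mult_cancel_right) simp
    also have "\<dots> \<le> (32 * exp 1 * V) / (real \<kappa> * 1)"
      using kappa(1) V by (intro divide_left_mono mult_left_mono) auto
    also have "\<dots> \<le> exp (- (1280 * C1 + 1))"
    proof -
      have "32 * exp 1 * V * exp (1280 * C1 + 1) / (real \<kappa> * exp (1280 * C1 + 1)) \<le> real \<kappa> / (real \<kappa> * exp (1280 * C1 + 1))"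
        using kappa unfolding V_def[symmetric] by (intro divide_right_mono) auto
      then show ?thesis using kappa(1) unfolding exp_minus inverse_eq_divide by simp
    qed
    finally show ?thesis .
  qed
  have pre: "C1 * ln X / \<Lambda> (Suc m) = 1280 * C1 * real r"
    unfolding lnX[of "Suc m"] using \<Lambda>_ge_1[of "Suc m"] m by (simp add: r_def rr_def)
  have "sE (block m) (\<lambda>\<epsilon>. (P m l \<epsilon> / real (ell m)) ^ (2 * r)) = sE (block m) (\<lambda>\<epsilon>. (1 / real (ell m) ^ (2 * r)) * (\<Sum>q\<in>block m. c (\<Lambda> l) q * \<epsilon> q) ^ (2 * r))"
    by (simp add: P_def power_divide)
  also have "\<dots> = (1 / real (ell m) ^ (2 * r)) * sE (block m) (\<lambda>\<epsilon>. (\<Sum>q\<in>block m. c (\<Lambda> l) q * \<epsilon> q) ^ (2 * r))"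
    by (rule sE_cmult)
  also have "\<dots> \<le> (1 / real (ell m) ^ (2 * r)) * (2 * real r * exp 1 * V) ^ r"
    using ell0 by (intro mult_left_mono sE_moment_le vs V r) auto
  also have "\<dots> = (2 * real r * exp 1 * V / (real (ell m))\<^sup>2) ^ r" by (simp add: power_divide power_mult)
  also have "\<dots> \<le> exp (- (1280 * C1 + 1)) ^ r" using V by (intro power_mono base) auto
  also have "\<dots> = exp (- (1280 * C1 * real r) - real r)"
    unfolding exp_of_nat_mult[symmetric] by (simp add: algebra_simps)
  finally have "sE (block m) (\<lambda>\<epsilon>. (P m l \<epsilon> / real (ell m)) ^ (2 * r)) * exp (1280 * C1 * real r)
      \<le> exp (- (1280 * C1 * real r) - real r) * exp (1280 * C1 * real r)"
    by (rule mult_right_mono) simp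
  also have "\<dots> = exp (- real r)" by (simp add: exp_add[symmetric])
  finally show ?thesis unfolding pre unfolding r_def .
qed

section \<open>Lengths of the polynomials\<close>

lemma dpoly_P:
  assumes "s < R" "l \<le> R"
  shows "dpoly (odd_primes X) (exp (\<Lambda> s) / 2) (exp (\<Lambda> s)) (P s l)"
proof -
  have "dpoly (odd_primes X) (exp (\<Lambda> s) / 2) (exp (\<Lambda> s)) (\<lambda>\<epsilon>. \<Sum>q\<in>block s. c (\<Lambda> l) q * \<epsilon> q)"
    using in_block(3)[OF _ assms(1)] \<Lambda>_ge_1[of s] assms
    by (intro dpoly_linear block_abs_sum block_subset) auto
  then show ?thesis by (simp add: P_def[abs_def])
qed

text \<open>The factor of block \<open>s\<close> has length
  \<open>exp (16 * ell s * \<Lambda> s)\<close>, which is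
  \<open>exp (ln X / 80 * (1/2) ^ s)\<close>, and the geometric series doubles the exponent at
  \<open>s = 0\<close>. The number 1280 in \<open>\<Lambda>\<close> is
  \<open>16 * 80\<close>.\<close>

lemma dpoly_g_prod:
  assumes l: "l \<le> R"
  shows "dpoly (odd_primes X) (exp (ln X / 40)) (exp (ln X / 40)) (\<lambda>\<epsilon>. \<Prod>s\<in>{l..<R}. g s l \<epsilon>)"
proof -
  define b where "b = (\<lambda>s. (exp (\<Lambda> s) ^ (8 * ell s))\<^sup>2)"
  have "dpoly (odd_primes X) (\<Prod>s\<in>{l..<R}. b s) (\<Prod>s\<in>{l..<R}. b s) (\<lambda>\<epsilon>. \<Prod>s\<in>{l..<R}. g s l \<epsilon>)"
  proof (rule dpoly_prod)
    fix s assume s: "s \<in> {l..<R}"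
    have "exp 1 \<le> exp (\<Lambda> s)" using \<Lambda>_ge_1[of s] s by simp
    then have "exp (\<Lambda> s) \<ge> 2" using exp_ge_add_one_self[of "1::real"] by linarith
    then have "dpoly (odd_primes X) (exp (\<Lambda> s) ^ (8 * ell s)) (exp (\<Lambda> s) ^ (8 * ell s)) (\<lambda>\<epsilon>. exp_trunc (8 * ell s) (P s l \<epsilon> / 2))"
      using s l ell_ge(2)[of s] by (intro dpoly_exp_trunc[OF dpoly_P]) auto
    from dpoly_power[OF this, of 2] show "dpoly (odd_primes X) (b s) (b s) (g s l)"
      by (simp add: b_def g_def[abs_def])
  qed simp
  moreover have *: "(\<Prod>s\<in>{l..<R}. b s) \<le> exp (ln X / 40)"
  proof -
    have b: "b s = exp (ln X / 80 * (1/2) ^ s)" for s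
    proof -
      have "b s = exp (real (2 * (8 * ell s)) * \<Lambda> s)"
        unfolding b_def exp_of_nat_mult by (simp add: power_mult[symmetric] mult.commute)
      also have "real (2 * (8 * ell s)) * \<Lambda> s = ln X / 80 * (8 ^ s / 16 ^ s)"
        using kappa(1) by (simp add: \<Lambda>_def ell_def)
      also have "(8 ^ s / 16 ^ s :: real) = (1/2) ^ s" by (simp add: power_divide[symmetric])
      finally show ?thesis .
    qed
    have "(\<Prod>s\<in>{l..<R}. b s) = exp (ln X / 80 * (\<Sum>s\<in>{l..<R}. (1/2) ^ s))"
      unfolding b by (simp add: exp_sum sum_distrib_left)
    also have "\<dots> \<le> exp (ln X / 80 * 2)"
      unfolding exp_le_cancel_iff using lnX_pos by (intro mult_left_mono sum_geometric_half_le) auto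
    finally show ?thesis by simp
  qed
  ultimately show ?thesis using * by (rule dpoly_mono)
qed

lemma dpoly_P_power:
  assumes m: "m < R" and l: "l \<le> R"
  shows "dpoly (odd_primes X) (exp (ln X / 40)) (exp (ln X / 40)) (\<lambda>\<epsilon>. (P m l \<epsilon> / real (ell m)) ^ (2 * rr m))"
proof -
  have x: "exp (\<Lambda> m) ^ (2 * rr m) = exp (ln X / 40)"
  proof -
    have "real (2 * rr m) * \<Lambda> m = ln X / 40" using kappa(1) by (simp add: \<Lambda>_def rr_def)
    then show ?thesis by (simp only: exp_of_nat_mult[symmetric])
  qed
  have "dpoly (odd_primes X) (exp (\<Lambda> m)) (exp (\<Lambda> m)) (P m l)"
    by (rule dpoly_mono[OF dpoly_P[OF m l]]) simp_all
  from dpoly_power[OF this, of "2 * rr m"]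
  have "dpoly (odd_primes X) (exp (ln X / 40)) (exp (ln X / 40)) (\<lambda>\<epsilon>. P m l \<epsilon> ^ (2 * rr m))" by (simp only: x)
  then have "dpoly (odd_primes X) (\<bar>1 / real (ell m) ^ (2 * rr m)\<bar> * exp (ln X / 40)) (exp (ln X / 40)) (\<lambda>\<epsilon>. (1 / real (ell m) ^ (2 * rr m)) * P m l \<epsilon> ^ (2 * rr m))"
    using lnX_pos by (intro dpoly_cmult) auto
  moreover have "\<bar>1 / real (ell m) ^ (2 * rr m)\<bar> * exp (ln X / 40) \<le> 1 * exp (ln X / 40)"
  proof (rule mult_right_mono)
    have "1 \<le> real (ell m) ^ (2 * rr m)" using ell_ge(2)[of m] by (intro one_le_power) simp
    then show "\<bar>1 / real (ell m) ^ (2 * rr m)\<bar> \<le> 1" using ell_ge(2)[of m] by (simp add: divide_le_eq_1 Suc_le_eq)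
  qed simp
  ultimately have "dpoly (odd_primes X) (1 * exp (ln X / 40)) (exp (ln X / 40)) (\<lambda>\<epsilon>. (1 / real (ell m) ^ (2 * rr m)) * P m l \<epsilon> ^ (2 * rr m))"
    by (rule dpoly_mono) simp
  then show ?thesis by (simp add: power_divide)
qed

definition T0 :: "(nat \<Rightarrow> real) \<Rightarrow> real" where
  "T0 \<epsilon> = (\<Prod>s\<in>{0..<R}. g s 0 \<epsilon>)"

text \<open>Majorant for the case that block \<open>m\<close> is large at scale \<open>l\<close>
  while all blocks of smaller primes are good: there the even power is at least 1, and elsewhere it
  is still nonnegative.\<close>

definition T :: "nat \<Rightarrow> nat \<Rightarrow> (nat \<Rightarrow> real) \<Rightarrow> real" where
  "T m l \<epsilon> = (\<Prod>s\<in>{Suc m..<R}. g s (Suc m) \<epsilon>) * (P m l \<epsilon> / real (ell m)) ^ (2 * rr m)"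

lemma T0_nonneg: "T0 \<epsilon> \<ge> 0" unfolding T0_def by (intro prod_nonneg) (simp add: g_nonneg)
lemma T_nonneg: "T m l \<epsilon> \<ge> 0" unfolding T_def
  by (intro mult_nonneg_nonneg prod_nonneg zero_le_even_power) (simp_all add: g_nonneg)

lemma dpoly_T0: "dpoly (odd_primes X) (exp (ln X / 20)) (exp (ln X / 20)) T0"
proof -
  have "dpoly (odd_primes X) (exp (ln X / 40)) (exp (ln X / 40)) T0"
    unfolding T0_def[abs_def] by (rule dpoly_g_prod) simp
  then show ?thesis using lnX_pos by (elim dpoly_mono) auto
qed

lemma dpoly_T:
  assumes "m < R" "l \<le> m"
  shows "dpoly (odd_primes X) (exp (ln X / 20)) (exp (ln X / 20)) (T m l)"
proof -
  have e: "exp (ln X / 40) * exp (ln X / 40) = exp (ln X / 20)" by (simp add: exp_add[symmetric])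
  show ?thesis unfolding T_def[abs_def] e[symmetric]
    using assms by (intro dpoly_mult dpoly_g_prod dpoly_P_power) auto
qed

lemma G_ge_1: "G \<ge> 1"
  unfolding G_def by (simp add: sum_nonneg)

lemma sE_blocks_le:
  assumes "l \<le> R"
  shows "(\<Prod>s\<in>{l..<R}. sE (block s) (g s l)) \<le> G"
proof -
  have "(\<Prod>s\<in>{l..<R}. sE (block s) (g s l)) \<le> (\<Prod>s\<in>{l..<R}. exp ((\<Sum>q\<in>block s. (h q)\<^sup>2 / real q) / 2))"
    using assms by (intro prod_mono conjI sE_nonneg sE_g_le) (auto simp: g_nonneg)
  also have "\<dots> = exp ((\<Sum>s\<in>{l..<R}. \<Sum>q\<in>block s. (h q)\<^sup>2 / real q) / 2)"
    by (simp add: exp_sum sum_divide_distrib)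
  also have "(\<Sum>s\<in>{l..<R}. \<Sum>q\<in>block s. (h q)\<^sup>2 / real q) = (\<Sum>q\<in>(\<Union>s\<in>{l..<R}. block s). (h q)\<^sup>2 / real q)"
    using block_disjoint by (intro sum.UNION_disjoint[symmetric]) auto
  also have "\<dots> \<le> (\<Sum>q\<in>odd_primes X. (h q)\<^sup>2 / real q)"
    using block_subset by (intro sum_mono2) auto
  finally show ?thesis by (simp add: G_def)
qed

lemma sE_T0_le: "sE (odd_primes X) T0 \<le> G"
proof -
  have "sE (odd_primes X) T0 = sE (\<Union>s\<in>{0..<R}. block s) (\<lambda>\<epsilon>. \<Prod>s\<in>{0..<R}. g s 0 \<epsilon>)"
    unfolding T0_def[abs_def]
  proof (rule sE_restrict)
    show "(\<Union>s\<in>{0..<R}. block s) \<subseteq> odd_primes X" using block_subset by blast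
    show "(\<Prod>s\<in>{0..<R}. g s 0 \<epsilon>) = (\<Prod>s\<in>{0..<R}. g s 0 \<epsilon>')" if "\<And>q. q \<in> (\<Union>s\<in>{0..<R}. block s) \<Longrightarrow> \<epsilon> q = \<epsilon>' q" for \<epsilon> \<epsilon>'
      by (rule prod.cong[OF refl], rule g_local, rule that) blast
  qed simp
  also have "\<dots> = (\<Prod>s\<in>{0..<R}. sE (block s) (g s 0))"
  proof (rule sE_prod_indep)
    show "g s 0 \<epsilon> = g s 0 \<epsilon>'" if "\<And>q. q \<in> block s \<Longrightarrow> \<epsilon> q = \<epsilon>' q" for s \<epsilon> \<epsilon>' by (rule g_local) (rule that)
  qed (auto dest: block_disjoint)
  also have "\<dots> \<le> G" by (rule sE_blocks_le) simp
  finally show ?thesis .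
qed

lemma sE_T_le:
  assumes m: "m < R" and l: "l \<le> m"
  shows "sE (odd_primes X) (T m l) * exp (C1 * ln X / \<Lambda> (Suc m)) \<le> G * exp (- real (rr m))"
proof -
  \<comment> \<open>Block \<open>m\<close> carries the moment in place of the squared polynomial;
    one family over \<open>{m..<R}\<close> lets the expectation factorise over disjoint
    blocks.\<close>
  define gg where "gg = (\<lambda>s \<epsilon>. if s = m then (P m l \<epsilon> / real (ell m)) ^ (2 * rr m) else g s (Suc m) \<epsilon>)"
  have Ieq: "{m..<R} = insert m {Suc m..<R}" using m by auto
  have gg_local: "gg s \<epsilon> = gg s \<epsilon>'" if "\<And>q. q \<in> block s \<Longrightarrow> \<epsilon> q = \<epsilon>' q" for s \<epsilon> \<epsilon>'
  proof (cases "s = m")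
    case True
    have "P m l \<epsilon> = P m l \<epsilon>'" by (rule P_local) (use that True in simp)
    then show ?thesis using True by (simp add: gg_def)
  next
    case False
    have "g s (Suc m) \<epsilon> = g s (Suc m) \<epsilon>'" by (rule g_local) (rule that)
    then show ?thesis using False by (simp add: gg_def)
  qed
  have Teq: "T m l = (\<lambda>\<epsilon>. \<Prod>s\<in>{m..<R}. gg s \<epsilon>)"
  proof
    fix \<epsilon>
    have "(\<Prod>s\<in>{Suc m..<R}. gg s \<epsilon>) = (\<Prod>s\<in>{Suc m..<R}. g s (Suc m) \<epsilon>)"
      by (rule prod.cong) (auto simp: gg_def)
    then show "T m l \<epsilon> = (\<Prod>s\<in>{m..<R}. gg s \<epsilon>)" unfolding Ieq T_def by (simp add: gg_def mult.commute)
  qed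
  have "sE (odd_primes X) (T m l) = sE (\<Union>s\<in>{m..<R}. block s) (\<lambda>\<epsilon>. \<Prod>s\<in>{m..<R}. gg s \<epsilon>)"
    unfolding Teq
  proof (rule sE_restrict)
    show "(\<Union>s\<in>{m..<R}. block s) \<subseteq> odd_primes X" using block_subset by blast
    show "(\<Prod>s\<in>{m..<R}. gg s \<epsilon>) = (\<Prod>s\<in>{m..<R}. gg s \<epsilon>')" if "\<And>q. q \<in> (\<Union>s\<in>{m..<R}. block s) \<Longrightarrow> \<epsilon> q = \<epsilon>' q" for \<epsilon> \<epsilon>'
      by (rule prod.cong[OF refl], rule gg_local, rule that) blast
  qed simp
  also have "\<dots> = (\<Prod>s\<in>{m..<R}. sE (block s) (gg s))"
  proof (rule sE_prod_indep)
    show "gg s \<epsilon> = gg s \<epsilon>'" if "\<And>q. q \<in> block s \<Longrightarrow> \<epsilon> q = \<epsilon>' q" for s \<epsilon> \<epsilon>' by (rule gg_local) (rule that)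
  qed (auto dest: block_disjoint)
  also have "\<dots> = sE (block m) (gg m) * (\<Prod>s\<in>{Suc m..<R}. sE (block s) (gg s))" unfolding Ieq by simp
  also have "gg m = (\<lambda>\<epsilon>. (P m l \<epsilon> / real (ell m)) ^ (2 * rr m))" by (simp add: gg_def)
  also have "(\<Prod>s\<in>{Suc m..<R}. sE (block s) (gg s)) = (\<Prod>s\<in>{Suc m..<R}. sE (block s) (g s (Suc m)))"
    by (rule prod.cong) (auto simp: gg_def[abs_def])
  finally have "sE (odd_primes X) (T m l) * exp (C1 * ln X / \<Lambda> (Suc m)) =
     (\<Prod>s\<in>{Suc m..<R}. sE (block s) (g s (Suc m))) *
     (sE (block m) (\<lambda>\<epsilon>. (P m l \<epsilon> / real (ell m)) ^ (2 * rr m)) * exp (C1 * ln X / \<Lambda> (Suc m)))"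
    by simp
  also have "\<dots> \<le> G * exp (- real (rr m))"
  proof (intro mult_mono sE_blocks_le sE_P_power_le)
    show "0 \<le> sE (block m) (\<lambda>\<epsilon>. (P m l \<epsilon> / real (ell m)) ^ (2 * rr m)) * exp (C1 * ln X / \<Lambda> (Suc m))"
      by (intro mult_nonneg_nonneg sE_nonneg zero_le_even_power) simp_all
  qed (use m l G_ge_1 in auto)
  finally show ?thesis .
qed

text \<open>The factors \<open>(1 + exp (- ell s))^2\<close> lost per block have a bounded product
  because \<open>ell s \<ge> Suc s\<close>.\<close>

lemma exp_block_le:
  assumes l: "l \<le> R" and b: "\<And>s. s \<in> {l..<R} \<Longrightarrow> \<bar>P s l \<epsilon>\<bar> \<le> real (ell s)"
  shows "exp (\<Sum>s\<in>{l..<R}. P s l \<epsilon>) \<le> exp 2 * (\<Prod>s\<in>{l..<R}. g s l \<epsilon>)"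
proof -
  have "exp (\<Sum>s\<in>{l..<R}. P s l \<epsilon>) = (\<Prod>s\<in>{l..<R}. exp (P s l \<epsilon>))" by (simp add: exp_sum)
  also have "\<dots> \<le> (\<Prod>s\<in>{l..<R}. (1 + exp (- real (ell s)))\<^sup>2 * g s l \<epsilon>)"
  proof (intro prod_mono conjI)
    fix s assume s: "s \<in> {l..<R}"
    show "exp (P s l \<epsilon>) \<le> (1 + exp (- real (ell s)))\<^sup>2 * g s l \<epsilon>"
      unfolding g_def by (rule exp_le_exp_trunc[OF b[OF s] ell_ge(2)])
  qed simp
  also have "\<dots> = (\<Prod>s\<in>{l..<R}. (1 + exp (- real (ell s)))\<^sup>2) * (\<Prod>s\<in>{l..<R}. g s l \<epsilon>)" by (rule prod.distrib)
  also have "\<dots> \<le> exp 2 * (\<Prod>s\<in>{l..<R}. g s l \<epsilon>)"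
  proof (rule mult_right_mono)
    have "(\<Prod>s\<in>{l..<R}. (1 + exp (- real (ell s)))\<^sup>2) \<le> (\<Prod>s\<in>{l..<R}. exp ((1/2) ^ s))"
    proof (intro prod_mono conjI)
      fix s
      have "exp (- real (ell s)) \<le> exp (- real (Suc s))" using ell_ge(1)[of s] by (subst exp_le_cancel_iff) linarith
      also have "\<dots> \<le> (1/2) ^ Suc s" by (rule exp_minus_le_half_power)
      finally have 1: "exp (- real (ell s)) \<le> (1/2) ^ s / 2" by simp
      have "1 + exp (- real (ell s)) \<le> exp (exp (- real (ell s)))" by (rule exp_ge_add_one_self)
      also have "\<dots> \<le> exp ((1/2) ^ s / 2)" using 1 by simp
      finally have "(1 + exp (- real (ell s)))\<^sup>2 \<le> (exp ((1/2) ^ s / 2))\<^sup>2" by (intro power_mono) (auto intro: add_nonneg_nonneg)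
      also have "(exp ((1/2) ^ s / 2))\<^sup>2 = exp ((1/2 :: real) ^ s)" by (simp add: power2_eq_square exp_add[symmetric])
      finally show "(1 + exp (- real (ell s)))\<^sup>2 \<le> exp ((1/2) ^ s)" .
    qed simp
    also have "\<dots> = exp (\<Sum>s\<in>{l..<R}. (1/2) ^ s)" by (simp add: exp_sum)
    also have "\<dots> \<le> exp 2" unfolding exp_le_cancel_iff by (rule sum_geometric_half_le) simp
    finally show "(\<Prod>s\<in>{l..<R}. (1 + exp (- real (ell s)))\<^sup>2) \<le> exp 2" .
  qed (auto intro: prod_nonneg simp: g_nonneg)
  finally show ?thesis .
qed

text \<open>Trivial bound for the primes up to \<open>exp (\<Lambda> R) \<le> exp (16 * y0)\<close>,
  which belong to no block, together with the loss \<open>exp 2\<close> from truncation.\<close>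

definition K0 :: real where "K0 = exp 2 * exp (H * exp (16 * y0))"

lemma scale_bound:
  assumes e: "\<And>q. \<bar>\<epsilon> q\<bar> \<le> 1" and l: "l \<le> R" and b: "\<And>s. s \<in> {l..<R} \<Longrightarrow> \<bar>P s l \<epsilon>\<bar> \<le> real (ell s)"
  shows "exp ((\<Sum>q\<in>odd_primes (exp (\<Lambda> l)). c (\<Lambda> l) q * \<epsilon> q) + C1 * ln X / \<Lambda> l)
    \<le> K0 * (exp (C1 * ln X / \<Lambda> l) * (\<Prod>s\<in>{l..<R}. g s l \<epsilon>))"
proof -
  have "(\<Sum>q\<in>odd_primes (exp (\<Lambda> R)). c (\<Lambda> l) q * \<epsilon> q) \<le> (\<Sum>q\<in>odd_primes (exp (\<Lambda> R)). H)"
  proof (rule sum_mono)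
    fix q assume q: "q \<in> odd_primes (exp (\<Lambda> R))"
    have q0: "q > 0" using q by (auto simp: odd_primes_def)
    have "c (\<Lambda> l) q * \<epsilon> q \<le> \<bar>c (\<Lambda> l) q\<bar> * \<bar>\<epsilon> q\<bar>" unfolding abs_mult[symmetric] by (rule abs_ge_self)
    also have "\<dots> \<le> \<bar>c (\<Lambda> l) q\<bar> * 1" using e by (intro mult_left_mono) auto
    also have "\<dots> \<le> \<bar>h q\<bar> / sqrt (real q)" using c[OF \<Lambda>_ge_1[OF l] q0] by simp
    also have "\<dots> \<le> \<bar>h q\<bar> / 1" using q0 by (intro divide_left_mono) auto
    also have "\<dots> \<le> H" using h[of q] by simp
    finally show "c (\<Lambda> l) q * \<epsilon> q \<le> H" .
  qed
  also have "\<dots> = H * real (card (odd_primes (exp (\<Lambda> R))))" by simp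
  also have "\<dots> \<le> H * exp (16 * y0)"
  proof (rule mult_left_mono[OF _ H0])
    have "real (card (odd_primes (exp (\<Lambda> R)))) \<le> exp (\<Lambda> R)" by (rule card_odd_primes) simp
    also have "\<dots> \<le> exp (16 * y0)" using \<Lambda>_R by simp
    finally show "real (card (odd_primes (exp (\<Lambda> R)))) \<le> exp (16 * y0)" .
  qed
  finally have base: "(\<Sum>q\<in>odd_primes (exp (\<Lambda> R)). c (\<Lambda> l) q * \<epsilon> q) \<le> H * exp (16 * y0)" .
  have "exp ((\<Sum>q\<in>odd_primes (exp (\<Lambda> l)). c (\<Lambda> l) q * \<epsilon> q) + C1 * ln X / \<Lambda> l) \<le>
     exp (H * exp (16 * y0) + (\<Sum>s\<in>{l..<R}. P s l \<epsilon>) + C1 * ln X / \<Lambda> l)"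
    unfolding exp_le_cancel_iff sum_odd_primes_split[OF l] P_def using base by linarith
  also have "\<dots> = exp (H * exp (16 * y0)) * exp (\<Sum>s\<in>{l..<R}. P s l \<epsilon>) * exp (C1 * ln X / \<Lambda> l)"
    by (simp only: exp_add)
  also have "\<dots> \<le> exp (H * exp (16 * y0)) * (exp 2 * (\<Prod>s\<in>{l..<R}. g s l \<epsilon>)) * exp (C1 * ln X / \<Lambda> l)"
    by (intro mult_right_mono mult_left_mono exp_block_le l b) auto
  also have "\<dots> = K0 * (exp (C1 * ln X / \<Lambda> l) * (\<Prod>s\<in>{l..<R}. g s l \<epsilon>))"
    unfolding K0_def by (simp only: mult_ac)
  finally show ?thesis .
qed

text \<open>The sum over all cases for the first bad block. The summands are nonnegative, so this
  single function dominates in every case and can be averaged over all discriminants.\<close>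

definition S :: "(nat \<Rightarrow> real) \<Rightarrow> real" where
  "S \<epsilon> = exp (C1 * ln X / \<Lambda> 0) * T0 \<epsilon> + (\<Sum>m<R. \<Sum>l\<le>m. exp (C1 * ln X / \<Lambda> (Suc m)) * T m l \<epsilon>)"

lemma S_nonneg: "S \<epsilon> \<ge> 0"
  unfolding S_def by (intro add_nonneg_nonneg sum_nonneg mult_nonneg_nonneg T0_nonneg T_nonneg) auto

text \<open>Let \<open>m\<close> be the first block, starting from the small primes, on which one of the sums is large.
  The bound at scale \<open>Suc m\<close> only involves blocks without large sums, and a high power of the large
  sum compensates for the bad quality of that bound.\<close>
lemma pointwise_bound:
  assumes e: "\<And>q. \<bar>\<epsilon> q\<bar> \<le> 1"
    and v: "\<And>L. 1 \<le> L \<Longrightarrow> L \<le> ln X \<Longrightarrow> v \<le> exp ((\<Sum>q\<in>odd_primes (exp L). c L q * \<epsilon> q) + C1 * ln X / L)"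
  shows "v \<le> K0 * S \<epsilon>"
proof -
  have K0: "K0 > 0" by (simp add: K0_def)
  have vl: "v \<le> K0 * (exp (C1 * ln X / \<Lambda> l) * (\<Prod>s\<in>{l..<R}. g s l \<epsilon>))"
    if l: "l \<le> R" and b: "\<And>s. s \<in> {l..<R} \<Longrightarrow> \<bar>P s l \<epsilon>\<bar> \<le> real (ell s)" for l
    by (rule order.trans[OF v[OF \<Lambda>_ge_1[OF l] \<Lambda>_le] scale_bound[OF e l b]])
  have Tsum: "0 \<le> (\<Sum>l\<le>m. exp (C1 * ln X / \<Lambda> (Suc m)) * T m l \<epsilon>)" for m
    by (intro sum_nonneg mult_nonneg_nonneg T_nonneg) auto
  show ?thesis
  proof (cases "\<exists>m<R. \<exists>l\<le>m. \<bar>P m l \<epsilon>\<bar> > real (ell m)")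
    case False
    have "v \<le> K0 * (exp (C1 * ln X / \<Lambda> 0) * T0 \<epsilon>)"
      unfolding T0_def
    proof (rule vl)
      show "\<bar>P s 0 \<epsilon>\<bar> \<le> real (ell s)" if "s \<in> {0..<R}" for s
        using False that by (meson atLeastLessThan_iff le0 not_le)
    qed simp
    also have "\<dots> \<le> K0 * S \<epsilon>"
      unfolding S_def using K0 Tsum by (intro mult_left_mono) (auto intro: sum_nonneg)
    finally show ?thesis .
  next
    case True
    define A where "A = {m. m < R \<and> (\<exists>l\<le>m. \<bar>P m l \<epsilon>\<bar> > real (ell m))}"
    have A: "finite A" "A \<noteq> {}" using True by (auto simp: A_def)
    \<comment> \<open>A larger index means smaller primes, hence the maximum.\<close>
    define m where "m = Max A"
    have "m \<in> A" unfolding m_def using A by (rule Max_in)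
    then obtain l where m: "m < R" and l: "l \<le> m" "\<bar>P m l \<epsilon>\<bar> > real (ell m)" by (auto simp: A_def)
    have good: "\<bar>P s (Suc m) \<epsilon>\<bar> \<le> real (ell s)" if "s \<in> {Suc m..<R}" for s
    proof -
      have "s \<notin> A" using Max_ge[OF A(1), of s] that unfolding m_def[symmetric] by auto
      then show ?thesis using that unfolding A_def by (auto simp: not_less)
    qed
    define pr where "pr = (\<Prod>s\<in>{Suc m..<R}. g s (Suc m) \<epsilon>)"
    have pr: "pr \<ge> 0" unfolding pr_def by (intro prod_nonneg) (simp add: g_nonneg)
    have "v \<le> K0 * (exp (C1 * ln X / \<Lambda> (Suc m)) * pr)"
      unfolding pr_def using m by (intro vl good) auto
    also have "\<dots> \<le> K0 * (exp (C1 * ln X / \<Lambda> (Suc m)) * T m l \<epsilon>)"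
    proof -
      have e0: "real (ell m) > 0" using ell_ge(2)[of m] by simp
      have "1 \<le> \<bar>P m l \<epsilon> / real (ell m)\<bar>" using l(2) e0 by simp
      then have "1 \<le> \<bar>P m l \<epsilon> / real (ell m)\<bar> ^ (2 * rr m)" by (rule one_le_power)
      also have "\<dots> = (P m l \<epsilon> / real (ell m)) ^ (2 * rr m)" by (rule power_even_abs) simp
      finally have "pr * 1 \<le> T m l \<epsilon>" unfolding T_def pr_def[symmetric] using pr by (rule mult_left_mono)
      then show ?thesis using K0 by (intro mult_left_mono) auto
    qed
    also have "\<dots> \<le> K0 * S \<epsilon>"
    proof (rule mult_left_mono)
      have "exp (C1 * ln X / \<Lambda> (Suc m)) * T m l \<epsilon> \<le> (\<Sum>l\<le>m. exp (C1 * ln X / \<Lambda> (Suc m)) * T m l \<epsilon>)"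
        using l by (intro member_le_sum) (auto simp: T_nonneg)
      also have "\<dots> \<le> (\<Sum>m<R. \<Sum>l\<le>m. exp (C1 * ln X / \<Lambda> (Suc m)) * T m l \<epsilon>)"
        using m Tsum by (intro member_le_sum) auto
      also have "\<dots> \<le> S \<epsilon>" unfolding S_def using T0_nonneg[of \<epsilon>] by simp
      finally show "exp (C1 * ln X / \<Lambda> (Suc m)) * T m l \<epsilon> \<le> S \<epsilon>" .
    qed (use K0 in auto)
    finally show ?thesis .
  qed
qed

text \<open>For a bad block \<open>m\<close> there are \<open>Suc m\<close> possible scales
  \<open>l\<close>, against a saving that is doubly exponential in \<open>m\<close>.\<close>

lemma rr_sum: "(\<Sum>m<R. real (Suc m) * exp (- real (rr m))) \<le> 2"
proof -
  have "(\<Sum>m<R. real (Suc m) * exp (- real (rr m))) \<le> (\<Sum>m<R. (1/2) ^ m)"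
  proof (rule sum_mono)
    fix m
    have "2 * Suc m \<le> 16 * 16 ^ m" by (induction m) auto
    also have "\<dots> \<le> rr m" using kappa(1) by (simp add: rr_def)
    finally have "2 * real (Suc m) \<le> real (rr m)" by (metis of_nat_le_iff of_nat_mult of_nat_numeral)
    then have "exp (- real (rr m)) \<le> exp (- real (Suc m) + - real (Suc m))" by (subst exp_le_cancel_iff) simp
    also have "\<dots> = exp (- real (Suc m)) * exp (- real (Suc m))" by (rule exp_add)
    finally have "real (Suc m) * exp (- real (rr m)) \<le> real (Suc m) * (exp (- real (Suc m)) * exp (- real (Suc m)))"
      by (intro mult_left_mono) auto
    also have "\<dots> \<le> exp (real (Suc m)) * (exp (- real (Suc m)) * exp (- real (Suc m)))"
      using exp_ge_add_one_self[of "real (Suc m)"] by (intro mult_right_mono mult_nonneg_nonneg exp_ge_zero) linarith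
    also have "\<dots> = exp (- real (Suc m))" by (simp only: exp_add[symmetric]) simp
    also have "\<dots> \<le> (1/2) ^ Suc m" by (rule exp_minus_le_half_power)
    also have "\<dots> \<le> (1/2) ^ m" by simp
    finally show "real (Suc m) * exp (- real (rr m)) \<le> (1/2) ^ m" .
  qed
  also have "\<dots> \<le> 2" by (rule sum_geometric_half_le) simp
  finally show ?thesis .
qed

lemma R_le: "real R \<le> ln X"
proof -
  have "real R \<le> 16 ^ R" using less_exp[of R] power_mono[of 2 16 R] by (simp add: order.trans[OF less_imp_le])
  also have "(16::real) ^ R = 1 * 1 * 16 ^ R * 1" by simp
  also have "\<dots> \<le> 1280 * real \<kappa> * 16 ^ R * \<Lambda> R" using kappa(1) \<Lambda>_ge_1[of R] by (intro mult_mono) auto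
  finally show ?thesis using lnX[of R] by simp
qed

lemma prefactor_le: "l \<le> R \<Longrightarrow> exp (C1 * ln X / \<Lambda> l) \<le> exp (ln X / 20)"
proof -
  assume l: "l \<le> R"
  have "20 * C1 \<le> \<Lambda> l" using \<Lambda>_ge[OF l] y0(2) by linarith
  then have "C1 / \<Lambda> l \<le> 1 / 20" using \<Lambda>_ge_1[OF l] by (simp add: field_simps)
  then have "ln X * (C1 / \<Lambda> l) \<le> ln X * (1 / 20)" using lnX_pos by (intro mult_left_mono) auto
  then show ?thesis by (simp add: mult.commute)
qed

text \<open>\<open>S\<close> consists of at most \<open>(1 + ln X)^2\<close> polynomials, each
  averaged by \<open>dpoly_transfer\<close>. Coefficient norm and prefactor are both at most
  \<open>exp (ln X / 20)\<close>, whence the factor \<open>exp (ln X / 10)\<close> in front of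
  \<open>Er\<close>.\<close>

lemma weighted_S_bound:
  assumes w: "\<And>n. n \<in> D \<Longrightarrow> \<omega> n \<ge> 0" "(\<Sum>n\<in>D. \<omega> n) \<le> W" and Er: "Er \<ge> 0"
    and err: "\<And>M. set_mset M \<subseteq> odd_primes X \<Longrightarrow> real (prod_mset M) \<le> exp (ln X / 20) \<Longrightarrow>
       \<bar>(\<Sum>d\<in>D. \<omega> d * (\<Prod>q\<in>#M. \<epsilon> d q)) - (\<Sum>n\<in>D. \<omega> n) * (if \<forall>q. even (count M q) then 1 else 0)\<bar> \<le> Er"
  shows "(\<Sum>d\<in>D. \<omega> d * S (\<epsilon> d)) \<le> W * (exp (1280 * C1 * \<kappa>) + 2) * G + (1 + ln X)\<^sup>2 * (exp (ln X / 10) * Er)"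
proof -
  define V where "V = (\<Sum>n\<in>D. \<omega> n)"
  have V: "0 \<le> V" "V \<le> W" unfolding V_def using w by (auto intro: sum_nonneg)
  have tr: "(\<Sum>d\<in>D. \<omega> d * F (\<epsilon> d)) \<le> V * sE (odd_primes X) F + exp (ln X / 20) * Er"
    if "dpoly (odd_primes X) (exp (ln X / 20)) (exp (ln X / 20)) F" for F
    using dpoly_transfer[OF that finite_odd_primes err] unfolding V_def by fastforce
  have e10: "exp (ln X / 20) * exp (ln X / 20) = exp (ln X / 10)" by (simp add: exp_add[symmetric])
  have one: "(\<Sum>d\<in>D. \<omega> d * (a * F (\<epsilon> d))) \<le> V * (sE (odd_primes X) F * a) + exp (ln X / 10) * Er"
    if F: "dpoly (odd_primes X) (exp (ln X / 20)) (exp (ln X / 20)) F" and a: "0 \<le> a" "a \<le> exp (ln X / 20)" for F a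
  proof -
    have "(\<Sum>d\<in>D. \<omega> d * (a * F (\<epsilon> d))) = a * (\<Sum>d\<in>D. \<omega> d * F (\<epsilon> d))"
      by (simp add: sum_distrib_left mult_ac)
    also have "\<dots> \<le> a * (V * sE (odd_primes X) F + exp (ln X / 20) * Er)" using a tr[OF F] by (intro mult_left_mono) auto
    also have "\<dots> = V * (sE (odd_primes X) F * a) + a * (exp (ln X / 20) * Er)" by (simp add: algebra_simps)
    also have "a * (exp (ln X / 20) * Er) \<le> exp (ln X / 20) * (exp (ln X / 20) * Er)"
      using a Er by (intro mult_right_mono) auto
    finally show ?thesis by (simp only: mult.assoc[symmetric] e10)
  qed
  define E where "E = exp (ln X / 10) * Er"
  have E: "E \<ge> 0" using Er by (simp add: E_def)
  have "(\<Sum>d\<in>D. \<omega> d * S (\<epsilon> d)) = (\<Sum>d\<in>D. \<omega> d * (exp (C1 * ln X / \<Lambda> 0) * T0 (\<epsilon> d))) +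
      (\<Sum>d\<in>D. \<Sum>m<R. \<Sum>l\<le>m. \<omega> d * (exp (C1 * ln X / \<Lambda> (Suc m)) * T m l (\<epsilon> d)))"
    unfolding S_def by (simp only: distrib_left sum.distrib sum_distrib_left)
  also have "(\<Sum>d\<in>D. \<Sum>m<R. \<Sum>l\<le>m. \<omega> d * (exp (C1 * ln X / \<Lambda> (Suc m)) * T m l (\<epsilon> d)))
      = (\<Sum>m<R. \<Sum>l\<le>m. \<Sum>d\<in>D. \<omega> d * (exp (C1 * ln X / \<Lambda> (Suc m)) * T m l (\<epsilon> d)))"
    by (subst sum.swap) (intro sum.cong refl sum.swap)
  also have "\<dots> \<le> (\<Sum>m<R. \<Sum>l\<le>m. V * (G * exp (- real (rr m))) + E)"
  proof (intro sum_mono)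
    fix m l assume ml: "m \<in> {..<R}" "l \<in> {..m}"
    have "(\<Sum>d\<in>D. \<omega> d * (exp (C1 * ln X / \<Lambda> (Suc m)) * T m l (\<epsilon> d))) \<le> V * (sE (odd_primes X) (T m l) * exp (C1 * ln X / \<Lambda> (Suc m))) + E"
      unfolding E_def using ml by (intro one dpoly_T prefactor_le) auto
    also have "\<dots> \<le> V * (G * exp (- real (rr m))) + E"
      using ml V by (intro add_right_mono mult_left_mono sE_T_le) auto
    finally show "(\<Sum>d\<in>D. \<omega> d * (exp (C1 * ln X / \<Lambda> (Suc m)) * T m l (\<epsilon> d))) \<le> V * (G * exp (- real (rr m))) + E" .
  qed
  also have "\<dots> = V * G * (\<Sum>m<R. real (Suc m) * exp (- real (rr m))) + (\<Sum>m<R. real (Suc m)) * E"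
    by (simp add: sum.distrib sum_distrib_left sum_distrib_right algebra_simps)
  also have "\<dots> \<le> V * G * 2 + (real R)\<^sup>2 * E"
  proof (intro add_mono mult_left_mono mult_right_mono rr_sum E)
    have "(\<Sum>m<R. real (Suc m)) \<le> (\<Sum>m<R. real R)" by (rule sum_mono) auto
    then show "(\<Sum>m<R. real (Suc m)) \<le> (real R)\<^sup>2" by (simp add: power2_eq_square)
  qed (use V G_ge_1 in auto)
  also have "(\<Sum>d\<in>D. \<omega> d * (exp (C1 * ln X / \<Lambda> 0) * T0 (\<epsilon> d))) \<le> V * (G * exp (1280 * C1 * \<kappa>)) + E"
  proof -
    have pre: "C1 * ln X / \<Lambda> 0 = 1280 * C1 * \<kappa>" unfolding lnX[of 0] using \<Lambda>_ge_1[of 0] by simp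
    have "(\<Sum>d\<in>D. \<omega> d * (exp (C1 * ln X / \<Lambda> 0) * T0 (\<epsilon> d))) \<le> V * (sE (odd_primes X) T0 * exp (C1 * ln X / \<Lambda> 0)) + E"
      unfolding E_def by (intro one dpoly_T0 prefactor_le) auto
    also have "\<dots> \<le> V * (G * exp (C1 * ln X / \<Lambda> 0)) + E"
      using V by (intro add_right_mono mult_left_mono mult_right_mono sE_T0_le) auto
    finally show ?thesis unfolding pre .
  qed
  finally have "(\<Sum>d\<in>D. \<omega> d * S (\<epsilon> d)) \<le> V * ((exp (1280 * C1 * \<kappa>) + 2) * G) + (1 + (real R)\<^sup>2) * E"
    by (simp add: algebra_simps)
  also have "\<dots> \<le> W * ((exp (1280 * C1 * \<kappa>) + 2) * G) + (1 + ln X)\<^sup>2 * E"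
  proof (intro add_mono mult_right_mono E V)
    have "(real R)\<^sup>2 \<le> (ln X)\<^sup>2" using R_le by (intro power_mono) auto
    moreover have "(1 + ln X)\<^sup>2 = 1 + (ln X)\<^sup>2 + 2 * ln X" by (simp add: power2_sum)
    ultimately show "1 + (real R)\<^sup>2 \<le> (1 + ln X)\<^sup>2" using lnX_pos by linarith
  qed (use G_ge_1 in \<open>auto intro!: mult_nonneg_nonneg add_nonneg_nonneg\<close>)
  finally show ?thesis by (simp add: E_def mult.assoc)
qed

end

text \<open>The scales start at a fixed fraction of \<open>ln X\<close> and have to stop at a size
  bounded independently of \<open>X\<close>; \<open>16 ^ R\<close> is the largest power of 16 not
  exceeding \<open>Y / y\<close>.\<close>

lemma exists_geometric_scale:
  fixes y Y :: real
  assumes "y > 0" "Y \<ge> y"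
  obtains R where "y \<le> Y / 16 ^ R" "Y / 16 ^ R \<le> 16 * y"
proof -
  define k where "k = nat \<lfloor>Y / y\<rfloor>"
  have k1: "Y / y \<ge> 1" using assms by simp
  then have k: "k \<ge> 1" unfolding k_def by linarith
  obtain R where R: "16 ^ R \<le> k" "k < 16 ^ (R + 1)" using ex_power_ivl1[of 16 k] k by auto
  have "real (16 ^ R) \<le> real k" using R(1) by (rule of_nat_mono)
  also have "\<dots> \<le> Y / y" unfolding k_def using k1 by simp
  finally have 1: "16 ^ R \<le> Y / y" by simp
  have "Y / y < real k + 1" unfolding k_def using k1 by linarith
  also have "\<dots> = real (k + 1)" by simp
  also have "\<dots> \<le> real (16 ^ (R + 1))" using R(2) by (intro of_nat_mono) simp
  finally have 2: "Y / y \<le> 16 * 16 ^ R" by simp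
  show thesis
  proof (rule that)
    show "y \<le> Y / 16 ^ R" using 1 assms by (simp add: field_simps)
    show "Y / 16 ^ R \<le> 16 * y" using 2 assms by (simp add: field_simps)
  qed
qed

text \<open>The constants depend on \<open>H\<close> and \<open>C1\<close> but not on
  \<open>h\<close>, \<open>c\<close> or \<open>f\<close>, which makes the final estimate uniform in
  the shifts. The values \<open>f d\<close> enter through their bounds for all cut-offs at once,
  since the cut-off in use varies with \<open>d\<close>.\<close>

lemma twisted_moment_bound:
  assumes grh: GRH and H: "H \<ge> 0" and C1: "C1 > 0"
  obtains C X0 :: real where "C > 0"
    "\<And>X h c f. \<lbrakk>X \<ge> X0; \<And>q. \<bar>h q\<bar> \<le> H; \<And>L q. L \<ge> 1 \<Longrightarrow> q > 0 \<Longrightarrow> \<bar>c L q\<bar> \<le> \<bar>h q\<bar> / sqrt (real q);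
       \<And>d L. d \<in> odd_primes X \<Longrightarrow> 1 \<le> L \<Longrightarrow> L \<le> ln X \<Longrightarrow>
         f d \<le> exp ((\<Sum>q\<in>odd_primes (exp L). c L q * leg_sign d q) + C1 * ln X / L)\<rbrakk> \<Longrightarrow>
     (\<Sum>d\<in>odd_primes X. ln (real d) * f d) \<le> C * X * exp ((\<Sum>q\<in>odd_primes X. (h q)\<^sup>2 / real q) / 2)"
proof -
  obtain CT :: real where CT: "CT > 0"
    "\<And>X M. \<lbrakk>GRH; X \<ge> 1; \<And>q. q \<in># M \<Longrightarrow> prime q \<and> q > 2\<rbrakk> \<Longrightarrow>
      \<bar>(\<Sum>m=1..nat \<lceil>3 * X\<rceil>. pweight X m * (\<Prod>q\<in>#M. leg_sign m q)) -
        (\<Sum>m=1..nat \<lceil>3 * X\<rceil>. pweight X m) * (if \<forall>q. even (count M q) then 1 else 0)\<bar>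
      \<le> CT * (ln X + 2) * X powr (3/4) * real (prod_mset M)"
  proof (rule leg_sign_transfer)
    fix C :: real
    assume a: "C > 0" and b: "\<And>X M. \<lbrakk>GRH; X \<ge> 1; \<And>q. q \<in># M \<Longrightarrow> prime q \<and> q > 2\<rbrakk> \<Longrightarrow>
      \<bar>(\<Sum>m=1..nat \<lceil>3 * X\<rceil>. pweight X m * (\<Prod>q\<in>#M. leg_sign m q)) -
        (\<Sum>m=1..nat \<lceil>3 * X\<rceil>. pweight X m) * (if \<forall>q. even (count M q) then 1 else 0)\<bar>
      \<le> C * (ln X + 2) * X powr (3/4) * real (prod_mset M)"
    show thesis by (rule that[OF a]) (rule b)
  qed
  define y0 where "y0 = max 1 (max (20 * C1) (2 * ln (2 * H + 1)))"
  have y0: "y0 \<ge> 1" "y0 \<ge> 20 * C1" "y0 \<ge> 2 * ln (2 * H + 1)" unfolding y0_def by linarith+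
  have y0H: "exp (y0 / 2) \<ge> 2 * H"
  proof -
    have "2 * H + 1 = exp (ln (2 * H + 1))" using H by simp
    also have "\<dots> \<le> exp (y0 / 2)" using y0(3) by (subst exp_le_cancel_iff) linarith
    finally show ?thesis by linarith
  qed
  obtain \<kappa>' :: nat where \<kappa>': "32 * exp 1 * (288 * H\<^sup>2 + 1) * exp (1280 * C1 + 1) \<le> real \<kappa>'"
    using real_arch_simple by blast
  define \<kappa> where "\<kappa> = Suc \<kappa>'"
  have \<kappa>: "\<kappa> \<ge> 1" "real \<kappa> \<ge> 32 * exp 1 * (288 * H\<^sup>2 + 1) * exp (1280 * C1 + 1)" using \<kappa>' by (auto simp: \<kappa>_def)
  \<comment> \<open>So large that the first scale \<open>\<Lambda> 0\<close> is at least
    \<open>y0\<close>.\<close>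
  define X0 where "X0 = exp (1280 * real \<kappa> * y0)"
  define K where "K = exp 2 * exp (H * exp (16 * y0))"
  define C where "C = 4 * K * (72 * (exp (1280 * C1 * real \<kappa>) + 2) + 81000 * CT)"
  have C: "C > 0" unfolding C_def K_def using CT(1) by (intro mult_pos_pos add_pos_pos) auto
  have main: "(\<Sum>d\<in>odd_primes X. ln (real d) * f d) \<le> C * X * exp ((\<Sum>q\<in>odd_primes X. (h q)\<^sup>2 / real q) / 2)"
    if XX: "X \<ge> X0" and h: "\<And>q. \<bar>h q\<bar> \<le> H" and c: "\<And>L q. L \<ge> 1 \<Longrightarrow> q > 0 \<Longrightarrow> \<bar>c L q\<bar> \<le> \<bar>h q\<bar> / sqrt (real q)"
      and f: "\<And>d L. d \<in> odd_primes X \<Longrightarrow> 1 \<le> L \<Longrightarrow> L \<le> ln X \<Longrightarrow>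
         f d \<le> exp ((\<Sum>q\<in>odd_primes (exp L). c L q * leg_sign d q) + C1 * ln X / L)"
    for X h c f
  proof -
    have X0: "X0 > 0" by (simp add: X0_def)
    have X: "X > 0" using XX X0 by linarith
    have "ln X0 \<le> ln X" using XX X0 X by (subst ln_le_cancel_iff)
    then have lX: "1280 * real \<kappa> * y0 \<le> ln X" by (simp add: X0_def)
    have "1 * 1 \<le> 1280 * real \<kappa> * y0" using \<kappa>(1) y0(1) by (intro mult_mono) auto
    then have lX1: "ln X \<ge> 1" using lX by linarith
    have X1: "X \<ge> 1" using lX1 X ln_ge_zero_iff[of X] by linarith
    have "y0 \<le> ln X / (1280 * real \<kappa>)" using lX \<kappa>(1) by (simp add: field_simps)
    then obtain R where R: "y0 \<le> ln X / (1280 * real \<kappa>) / 16 ^ R" "ln X / (1280 * real \<kappa>) / 16 ^ R \<le> 16 * y0"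
      using exists_geometric_scale[of y0 "ln X / (1280 * real \<kappa>)"] y0(1) by (metis less_le_trans zero_less_one)
    interpret ps: prime_scales X H C1 y0 \<kappa> R h c "\<lambda>s. ln X / (1280 * real \<kappa> * 16 ^ s)"
      using X C1 y0 y0H R \<kappa> h c by unfold_locales auto
    have K0: "ps.K0 = K" by (simp add: ps.K0_def K_def)
    have K: "K > 0" by (simp add: K_def)
    define J where "J = nat \<lceil>3 * X\<rceil>"
    define Er where "Er = CT * (ln X + 2) * X powr (3/4) * exp (ln X / 20)"
    have Er: "Er \<ge> 0" unfolding Er_def using CT(1) lX1 by simp
    have sub: "odd_primes X \<subseteq> {1..J}"
    proof
      fix d assume d: "d \<in> odd_primes X"
      have "real d \<le> 3 * X" using d X by (auto simp: odd_primes_def)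
      also have "\<dots> \<le> real J" unfolding J_def by (rule real_nat_ceiling_ge)
      finally show "d \<in> {1..J}" using d by (auto simp: odd_primes_def)
    qed
    have "(\<Sum>d\<in>odd_primes X. ln (real d) * f d) \<le> (\<Sum>d\<in>odd_primes X. 4 * K * (pweight X d * ps.S (leg_sign d)))"
    proof (rule sum_mono)
      fix d assume d: "d \<in> odd_primes X"
      then have d': "prime d" "real d \<le> X" "d > 2" by (auto simp: odd_primes_def)
      have "f d \<le> K * ps.S (leg_sign d)" unfolding K0[symmetric]
        by (rule ps.pointwise_bound[OF leg_sign_bound f[OF d]])
      then have "ln (real d) * f d \<le> ln (real d) * (K * ps.S (leg_sign d))" using d' by (intro mult_left_mono) auto
      also have "\<dots> \<le> (4 * pweight X d) * (K * ps.S (leg_sign d))"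
        using pweight_prime[OF d'(1,2)] K ps.S_nonneg by (intro mult_right_mono) auto
      finally show "ln (real d) * f d \<le> 4 * K * (pweight X d * ps.S (leg_sign d))" by (simp only: mult_ac)
    qed
    also have "\<dots> = 4 * K * (\<Sum>d\<in>odd_primes X. pweight X d * ps.S (leg_sign d))" by (simp only: sum_distrib_left)
    \<comment> \<open>Weight and majorant are nonnegative everywhere, so the sum may be extended
      from the odd primes to all integers up to \<open>J\<close>.\<close>
    also have "\<dots> \<le> 4 * K * (\<Sum>d\<in>{1..J}. pweight X d * ps.S (leg_sign d))"
      using K sub by (intro mult_left_mono sum_mono2) (auto intro!: mult_nonneg_nonneg pweight_nonneg ps.S_nonneg)
    also have "\<dots> \<le> 4 * K * ((72 * X) * (exp (1280 * C1 * \<kappa>) + 2) * ps.G + (1 + ln X)\<^sup>2 * (exp (ln X / 10) * Er))"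
    proof (intro mult_left_mono ps.weighted_S_bound)
      show "(\<Sum>n\<in>{1..J}. pweight X n) \<le> 72 * X" by (rule pweight_total[OF X1])
      fix M assume M: "set_mset M \<subseteq> odd_primes X" "real (prod_mset M) \<le> exp (ln X / 20)"
      have "\<bar>(\<Sum>d\<in>{1..J}. pweight X d * (\<Prod>q\<in>#M. leg_sign d q)) - (\<Sum>n\<in>{1..J}. pweight X n) * (if \<forall>q. even (count M q) then 1 else 0)\<bar>
         \<le> CT * (ln X + 2) * X powr (3/4) * real (prod_mset M)"
        unfolding J_def by (rule CT(2)[OF grh X1]) (use M(1) in \<open>auto simp: odd_primes_def\<close>)
      also have "\<dots> \<le> Er" unfolding Er_def using M(2) CT(1) lX1 by (intro mult_left_mono) auto
      finally show "\<bar>(\<Sum>d\<in>{1..J}. pweight X d * (\<Prod>q\<in>#M. leg_sign d q)) - (\<Sum>n\<in>{1..J}. pweight X n) * (if \<forall>q. even (count M q) then 1 else 0)\<bar> \<le> Er" .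
    qed (use K Er pweight_nonneg in auto)
    \<comment> \<open>The exponents add up to 1: 1/10 from norm and prefactor, 3/4 and 1/20 from
      \<open>Er\<close>, and 1/10 for the cube of the logarithm.\<close>
    also have "(1 + ln X)\<^sup>2 * (exp (ln X / 10) * Er) \<le> 81000 * CT * X * ps.G"
    proof -
      define y where "y = ln X"
      have y: "y \<ge> 1" "X = exp y" using lX1 X by (auto simp: y_def)
      have cube: "(y + 2) ^ 3 \<le> 81000 * exp (y / 10)"
      proof -
        have "(y + 2) / 30 \<le> exp ((y + 2) / 30)" using exp_ge_add_one_self[of "(y + 2) / 30"] by linarith
        then have "((y + 2) / 30) ^ 3 \<le> exp ((y + 2) / 30) ^ 3" using y by (intro power_mono) auto
        also have "\<dots> = exp (y / 10 + 1 / 5)" unfolding exp_of_nat_mult[symmetric] by (simp add: add_divide_distrib)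
        also have "\<dots> = exp (y / 10) * exp (1 / 5)" by (rule exp_add)
        also have "\<dots> \<le> exp (y / 10) * 3"
        proof (rule mult_left_mono)
          have "exp (1 / 5) \<le> exp (1::real)" by simp
          then show "exp (1 / 5) \<le> (3::real)" using exp_le by linarith
        qed simp
        finally show ?thesis by (simp add: power_divide)
      qed
      have "(1 + ln X)\<^sup>2 * (exp (ln X / 10) * Er) = CT * ((1 + y)\<^sup>2 * (y + 2)) * (exp (y / 10) * exp (3 / 4 * y) * exp (y / 20))"
        unfolding Er_def y_def[symmetric] by (simp add: y(2) powr_def)
      also have "\<dots> \<le> CT * (81000 * exp (y / 10)) * (exp (y / 10) * exp (3 / 4 * y) * exp (y / 20))"
      proof (intro mult_right_mono mult_left_mono)
        have "(1 + y)\<^sup>2 * (y + 2) \<le> (y + 2)\<^sup>2 * (y + 2)" using y by (intro mult_right_mono power_mono) auto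
        also have "\<dots> = (y + 2) ^ 3" by (simp add: power2_eq_square power3_eq_cube)
        finally show "(1 + y)\<^sup>2 * (y + 2) \<le> 81000 * exp (y / 10)" using cube by linarith
      qed (use CT(1) in auto)
      also have "\<dots> = 81000 * CT * (exp (y / 10) * (exp (y / 10) * exp (3 / 4 * y) * exp (y / 20)))" by simp
      also have "exp (y / 10) * (exp (y / 10) * exp (3 / 4 * y) * exp (y / 20)) = X"
        unfolding exp_add[symmetric] y(2) by (rule arg_cong[of _ _ exp]) (simp add: field_simps)
      also have "81000 * CT * X = 81000 * CT * X * 1" by simp
      also have "\<dots> \<le> 81000 * CT * X * ps.G" using CT(1) X ps.G_ge_1 by (intro mult_left_mono) auto
      finally show ?thesis .
    qed
    finally have "(\<Sum>d\<in>odd_primes X. ln (real d) * f d) \<le> 4 * K * ((72 * X) * (exp (1280 * C1 * \<kappa>) + 2) * ps.G + 81000 * CT * X * ps.G)"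
      using K by simp
    also have "\<dots> = C * X * ps.G" by (simp add: C_def algebra_simps)
    finally show ?thesis by (simp add: ps.G_def)
  qed
  show thesis by (rule that[OF C]) (rule main)
qed

section \<open>The moment bound\<close>

lemma sum_square_split:
  fixes x :: "nat \<Rightarrow> real"
  shows "(\<Sum>m<k. x m)\<^sup>2 = (\<Sum>m<k. (x m)\<^sup>2) + 2 * (\<Sum>m<k. \<Sum>l\<in>{m<..<k}. x m * x l)"
proof (induction k)
  case (Suc k)
  have "(\<Sum>m<Suc k. \<Sum>l\<in>{m<..<Suc k}. x m * x l) = (\<Sum>m<k. \<Sum>l\<in>{m<..<Suc k}. x m * x l)"
  proof -
    have "{k<..<Suc k} = {}" by auto
    then show ?thesis by simp
  qed
  also have "\<dots> = (\<Sum>m<k. (\<Sum>l\<in>{m<..<k}. x m * x l) + x m * x k)"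
  proof (rule sum.cong)
    fix m assume "m \<in> {..<k}"
    then have "{m<..<Suc k} = insert k {m<..<k}" by auto
    then show "(\<Sum>l\<in>{m<..<Suc k}. x m * x l) = (\<Sum>l\<in>{m<..<k}. x m * x l) + x m * x k" by simp
  qed simp
  also have "\<dots> = (\<Sum>m<k. \<Sum>l\<in>{m<..<k}. x m * x l) + (\<Sum>m<k. x m) * x k"
    by (simp add: sum.distrib sum_distrib_right)
  finally show ?case using Suc by (simp add: power2_sum algebra_simps)
qed simp

text \<open>Products of cosines become sums. Diagonal terms have frequencies 0 and
  \<open>2 * t m\<close>, mixed ones \<open>t m - t l\<close> and \<open>t m + t l\<close>.
  Frequency 0 is the source of the power of \<open>ln X\<close>, the others of the zeta
  factors.\<close>

lemma prime_square_sum: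
  fixes a t :: "nat \<Rightarrow> real"
  shows "(\<Sum>q\<in>primes_upto X. (\<Sum>j<k. a j * cos (t j * ln (real q)))\<^sup>2 / real q) / 2 =
    (\<Sum>m<k. (a m)\<^sup>2 / 4 * (prime_cos X 0 + prime_cos X (2 * t m)))
    + (\<Sum>m<k. \<Sum>l\<in>{m<..<k}. a m * a l / 2 * (prime_cos X (t m - t l) + prime_cos X (t m + t l)))"
proof -
  have "(\<Sum>q\<in>primes_upto X. (\<Sum>j<k. a j * cos (t j * ln (real q)))\<^sup>2 / real q) / 2 =
    (\<Sum>q\<in>primes_upto X. (\<Sum>m<k. (a m)\<^sup>2 / 4 * (cos (0 * ln (real q)) / real q + cos (2 * t m * ln (real q)) / real q))
      + (\<Sum>m<k. \<Sum>l\<in>{m<..<k}. a m * a l / 2 * (cos ((t m - t l) * ln (real q)) / real q + cos ((t m + t l) * ln (real q)) / real q)))"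
    unfolding sum_divide_distrib[where A = "primes_upto X"]
  proof (rule sum.cong)
    fix q assume "q \<in> primes_upto X"
    define u where "u = ln (real q)"
    define r where "r = real q"
    have 1: "(a m * cos (t m * u))\<^sup>2 / r / 2 = (a m)\<^sup>2 / 4 * (cos (0 * u) / r + cos (2 * t m * u) / r)" for m
    proof -
      have "cos (2 * t m * u) = 2 * (cos (t m * u))\<^sup>2 - 1" using cos_double_cos[of "t m * u"] by (simp add: mult.assoc)
      then have "cos (0 * u) / r + cos (2 * t m * u) / r = 2 * (cos (t m * u))\<^sup>2 / r"
        by (simp add: add_divide_distrib[symmetric])
      then show ?thesis by (simp only:) (simp add: power_mult_distrib)
    qed
    have 2: "a m * cos (t m * u) * (a l * cos (t l * u)) / r = a m * a l / 2 * (cos ((t m - t l) * u) / r + cos ((t m + t l) * u) / r)" for m l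
    proof -
      have "cos ((t m - t l) * u) + cos ((t m + t l) * u) = 2 * (cos (t m * u) * cos (t l * u))"
        by (simp add: left_diff_distrib distrib_right cos_diff cos_add)
      then have "cos ((t m - t l) * u) / r + cos ((t m + t l) * u) / r = 2 * (cos (t m * u) * cos (t l * u)) / r"
        by (simp only: add_divide_distrib[symmetric])
      then show ?thesis by simp
    qed
    have "(\<Sum>j<k. a j * cos (t j * u))\<^sup>2 / r / 2 =
      (\<Sum>m<k. (a m * cos (t m * u))\<^sup>2 / r / 2) + (\<Sum>m<k. \<Sum>l\<in>{m<..<k}. a m * cos (t m * u) * (a l * cos (t l * u)) / r)"
      unfolding sum_square_split by (simp add: add_divide_distrib sum_divide_distrib)
    from this[unfolded 1 2] show "(\<Sum>j<k. a j * cos (t j * ln (real q)))\<^sup>2 / real q / 2 =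
      (\<Sum>m<k. (a m)\<^sup>2 / 4 * (cos (0 * ln (real q)) / real q + cos (2 * t m * ln (real q)) / real q))
      + (\<Sum>m<k. \<Sum>l\<in>{m<..<k}. a m * a l / 2 * (cos ((t m - t l) * ln (real q)) / real q + cos ((t m + t l) * ln (real q)) / real q))"
      unfolding u_def r_def .
  qed simp
  also have "\<dots> = (\<Sum>m<k. \<Sum>q\<in>primes_upto X. (a m)\<^sup>2 / 4 * (cos (0 * ln (real q)) / real q + cos (2 * t m * ln (real q)) / real q))
      + (\<Sum>m<k. \<Sum>l\<in>{m<..<k}. \<Sum>q\<in>primes_upto X. a m * a l / 2 * (cos ((t m - t l) * ln (real q)) / real q + cos ((t m + t l) * ln (real q)) / real q))"
    unfolding sum.distrib
    by (rule arg_cong2[of _ _ _ _ "(+)"], rule sum.swap, rule trans[OF sum.swap], rule sum.cong[OF refl], rule sum.swap)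
  also have "\<dots> = (\<Sum>m<k. (a m)\<^sup>2 / 4 * (prime_cos X 0 + prime_cos X (2 * t m)))
    + (\<Sum>m<k. \<Sum>l\<in>{m<..<k}. a m * a l / 2 * (prime_cos X (t m - t l) + prime_cos X (t m + t l)))"
    unfolding prime_cos_def by (simp only: sum.distrib[symmetric] sum_distrib_left)
  finally show ?thesis .
qed

theorem theorem1p1:
  fixes k :: nat and a :: "nat \<Rightarrow> real" and A :: real
  assumes grh: GRH
    and k: "k \<ge> 1"
    and a_pos: "\<forall>j<k. a j > 0"
    and A_pos: "A > 0"
  shows "\<exists>C X\<^sub>0. \<forall>(X::real) (t::nat \<Rightarrow> real). X \<ge> X\<^sub>0 \<and> (\<forall>j<k. \<bar>t j\<bar> \<le> X powr A) \<longrightarrow>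
    (\<Sum>p\<in>{p::nat. prime p \<and> odd p \<and> real p \<le> X}.
        ln (real p) * (\<Prod>j<k. cmod (dirichlet_L (kron_char (8 * int p))
                                     (Complex (1/2) (t j))) powr a j))
    \<le> C * (X * ln X powr ((\<Sum>j<k. (a j)\<^sup>2) / 4)
        * (\<Prod>m<k. \<Prod>l\<in>{m<..<k}.
             cmod (zeta (Complex (1 + 1 / ln X) (t m - t l))) powr (a m * a l / 2)
           * cmod (zeta (Complex (1 + 1 / ln X) (t m + t l))) powr (a m * a l / 2))
        * (\<Prod>m<k. cmod (zeta (Complex (1 + 1 / ln X) (2 * t m))) powr ((a m)\<^sup>2 / 4 + a m / 2)))"
proof -
  obtain C1 \<delta> :: real where C1: "C1 > 0" "\<delta> > 0"
    "\<And>d t L X. \<lbrakk>GRH; prime d; d > 2; real d \<le> X; 1 \<le> L; L \<le> ln X; \<bar>t\<bar> \<le> X powr A\<rbrakk> \<Longrightarrow>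
      cmod (dirichlet_L (kron_char (8 * int d)) (Complex (1/2) t)) \<le>
        exp ((\<Sum>q\<in>odd_primes (exp L). prime_coeff \<delta> L q * cos (t * ln (real q)) * leg_sign d q)
              + prime_cos X (2 * t) / 2 + C1 * ln X / L)"
    by (rule dirichlet_L_prime_bound[OF A_pos]) (rule that; assumption)
  define H where "H = (\<Sum>j<k. a j)"
  have H: "H > 0" unfolding H_def using k a_pos by (intro sum_pos) (auto simp: lessThan_empty_iff)
  obtain C X0 :: real where C: "C > 0" and moment:
    "\<And>X h c f. \<lbrakk>X \<ge> X0; \<And>q. \<bar>h q\<bar> \<le> H; \<And>L q. L \<ge> 1 \<Longrightarrow> q > 0 \<Longrightarrow> \<bar>c L q\<bar> \<le> \<bar>h q\<bar> / sqrt (real q);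
       \<And>d L. d \<in> odd_primes X \<Longrightarrow> 1 \<le> L \<Longrightarrow> L \<le> ln X \<Longrightarrow>
         f d \<le> exp ((\<Sum>q\<in>odd_primes (exp L). c L q * leg_sign d q) + (C1 * H) * ln X / L)\<rbrakk> \<Longrightarrow>
     (\<Sum>d\<in>odd_primes X. ln (real d) * f d) \<le> C * X * exp ((\<Sum>q\<in>odd_primes X. (h q)\<^sup>2 / real q) / 2)"
  proof (rule twisted_moment_bound[OF grh, of H "C1 * H"])
    fix C X0 :: real
    assume a: "C > 0" and b: "\<And>X h c f. \<lbrakk>X \<ge> X0; \<And>q. \<bar>h q\<bar> \<le> H; \<And>L q. L \<ge> 1 \<Longrightarrow> q > 0 \<Longrightarrow> \<bar>c L q\<bar> \<le> \<bar>h q\<bar> / sqrt (real q);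
       \<And>d L. d \<in> odd_primes X \<Longrightarrow> 1 \<le> L \<Longrightarrow> L \<le> ln X \<Longrightarrow>
         f d \<le> exp ((\<Sum>q\<in>odd_primes (exp L). c L q * leg_sign d q) + (C1 * H) * ln X / L)\<rbrakk> \<Longrightarrow>
     (\<Sum>d\<in>odd_primes X. ln (real d) * f d) \<le> C * X * exp ((\<Sum>q\<in>odd_primes X. (h q)\<^sup>2 / real q) / 2)"
    show thesis by (rule that[OF a]) (rule b)
  qed (use H C1(1) in auto)
  obtain C2 where C2: "C2 > 0" "\<And>X t. ln X \<ge> 1 \<Longrightarrow> X > 0 \<Longrightarrow>
    \<bar>prime_cos X t - ln (cmod (zeta (Complex (1 + 1 / ln X) t)))\<bar> \<le> C2 \<and> zeta (Complex (1 + 1 / ln X) t) \<noteq> 0"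
    by (rule zeta_prime_cos) (rule that; assumption)
  obtain C3 where C3: "C3 > 0" "\<And>X t. ln X \<ge> 1 \<Longrightarrow> X > 0 \<Longrightarrow> \<bar>prime_cos X t\<bar> \<le> ln (ln X) + C3"
    by (rule prime_cos_bound) (rule that; assumption)
  \<comment> \<open>The total of the bounded errors: \<open>C3\<close> for frequency 0,
    \<open>C2\<close> for each replacement of \<open>prime_cos\<close> by the logarithm of
    zeta.\<close>
  define K where "K = (\<Sum>m<k. (a m)\<^sup>2 / 4 * C3 + ((a m)\<^sup>2 / 4 + a m / 2) * C2) + (\<Sum>m<k. \<Sum>l\<in>{m<..<k}. a m * a l / 2 * (2 * C2))"
  have main: "(\<Sum>p\<in>{p::nat. prime p \<and> odd p \<and> real p \<le> X}.
        ln (real p) * (\<Prod>j<k. cmod (dirichlet_L (kron_char (8 * int p)) (Complex (1/2) (t j))) powr a j))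
    \<le> C * exp K * (X * ln X powr ((\<Sum>j<k. (a j)\<^sup>2) / 4)
        * (\<Prod>m<k. \<Prod>l\<in>{m<..<k}.
             cmod (zeta (Complex (1 + 1 / ln X) (t m - t l))) powr (a m * a l / 2)
           * cmod (zeta (Complex (1 + 1 / ln X) (t m + t l))) powr (a m * a l / 2))
        * (\<Prod>m<k. cmod (zeta (Complex (1 + 1 / ln X) (2 * t m))) powr ((a m)\<^sup>2 / 4 + a m / 2)))"
    if XX: "X \<ge> max X0 (exp 1)" and t: "\<forall>j<k. \<bar>t j\<bar> \<le> X powr A" for X t
  proof -
    have X: "X > 0" using XX by (meson exp_gt_zero less_le_trans max.cobounded2)
    have lX: "ln X \<ge> 1" using XX X by (subst ln_ge_iff) auto
    define lz where "lz = (\<lambda>u. ln (cmod (zeta (Complex (1 + 1 / ln X) u))))"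
    have pc: "prime_cos X u \<le> lz u + C2" for u using C2(2)[OF lX X, of u] unfolding lz_def by linarith
    have zp: "cmod (zeta (Complex (1 + 1 / ln X) u)) powr b = exp (b * lz u)" for u b
      using C2(2)[OF lX X, of u] by (simp add: powr_def lz_def)
    define h where "h = (\<lambda>q. \<Sum>j<k. a j * cos (t j * ln (real q)))"
    define c where "c = (\<lambda>L q. h q * prime_coeff \<delta> L q)"
    \<comment> \<open>The contribution of the squares of primes is the same for all discriminants.
      It is divided out before the moment bound is applied and later yields the exponents
      \<open>a m / 2\<close>.\<close>
    define E where "E = (\<Sum>j<k. a j * (prime_cos X (2 * t j) / 2))"
    define F where "F = (\<lambda>p. \<Prod>j<k. cmod (dirichlet_L (kron_char (8 * int p)) (Complex (1/2) (t j))) powr a j)"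
    have "(\<Sum>d\<in>odd_primes X. ln (real d) * (exp (- E) * F d)) \<le> C * X * exp ((\<Sum>q\<in>odd_primes X. (h q)\<^sup>2 / real q) / 2)"
    proof (rule moment)
      show "X0 \<le> X" using XX by simp
      show "\<bar>h q\<bar> \<le> H" for q
      proof -
        have "\<bar>h q\<bar> \<le> (\<Sum>j<k. \<bar>a j * cos (t j * ln (real q))\<bar>)" unfolding h_def by (rule sum_abs)
        also have "\<dots> \<le> H" unfolding H_def
        proof (rule sum_mono)
          fix j assume "j \<in> {..<k}"
          then have "a j > 0" using a_pos by simp
          then show "\<bar>a j * cos (t j * ln (real q))\<bar> \<le> a j"
            using abs_cos_le_one[of "t j * ln (real q)"] by (simp add: abs_mult)
        qed
        finally show ?thesis .
      qed
      show "\<bar>c L q\<bar> \<le> \<bar>h q\<bar> / sqrt (real q)" if "L \<ge> 1" "q > 0" for L q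
      proof -
        have "real q powr - (1/2 + \<delta> / L) \<le> real q powr - (1/2)" using that C1(2) by (intro powr_mono) auto
        also have "\<dots> = 1 / sqrt (real q)" by (simp only: powr_minus powr_half_sqrt[OF of_nat_0_le_iff] inverse_eq_divide)
        finally have "real q powr - (1/2 + \<delta> / L) * \<bar>jft (6 * ln (real q) / L)\<bar> \<le> 1 / sqrt (real q) * 1"
          using jft_abs_le_1 by (intro mult_mono) auto
        then have "\<bar>h q\<bar> * (real q powr - (1/2 + \<delta> / L) * \<bar>jft (6 * ln (real q) / L)\<bar>) \<le> \<bar>h q\<bar> * (1 / sqrt (real q))"
          by (intro mult_left_mono) auto
        then show ?thesis by (simp add: c_def prime_coeff_def abs_mult)
      qed
      show "exp (- E) * F d \<le> exp ((\<Sum>q\<in>odd_primes (exp L). c L q * leg_sign d q) + C1 * H * ln X / L)"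
        if d: "d \<in> odd_primes X" and L: "1 \<le> L" "L \<le> ln X" for d L
      proof -
        have d': "prime d" "d > 2" "real d \<le> X" using d by (auto simp: odd_primes_def)
        define Q where "Q = (\<lambda>j. \<Sum>q\<in>odd_primes (exp L). prime_coeff \<delta> L q * cos (t j * ln (real q)) * leg_sign d q)"
        have "F d \<le> (\<Prod>j<k. exp (a j * (Q j + prime_cos X (2 * t j) / 2 + C1 * ln X / L)))"
          unfolding F_def
        proof (intro prod_mono conjI)
          fix j assume j: "j \<in> {..<k}"
          have "cmod (dirichlet_L (kron_char (8 * int d)) (Complex (1/2) (t j))) powr a j
              \<le> exp (Q j + prime_cos X (2 * t j) / 2 + C1 * ln X / L) powr a j"
            unfolding Q_def using j a_pos t by (intro powr_mono2 C1(3)[OF grh d' L]) (auto intro: less_imp_le)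
          also have "\<dots> = exp (a j * (Q j + prime_cos X (2 * t j) / 2 + C1 * ln X / L))" by (simp add: powr_def)
          finally show "cmod (dirichlet_L (kron_char (8 * int d)) (Complex (1/2) (t j))) powr a j
              \<le> exp (a j * (Q j + prime_cos X (2 * t j) / 2 + C1 * ln X / L))" .
        qed simp
        also have "\<dots> = exp (\<Sum>j<k. a j * Q j + a j * (prime_cos X (2 * t j) / 2) + C1 * a j * ln X / L)"
          by (simp add: exp_sum algebra_simps)
        also have "(\<Sum>j<k. a j * Q j + a j * (prime_cos X (2 * t j) / 2) + C1 * a j * ln X / L) = (\<Sum>j<k. a j * Q j) + E + C1 * H * ln X / L"
          unfolding E_def H_def by (simp only: sum.distrib sum_distrib_left sum_distrib_right sum_divide_distrib)
        also have "(\<Sum>j<k. a j * Q j) = (\<Sum>q\<in>odd_primes (exp L). c L q * leg_sign d q)"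
          unfolding Q_def c_def h_def sum_distrib_left sum_distrib_right by (subst sum.swap) (simp only: mult_ac)
        finally have "exp (- E) * F d \<le> exp (- E) * exp ((\<Sum>q\<in>odd_primes (exp L). c L q * leg_sign d q) + E + C1 * H * ln X / L)"
          by (rule mult_left_mono) simp
        then show ?thesis by (simp add: exp_add[symmetric])
      qed
    qed
    also have "(\<Sum>d\<in>odd_primes X. ln (real d) * (exp (- E) * F d)) = exp (- E) * (\<Sum>d\<in>odd_primes X. ln (real d) * F d)"
      by (simp add: sum_distrib_left mult_ac)
    \<comment> \<open>Admitting the prime 2 enlarges the sum and completes it to
      \<open>prime_cos\<close>.\<close>
    also have "C * X * exp ((\<Sum>q\<in>odd_primes X. (h q)\<^sup>2 / real q) / 2) \<le> C * X * exp ((\<Sum>q\<in>primes_upto X. (h q)\<^sup>2 / real q) / 2)"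
    proof (intro mult_left_mono)
      have "(\<Sum>q\<in>odd_primes X. (h q)\<^sup>2 / real q) \<le> (\<Sum>q\<in>primes_upto X. (h q)\<^sup>2 / real q)"
        by (rule sum_mono2) (auto simp: odd_primes_def)
      then show "exp ((\<Sum>q\<in>odd_primes X. (h q)\<^sup>2 / real q) / 2) \<le> exp ((\<Sum>q\<in>primes_upto X. (h q)\<^sup>2 / real q) / 2)" by simp
    qed (use C X in auto)
    finally have "exp E * (exp (- E) * (\<Sum>d\<in>odd_primes X. ln (real d) * F d)) \<le> exp E * (C * X * exp ((\<Sum>q\<in>primes_upto X. (h q)\<^sup>2 / real q) / 2))"
      by (rule mult_left_mono) simp
    also have "exp E * (exp (- E) * (\<Sum>d\<in>odd_primes X. ln (real d) * F d)) = (\<Sum>d\<in>odd_primes X. ln (real d) * F d)"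
      by (simp add: exp_minus)
    also have "exp E * (C * X * exp ((\<Sum>q\<in>primes_upto X. (h q)\<^sup>2 / real q) / 2)) = C * X * exp (E + (\<Sum>q\<in>primes_upto X. (h q)\<^sup>2 / real q) / 2)"
      by (simp only: exp_add mult_ac)
    finally have "(\<Sum>d\<in>odd_primes X. ln (real d) * F d) \<le> C * X * exp (E + (\<Sum>q\<in>primes_upto X. (h q)\<^sup>2 / real q) / 2)" .
    also have "\<dots> \<le> C * X * exp (K + (((\<Sum>j<k. (a j)\<^sup>2) / 4) * ln (ln X)
          + (\<Sum>m<k. \<Sum>l\<in>{m<..<k}. a m * a l / 2 * lz (t m - t l) + a m * a l / 2 * lz (t m + t l))
          + (\<Sum>m<k. ((a m)\<^sup>2 / 4 + a m / 2) * lz (2 * t m))))"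
    proof (intro mult_left_mono)
      have pc0: "prime_cos X 0 \<le> ln (ln X) + C3" using C3(2)[OF lX X, of 0] by linarith
      have "E + (\<Sum>q\<in>primes_upto X. (h q)\<^sup>2 / real q) / 2 =
        (\<Sum>m<k. (a m)\<^sup>2 / 4 * prime_cos X 0 + ((a m)\<^sup>2 / 4 + a m / 2) * prime_cos X (2 * t m))
        + (\<Sum>m<k. \<Sum>l\<in>{m<..<k}. a m * a l / 2 * (prime_cos X (t m - t l) + prime_cos X (t m + t l)))"
        unfolding h_def prime_square_sum E_def by (simp add: sum.distrib[symmetric] algebra_simps)
      also have "\<dots> \<le> (\<Sum>m<k. (a m)\<^sup>2 / 4 * (ln (ln X) + C3) + ((a m)\<^sup>2 / 4 + a m / 2) * (lz (2 * t m) + C2))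
        + (\<Sum>m<k. \<Sum>l\<in>{m<..<k}. a m * a l / 2 * ((lz (t m - t l) + C2) + (lz (t m + t l) + C2)))"
        using a_pos by (intro add_mono sum_mono mult_left_mono pc pc0) (auto intro!: add_nonneg_nonneg mult_nonneg_nonneg simp: less_imp_le)
      also have "\<dots> = (\<Sum>m<k. ((a m)\<^sup>2 / 4 * C3 + ((a m)\<^sup>2 / 4 + a m / 2) * C2) + ((a m)\<^sup>2 / 4 * ln (ln X) + ((a m)\<^sup>2 / 4 + a m / 2) * lz (2 * t m)))
        + (\<Sum>m<k. \<Sum>l\<in>{m<..<k}. a m * a l / 2 * (2 * C2) + (a m * a l / 2 * lz (t m - t l) + a m * a l / 2 * lz (t m + t l)))"
        by (rule arg_cong2[of _ _ _ _ "(+)"]; intro sum.cong refl; simp add: algebra_simps add_divide_distrib)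
      also have "\<dots> = K + (((\<Sum>j<k. (a j)\<^sup>2) / 4) * ln (ln X)
          + (\<Sum>m<k. \<Sum>l\<in>{m<..<k}. a m * a l / 2 * lz (t m - t l) + a m * a l / 2 * lz (t m + t l))
          + (\<Sum>m<k. ((a m)\<^sup>2 / 4 + a m / 2) * lz (2 * t m)))"
        unfolding K_def sum_divide_distrib sum_distrib_right by (simp only: sum.distrib add_ac)
      finally show "exp (E + (\<Sum>q\<in>primes_upto X. (h q)\<^sup>2 / real q) / 2) \<le> exp (K + (((\<Sum>j<k. (a j)\<^sup>2) / 4) * ln (ln X)
          + (\<Sum>m<k. \<Sum>l\<in>{m<..<k}. a m * a l / 2 * lz (t m - t l) + a m * a l / 2 * lz (t m + t l))
          + (\<Sum>m<k. ((a m)\<^sup>2 / 4 + a m / 2) * lz (2 * t m))))" by simp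
    qed (use C X in auto)
    also have "\<dots> = C * exp K * (X * exp (((\<Sum>j<k. (a j)\<^sup>2) / 4) * ln (ln X))
        * (\<Prod>m<k. \<Prod>l\<in>{m<..<k}. exp (a m * a l / 2 * lz (t m - t l)) * exp (a m * a l / 2 * lz (t m + t l)))
        * (\<Prod>m<k. exp (((a m)\<^sup>2 / 4 + a m / 2) * lz (2 * t m))))"
      by (simp only: exp_add exp_sum[OF finite_lessThan] exp_sum[OF finite_greaterThanLessThan] mult_ac)
    also have "exp (((\<Sum>j<k. (a j)\<^sup>2) / 4) * ln (ln X)) = ln X powr ((\<Sum>j<k. (a j)\<^sup>2) / 4)"
      using lX by (simp add: powr_def)
    finally have "(\<Sum>d\<in>odd_primes X. ln (real d) * F d) \<le> C * exp K * (X * ln X powr ((\<Sum>j<k. (a j)\<^sup>2) / 4)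
        * (\<Prod>m<k. \<Prod>l\<in>{m<..<k}.
             cmod (zeta (Complex (1 + 1 / ln X) (t m - t l))) powr (a m * a l / 2)
           * cmod (zeta (Complex (1 + 1 / ln X) (t m + t l))) powr (a m * a l / 2))
        * (\<Prod>m<k. cmod (zeta (Complex (1 + 1 / ln X) (2 * t m))) powr ((a m)\<^sup>2 / 4 + a m / 2)))"
      unfolding zp .
    moreover have "{p::nat. prime p \<and> odd p \<and> real p \<le> X} = odd_primes X"
    proof -
      have "odd p \<longleftrightarrow> p > 2" if "prime p" for p :: nat
        using prime_odd_nat[OF that] prime_ge_2_nat[OF that] by (cases "p = 2") auto
      then show ?thesis by (auto simp: odd_primes_def)
    qed
    ultimately show ?thesis by (simp only: F_def)
  qed
  show ?thesis
    by (rule exI[of _ "C * exp K"], rule exI[of _ "max X0 (exp 1)"], intro allI impI, elim conjE, rule main)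
qed

end
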